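(* Let $f:\mathbb{R}^4\times\mathbb{R}^m\to\mathbb{R}^4$ ($m=1$ or $2$) be analytic and consider $\dot x=f(x;\mu)$. Assume: (A1) $x=0$ is an equilibrium at $\mu=0$ and $\mathrm{D}_xf(0;0)$ has four real eigenvalues $\lambda_1\le\lambda_2<0<\lambda_3\le\lambda_4$; (A2) at $\mu=0$ the saddle $x=0$ has a homoclinic orbit $x^{\mathrm h}(t)$, and there is a two-dimensional analytic manifold $\mathscr{M}$, invariant under the flow at $\mu=0$, containing $x=0$ and $x^{\mathrm h}(t)$. Suppose that condition (C) holds: the variational equation (VE) $$\dot\xi=\mathrm{D}_xf(x^{\mathrm h}(t);0)\,\xi,\qquad \xi\in\mathbb{R}^4,$$ has a solution bounded on $\mathbb{R}$ which is linearly independent of the bounded solution $\dot x^{\mathrm h}(t)$. Then the VE has a triangularizable differential Galois group when regarded as a complex linear differential equation with meromorphic coefficients on the desingularized neighborhood $\Gamma_{\mathrm{loc}}$ of the homoclinic orbit $x^{\mathrm h}(t)$ in $\mathbb{C}^4$.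
   Context: Complexification: $f(\cdot;0)$ and $\mathscr M$ are real analytic and are extended to complex analytic objects in a neighborhood of $\mathbb{R}^4$ in $\mathbb{C}^4$; $x^{\mathrm h}(t)$ is extended holomorphically to complex $t$. The surface $\Gamma_{\mathrm{loc}}$: let $\lambda_-<0<\lambda_+$ be the two eigenvalues of $\mathrm{D}_xf(0;0)$ restricted to $T_0\mathscr M$. There are holomorphic maps $h_\pm$ from a neighborhood of $0\in\mathbb{C}$ to $\mathbb{C}^4$, $h_\pm(0)=0$, such that $x^{\mathrm h}(t)=h_-(e^{\lambda_-t})$ near $t=+\infty$ and $x^{\mathrm h}(t)=h_+(e^{\lambda_+t})$ near $t=-\infty$. $\Gamma_{\mathrm{loc}}=\Sigma_-\cup\Sigma_t\cup\Sigma_+$ is the simply connected Riemann surface obtained as follows: $\Sigma_\pm$ are small disks with coordinate $z_\pm$ centred at points $0_\pm$ (two distinct copies of the origin $x=0$), parametrizing via $x=h_\pm(z_\pm)$ the two local branches at $x=0$ of the complex separatrix; $\Sigma_t$ is a sufficiently narrow simply connected neighborhood, with coordinate $t$ and parametrization $x=x^{\mathrm h}(t)$, of the remaining compact part of the real homoclinic orbit, intersecting each of $\Sigma_\pm$ in a simply connected domain; the coordinates are glued by $z_\pm=e^{\lambda_\pm t}$. The VE on $\Gamma_{\mathrm{loc}}$ is unchanged in $\Sigma_t$ and reads $\frac{\mathrm d\xi}{\mathrm dz_\pm}=\frac{1}{\lambda_\pm z_\pm}\mathrm{D}_xf(h_\pm(z_\pm);0)\xi$ in $\Sigma_\pm$.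 It has singularities only at $0_\pm$. Differential Galois group: the base differential field $\mathbb{K}$ is the field of meromorphic functions on $\Gamma_{\mathrm{loc}}$ with derivation $\mathrm d/\mathrm dt$ ($=\lambda_\pm z_\pm\,\mathrm d/\mathrm dz_\pm$ in $\Sigma_\pm$), whose field of constants is $\mathbb{C}$. For a Picard-Vessiot extension $\mathbb{L}\supset\mathbb{K}$ of the linear system (generated by the entries of a fundamental matrix $\Phi$, with no new constants), the differential Galois group is the group of matrices $M_\sigma\in\mathrm{GL}(4,\mathbb{C})$ defined by $\sigma(\Phi)=\Phi M_\sigma$, where $\sigma$ ranges over the field automorphisms of $\mathbb{L}$ commuting with the derivation and fixing $\mathbb{K}$ pointwise; it is defined up to conjugation. A subgroup of $\mathrm{GL}(n,\mathbb{C})$ is triangularizable if it is conjugate to a subgroup of the group of upper triangular matrices. *)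

theory Defs
  imports
    "HOL-Complex_Analysis.Complex_Analysis"
    "HOL-Algebra.Algebraic_Closure_Type"
    "HOL-Algebra.Generated_Fields"
begin

section \<open>Real analytic maps, vector fields and invariant surfaces\<close>

text \<open>A multi-index is a function on the standard basis; \<open>has_sum\<close> is unconditional (equivalently,
  in finite dimension, absolute) convergence of the multiple power series.\<close>

definition real_analytic_on ::
    "('a::euclidean_space \<Rightarrow> 'b::euclidean_space) \<Rightarrow> 'a set \<Rightarrow> bool" where
  "real_analytic_on f S \<longleftrightarrow>
     (\<forall>p\<in>S. \<exists>(c :: ('a \<Rightarrow> nat) \<Rightarrow> 'b) r. r > 0 \<and>
        (\<forall>x\<in>ball p r.
           ((\<lambda>\<alpha>. (\<Prod>b\<in>Basis. ((x - p) \<bullet> b) ^ \<alpha> b) *\<^sub>R c \<alpha>) has_sum f x) (Basis \<rightarrow>\<^sub>E UNIV)))"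

definition solves_on :: "(real^4 \<Rightarrow> real^4) \<Rightarrow> (real \<Rightarrow> real^4) \<Rightarrow> real set \<Rightarrow> bool" where
  "solves_on V x I \<longleftrightarrow> (\<forall>t\<in>I. (x has_vector_derivative V (x t)) (at t))"

definition homoclinic_orbit :: "(real^4 \<Rightarrow> real^4) \<Rightarrow> (real \<Rightarrow> real^4) \<Rightarrow> bool" where
  "homoclinic_orbit V xh \<longleftrightarrow>
     solves_on V xh UNIV \<and> (\<exists>t. xh t \<noteq> 0) \<and> (xh \<longlongrightarrow> 0) at_top \<and> (xh \<longlongrightarrow> 0) at_bot"

text \<open>Embedded two-dimensional real analytic submanifolds, by local parametrizations.\<close>

definition analytic_surface :: "(real^4) set \<Rightarrow> bool" where
  "analytic_surface M \<longleftrightarrow>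
     (\<forall>p\<in>M. \<exists>U (W :: (real^2) set) \<phi> \<psi>.
        open U \<and> p \<in> U \<and> open W \<and> real_analytic_on \<phi> W \<and>
        homeomorphism W (M \<inter> U) \<phi> \<psi> \<and> (\<forall>w\<in>W. inj (frechet_derivative \<phi> (at w))))"

text \<open>The flow need not be complete, so invariance refers to all solutions on open intervals.\<close>

definition flow_invariant :: "(real^4 \<Rightarrow> real^4) \<Rightarrow> (real^4) set \<Rightarrow> bool" where
  "flow_invariant V M \<longleftrightarrow>
     (\<forall>x a b s. s \<in> {a<..<b} \<and> solves_on V x {a<..<b} \<and> x s \<in> M \<longrightarrow> x ` {a<..<b} \<subseteq> M)"

definition tangent_space :: "(real^4) set \<Rightarrow> real^4 \<Rightarrow> (real^4) set" where
  "tangent_space M p =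
     {v. \<exists>\<gamma> e. e > 0 \<and> \<gamma> ` {-e<..<e} \<subseteq> M \<and> \<gamma> 0 = p \<and> (\<gamma> has_vector_derivative v) (at (0::real))}"

definition eigenvalue_on :: "real^4^4 \<Rightarrow> (real^4) set \<Rightarrow> real \<Rightarrow> bool" where
  "eigenvalue_on A T l \<longleftrightarrow> (\<exists>v\<in>T. v \<noteq> 0 \<and> A *v v = l *\<^sub>R v)"

definition solves_VE ::
    "(real^4 \<Rightarrow> real^4) \<Rightarrow> (real \<Rightarrow> real^4) \<Rightarrow> (real \<Rightarrow> real^4) \<Rightarrow> bool" where
  "solves_VE V xh \<xi> \<longleftrightarrow>
     (\<forall>t. (\<xi> has_vector_derivative (jacobian V (at (xh t)) *v \<xi> t)) (at t))"

text \<open>Linear independence as functions of \<open>t\<close>.\<close>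

definition lin_indep_solutions :: "(real \<Rightarrow> real^4) \<Rightarrow> (real \<Rightarrow> real^4) \<Rightarrow> bool" where
  "lin_indep_solutions \<xi> \<eta> \<longleftrightarrow>
     (\<forall>a b :: real. (\<forall>t. a *\<^sub>R \<xi> t + b *\<^sub>R \<eta> t = 0) \<longrightarrow> a = 0 \<and> b = 0)"

section \<open>Complexification and the desingularized neighborhood\<close>

definition complex_vec :: "real^'n \<Rightarrow> complex^'n" where
  "complex_vec x = (\<chi> i. complex_of_real (x $ i))"

text \<open>\<open>F\<close> is a holomorphic extension of the real vector field \<open>V\<close> to the neighborhood \<open>U\<close> of
  the real points. Holomorphy means that the (real) Frechet derivative exists and is complex
  linear; hence \<open>jacobian F\<close> is the complex Jacobian matrix on \<open>U\<close>.\<close>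

definition complexification ::
    "(real^4 \<Rightarrow> real^4) \<Rightarrow> (complex^4) set \<Rightarrow> (complex^4 \<Rightarrow> complex^4) \<Rightarrow> bool" where
  "complexification V U F \<longleftrightarrow>
     open U \<and> (\<forall>x. complex_vec x \<in> U \<and> F (complex_vec x) = complex_vec (V x)) \<and>
     (\<forall>p\<in>U. \<exists>J :: complex^4^4. (F has_derivative (\<lambda>v. J *v v)) (at p))"

definition holomorphic_curve_on :: "(complex \<Rightarrow> complex^4) \<Rightarrow> complex set \<Rightarrow> bool" where
  "holomorphic_curve_on h S \<longleftrightarrow> (\<forall>i. (\<lambda>z. h z $ i) holomorphic_on S)"

text \<open>The surface \<open>\<Gamma>\<^sub>l\<^sub>o\<^sub>c\<close> is given by three charts: the discs \<open>\<Sigma>\<^sub>-\<close>, \<open>\<Sigma>\<^sub>+\<close> about the two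
  copies of the origin, of radii \<open>rad_minus\<close> and \<open>rad_plus\<close>, and the domain \<open>\<Sigma>\<^sub>t\<close> in the complex
  time plane. The last three record components are the parametrizations in these charts.\<close>

record desing =
  lam_minus :: real
  lam_plus :: real
  rad_minus :: real
  rad_plus :: real
  Sigma_t :: "complex set"
  h_minus :: "complex \<Rightarrow> complex^4"
  h_plus :: "complex \<Rightarrow> complex^4"
  x_t :: "complex \<Rightarrow> complex^4"

datatype chart = Minus | Time | Plus

fun chart_dom :: "desing \<Rightarrow> chart \<Rightarrow> complex set" where
  "chart_dom \<Gamma> Minus = ball 0 (rad_minus \<Gamma>)"
| "chart_dom \<Gamma> Time = Sigma_t \<Gamma>"
| "chart_dom \<Gamma> Plus = ball 0 (rad_plus \<Gamma>)"

fun param :: "desing \<Rightarrow> chart \<Rightarrow> complex \<Rightarrow> complex^4" where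
  "param \<Gamma> Minus = h_minus \<Gamma>"
| "param \<Gamma> Time = x_t \<Gamma>"
| "param \<Gamma> Plus = h_plus \<Gamma>"

text \<open>Gluing maps from the time chart to the two discs, and the parts of \<open>\<Sigma>\<^sub>t\<close> that are glued.\<close>

definition glue_minus :: "desing \<Rightarrow> complex \<Rightarrow> complex" where
  "glue_minus \<Gamma> t = exp (of_real (lam_minus \<Gamma>) * t)"

definition glue_plus :: "desing \<Rightarrow> complex \<Rightarrow> complex" where
  "glue_plus \<Gamma> t = exp (of_real (lam_plus \<Gamma>) * t)"

definition overlap_minus :: "desing \<Rightarrow> complex set" where
  "overlap_minus \<Gamma> = {t \<in> Sigma_t \<Gamma>. glue_minus \<Gamma> t \<in> chart_dom \<Gamma> Minus}"

definition overlap_plus :: "desing \<Rightarrow> complex set" where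
  "overlap_plus \<Gamma> = {t \<in> Sigma_t \<Gamma>. glue_plus \<Gamma> t \<in> chart_dom \<Gamma> Plus}"

text \<open>The charts and gluings described by \<open>\<Gamma>\<close> form the desingularized neighborhood of the orbit
  \<open>xh\<close> of \<open>V\<close>. In time, the discs \<open>\<Sigma>\<^sub>-\<close> and \<open>\<Sigma>\<^sub>+\<close> contain the two ends of the real orbit; they
  are small enough to have no real time in common, and \<open>\<Sigma>\<^sub>t\<close> contains the closed interval of
  times left over. Narrowness of \<open>\<Sigma>\<^sub>t\<close> enters through holomorphy of \<open>x_t\<close> with values in \<open>U\<close>,
  injectivity of the gluing maps, and simple connectedness of the overlaps.\<close>

definition desingularized_nbhd ::
    "(real^4 \<Rightarrow> real^4) \<Rightarrow> (real \<Rightarrow> real^4) \<Rightarrow> (real^4) set \<Rightarrow> (complex^4) set \<Rightarrow> desing \<Rightarrow> bool" where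
  "desingularized_nbhd V xh M U \<Gamma> \<longleftrightarrow>
     lam_minus \<Gamma> < 0 \<and> 0 < lam_plus \<Gamma> \<and>
     eigenvalue_on (jacobian V (at 0)) (tangent_space M 0) (lam_minus \<Gamma>) \<and>
     eigenvalue_on (jacobian V (at 0)) (tangent_space M 0) (lam_plus \<Gamma>) \<and>
     rad_minus \<Gamma> > 0 \<and> rad_plus \<Gamma> > 0 \<and>
     (\<forall>c. holomorphic_curve_on (param \<Gamma> c) (chart_dom \<Gamma> c) \<and> param \<Gamma> c ` chart_dom \<Gamma> c \<subseteq> U) \<and>
     h_minus \<Gamma> 0 = 0 \<and> h_plus \<Gamma> 0 = 0 \<and>
     (\<forall>\<^sub>F t in at_top. complex_vec (xh t) = h_minus \<Gamma> (glue_minus \<Gamma> (of_real t))) \<and>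
     (\<forall>\<^sub>F t in at_bot. complex_vec (xh t) = h_plus \<Gamma> (glue_plus \<Gamma> (of_real t))) \<and>
     (\<forall>t. \<not> (exp (lam_minus \<Gamma> * t) < rad_minus \<Gamma> \<and> exp (lam_plus \<Gamma> * t) < rad_plus \<Gamma>)) \<and>
     (\<forall>t. exp (lam_minus \<Gamma> * t) \<ge> rad_minus \<Gamma> \<and> exp (lam_plus \<Gamma> * t) \<ge> rad_plus \<Gamma> \<longrightarrow>
          complex_of_real t \<in> Sigma_t \<Gamma>) \<and>
     open (Sigma_t \<Gamma>) \<and> simply_connected (Sigma_t \<Gamma>) \<and>
     (\<forall>t. complex_of_real t \<in> Sigma_t \<Gamma> \<longrightarrow> x_t \<Gamma> (of_real t) = complex_vec (xh t)) \<and>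
     simply_connected (overlap_minus \<Gamma>) \<and> inj_on (glue_minus \<Gamma>) (overlap_minus \<Gamma>) \<and>
     simply_connected (overlap_plus \<Gamma>) \<and> inj_on (glue_plus \<Gamma>) (overlap_plus \<Gamma>)"

section \<open>The differential field of meromorphic functions on the surface\<close>

text \<open>A function on the surface is the family \<open>g\<close> of its representatives in the charts. As usual
  in the library, a meromorphic function is represented by the function without removable
  singularities that takes the value 0 at its poles; outside the chart domains it is 0, so that
  equality in the field is equality of functions. Sums, products and derivatives have to be
  brought into this form by \<open>reduce\<close>.\<close>

type_synonym surface_fun = "chart \<Rightarrow> complex \<Rightarrow> complex"

definition meromorphic_functions :: "desing \<Rightarrow> surface_fun set" where
  "meromorphic_functions \<Gamma> =
     {g. (\<forall>c. g c nicely_meromorphic_on chart_dom \<Gamma> c \<and> (\<forall>z. z \<notin> chart_dom \<Gamma> c \<longrightarrow> g c z = 0)) \<and>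
         (\<forall>t\<in>overlap_minus \<Gamma>. g Time t = g Minus (glue_minus \<Gamma> t)) \<and>
         (\<forall>t\<in>overlap_plus \<Gamma>. g Time t = g Plus (glue_plus \<Gamma> t))}"

definition reduce :: "desing \<Rightarrow> surface_fun \<Rightarrow> surface_fun" where
  "reduce \<Gamma> g = (\<lambda>c z. if z \<in> chart_dom \<Gamma> c then remove_sings (g c) z else 0)"

definition const_fun :: "desing \<Rightarrow> complex \<Rightarrow> surface_fun" where
  "const_fun \<Gamma> a = (\<lambda>c z. if z \<in> chart_dom \<Gamma> c then a else 0)"

definition meromorphic_field :: "desing \<Rightarrow> surface_fun ring" where
  "meromorphic_field \<Gamma> =
     \<lparr> carrier = meromorphic_functions \<Gamma>,
       monoid.mult = (\<lambda>g h. reduce \<Gamma> (\<lambda>c z. g c z * h c z)),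
       one = const_fun \<Gamma> 1,
       ring.zero = const_fun \<Gamma> 0,
       add = (\<lambda>g h. reduce \<Gamma> (\<lambda>c z. g c z + h c z)) \<rparr>"

text \<open>The vector field \<open>d/dt\<close> in the charts: since \<open>z = exp (\<lambda> t)\<close> in the discs, it is
  \<open>\<lambda> z d/dz\<close> there.\<close>

fun time_field :: "desing \<Rightarrow> chart \<Rightarrow> complex \<Rightarrow> complex" where
  "time_field \<Gamma> Minus z = of_real (lam_minus \<Gamma>) * z"
| "time_field \<Gamma> Time z = 1"
| "time_field \<Gamma> Plus z = of_real (lam_plus \<Gamma>) * z"

definition time_deriv :: "desing \<Rightarrow> surface_fun \<Rightarrow> surface_fun" where
  "time_deriv \<Gamma> g = reduce \<Gamma> (\<lambda>c z. time_field \<Gamma> c z * deriv (g c) z)"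

text \<open>The coefficient matrix of the variational equation with respect to the derivation \<open>d/dt\<close>.
  Dividing by \<open>\<lambda> z\<close> in a disc gives the equation
  \<open>d\<xi>/dz = 1/(\<lambda> z) DF(h(z)) \<xi>\<close>, singular at the centre only.\<close>

definition VE_matrix :: "(complex^4 \<Rightarrow> complex^4) \<Rightarrow> desing \<Rightarrow> surface_fun^4^4" where
  "VE_matrix F \<Gamma> =
     (\<chi> i j. (\<lambda>c z. if z \<in> chart_dom \<Gamma> c then jacobian F (at (param \<Gamma> c z)) $ i $ j else 0))"

section \<open>Picard-Vessiot extensions and differential Galois groups\<close>

text \<open>\<open>(K, \<delta>)\<close> is the base differential field, the type \<open>'l\<close> with the derivation \<open>D\<close> is the
  extension field, \<open>\<iota>\<close> the embedding, and \<open>\<Phi>\<close> a fundamental matrix of the linear system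
  \<open>\<delta> \<xi> = A \<xi>\<close>.\<close>

definition derivation :: "('l::field \<Rightarrow> 'l) \<Rightarrow> bool" where
  "derivation D \<longleftrightarrow> (\<forall>x y. D (x + y) = D x + D y) \<and> (\<forall>x y. D (x * y) = D x * y + x * D y)"

definition picard_vessiot ::
    "'k ring \<Rightarrow> ('k \<Rightarrow> 'k) \<Rightarrow> 'k^'n^'n \<Rightarrow>
     ('k \<Rightarrow> 'l::field) \<Rightarrow> ('l \<Rightarrow> 'l) \<Rightarrow> 'l^'n^'n \<Rightarrow> bool" where
  "picard_vessiot K \<delta> A \<iota> D \<Phi> \<longleftrightarrow>
     \<iota> \<in> ring_hom K ring_of_type_algebra \<and>
     derivation D \<and> (\<forall>a\<in>carrier K. D (\<iota> a) = \<iota> (\<delta> a)) \<and>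
     invertible \<Phi> \<and> map_matrix D \<Phi> = map_matrix \<iota> A ** \<Phi> \<and>
     generate_field ring_of_type_algebra (\<iota> ` carrier K \<union> {\<Phi> $ i $ j |i j. True}) = UNIV \<and>
     {x. D x = 0} = \<iota> ` {a \<in> carrier K. \<delta> a = \<zero>\<^bsub>K\<^esub>}"

text \<open>Here \<open>\<kappa>\<close> embeds the field of constants \<open>\<complex>\<close> into \<open>K\<close>.\<close>

definition galois_group ::
    "'k ring \<Rightarrow> (complex \<Rightarrow> 'k) \<Rightarrow> ('k \<Rightarrow> 'l::field) \<Rightarrow> ('l \<Rightarrow> 'l) \<Rightarrow> 'l^'n^'n \<Rightarrow> (complex^'n^'n) set" where
  "galois_group K \<kappa> \<iota> D \<Phi> =
     {M. invertible M \<and>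
         (\<exists>\<sigma> \<in> ring_iso ring_of_type_algebra ring_of_type_algebra.
            (\<forall>x. \<sigma> (D x) = D (\<sigma> x)) \<and> (\<forall>a\<in>carrier K. \<sigma> (\<iota> a) = \<iota> a) \<and>
            map_matrix \<sigma> \<Phi> = \<Phi> ** map_matrix (\<iota> \<circ> \<kappa>) M)}"

definition upper_triangular :: "((complex, 'n::{finite,linorder}) vec, 'n) vec \<Rightarrow> bool" where
  "upper_triangular M \<longleftrightarrow> (\<forall>i j. j < i \<longrightarrow> M $ i $ j = 0)"

definition triangularizable :: "(((complex, 'n::{finite,linorder}) vec, 'n) vec) set \<Rightarrow> bool" where
  "triangularizable G \<longleftrightarrow>
     (\<exists>P :: ((complex, 'n) vec, 'n) vec. invertible P \<and> (\<forall>M\<in>G. upper_triangular (matrix_inv P ** M ** P)))"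

end

theory Submission
  imports Defs
begin

text \<open>The variational equation has two planes of solutions containing \<open>\<xi>\<^sub>1 = dx\<^sup>h/dt\<close>: the plane \<open>E\<close> of
  bounded solutions, spanned by \<open>\<xi>\<^sub>1\<close> and the solution of condition (C), and the plane \<open>T\<close> of solutions
  tangent to \<open>M\<close>. The Pluecker coordinates of \<open>E\<close> and of \<open>T\<close> are multiplied by a constant under
  continuation around each of the two singular points: for \<open>E\<close>, because continuation of a bounded
  solution by the period is bounded and hyperbolicity allows at most two independent solutions that are
  bounded at one end; for \<open>T\<close>, because near the singular point \<open>M\<close> is a graph with single-valued
  holomorphic slope. By Gronwall's inequality they have moderate growth, so that their ratios are
  meromorphic on the surface. Hence \<open>\<langle>\<xi>\<^sub>1\<rangle> \<subset> E \<subset> E + T\<close> is a flag defined over the base field, invariant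
  under the equation, and the Galois group preserves it. Finally \<open>E \<noteq> T\<close>: at \<open>t = \<infinity>\<close> a Lyapunov
  form is negative on \<open>E\<close>, while the limit of \<open>T\<close> contains an expanding eigenvector.\<close>

text \<open>The obstacle is that single solutions are not functions on the surface: near a singular
  point they involve powers of the coordinate with arbitrary exponents and possibly logarithms. When
  continuation maps a plane of solutions to itself, only the determinant of a 2 by 2 matrix is left,
  which a factor exp(s t) removes; in quotients of Pluecker coordinates this factor cancels. Two
  planes are used because one line and one plane in dimension four leave a two-dimensional quotient
  undecided; the second plane supplies the three-dimensional member of the flag. Continuation is
  studied in the time variable, where a punctured disc becomes a half-plane and a turn around its
  centre becomes a translation: there solutions are single-valued and the coefficients stay bounded
  up to infinity. Growth has to be controlled because periodicity alone would permit essential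
  singularities. The flag is used directly, so neither the monodromy group nor its Zariski closure
  is computed, and multiple or resonant eigenvalues call for no separate treatment.\<close>

no_notation fps_nth (infixl \<open>$\<close> 75)

section \<open>Triangularizing matrices\<close>

lemma matrix_inv_mult:
  fixes A :: "'a::semiring_1^'n^'m"
  assumes "invertible A"
  shows "A ** matrix_inv A = mat 1" "matrix_inv A ** A = mat 1"
  using assms unfolding invertible_def matrix_inv_def
  by (auto dest!: someI_ex[of "\<lambda>B. A ** B = mat 1 \<and> B ** A = mat 1"])

lemma matrix_inv_eqI:
  fixes A :: "'a::semiring_1^'n^'m"
  assumes "A ** B = mat 1" "B ** A = mat 1"
  shows "matrix_inv A = B"
proof -
  have i: "invertible A" using assms by (auto simp: invertible_def)
  have "matrix_inv A = matrix_inv A ** (A ** B)" using assms by simp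
  then show ?thesis by (simp only: matrix_mul_assoc matrix_inv_mult[OF i]) simp
qed

text \<open>One step of Gaussian elimination: rows \<open>k\<close> and \<open>i\<close> are
  exchanged to bring a pivot into position \<open>k\<close>, then multiples of the pivot row are
  subtracted from the later rows. The clauses about indices below \<open>k\<close> ensure that
  columns cleared earlier stay cleared. The field is arbitrary because the step is used over the
  reals and over the constants.\<close>

lemma exists_elimination_matrix:
  fixes d :: "('a::field,'n::{finite,wellorder}) vec"
  assumes "k \<le> i" "d $ i \<noteq> 0"
  shows "\<exists>P :: (('a,'n) vec,'n) vec. invertible P \<and> (\<forall>r s. s < k \<longrightarrow> P $ r $ s = (if r = s then 1 else 0)) \<and>
           (\<forall>x r. r < k \<longrightarrow> (P *v x) $ r = x $ r) \<and> (\<forall>r>k. (P *v d) $ r = 0) \<and> (P *v d) $ k \<noteq> 0"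
proof -
  define \<tau> where "\<tau> = Transposition.transpose k i"
  define m where "m r = d $ \<tau> r / d $ i" for r
  define P :: "(('a,'n) vec,'n) vec" where
    "P = (\<chi> r c. (if c = \<tau> r then 1 else 0) - (if r > k \<and> c = i then m r else 0))"
  have \<tau>k: "\<tau> k = i" by (simp add: \<tau>_def)
  have \<tau>lt: "\<tau> r = r" if "r < k" for r using that assms(1) by (auto simp: \<tau>_def Transposition.transpose_def)
  have \<tau>\<tau>: "\<tau> (\<tau> r) = r" for r by (simp add: \<tau>_def)
  have Pv: "(P *v x) $ r = x $ \<tau> r - (if r > k then m r * x $ i else 0)" for x r
    by (auto simp: P_def matrix_vector_mult_def algebra_simps sum_subtractf if_distrib[of "\<lambda>y. x $ _ * y"]
        if_distrib[of "\<lambda>y. y * _"] cong: if_cong)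
  have inv: "invertible P"
  proof -
    have "x = 0" if "P *v x = 0" for x
    proof -
      have e: "x $ \<tau> r - (if r > k then m r * x $ i else 0) = 0" for r using that Pv[of x r] by simp
      from e[of k] have xi: "x $ i = 0" by (simp add: \<tau>k)
      have "x $ \<tau> r = 0" for r using e[of r] xi by (simp split: if_splits)
      then have "x $ r = 0" for r using \<tau>\<tau>[of r] by metis
      then show ?thesis by (simp add: vec_eq_iff)
    qed
    then show ?thesis
      using matrix_left_invertible_ker[of P] invertible_left_inverse[of P] by blast
  qed
  have 1: "P $ r $ s = (if r = s then 1 else 0)" if s: "s < k" for r s
  proof -
    have "s = \<tau> r \<longleftrightarrow> r = s" using \<tau>lt[OF s] \<tau>\<tau> by metis
    moreover have "s \<noteq> i" using s assms(1) by auto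
    ultimately show ?thesis by (simp add: P_def)
  qed
  show ?thesis
    using inv 1 assms(2) by (intro exI[of _ P]) (auto simp: Pv \<tau>k \<tau>lt m_def)
qed

text \<open>Induction over the columns of a matrix. An abstract finite ordered index type carries no
  successor function, so the number of finished columns is replaced by an initial segment.\<close>

lemma finite_linorder_downset_induct [case_names empty step]:
  fixes Q :: "'n::{finite,wellorder} set \<Rightarrow> bool"
  assumes "Q {}" "\<And>b. Q {..<b} \<Longrightarrow> Q {..b}"
  shows "Q UNIV"
proof -
  have "(\<forall>a\<in>A. \<forall>j\<le>a. j \<in> A) \<longrightarrow> Q A" for A :: "'n set"
  proof (induction A rule: finite_linorder_max_induct[OF finite])
    case (2 b A)
    show ?case
    proof
      assume down: "\<forall>a\<in>insert b A. \<forall>j\<le>a. j \<in> insert b A"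
      have Ab: "A = {..<b}"
        using down 2(2) by (auto simp: less_le)
      have "\<forall>a\<in>A. \<forall>j\<le>a. j \<in> A" by (auto simp: Ab)
      then have "Q {..<b}" using 2(3) Ab by blast
      then have "Q {..b}" by (rule assms(2))
      moreover have "insert b A = {..b}" by (auto simp: Ab)
      ultimately show "Q (insert b A)" by simp
    qed
  qed (use assms(1) in auto)
  then show ?thesis by blast
qed

text \<open>Pigeonhole principle: an injective \<open>p\<close> cannot send the indices from
  \<open>b\<close> on into the strictly smaller set above \<open>b\<close>, so every term of the
  Leibniz expansion contains a zero entry.\<close>

lemma det_eq_0_block:
  fixes Z :: "(('a::field,'n::{finite,wellorder}) vec,'n) vec"
  assumes "\<And>r c. b \<le> r \<Longrightarrow> c \<le> b \<Longrightarrow> Z $ r $ c = 0"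
  shows "det Z = 0"
  unfolding det_def
proof (rule sum.neutral, safe)
  fix p :: "'n \<Rightarrow> 'n" assume p: "p permutes UNIV"
  have "\<exists>r\<ge>b. p r \<le> b"
  proof (rule ccontr)
    assume "\<not> ?thesis"
    then have "p ` {b..} \<subseteq> {b<..}" by force
    then have "card (p ` {b..}) \<le> card {b<..}" by (intro card_mono) auto
    moreover have "card (p ` {b..}) = card {b..}" by (rule card_image) (use p in \<open>auto intro: inj_on_subset[OF permutes_inj]\<close>)
    moreover have "{b<..} \<subset> {b..}" by auto
    then have "card {b<..} < card {b..}" by (intro psubset_card_mono) auto
    ultimately show False by simp
  qed
  then obtain r where "r \<ge> b" "p r \<le> b" by blast
  then have "(\<Prod>i\<in>UNIV. Z $ i $ p i) = 0" using assms by (intro prod_zero) auto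
  then show "of_int (sign p) * (\<Prod>i\<in>UNIV. Z $ i $ p i) = 0" by simp
qed

text \<open>\<open>upper_triangular\<close> for other entry types: the notion is needed over the
  reals, the constants and the extension field.\<close>

definition upper_tri :: "(('a::zero,'n::{finite,wellorder}) vec,'n) vec \<Rightarrow> bool" where
  "upper_tri A \<longleftrightarrow> (\<forall>i j. j < i \<longrightarrow> A $ i $ j = 0)"

lemma map_matrix_nth [simp]: "map_matrix f A $ i $ j = f (A $ i $ j)"
  by (simp add: map_matrix_def)

lemma matrix_mult_nth: "(A ** B) $ i $ j = (\<Sum>k\<in>UNIV. A $ i $ k * B $ k $ j)"
  by (simp add: matrix_matrix_mult_def)

text \<open>Column by column, with the eigenvalues in the prescribed order. The block not yet
  treated has the product over the remaining eigenvalues as its characteristic polynomial, so it has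
  an eigenvector for \<open>l b\<close>; elimination turns this vector into the next basis
  vector.\<close>

lemma triangularize_split:
  fixes A :: "((real,'n::{finite,wellorder}) vec,'n) vec" and l :: "'n \<Rightarrow> real"
  assumes char: "\<And>s. det (mat s - A) = (\<Prod>i\<in>UNIV. s - l i)"
  shows "\<exists>P B. invertible P \<and> P ** A = B ** P \<and> upper_tri B \<and> (\<forall>i. B $ i $ i = l i)"
proof -
  have "\<exists>P B. invertible P \<and> P ** A = B ** P \<and> (\<forall>c\<in>UNIV. B $ c $ c = l c \<and> (\<forall>r>c. B $ r $ c = 0))"
  proof (induction rule: finite_linorder_downset_induct)
    case empty
    have "invertible (mat 1 :: ((real, 'n) vec, 'n) vec)" by (auto simp: invertible_def intro!: exI[of _ "mat 1"])
    moreover have "mat 1 ** A = A ** mat 1" by (simp add: matrix_mul_lid matrix_mul_rid)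
    ultimately show ?case by blast
  next
    case (step b)
    then obtain P B where P: "invertible P" and PA: "P ** A = B ** P"
      and B: "\<And>c. c < b \<Longrightarrow> B $ c $ c = l c" "\<And>c r. c < b \<Longrightarrow> r > c \<Longrightarrow> B $ r $ c = 0" by auto
    \<comment> \<open>The factorization separates the two parts of the characteristic polynomial:
      \<open>H\<close> carries the finished columns and has a known triangular determinant,
      \<open>G\<close> carries the remaining ones.\<close>
    define G where "G s = (\<chi> r c. if c < b then (if r = c then 1 else 0) else (mat s - B) $ r $ c)" for s
    define H where "H s = (\<chi> r c. if c < b then (mat s - B) $ r $ c else (if r = c then 1 else 0))" for s
    have GH: "G s ** H s = mat s - B" for s
    proof -
      have "(\<Sum>k\<in>UNIV. G s $ r $ k * H s $ k $ c) = (mat s - B) $ r $ c" for r c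
      proof (cases "c < b")
        case False
        then show ?thesis by (simp add: G_def H_def if_distrib[of "\<lambda>y. _ * y"] cong: if_cong)
      next
        case True
        have z: "H s $ k $ c = 0" if "\<not> k < b" for k
          using that True B(2)[of c k] by (auto simp: H_def mat_def)
        have "G s $ r $ k * H s $ k $ c = (if k = r then H s $ k $ c else 0)" for k
          by (cases "k < b") (auto simp: z, auto simp: G_def)
        then show ?thesis using True by (simp add: H_def)
      qed
      then show ?thesis by (simp add: matrix_matrix_mult_def vec_eq_iff)
    qed
    have detH: "det (H s) = (\<Prod>c\<in>{..<b}. s - l c)" for s
    proof -
      have "det (H s) = (\<Prod>i\<in>UNIV. H s $ i $ i)"
        by (rule det_upperdiagonal) (use B(2) in \<open>auto simp: H_def mat_def\<close>)
      also have "\<dots> = (\<Prod>i\<in>UNIV. if i \<in> {..<b} then s - l i else 1)"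
        by (rule prod.cong) (auto simp: H_def mat_def B(1))
      also have "\<dots> = (\<Prod>c\<in>{..<b}. s - l c)"
        by (subst prod.inter_restrict[symmetric]) auto
      finally show ?thesis .
    qed
    have detB: "det (mat s - B) = (\<Prod>i\<in>UNIV. s - l i)" for s
    proof -
      have "P ** (mat s - A) = (mat s - B) ** P"
      proof -
        have "(P ** (mat s - A)) $ r $ c = ((mat s - B) ** P) $ r $ c" for r c
          using arg_cong[OF PA, of "\<lambda>M. M $ r $ c"]
          by (simp add: matrix_mult_nth right_diff_distrib left_diff_distrib sum_subtractf mat_def
              if_distrib[of "\<lambda>y. _ * y"] if_distrib[of "\<lambda>y. y * _"] cong: if_cong)
        then show ?thesis by (simp add: vec_eq_iff)
      qed
      then have "det P * det (mat s - A) = det (mat s - B) * det P" by (metis det_mul)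
      moreover have "det P \<noteq> 0" using P invertible_det_nz by blast
      ultimately show ?thesis using char by simp
    qed
    have prodsplit: "(\<Prod>i\<in>UNIV. s - l i) = (\<Prod>c\<in>{..<b}. s - l c) * (\<Prod>c\<in>{b..}. s - l c)" for s
      by (subst prod.union_disjoint[symmetric]) (auto intro!: prod.cong)
    define \<delta> where "\<delta> s = det (G s)" for s
    have cont: "isCont \<delta> s" for s
    proof -
      have e: "((\<lambda>s. G s $ r $ c) \<longlongrightarrow> G s $ r $ c) (at s)" for r c
        by (cases "c < b"; cases "r = c") (auto simp: G_def mat_def intro!: tendsto_intros)
      show ?thesis unfolding \<delta>_def det_def isCont_def
        by (intro tendsto_sum tendsto_mult tendsto_const tendsto_prod e)
    qed
    \<comment> \<open>If \<open>l b\<close> also occurs among the finished eigenvalues,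
      \<open>det (H s)\<close> vanishes at \<open>l b\<close> and cannot be cancelled there. It is
      cancelled at nearby \<open>s\<close>, and the value at \<open>l b\<close> follows by
      continuity.\<close>
    have ev: "\<forall>\<^sub>F s in at (l b). \<delta> s = (\<Prod>c\<in>{b..}. s - l c)"
    proof -
      have "\<forall>\<^sub>F s in at (l b). \<forall>c\<in>UNIV. s \<noteq> l c"
      proof (rule eventually_ball_finite)
        show "\<forall>c\<in>UNIV. \<forall>\<^sub>F s in at (l b). s \<noteq> l c"
          by (metis eventually_neq_at_within)
      qed simp
      then show ?thesis
      proof eventually_elim
        case (elim s)
        have "\<delta> s * (\<Prod>c\<in>{..<b}. s - l c) = (\<Prod>i\<in>UNIV. s - l i)"
          unfolding \<delta>_def detH[symmetric] det_mul[symmetric] GH detB ..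
        moreover have "(\<Prod>c\<in>{..<b}. s - l c) \<noteq> 0" using elim by simp
        ultimately show ?case by (simp add: prodsplit)
      qed
    qed
    have "(\<lambda>s. \<Prod>c\<in>{b..}. s - l c) \<midarrow>l b\<rightarrow> \<delta> (l b)"
      using cont[of "l b"] ev unfolding isCont_def by (rule Lim_transform_eventually)
    moreover have "(\<lambda>s. \<Prod>c\<in>{b..}. s - l c) \<midarrow>l b\<rightarrow> (\<Prod>c\<in>{b..}. l b - l c)"
      by (intro tendsto_intros)
    ultimately have "\<delta> (l b) = (\<Prod>c\<in>{b..}. l b - l c)" using LIM_unique by blast
    also have "\<dots> = 0" by (rule prod_zero) auto
    finally have "\<not> invertible (G (l b))" unfolding \<delta>_def invertible_det_nz by simp
    then obtain x where x0: "x \<noteq> 0" and Gx: "G (l b) *v x = 0"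
      using invertible_left_inverse matrix_left_invertible_ker by blast
    \<comment> \<open>Only the components from \<open>b\<close> on matter: modulo the coordinates
      before \<open>b\<close>, the vector \<open>d\<close> is an eigenvector of \<open>B\<close> for
      \<open>l b\<close>.\<close>
    define d where "d = (\<chi> r. if b \<le> r then x $ r else 0)"
    have Gx': "(if r < b then x $ r else 0) + (\<Sum>c\<in>UNIV. if c < b then 0 else (mat (l b) - B) $ r $ c * x $ c) = 0" for r
    proof -
      have "(\<Sum>c\<in>UNIV. G (l b) $ r $ c * x $ c) = 0"
        using Gx by (simp add: vec_eq_iff matrix_vector_mult_def)
      moreover have "G (l b) $ r $ c * x $ c = (if c = r then (if r < b then x $ r else 0) else 0) +
          (if c < b then 0 else (mat (l b) - B) $ r $ c * x $ c)" for c
        by (auto simp: G_def)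
      ultimately show ?thesis by (simp add: sum.distrib)
    qed
    have Bd: "(B *v d) $ r = l b * d $ r" if "b \<le> r" for r
    proof -
      have "0 = (\<Sum>c\<in>UNIV. if c < b then 0 else (mat (l b) - B) $ r $ c * x $ c)"
        using Gx'[of r] by (simp only: not_less[symmetric, THEN iffD2] that[unfolded not_less[symmetric]] if_False add_0_left)
      also have "\<dots> = (\<Sum>c\<in>UNIV. (mat (l b) - B) $ r $ c * d $ c)"
        by (rule sum.cong) (auto simp: d_def)
      also have "\<dots> = l b * d $ r - (B *v d) $ r"
        by (simp add: mat_def matrix_vector_mult_def algebra_simps sum_subtractf if_distrib[of "\<lambda>y. _ * y"] if_distrib[of "\<lambda>y. y * _"] cong: if_cong)
      finally show ?thesis by simp
    qed
    have "d \<noteq> 0"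
    proof
      assume "d = 0"
      then have "d $ r = 0" for r by simp
      then have xx: "x $ r = 0" if "b \<le> r" for r using that by (simp add: d_def) metis
      then have "(\<Sum>c\<in>UNIV. if c < b then 0 else (mat (l b) - B) $ r $ c * x $ c) = 0" for r
        by (intro sum.neutral) auto
      then have "x $ r = 0" if "r < b" for r using Gx'[of r] that by simp
      then have "x = 0" using xx by (simp add: vec_eq_iff) (meson not_le)
      then show False using x0 by simp
    qed
    then obtain i where i: "d $ i \<noteq> 0" by (auto simp: vec_eq_iff)
    then have "b \<le> i" by (auto simp: d_def split: if_splits)
    from exists_elimination_matrix[OF this, of d] i obtain P' where P': "invertible P'"
      "\<And>r s. s < b \<Longrightarrow> P' $ r $ s = (if r = s then 1 else 0)"
      "\<And>x r. r < b \<Longrightarrow> (P' *v x) $ r = x $ r" "\<And>r. r > b \<Longrightarrow> (P' *v d) $ r = 0" "(P' *v d) $ b \<noteq> 0"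
      by blast
    define Q where "Q = matrix_inv P'"
    have Q: "P' ** Q = mat 1" "Q ** P' = mat 1" unfolding Q_def using P'(1)
      by (simp_all add: matrix_inv_mult)
    define B' where "B' = P' ** B ** Q"
    have B'P': "B' ** P' = P' ** B" by (simp add: B'_def matrix_mul_assoc[symmetric] Q)
    have pa: "(P' ** P) ** A = B' ** (P' ** P)"
      by (simp add: matrix_mul_assoc B'P') (simp add: matrix_mul_assoc[symmetric] PA)
    have fixlow: "P' *v y = y" if "\<And>r. b \<le> r \<Longrightarrow> y $ r = 0" for y
    proof -
      have "(P' *v y) $ r = y $ r" for r
      proof -
        have "(P' *v y) $ r = (\<Sum>c\<in>UNIV. if c = r then y $ r else 0)"
          unfolding matrix_vector_mult_def vec_lambda_beta by (intro sum.cong refl) (metis P'(2) mult_1 mult_zero_left mult_zero_right not_le that)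
        then show ?thesis by simp
      qed
      then show ?thesis by (simp add: vec_eq_iff)
    qed
    have col: "B' *v axis c 1 = B *v axis c 1" if c: "c < b" for c
    proof -
      have "B' *v axis c 1 = B' *v (P' *v axis c 1)"
        using c by (subst fixlow[of "axis c 1"]) (auto simp: axis_def)
      also have "\<dots> = P' *v (B *v axis c 1)" by (simp add: matrix_vector_mul_assoc B'P')
      also have "\<dots> = B *v axis c 1"
        by (rule fixlow) (use B(2) c in \<open>auto simp: matrix_vector_mult_basis column_def\<close>)
      finally show ?thesis .
    qed
    have colc: "B' $ r $ c = B $ r $ c" if "c < b" for r c
      using col[OF that] by (simp add: matrix_vector_mult_basis column_def vec_eq_iff)
    define \<kappa> where "\<kappa> = (P' *v d) $ b"
    have P'd: "P' *v d = \<kappa> *s axis b 1"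
    proof -
      have "(P' *v d) $ r = (if r = b then \<kappa> else 0)" for r
        using P'(3)[of r d] P'(4)[of r] by (cases r b rule: linorder_cases) (auto simp: \<kappa>_def d_def)
      then show ?thesis by (simp add: vec_eq_iff axis_def)
    qed
    have "\<kappa> * B' $ r $ b = (if r = b then l b * \<kappa> else 0)" if r: "b \<le> r" for r
    proof -
      have "\<kappa> *s (B' *v axis b 1) = B' *v (P' *v d)"
        by (simp add: P'd vector_scalar_commute)
      also have "\<dots> = P' *v (B *v d)" by (simp add: matrix_vector_mul_assoc B'P')
      also have "B *v d = l b *s d + (B *v d - l b *s d)" by simp
      also have "P' *v \<dots> = P' *v (l b *s d) + P' *v (B *v d - l b *s d)" by (rule matrix_vector_right_distrib)
      also have "P' *v (B *v d - l b *s d) = B *v d - l b *s d"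
        by (rule fixlow) (use Bd in auto)
      also have "P' *v (l b *s d) = l b *s (\<kappa> *s axis b 1)" by (simp only: vector_scalar_commute P'd)
      finally have "(\<kappa> *s (B' *v axis b 1)) $ r = (l b *s (\<kappa> *s axis b 1) + (B *v d - l b *s d)) $ r" by simp
      moreover have "(B' *v axis b 1) $ r = B' $ r $ b" by (simp add: matrix_vector_mult_basis column_def)
      ultimately show ?thesis using Bd[OF r] by (auto simp: axis_def[of b 1])
    qed
    note kap = this
    have "\<kappa> \<noteq> 0" using P'(5) by (simp add: \<kappa>_def)
    then have cb1: "B' $ b $ b = l b" using kap[OF order_refl] by simp
    have cb2: "B' $ r $ b = 0" if "b < r" for r
      using kap[OF less_imp_le[OF that]] that \<open>\<kappa> \<noteq> 0\<close> by (metis less_irrefl mult_eq_0_iff)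
    have "invertible (P' ** P)" using P P'(1) by (rule invertible_mult[rotated])
    then show ?case
      using pa cb1 cb2 colc B by (intro exI[of _ "P' ** P"] exI[of _ B'] conjI) (auto simp: le_less)
  qed
  then show ?thesis unfolding upper_tri_def by blast
qed

text \<open>Since \<open>N\<close> is \<open>T\<close> times the inverse of \<open>S\<close>, this
  is the group property of triangular matrices; columns are compared in increasing order, dividing
  by the nonzero diagonal entries of \<open>S\<close>.\<close>

lemma upper_tri_inverse_left:
  fixes N T S :: "(('a::field,'n::{finite,wellorder}) vec,'n) vec"
  assumes "N ** S = T" "upper_tri S" "upper_tri T" "invertible S"
  shows "upper_tri N"
proof -
  have "det S = (\<Prod>i\<in>UNIV. S $ i $ i)"
    by (rule det_upperdiagonal) (use assms(2) in \<open>auto simp: upper_tri_def\<close>)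
  then have diag: "S $ i $ i \<noteq> 0" for i
    using assms(4) by (auto simp: invertible_det_nz)
  have "\<forall>r>c. N $ r $ c = 0" for c
  proof (induction c rule: less_induct)
    case (less c)
    show ?case
    proof safe
      fix r assume r: "r > c"
      have "0 = (\<Sum>k\<in>UNIV. N $ r $ k * S $ k $ c)"
        using assms(3) r by (simp add: assms(1)[symmetric] upper_tri_def matrix_mult_nth)
      also have "\<dots> = (\<Sum>k\<in>UNIV. if k = c then N $ r $ c * S $ c $ c else 0)"
      proof (rule sum.cong)
        fix k show "N $ r $ k * S $ k $ c = (if k = c then N $ r $ c * S $ c $ c else 0)"
        proof (cases k c rule: linorder_cases)
          case less
          then show ?thesis using less.IH[OF less] r by simp
        next
          case greater
          then show ?thesis using assms(2) by (simp add: upper_tri_def)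
        qed auto
      qed simp
      finally show "N $ r $ c = 0" using diag by simp
    qed
  qed
  then show ?thesis by (simp add: upper_tri_def)
qed

section \<open>Linear differential systems and constant matrices over a differential field\<close>

locale constant_field =
  fixes D :: "'l::field \<Rightarrow> 'l" and j :: "'c::field \<Rightarrow> 'l"
  assumes D: "derivation D"
    and j_add: "j (a + b) = j a + j b" and j_mult: "j (a * b) = j a * j b" and j_1: "j 1 = 1"
    and range_j: "range j = {x. D x = 0}"
begin

lemma D_add: "D (x + y) = D x + D y" and D_mult: "D (x * y) = D x * y + x * D y"
  using D by (auto simp: derivation_def)

lemma D_0: "D 0 = 0" using D_add[of 0 0] by (metis add.right_neutral add_left_cancel)

lemma D_sum: "D (sum f A) = (\<Sum>x\<in>A. D (f x))"
  by (induction A rule: infinite_finite_induct) (auto simp: D_0 D_add)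

lemma j_0: "j 0 = 0" using j_add[of 0 0] by (metis add.right_neutral add_left_cancel)

lemma D_j: "D (j a) = 0" using range_j by auto

lemma j_sum: "j (sum f A) = (\<Sum>x\<in>A. j (f x))"
  by (induction A rule: infinite_finite_induct) (auto simp: j_0 j_add)

lemma j_matrix_mult: "map_matrix j (A ** B) = map_matrix j A ** map_matrix j B"
  by (simp add: vec_eq_iff matrix_mult_nth j_sum j_mult)

lemma j_matrix_mat1: "map_matrix j (mat 1) = mat 1"
  by (simp add: vec_eq_iff mat_def j_0 j_1)

lemma invertible_j: "invertible P \<Longrightarrow> invertible (map_matrix j P)"
  unfolding invertible_def by (metis j_matrix_mult j_matrix_mat1)

lemma D_matrix_mult: "map_matrix D (A ** B) = map_matrix D A ** B + A ** map_matrix D B"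
  by (simp add: vec_eq_iff matrix_mult_nth D_sum D_mult sum.distrib)

text \<open>Two solutions of the same scalar equation of order one have a quotient with derivative
  zero, and \<open>range_j\<close>, the absence of new constants, places it in the constant
  field.\<close>

lemma ratio_constant:
  assumes "D x = e * x" "D y = e * y" "y \<noteq> 0"
  shows "\<exists>c. x = j c * y"
proof -
  have "D x = D (x / y) * y + (x / y) * D y" using D_mult[of "x / y" y] assms(3) by simp
  then have "D (x / y) * y = 0" using assms by simp
  then have "D (x / y) = 0" using assms(3) by simp
  then obtain c where "x / y = j c" using range_j by auto
  then show ?thesis using assms(3) by (intro exI[of _ c]) (simp add: field_simps)
qed

text \<open>In the rows from \<open>b\<close> on, the next column of \<open>Y\<close> satisfies a
  scalar equation with coefficient \<open>R $ b $ b\<close>, because \<open>R\<close> is triangular.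
  Its entries there are constant multiples of one of them, so an elimination matrix with constant
  entries clears them. Multiplication by a constant matrix from the left preserves the equation, and
  the argument can be repeated.\<close>

lemma constant_triangularization:
  fixes Y R :: "(('l,'n::{finite,wellorder}) vec,'n) vec"
  assumes Y: "invertible Y" and DY: "map_matrix D Y = Y ** R" and R: "upper_tri R"
  shows "\<exists>P :: (('c,'n) vec,'n) vec. invertible P \<and> upper_tri (map_matrix j P ** Y)"
proof -
  have "\<exists>P :: (('c,'n) vec,'n) vec. invertible P \<and> (\<forall>c\<in>UNIV. \<forall>r>c. (map_matrix j P ** Y) $ r $ c = 0)"
  proof (induction rule: finite_linorder_downset_induct)
    case empty
    have "invertible (mat 1 :: (('c, 'n) vec, 'n) vec)" by (auto simp: invertible_def intro!: exI[of _ "mat 1"])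
    then show ?case by auto
  next
    case (step b)
    then obtain P :: "(('c,'n) vec,'n) vec" where P: "invertible P"
      and PY: "\<And>c r. c < b \<Longrightarrow> r > c \<Longrightarrow> (map_matrix j P ** Y) $ r $ c = 0" by auto
    define Z where "Z = map_matrix j P ** Y"
    have Z0: "Z $ r $ c = 0" if "c < b" "r > c" for r c using PY that by (simp add: Z_def)
    have invZ: "invertible Z" unfolding Z_def by (intro invertible_mult invertible_j P Y)
    have "map_matrix D (map_matrix j P) = 0" by (simp add: vec_eq_iff D_j)
    then have DZ: "map_matrix D Z = Z ** R" unfolding Z_def D_matrix_mult DY
      by (simp add: matrix_mul_assoc)
    have Dz: "D (Z $ r $ b) = R $ b $ b * Z $ r $ b" if r: "b \<le> r" for r
    proof -
      have "D (Z $ r $ b) = (\<Sum>c\<in>UNIV. Z $ r $ c * R $ c $ b)"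
        using arg_cong[OF DZ, of "\<lambda>M. M $ r $ b"] by (simp add: matrix_mult_nth)
      also have "\<dots> = (\<Sum>c\<in>UNIV. if c = b then Z $ r $ b * R $ b $ b else 0)"
      proof (rule sum.cong)
        fix c show "Z $ r $ c * R $ c $ b = (if c = b then Z $ r $ b * R $ b $ b else 0)"
          using r R Z0[of c r] by (cases c b rule: linorder_cases) (auto simp: upper_tri_def)
      qed simp
      finally show ?thesis by (simp add: mult.commute)
    qed
    \<comment> \<open>A pivot exists: otherwise the rows from \<open>b\<close> on would vanish in
      all columns up to \<open>b\<close>, which invertibility excludes.\<close>
    have "\<exists>i\<ge>b. Z $ i $ b \<noteq> 0"
    proof (rule ccontr)
      assume "\<not> ?thesis"
      then have "Z $ r $ c = 0" if "b \<le> r" "c \<le> b" for r c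
        using that Z0[of c r] by (cases "c = b") auto
      then have "det Z = 0" by (rule det_eq_0_block)
      then show False using invZ by (simp add: invertible_det_nz)
    qed
    then obtain i where i: "b \<le> i" "Z $ i $ b \<noteq> 0" by blast
    have "\<forall>r. \<exists>c. b \<le> r \<longrightarrow> Z $ r $ b = j c * Z $ i $ b"
      using ratio_constant[OF Dz Dz[OF i(1)] i(2)] by blast
    then obtain d0 where d0: "\<And>r. b \<le> r \<Longrightarrow> Z $ r $ b = j (d0 r) * Z $ i $ b" by metis
    define d where "d = (\<chi> r. if b \<le> r then d0 r else 0)"
    have "d $ i \<noteq> 0" using d0[OF i(1)] i j_0 by (auto simp: d_def)
    from exists_elimination_matrix[OF i(1) this] obtain P' where P': "invertible P'"
      "\<And>r s. s < b \<Longrightarrow> P' $ r $ s = (if r = s then 1 else 0)"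
      "\<And>r. r > b \<Longrightarrow> (P' *v d) $ r = 0" by blast
    have eq: "map_matrix j (P' ** P) ** Y = map_matrix j P' ** Z"
      by (simp add: j_matrix_mult Z_def matrix_mul_assoc)
    have "(map_matrix j P' ** Z) $ r $ c = 0" if "c \<le> b" "r > c" for r c
    proof (cases "c = b")
      case False
      then have cb: "c < b" using that by simp
      have "j (P' $ r $ s) * Z $ s $ c = 0" for s
      proof (cases "s \<le> c")
        case True
        then have "s < b" "r \<noteq> s" using cb that by auto
        then show ?thesis by (simp add: P'(2) j_0)
      qed (use Z0[OF cb] in auto)
      then show ?thesis unfolding matrix_mult_nth map_matrix_nth by (intro sum.neutral) auto
    next
      case True
      have "j (P' $ r $ s) * Z $ s $ b = j (P' $ r $ s * d $ s) * Z $ i $ b" for s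
      proof (cases "b \<le> s")
        case True
        then show ?thesis using d0[OF True] by (simp add: d_def j_mult)
      next
        case False
        then have "r \<noteq> s" using that \<open>c = b\<close> by auto
        then show ?thesis using False by (simp add: P'(2) j_0)
      qed
      then have "(map_matrix j P' ** Z) $ r $ c = j (\<Sum>s\<in>UNIV. P' $ r $ s * d $ s) * Z $ i $ b"
        using True by (simp add: matrix_mult_nth j_sum sum_distrib_right)
      also have "(\<Sum>s\<in>UNIV. P' $ r $ s * d $ s) = (P' *v d) $ r" by (simp add: matrix_vector_mult_def)
      also have "\<dots> = 0" using P'(3) that True by simp
      finally show ?thesis by (simp add: j_0)
    qed
    then show ?case using invertible_mult[OF P'(1) P] eq by (intro exI[of _ "P' ** P"]) auto
  qed
  then show ?thesis unfolding upper_tri_def by blast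
qed

text \<open>The columns of \<open>U\<close> span a flag of \<open>K\<close>-rational subspaces that is stable under \<open>D - A\<close>;
  in the coordinates given by \<open>\<Phi>\<close> it becomes a flag of constant subspaces.\<close>

lemma constant_matrices_triangularizable:
  fixes \<Phi> U A R :: "(('l,'n::{finite,wellorder}) vec,'n) vec"
  assumes \<Phi>: "invertible \<Phi>" "map_matrix D \<Phi> = A ** \<Phi>"
    and U: "invertible U" "map_matrix D U = A ** U + U ** R" and R: "upper_tri R"
  shows "\<exists>P :: (('c,'n) vec,'n) vec. invertible P \<and>
    (\<forall>M \<sigma>. (\<forall>x y. \<sigma> (x + y) = \<sigma> x + \<sigma> y) \<longrightarrow> (\<forall>x y. \<sigma> (x * y) = \<sigma> x * \<sigma> y) \<longrightarrow> \<sigma> 1 = 1 \<longrightarrow>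
        (\<forall>c. \<sigma> (j c) = j c) \<longrightarrow> map_matrix \<sigma> U = U \<longrightarrow> map_matrix \<sigma> \<Phi> = \<Phi> ** map_matrix j M \<longrightarrow>
        upper_tri (matrix_inv P ** M ** P))"
proof -
  define \<Psi> where "\<Psi> = matrix_inv \<Phi>"
  have \<Psi>: "\<Phi> ** \<Psi> = mat 1" "\<Psi> ** \<Phi> = mat 1" unfolding \<Psi>_def using \<Phi>(1) by (simp_all add: matrix_inv_mult)
  define Y where "Y = \<Psi> ** U"
  have \<Phi>Y: "\<Phi> ** Y = U" by (simp add: Y_def matrix_mul_assoc \<Psi>)
  have invY: "invertible Y" unfolding Y_def
    using invertible_mult[of \<Psi> U] \<Psi> U(1) unfolding invertible_def by blast
  \<comment> \<open>Differentiation of \<open>\<Phi> ** Y = U\<close> in two ways: the terms with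
    \<open>A\<close> cancel, and the coordinates \<open>Y\<close> of the flag satisfy an equation
    whose only coefficient is the triangular \<open>R\<close>.\<close>
  have "A ** U + \<Phi> ** map_matrix D Y = map_matrix D (\<Phi> ** Y)"
    by (simp add: D_matrix_mult \<Phi>(2)) (simp add: matrix_mul_assoc[symmetric] \<Phi>Y)
  also have "\<dots> = A ** U + \<Phi> ** (Y ** R)" by (simp add: \<Phi>Y U(2) matrix_mul_assoc)
  finally have "\<Psi> ** (\<Phi> ** map_matrix D Y) = \<Psi> ** (\<Phi> ** (Y ** R))" by simp
  then have "map_matrix D Y = Y ** R" by (simp add: matrix_mul_assoc \<Psi>)
  from constant_triangularization[OF invY this R] obtain P :: "(('c,'n) vec,'n) vec"
    where P: "invertible P" and up: "upper_tri (map_matrix j P ** Y)" by blast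
  define Q where "Q = matrix_inv P"
  have PQ: "P ** Q = mat 1" "Q ** P = mat 1" unfolding Q_def using P by (simp_all add: matrix_inv_mult)
  have invQ: "matrix_inv Q = P" using PQ by (intro matrix_inv_eqI)
  show ?thesis
  proof (intro exI[of _ Q] conjI allI impI)
    show "invertible Q" using PQ by (auto simp: invertible_def)
    fix M \<sigma>
    assume \<sigma>: "\<forall>x y. \<sigma> (x + y) = \<sigma> x + \<sigma> y" "\<forall>x y. \<sigma> (x * y) = \<sigma> x * \<sigma> y" "\<sigma> 1 = 1"
      "\<forall>c. \<sigma> (j c) = j c" "map_matrix \<sigma> U = U" "map_matrix \<sigma> \<Phi> = \<Phi> ** map_matrix j M"
    have \<sigma>0: "\<sigma> 0 = 0" using \<sigma>(1)[rule_format, of 0 0] by (metis add.right_neutral add_left_cancel)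
    have \<sigma>_sum: "\<sigma> (sum f A) = (\<Sum>x\<in>A. \<sigma> (f x))" for f and A :: "'n set"
      by (induction A rule: infinite_finite_induct) (auto simp: \<sigma>0 \<sigma>(1))
    have \<sigma>_mult: "map_matrix \<sigma> (A ** B) = map_matrix \<sigma> A ** map_matrix \<sigma> B" for A B :: "(('l,'n) vec,'n) vec"
      by (simp add: vec_eq_iff matrix_mult_nth \<sigma>_sum \<sigma>(2))
    have \<sigma>j: "map_matrix \<sigma> (map_matrix j B) = map_matrix j B" for B :: "(('c,'n) vec,'n) vec"
      by (simp add: vec_eq_iff \<sigma>(4))
    have \<sigma>nz: "\<sigma> x \<noteq> 0" if "x \<noteq> 0" for x
    proof
      assume "\<sigma> x = 0"
      then have "\<sigma> (x * inverse x) = 0" by (simp add: \<sigma>(2))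
      then show False using that \<sigma>(3) by simp
    qed
    define T where "T = map_matrix j P ** Y"
    have \<sigma>T: "map_matrix \<sigma> T = map_matrix j P ** map_matrix \<sigma> Y" by (simp add: T_def \<sigma>_mult \<sigma>j)
    have "\<Phi> ** (map_matrix j M ** map_matrix \<sigma> Y) = map_matrix \<sigma> (\<Phi> ** Y)"
      by (simp add: \<sigma>_mult \<sigma>(6) matrix_mul_assoc)
    also have "\<dots> = \<Phi> ** Y" by (simp add: \<Phi>Y \<sigma>(5))
    finally have "\<Psi> ** (\<Phi> ** (map_matrix j M ** map_matrix \<sigma> Y)) = \<Psi> ** (\<Phi> ** Y)" by simp
    then have MY: "map_matrix j M ** map_matrix \<sigma> Y = Y" by (simp add: matrix_mul_assoc \<Psi>)
    \<comment> \<open>As \<sigma> fixes \<open>U\<close> and sends \<open>\<Phi>\<close> to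
      \<open>\<Phi>\<close> times \<open>M\<close>, it sends \<open>Y\<close> to the inverse of
      \<open>M\<close> times \<open>Y\<close>. Hence the constant matrix \<open>P ** M ** Q\<close>
      carries the image of \<open>T\<close> under \<sigma>, which is again triangular, to the
      triangular \<open>T\<close>; this forces it to be triangular.\<close>
    have "map_matrix j (P ** M ** Q) ** map_matrix \<sigma> T =
        map_matrix j P ** (map_matrix j M ** (map_matrix j (Q ** P) ** map_matrix \<sigma> Y))"
      unfolding \<sigma>T by (simp add: j_matrix_mult matrix_mul_assoc)
    also have "\<dots> = T" by (simp add: PQ j_matrix_mat1 MY T_def)
    finally have 1: "map_matrix j (P ** M ** Q) ** map_matrix \<sigma> T = T" .
    have upT: "upper_tri T" using up by (simp add: T_def)
    then have "upper_tri (map_matrix \<sigma> T)" by (simp add: upper_tri_def \<sigma>0)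
    moreover have "invertible T" unfolding T_def by (intro invertible_mult invertible_j P invY)
    then have "invertible (map_matrix \<sigma> T)" unfolding invertible_def
    proof safe
      fix S assume "T ** S = mat 1" "S ** T = mat 1"
      moreover have "map_matrix \<sigma> (mat 1) = (mat 1 :: (('l,'n) vec,'n) vec)"
        by (simp add: vec_eq_iff mat_def \<sigma>0 \<sigma>(3))
      ultimately show "\<exists>A'. map_matrix \<sigma> T ** A' = mat 1 \<and> A' ** map_matrix \<sigma> T = mat 1"
        by (metis \<sigma>_mult)
    qed
    ultimately have up2: "upper_tri (map_matrix j (P ** M ** Q))"
      using upper_tri_inverse_left[OF 1] upT by blast
    have "c = 0" if "j c = 0" for c
    proof (rule ccontr)
      assume "c \<noteq> 0"
      then have "j c * j (inverse c) = 1" by (simp add: j_mult[symmetric] j_1)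
      then show False using that by simp
    qed
    then show "upper_tri (matrix_inv Q ** M ** Q)"
      using up2 unfolding invQ upper_tri_def by simp
  qed
qed

end

section \<open>Meromorphic functions on the surface\<close>

text \<open>Identity theorem with equality at every point, poles included: the difference with
  singularities removed vanishes identically, so both functions have the same poles, and at a pole
  both take the value 0 by normalization.\<close>

lemma nicely_meromorphic_eqI:
  assumes f: "f nicely_meromorphic_on A" and g: "g nicely_meromorphic_on A"
    and A: "open A" "connected A" and z: "z \<in> A" "\<forall>\<^sub>F w in at z. f w = g w" and w: "w \<in> A"
  shows "f w = g w"
proof -
  define d where "d = remove_sings (\<lambda>z. f z - g z)"
  have fm: "f meromorphic_on A" and gm: "g meromorphic_on A"
    using f g by (auto simp: nicely_meromorphic_on_def)
  have fg: "(\<lambda>z. f z - g z) meromorphic_on A" by (intro meromorphic_intros fm gm)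
  have iso: "isolated_singularity_at (\<lambda>z. f z - g z) x" if "x \<in> A" for x
    using fg that by (metis meromorphic_on_isolated_singularity meromorphic_on_meromorphic_at)
  have d: "d nicely_meromorphic_on A" unfolding d_def by (rule remove_sings_nicely_meromorphic[OF fg])
  have "\<forall>\<^sub>F x in at z. d x = 0"
    using z(2) eventually_remove_sings_eq_at[OF iso[OF z(1)]] unfolding d_def by eventually_elim simp
  then have "\<exists>\<^sub>F x in at z. d x = 0" by (intro eventually_frequently) auto
  then have d0: "d x = 0" if "x \<in> A" for x
    using frequently_eq_meromorphic_imp_constant[OF _ d A z(1)] that by blast
  have ev: "\<forall>\<^sub>F x in at w. f x = g x"
  proof -
    have "\<forall>\<^sub>F x in at w. x \<in> A" using A w by (simp add: eventually_at_in_open')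
    then show ?thesis
      using eventually_remove_sings_eq_at[OF iso[OF w]] by eventually_elim (use d0 in \<open>simp add: d_def\<close>)
  qed
  have fw: "is_pole f w \<and> f w = 0 \<or> f \<midarrow>w\<rightarrow> f w" and gw: "is_pole g w \<and> g w = 0 \<or> g \<midarrow>w\<rightarrow> g w"
    using f g w by (auto simp: nicely_meromorphic_on_def)
  have pole: "is_pole f w \<longleftrightarrow> is_pole g w" by (rule is_pole_cong) (use ev in auto)
  show ?thesis
  proof (cases "is_pole f w")
    case True
    moreover have "\<not> f \<midarrow>w\<rightarrow> f w" using True unfolding is_pole_def
      by (auto dest: not_tendsto_and_filterlim_at_infinity[OF at_neq_bot])
    moreover have "\<not> g \<midarrow>w\<rightarrow> g w" using True pole unfolding is_pole_def
      by (auto dest: not_tendsto_and_filterlim_at_infinity[OF at_neq_bot])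
    ultimately show ?thesis using fw gw by auto
  next
    case False
    then have "f \<midarrow>w\<rightarrow> f w" "g \<midarrow>w\<rightarrow> g w" using fw gw pole by auto
    moreover have "f \<midarrow>w\<rightarrow> g w" using \<open>g \<midarrow>w\<rightarrow> g w\<close> ev tendsto_cong[OF ev] by blast
    ultimately show ?thesis using LIM_unique by blast
  qed
qed

lemma nicely_meromorphic_on_cong_open:
  assumes "open A" "\<And>z. z \<in> A \<Longrightarrow> f z = g z"
  shows "f nicely_meromorphic_on A \<longleftrightarrow> g nicely_meromorphic_on A"
proof -
  have ev: "\<forall>\<^sub>F w in at z. f w = g w" if "z \<in> A" for z
    using eventually_at_in_open'[OF assms(1) that] by eventually_elim (rule assms(2))
  have 1: "f meromorphic_on A \<longleftrightarrow> g meromorphic_on A" by (rule meromorphic_on_cong) (use ev in auto)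
  have 2: "is_pole f z \<longleftrightarrow> is_pole g z" if "z \<in> A" for z
    by (rule is_pole_cong) (use ev[OF that] in auto)
  have 3: "(f \<midarrow>z\<rightarrow> f z) \<longleftrightarrow> (g \<midarrow>z\<rightarrow> g z)" if "z \<in> A" for z
    using tendsto_cong[OF ev[OF that]] assms(2)[OF that] by simp
  show ?thesis unfolding nicely_meromorphic_on_def using 1 2 3 assms(2) by auto
qed

text \<open>An injective holomorphic map is open, hence a homeomorphism onto its image. In this form
  the fact lets statements valid near a point, but perhaps not at it, pass through the gluing
  maps.\<close>

lemma filtermap_at_injective_holomorphic:
  assumes "f holomorphic_on S" "open S" "inj_on f S" "z \<in> S"
  shows "filtermap f (at z) = at (f z)"
proof (rule filtermap_nhds_eq_imp_filtermap_at_eq)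
  show "filtermap f (nhds z) = nhds (f z)"
  proof (rule filtermap_nhds_open_map')
    show "isCont f z" using assms holomorphic_on_imp_continuous_on continuous_on_eq_continuous_at by blast
    show "open S" "z \<in> S" by fact+
    fix T assume "open T" "T \<subseteq> S"
    then show "open (f ` T)" using assms by (meson holomorphic_on_subset inj_on_subset open_mapping_thm3)
  qed
  show "\<forall>\<^sub>F x in at z. f x = f z \<longrightarrow> x = z"
    using eventually_at_in_open'[OF assms(2,4)] by eventually_elim (use assms(3,4) in \<open>auto dest: inj_onD\<close>)
qed

text \<open>The function theory of the surface depends on the gluing alone, not on the orbit. The
  points \<open>s1\<close> and \<open>s2\<close> witness that the overlaps are nonempty;
  \<open>t0\<close> is the point at which germs are taken.\<close>

locale surface_charts =
  fixes \<Gamma> :: desing and s1 s2 t0 :: complex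
  assumes lam: "lam_minus \<Gamma> < 0" "0 < lam_plus \<Gamma>" and rad: "rad_minus \<Gamma> > 0" "rad_plus \<Gamma> > 0"
    and open_Sigma: "open (Sigma_t \<Gamma>)" and conn_Sigma: "connected (Sigma_t \<Gamma>)"
    and conn_minus: "connected (overlap_minus \<Gamma>)" and conn_plus: "connected (overlap_plus \<Gamma>)"
    and inj_minus: "inj_on (glue_minus \<Gamma>) (overlap_minus \<Gamma>)"
    and inj_plus: "inj_on (glue_plus \<Gamma>) (overlap_plus \<Gamma>)"
    and s1: "s1 \<in> overlap_minus \<Gamma>" and s2: "s2 \<in> overlap_plus \<Gamma>" and t0: "t0 \<in> Sigma_t \<Gamma>"
begin

abbreviation "K \<equiv> meromorphic_functions \<Gamma>"

lemma open_dom: "open (chart_dom \<Gamma> c)" by (cases c) (auto simp: open_Sigma)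

lemma conn_dom: "connected (chart_dom \<Gamma> c)" by (cases c) (auto simp: conn_Sigma)

lemma glue_holo: "glue_minus \<Gamma> holomorphic_on S" "glue_plus \<Gamma> holomorphic_on S"
  unfolding glue_minus_def[abs_def] glue_plus_def[abs_def] by (auto intro!: holomorphic_intros)

lemma open_overlap: "open (overlap_minus \<Gamma>)" "open (overlap_plus \<Gamma>)"
proof -
  have "overlap_minus \<Gamma> = Sigma_t \<Gamma> \<inter> glue_minus \<Gamma> -` chart_dom \<Gamma> Minus"
    "overlap_plus \<Gamma> = Sigma_t \<Gamma> \<inter> glue_plus \<Gamma> -` chart_dom \<Gamma> Plus"
    by (auto simp: overlap_minus_def overlap_plus_def)
  then show "open (overlap_minus \<Gamma>)" "open (overlap_plus \<Gamma>)"
    by (simp_all only: continuous_open_preimage[OF holomorphic_on_imp_continuous_on open_Sigma open_dom] glue_holo)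
qed

lemma filtermap_glue:
  "t \<in> overlap_minus \<Gamma> \<Longrightarrow> filtermap (glue_minus \<Gamma>) (at t) = at (glue_minus \<Gamma> t)"
  "t \<in> overlap_plus \<Gamma> \<Longrightarrow> filtermap (glue_plus \<Gamma>) (at t) = at (glue_plus \<Gamma> t)"
  by (rule filtermap_at_injective_holomorphic[OF glue_holo(1) open_overlap(1) inj_minus], assumption)
    (rule filtermap_at_injective_holomorphic[OF glue_holo(2) open_overlap(2) inj_plus], assumption)

lemma K_mero: "g \<in> K \<Longrightarrow> g c meromorphic_on chart_dom \<Gamma> c"
  and K_nice: "g \<in> K \<Longrightarrow> g c nicely_meromorphic_on chart_dom \<Gamma> c"
  and K_glue: "g \<in> K \<Longrightarrow> t \<in> overlap_minus \<Gamma> \<Longrightarrow> g Time t = g Minus (glue_minus \<Gamma> t)"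
    "g \<in> K \<Longrightarrow> t \<in> overlap_plus \<Gamma> \<Longrightarrow> g Time t = g Plus (glue_plus \<Gamma> t)"
  by (auto simp: meromorphic_functions_def nicely_meromorphic_on_def)

text \<open>The germ at a single point determines a meromorphic function on the connected
  \<open>Sigma_t\<close>, and through the overlaps at \<open>s1\<close> and \<open>s2\<close> also
  on both discs.\<close>

lemma K_eqI:
  assumes g: "g \<in> K" and h: "h \<in> K" and t: "t \<in> Sigma_t \<Gamma>" and ev: "\<forall>\<^sub>F s in at t. g Time s = h Time s"
  shows "g = h"
proof -
  have 1: "g Time s = h Time s" if "s \<in> Sigma_t \<Gamma>" for s
    using nicely_meromorphic_eqI[OF K_nice[OF g, of Time] K_nice[OF h, of Time] _ _ _ ev] t that open_Sigma conn_Sigma by simp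
  have m: "\<forall>\<^sub>F z in at (glue_minus \<Gamma> s1). g Minus z = h Minus z"
    unfolding filtermap_glue(1)[OF s1, symmetric] eventually_filtermap
    using eventually_at_in_open'[OF open_overlap(1) s1]
    by eventually_elim (use 1 K_glue(1)[OF g] K_glue(1)[OF h] in \<open>auto simp: overlap_minus_def\<close>)
  have p: "\<forall>\<^sub>F z in at (glue_plus \<Gamma> s2). g Plus z = h Plus z"
    unfolding filtermap_glue(2)[OF s2, symmetric] eventually_filtermap
    using eventually_at_in_open'[OF open_overlap(2) s2]
    by eventually_elim (use 1 K_glue(2)[OF g] K_glue(2)[OF h] in \<open>auto simp: overlap_plus_def\<close>)
  have "g c z = h c z" if z: "z \<in> chart_dom \<Gamma> c" for c z
  proof (cases c)
    case Minus
    then show ?thesis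
      using nicely_meromorphic_eqI[OF K_nice[OF g, of Minus] K_nice[OF h, of Minus] open_dom conn_dom _ m] z s1
      by (auto simp: overlap_minus_def)
  next
    case Plus
    then show ?thesis
      using nicely_meromorphic_eqI[OF K_nice[OF g, of Plus] K_nice[OF h, of Plus] open_dom conn_dom _ p] z s2
      by (auto simp: overlap_plus_def)
  qed (use 1 z in auto)
  moreover have "g c z = h c z" if z: "z \<notin> chart_dom \<Gamma> c" for c z
    using z g h by (auto simp: meromorphic_functions_def)
  ultimately show ?thesis by (intro ext) metis
qed

lemma iso: "f meromorphic_on A \<Longrightarrow> z \<in> A \<Longrightarrow> isolated_singularity_at f z"
  by (metis meromorphic_on_isolated_singularity meromorphic_on_meromorphic_at)

text \<open>Compatibility of the representatives near one point of each overlap suffices: the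
  overlaps are connected, so the identity theorem spreads it once singularities are removed. The
  weak hypothesis is adapted to derivatives, where the chain rule is available only away from
  poles.\<close>

lemma reduce_K:
  assumes mero: "\<And>c. g c meromorphic_on chart_dom \<Gamma> c"
    and m: "\<forall>\<^sub>F t in at s1. g Time t = g Minus (glue_minus \<Gamma> t)"
    and p: "\<forall>\<^sub>F t in at s2. g Time t = g Plus (glue_plus \<Gamma> t)"
  shows "reduce \<Gamma> g \<in> K" and "t \<in> Sigma_t \<Gamma> \<Longrightarrow> \<forall>\<^sub>F s in at t. reduce \<Gamma> g Time s = g Time s"
proof -
  have glue: "remove_sings (g Time) t = remove_sings (g c) (G t)"
    if c: "G holomorphic_on O1" "open O1" "connected O1" "G ` O1 \<subseteq> chart_dom \<Gamma> c" "O1 \<subseteq> Sigma_t \<Gamma>"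
      "\<And>t. t \<in> O1 \<Longrightarrow> filtermap G (at t) = at (G t)"
      and s: "s \<in> O1" "\<forall>\<^sub>F t in at s. g Time t = g c (G t)" and t: "t \<in> O1" for G O1 c s t
  proof -
    have T: "g Time meromorphic_on O1" using mero[of Time] c(5) meromorphic_on_subset by auto
    have "(\<lambda>t. g c (G t)) meromorphic_on O1"
      by (rule meromorphic_on_compose[OF mero[of c]]) (use c in \<open>auto simp: analytic_on_open\<close>)
    then have C: "g c \<circ> G meromorphic_on O1" by (simp add: o_def)
    have ev: "\<forall>\<^sub>F t in at s. remove_sings (g Time) t = remove_sings (g c \<circ> G) t"
      using s(2) eventually_remove_sings_eq_at[OF iso[OF T s(1)]] eventually_remove_sings_eq_at[OF iso[OF C s(1)]]
      by eventually_elim simp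
    have "remove_sings (g Time) t = remove_sings (g c \<circ> G) t"
      by (rule nicely_meromorphic_eqI[OF _ _ c(2,3) s(1) ev t]) (auto intro: remove_sings_nicely_meromorphic T C)
    also have "\<dots> = remove_sings (g c) (G t)" by (rule remove_sings_compose[OF c(6)[OF t]])
    finally show ?thesis .
  qed
  have nice: "reduce \<Gamma> g c nicely_meromorphic_on chart_dom \<Gamma> c" for c
    using remove_sings_nicely_meromorphic[OF mero[of c]]
    by (subst nicely_meromorphic_on_cong_open[OF open_dom, of _ _ "remove_sings (g c)"]) (auto simp: reduce_def)
  have "reduce \<Gamma> g Time t = reduce \<Gamma> g Minus (glue_minus \<Gamma> t)" if t: "t \<in> overlap_minus \<Gamma>" for t
  proof -
    have "glue_minus \<Gamma> ` overlap_minus \<Gamma> \<subseteq> chart_dom \<Gamma> Minus" "overlap_minus \<Gamma> \<subseteq> Sigma_t \<Gamma>"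
      by (auto simp: overlap_minus_def)
    from glue[OF glue_holo(1) open_overlap(1) conn_minus this filtermap_glue(1) s1 m t]
    show ?thesis using t by (simp add: reduce_def overlap_minus_def)
  qed
  moreover have "reduce \<Gamma> g Time t = reduce \<Gamma> g Plus (glue_plus \<Gamma> t)" if t: "t \<in> overlap_plus \<Gamma>" for t
  proof -
    have "glue_plus \<Gamma> ` overlap_plus \<Gamma> \<subseteq> chart_dom \<Gamma> Plus" "overlap_plus \<Gamma> \<subseteq> Sigma_t \<Gamma>"
      by (auto simp: overlap_plus_def)
    from glue[OF glue_holo(2) open_overlap(2) conn_plus this filtermap_glue(2) s2 p t]
    show ?thesis using t by (simp add: reduce_def overlap_plus_def)
  qed
  moreover have "reduce \<Gamma> g c z = 0" if "z \<notin> chart_dom \<Gamma> c" for c z using that by (simp add: reduce_def)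
  ultimately show "reduce \<Gamma> g \<in> K" using nice unfolding meromorphic_functions_def by blast
  assume t: "t \<in> Sigma_t \<Gamma>"
  then have "isolated_singularity_at (g Time) t" using iso[OF mero[of Time]] by simp
  from eventually_remove_sings_eq_at[OF this] eventually_at_in_open'[OF open_Sigma t]
  show "\<forall>\<^sub>F s in at t. reduce \<Gamma> g Time s = g Time s"
    by eventually_elim (simp add: reduce_def)
qed

lemma reduce_K':
  assumes mero: "\<And>c. g c meromorphic_on chart_dom \<Gamma> c"
    and m: "\<forall>t\<in>overlap_minus \<Gamma>. g Time t = g Minus (glue_minus \<Gamma> t)"
    and p: "\<forall>t\<in>overlap_plus \<Gamma>. g Time t = g Plus (glue_plus \<Gamma> t)"
  shows "reduce \<Gamma> g \<in> K" and "t \<in> Sigma_t \<Gamma> \<Longrightarrow> \<forall>\<^sub>F s in at t. reduce \<Gamma> g Time s = g Time s"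
proof -
  have 1: "\<forall>\<^sub>F t in at s1. g Time t = g Minus (glue_minus \<Gamma> t)"
    using eventually_at_in_open'[OF open_overlap(1) s1] by eventually_elim (rule m[rule_format])
  have 2: "\<forall>\<^sub>F t in at s2. g Time t = g Plus (glue_plus \<Gamma> t)"
    using eventually_at_in_open'[OF open_overlap(2) s2] by eventually_elim (rule p[rule_format])
  show "reduce \<Gamma> g \<in> K" and "t \<in> Sigma_t \<Gamma> \<Longrightarrow> \<forall>\<^sub>F s in at t. reduce \<Gamma> g Time s = g Time s"
    using reduce_K[of g, OF mero 1 2] by blast+
qed

lemma holomorphic_K:
  assumes hol: "\<And>c. g c holomorphic_on chart_dom \<Gamma> c" and z: "\<And>c z. z \<notin> chart_dom \<Gamma> c \<Longrightarrow> g c z = 0"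
    and m: "\<And>t. t \<in> overlap_minus \<Gamma> \<Longrightarrow> g Time t = g Minus (glue_minus \<Gamma> t)"
    and p: "\<And>t. t \<in> overlap_plus \<Gamma> \<Longrightarrow> g Time t = g Plus (glue_plus \<Gamma> t)"
  shows "g \<in> K"
  unfolding meromorphic_functions_def using z m p hol open_dom
  by (auto simp: analytic_on_open intro!: analytic_on_imp_nicely_meromorphic_on)

lemma const_K: "const_fun \<Gamma> a \<in> K"
proof (rule holomorphic_K)
  fix c show "const_fun \<Gamma> a c holomorphic_on chart_dom \<Gamma> c"
    by (subst holomorphic_cong[OF refl, of _ _ "\<lambda>_. a"]) (auto simp: const_fun_def)
qed (auto simp: const_fun_def overlap_minus_def overlap_plus_def)

lemma ev_analytic: "g \<in> K \<Longrightarrow> t \<in> chart_dom \<Gamma> c \<Longrightarrow> \<forall>\<^sub>F s in at t. g c analytic_on {s}"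
proof -
  assume "g \<in> K" "t \<in> chart_dom \<Gamma> c"
  then obtain r where r: "r > 0" "g c analytic_on ball t r - {t}"
    using iso[OF K_mero[of g c]] unfolding isolated_singularity_at_def by blast
  have "\<forall>\<^sub>F s in at t. s \<in> ball t r - {t}" using r by (intro eventually_at_in_open) auto
  then show ?thesis by eventually_elim (use r in \<open>auto intro: analytic_on_subset\<close>)
qed

end

lemma deriv_eventually_cong:
  assumes "\<forall>\<^sub>F s in at t. f s = g s"
  shows "\<forall>\<^sub>F s in at (t::complex). deriv f s = deriv g s"
proof -
  obtain S where S: "open S" "t \<in> S" "\<And>s. s \<in> S \<Longrightarrow> s \<noteq> t \<Longrightarrow> f s = g s"
    using assms unfolding eventually_at_topological by blast
  have "\<forall>\<^sub>F s in at t. s \<in> S - {t}" using S by (intro eventually_at_in_open) auto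
  then show ?thesis
  proof eventually_elim
    case (elim s)
    have "open (S - {t})" using S by auto
    then have "\<forall>\<^sub>F x in nhds s. x \<in> S - {t}" using elim by (intro eventually_nhds_in_open) auto
    then have "\<forall>\<^sub>F x in nhds s. f x = g x" by eventually_elim (use S in auto)
    then show ?case by (rule deriv_cong_ev) simp
  qed
qed

section \<open>Calculation with germs in the extension field\<close>

locale pv_surface = surface_charts +
  fixes \<iota> :: "surface_fun \<Rightarrow> 'l::field" and D :: "'l \<Rightarrow> 'l"
  assumes hom: "\<iota> \<in> ring_hom (meromorphic_field \<Gamma>) ring_of_type_algebra"
    and derivation_D: "derivation D" and D_iota: "\<And>a. a \<in> meromorphic_functions \<Gamma> \<Longrightarrow> D (\<iota> a) = \<iota> (time_deriv \<Gamma> a)"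
    and constants: "{x. D x = 0} = \<iota> ` {a \<in> meromorphic_functions \<Gamma>. time_deriv \<Gamma> a = const_fun \<Gamma> 0}"
begin

text \<open>Elements of the base field are handled inside the extension through their germs at
  \<open>t0\<close> in the time chart. On germs the field operations and the derivation are the
  pointwise ones, which keeps \<open>reduce\<close> and the other charts out of later
  computations.\<close>

definition rep :: "'l \<Rightarrow> (complex \<Rightarrow> complex) \<Rightarrow> bool" where
  "rep x f \<longleftrightarrow> (\<exists>a\<in>K. x = \<iota> a \<and> (\<forall>\<^sub>F t in at t0. a Time t = f t))"

lemma iota_add: "a \<in> K \<Longrightarrow> b \<in> K \<Longrightarrow> \<iota> (reduce \<Gamma> (\<lambda>c z. a c z + b c z)) = \<iota> a + \<iota> b"
  and iota_mult: "a \<in> K \<Longrightarrow> b \<in> K \<Longrightarrow> \<iota> (reduce \<Gamma> (\<lambda>c z. a c z * b c z)) = \<iota> a * \<iota> b"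
  and iota_1: "\<iota> (const_fun \<Gamma> 1) = 1"
  using hom unfolding ring_hom_def meromorphic_field_def ring_of_type_algebra_def by auto

lemma rep_const: "rep (\<iota> (const_fun \<Gamma> a)) (\<lambda>_. a)"
proof -
  have "\<forall>\<^sub>F t in at t0. const_fun \<Gamma> a Time t = a"
    using eventually_at_in_open'[OF open_Sigma t0] by eventually_elim (simp add: const_fun_def)
  then show ?thesis unfolding rep_def using const_K by blast
qed

lemma rep_add: assumes "rep x f" "rep y g" shows "rep (x + y) (\<lambda>t. f t + g t)"
proof -
  obtain a b where a: "a \<in> K" "x = \<iota> a" "\<forall>\<^sub>F t in at t0. a Time t = f t"
    and b: "b \<in> K" "y = \<iota> b" "\<forall>\<^sub>F t in at t0. b Time t = g t" using assms by (auto simp: rep_def)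
  define h where "h c z = a c z + b c z" for c z
  have h1: "h c meromorphic_on chart_dom \<Gamma> c" for c
    unfolding h_def by (intro meromorphic_intros K_mero a b)
  have h2: "\<forall>t\<in>overlap_minus \<Gamma>. h Time t = h Minus (glue_minus \<Gamma> t)"
    using K_glue(1)[OF a(1)] K_glue(1)[OF b(1)] by (simp add: h_def[abs_def])
  have h3: "\<forall>t\<in>overlap_plus \<Gamma>. h Time t = h Plus (glue_plus \<Gamma> t)"
    using K_glue(2)[OF a(1)] K_glue(2)[OF b(1)] by (simp add: h_def[abs_def])
  note R = reduce_K'[OF h1 h2 h3]
  have "\<forall>\<^sub>F t in at t0. reduce \<Gamma> h Time t = f t + g t"
    using R(2)[OF t0] a(3) b(3) by eventually_elim (simp add: h_def[abs_def])
  moreover have "\<iota> (reduce \<Gamma> h) = x + y" using iota_add[OF a(1) b(1)] a b by (simp add: h_def[abs_def])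
  ultimately show ?thesis using R(1) unfolding rep_def by force
qed

lemma rep_mult: assumes "rep x f" "rep y g" shows "rep (x * y) (\<lambda>t. f t * g t)"
proof -
  obtain a b where a: "a \<in> K" "x = \<iota> a" "\<forall>\<^sub>F t in at t0. a Time t = f t"
    and b: "b \<in> K" "y = \<iota> b" "\<forall>\<^sub>F t in at t0. b Time t = g t" using assms by (auto simp: rep_def)
  define h where "h c z = a c z * b c z" for c z
  have h1: "h c meromorphic_on chart_dom \<Gamma> c" for c
    unfolding h_def by (intro meromorphic_intros K_mero a b)
  have h2: "\<forall>t\<in>overlap_minus \<Gamma>. h Time t = h Minus (glue_minus \<Gamma> t)"
    using K_glue(1)[OF a(1)] K_glue(1)[OF b(1)] by (simp add: h_def[abs_def])
  have h3: "\<forall>t\<in>overlap_plus \<Gamma>. h Time t = h Plus (glue_plus \<Gamma> t)"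
    using K_glue(2)[OF a(1)] K_glue(2)[OF b(1)] by (simp add: h_def[abs_def])
  note R = reduce_K'[OF h1 h2 h3]
  have "\<forall>\<^sub>F t in at t0. reduce \<Gamma> h Time t = f t * g t"
    using R(2)[OF t0] a(3) b(3) by eventually_elim (simp add: h_def[abs_def])
  moreover have "\<iota> (reduce \<Gamma> h) = x * y" using iota_mult[OF a(1) b(1)] a b by (simp add: h_def[abs_def])
  ultimately show ?thesis using R(1) unfolding rep_def by force
qed

lemma rep_eqI:
  assumes "rep x f" "rep y g" "\<forall>\<^sub>F t in at t0. f t = g t" shows "x = y"
proof -
  obtain a b where a: "a \<in> K" "x = \<iota> a" "\<forall>\<^sub>F t in at t0. a Time t = f t"
    and b: "b \<in> K" "y = \<iota> b" "\<forall>\<^sub>F t in at t0. b Time t = g t" using assms by (auto simp: rep_def)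
  have "\<forall>\<^sub>F t in at t0. a Time t = b Time t" using a(3) b(3) assms(3) by eventually_elim simp
  then show ?thesis using K_eqI[OF a(1) b(1) t0] a b by simp
qed

lemma iota_0: "\<iota> (const_fun \<Gamma> 0) = 0"
proof -
  have "\<iota> (const_fun \<Gamma> 0) + \<iota> (const_fun \<Gamma> 0) = \<iota> (const_fun \<Gamma> 0)"
    by (rule rep_eqI[OF rep_add[OF rep_const rep_const] rep_const]) simp
  then show ?thesis by (metis add.right_neutral add_left_cancel)
qed

lemma rep_0: "rep 0 (\<lambda>_. 0)" and rep_1: "rep 1 (\<lambda>_. 1)"
  using rep_const[of 0] rep_const[of 1] by (simp_all add: iota_0 iota_1)

lemma rep_uminus: assumes "rep x f" shows "rep (- x) (\<lambda>t. - f t)"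
proof -
  have "\<iota> (const_fun \<Gamma> (-1)) + 1 = 0"
    by (rule rep_eqI[OF rep_add[OF rep_const rep_1] rep_0]) simp
  then have "\<iota> (const_fun \<Gamma> (-1)) = -1" by (simp add: add_eq_0_iff2)
  then show ?thesis using rep_mult[OF rep_const[of "-1"] assms] by simp
qed

lemma rep_diff: "rep x f \<Longrightarrow> rep y g \<Longrightarrow> rep (x - y) (\<lambda>t. f t - g t)"
  using rep_add[OF _ rep_uminus] by fastforce

lemma rep_sum: "(\<And>i. i \<in> I \<Longrightarrow> rep (x i) (f i)) \<Longrightarrow> rep (sum x I) (\<lambda>t. \<Sum>i\<in>I. f i t)"
  by (induction I rule: infinite_finite_induct) (auto simp: rep_0 intro: rep_add)

lemma rep_prod: "(\<And>i. i \<in> I \<Longrightarrow> rep (x i) (f i)) \<Longrightarrow> rep (prod x I) (\<lambda>t. \<Prod>i\<in>I. f i t)"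
  by (induction I rule: infinite_finite_induct) (auto simp: rep_1 intro: rep_mult)

lemma rep_of_int: "rep (of_int n) (\<lambda>_. of_int n)"
proof (induction n rule: int_of_nat_induct)
  case (nonneg n)
  show ?case by (induction n) (use rep_0 rep_add[OF rep_1] in auto)
next
  case (neg n)
  have "rep (of_nat n) (\<lambda>_. of_nat n)" for n by (induction n) (use rep_0 rep_add[OF rep_1] in auto)
  from rep_uminus[OF this[of "Suc n"]] show ?case by simp
qed

lemma rep_det:
  fixes U :: "'l^'n^'n"
  assumes "\<And>i j. rep (U $ i $ j) (\<lambda>t. W t $ i $ j)"
  shows "rep (det U) (\<lambda>t. det (W t))"
  unfolding det_def by (intro rep_sum rep_mult rep_of_int rep_prod assms)

text \<open>The direction from the field to germs is the injectivity of a homomorphism of fields: a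
  germ that is not zero belongs to an invertible function, whose image cannot be 0.\<close>

lemma rep_eq_0_iff: assumes "rep x f" shows "x = 0 \<longleftrightarrow> (\<forall>\<^sub>F t in at t0. f t = 0)"
proof
  assume "\<forall>\<^sub>F t in at t0. f t = 0" then show "x = 0" by (rule rep_eqI[OF assms rep_0])
next
  assume x: "x = 0"
  obtain a where a: "a \<in> K" "x = \<iota> a" "\<forall>\<^sub>F t in at t0. a Time t = f t" using assms by (auto simp: rep_def)
  have T: "a Time meromorphic_on Sigma_t \<Gamma>" using K_mero[OF a(1), of Time] by simp
  show "\<forall>\<^sub>F t in at t0. f t = 0"
  proof (rule ccontr)
    assume n: "\<not> ?thesis"
    have "\<not> (\<forall>\<^sub>F t in at t0. a Time t = 0)"
    proof
      assume "\<forall>\<^sub>F t in at t0. a Time t = 0"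
      with a(3) have "\<forall>\<^sub>F t in at t0. f t = 0" by eventually_elim simp
      with n show False by simp
    qed
    \<comment> \<open>On a connected domain a meromorphic function that is not identically 0 has
      isolated zeros; hence the reciprocal is a true inverse near \<open>t0\<close>.\<close>
    then have nz: "\<forall>\<^sub>F t in at t0. a Time t \<noteq> 0"
      using meromorphic_imp_constant_or_avoid[OF T open_Sigma conn_Sigma, of 0]
        eventually_cosparse_imp_eventually_at[OF _ t0] by blast
    define h where "h c z = inverse (a c z)" for c z
    have h1: "h c meromorphic_on chart_dom \<Gamma> c" for c
      unfolding h_def by (intro meromorphic_intros K_mero a)
    have h2: "\<forall>t\<in>overlap_minus \<Gamma>. h Time t = h Minus (glue_minus \<Gamma> t)"
      using K_glue(1)[OF a(1)] by (simp add: h_def[abs_def])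
    have h3: "\<forall>t\<in>overlap_plus \<Gamma>. h Time t = h Plus (glue_plus \<Gamma> t)"
      using K_glue(2)[OF a(1)] by (simp add: h_def[abs_def])
    note R = reduce_K'[OF h1 h2 h3]
    have "rep (\<iota> (reduce \<Gamma> h)) (\<lambda>t. inverse (a Time t))"
      unfolding rep_def using R(1) R(2)[OF t0] by (intro bexI[OF _ R(1)]) (auto simp: h_def[abs_def])
    moreover have "rep x (a Time)" unfolding rep_def using a by auto
    ultimately have "x * \<iota> (reduce \<Gamma> h) = 1"
      using nz by (intro rep_eqI[OF rep_mult rep_1]) (auto elim!: eventually_mono)
    then show False using x by simp
  qed
qed

text \<open>The gluing maps carry d/dt to \<open>time_field\<close>, since exp(lam t) has derivative
  lam exp(lam t). By the chain rule the derivatives in the charts are compatible wherever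
  \<open>a\<close> is analytic.\<close>

lemma time_deriv_K:
  assumes a: "a \<in> K"
  shows "time_deriv \<Gamma> a \<in> K" and "t \<in> Sigma_t \<Gamma> \<Longrightarrow> \<forall>\<^sub>F s in at t. time_deriv \<Gamma> a Time s = deriv (a Time) s"
proof -
  define h where "h c z = time_field \<Gamma> c z * deriv (a c) z" for c z
  have tf: "time_field \<Gamma> c holomorphic_on S" for c S
  proof -
    have "time_field \<Gamma> Minus = (\<lambda>z. of_real (lam_minus \<Gamma>) * z)" "time_field \<Gamma> Time = (\<lambda>z. 1)"
      "time_field \<Gamma> Plus = (\<lambda>z. of_real (lam_plus \<Gamma>) * z)" by auto
    then show ?thesis by (cases c) (auto intro!: holomorphic_intros)
  qed
  have h1: "h c meromorphic_on chart_dom \<Gamma> c" for c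
    unfolding h_def using tf open_dom
    by (intro meromorphic_intros K_mero a analytic_on_imp_meromorphic_on) (auto simp: analytic_on_open)
  have main: "\<forall>\<^sub>F t in at s. h Time t = h c (G t)"
    if G: "\<And>t. (G has_field_derivative time_field \<Gamma> c (G t)) (at t)" "open O1" "s \<in> O1"
      "filtermap G (at s) = at (G s)" "G s \<in> chart_dom \<Gamma> c" "\<And>t. t \<in> O1 \<Longrightarrow> a Time t = a c (G t)" for c G O1 s
  proof -
    have "\<forall>\<^sub>F z in filtermap G (at s). a c analytic_on {z}" unfolding G(4) by (rule ev_analytic[OF a G(5)])
    then have "\<forall>\<^sub>F t in at s. a c analytic_on {G t}" by (simp add: eventually_filtermap)
    moreover have "\<forall>\<^sub>F t in at s. t \<in> O1" by (rule eventually_at_in_open'[OF G(2,3)])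
    ultimately show ?thesis
    proof eventually_elim
      case (elim t)
      have "(a c has_field_derivative deriv (a c) (G t)) (at (G t))"
        using elim(1) analytic_on_imp_differentiable_at DERIV_deriv_iff_field_differentiable by blast
      then have "((\<lambda>t. a c (G t)) has_field_derivative deriv (a c) (G t) * time_field \<Gamma> c (G t)) (at t)"
        by (rule DERIV_chain2[OF _ G(1)])
      then have "(a Time has_field_derivative deriv (a c) (G t) * time_field \<Gamma> c (G t)) (at t)"
        by (rule has_field_derivative_transform_within_open[OF _ G(2) elim(2)]) (use G(6) in auto)
      then show ?case by (simp add: h_def DERIV_imp_deriv)
    qed
  qed
  have m: "\<forall>\<^sub>F t in at s1. h Time t = h Minus (glue_minus \<Gamma> t)"
    by (rule main[OF _ open_overlap(1) s1 filtermap_glue(1)[OF s1] _ K_glue(1)[OF a]])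
      (use s1 in \<open>auto simp: glue_minus_def[abs_def] overlap_minus_def intro!: derivative_eq_intros\<close>)
  have p: "\<forall>\<^sub>F t in at s2. h Time t = h Plus (glue_plus \<Gamma> t)"
    by (rule main[OF _ open_overlap(2) s2 filtermap_glue(2)[OF s2] _ K_glue(2)[OF a]])
      (use s2 in \<open>auto simp: glue_plus_def[abs_def] overlap_plus_def intro!: derivative_eq_intros\<close>)
  have eq: "time_deriv \<Gamma> a = reduce \<Gamma> h" by (simp add: time_deriv_def h_def[abs_def])
  show "time_deriv \<Gamma> a \<in> K" and "t \<in> Sigma_t \<Gamma> \<Longrightarrow> \<forall>\<^sub>F s in at t. time_deriv \<Gamma> a Time s = deriv (a Time) s"
    using reduce_K[OF h1 m p] unfolding eq by (auto simp: h_def[abs_def])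
qed

lemma rep_D: assumes "rep x f" shows "rep (D x) (deriv f)"
proof -
  obtain a where a: "a \<in> K" "x = \<iota> a" "\<forall>\<^sub>F t in at t0. a Time t = f t" using assms by (auto simp: rep_def)
  have "\<forall>\<^sub>F t in at t0. time_deriv \<Gamma> a Time t = deriv f t"
    using time_deriv_K(2)[OF a(1) t0] deriv_eventually_cong[OF a(3)] by eventually_elim simp
  then show ?thesis using time_deriv_K(1)[OF a(1)] a D_iota[OF a(1)] unfolding rep_def by auto
qed

text \<open>A function with vanishing derivative is constant on a punctured disc about
  \<open>t0\<close>, which is connected, and then on the whole surface by \<open>K_eqI\<close>. This
  identifies the constants of the extension with the complex numbers.\<close>

lemma constants_eq: "range (\<lambda>c. \<iota> (const_fun \<Gamma> c)) = {x. D x = 0}"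
proof
  have "D (\<iota> (const_fun \<Gamma> c)) = 0" for c
    by (rule rep_eqI[OF rep_D[OF rep_const] rep_0]) simp
  then show "range (\<lambda>c. \<iota> (const_fun \<Gamma> c)) \<subseteq> {x. D x = 0}" by auto
  show "{x. D x = 0} \<subseteq> range (\<lambda>c. \<iota> (const_fun \<Gamma> c))"
    unfolding constants
  proof safe
    fix a assume a: "a \<in> K" "time_deriv \<Gamma> a = const_fun \<Gamma> 0"
    have "\<forall>\<^sub>F s in at t0. deriv (a Time) s = 0 \<and> a Time analytic_on {s}"
      using time_deriv_K(2)[OF a(1) t0] ev_analytic[OF a(1), of t0 Time] t0 unfolding a(2)
      by (auto simp: const_fun_def elim: eventually_elim2)
    then obtain S where S: "open S" "t0 \<in> S" "\<And>s. s \<in> S \<Longrightarrow> s \<noteq> t0 \<Longrightarrow> deriv (a Time) s = 0 \<and> a Time analytic_on {s}"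
      unfolding eventually_at_topological by blast
    obtain e where e: "e > 0" "ball t0 e \<subseteq> S" using S open_contains_ball by blast
    have "\<exists>c. \<forall>s\<in>ball t0 e - {t0}. a Time s = c"
    proof -
      have "a Time constant_on (ball t0 e - {t0})"
      proof (rule DERIV_zero_connected_constant_on[where K="{}"])
        show "connected (ball t0 e - {t0})" by (simp add: connected_punctured_ball)
        show "open (ball t0 e - {t0})" by auto
        have d: "(a Time has_field_derivative 0) (at s)" if "s \<in> ball t0 e - {t0}" for s
          using S(3)[of s] that e analytic_on_imp_differentiable_at[of "a Time" "{s}" s] DERIV_deriv_iff_field_differentiable[of "a Time" s] by auto
        then show "\<forall>s\<in>ball t0 e - {t0} - {}. (a Time has_field_derivative 0) (at s)" by auto
        show "continuous_on (ball t0 e - {t0}) (a Time)"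
          using d by (meson DERIV_isCont continuous_at_imp_continuous_on)
      qed auto
      then show ?thesis unfolding constant_on_def by blast
    qed
    then obtain c where c: "\<And>s. s \<in> ball t0 e - {t0} \<Longrightarrow> a Time s = c" by blast
    have "\<forall>\<^sub>F s in at t0. s \<in> ball t0 e - {t0}" using e by (intro eventually_at_in_open) auto
    then have "\<forall>\<^sub>F s in at t0. a Time s = const_fun \<Gamma> c Time s"
      using eventually_at_in_open'[OF open_Sigma t0] by eventually_elim (auto simp: c const_fun_def)
    from K_eqI[OF a(1) const_K t0 this] show "\<iota> a \<in> range (\<lambda>c. \<iota> (const_fun \<Gamma> c))" by simp
  qed
qed

lemma iota_const_hom:
  "\<iota> (const_fun \<Gamma> (a + b)) = \<iota> (const_fun \<Gamma> a) + \<iota> (const_fun \<Gamma> b)"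
  "\<iota> (const_fun \<Gamma> (a * b)) = \<iota> (const_fun \<Gamma> a) * \<iota> (const_fun \<Gamma> b)"
  by (rule rep_eqI[OF rep_const rep_add[OF rep_const rep_const]], simp)
    (rule rep_eqI[OF rep_const rep_mult[OF rep_const rep_const]], simp)

end

section \<open>Complex differentiable maps\<close>

text \<open>\<open>holomorphic_curve_on\<close> with any number of components; the charts of the
  invariant surface lead to curves with two.\<close>

definition holo_curve :: "(complex \<Rightarrow> complex^'n) \<Rightarrow> complex set \<Rightarrow> bool" where
  "holo_curve h S \<longleftrightarrow> (\<forall>i. (\<lambda>z. h z $ i) holomorphic_on S)"

lemma dist_add_le: "dist a (b + c) \<le> dist a b + norm (c :: 'a::real_normed_vector)"
  using dist_triangle[of a "b + c" b] by (simp add: dist_norm)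

lemma norm_vector_smult: "norm (c *s v) = norm c * norm (v :: complex^'n)"
  by (simp add: norm_vec_def vector_scalar_mult_def norm_mult L2_set_right_distrib)

lemma norm_vec_bound:
  fixes v :: "'a::real_normed_vector^'n"
  assumes "\<And>i. norm (v $ i) \<le> b"
  shows "norm v \<le> real CARD('n) * b"
proof -
  have "norm v \<le> (\<Sum>i\<in>UNIV. norm (v $ i))" unfolding norm_vec_def by (rule L2_set_le_sum) simp
  also have "\<dots> \<le> (\<Sum>i\<in>(UNIV::'n set). b)" by (rule sum_mono) (use assms in auto)
  finally show ?thesis by simp
qed

lemma norm_axis: "norm (axis i c :: 'a::real_normed_vector^'n) = norm c"
proof -
  have "(norm ((axis i c :: 'a^'n) $ k))\<^sup>2 = (if k = i then (norm c)\<^sup>2 else 0)" for k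
    by (simp add: axis_def)
  then show ?thesis by (simp add: norm_vec_def L2_set_def)
qed

definition cdiff_on :: "(complex^'n \<Rightarrow> complex^'m) \<Rightarrow> (complex^'n) set \<Rightarrow> bool" where
  "cdiff_on F U \<longleftrightarrow> open U \<and> (\<forall>p\<in>U. \<exists>J. (F has_derivative (\<lambda>v. J *v v)) (at p))"

lemma matrix_of_mult: "matrix (\<lambda>v. (J :: 'a::semiring_1^'n^'m) *v v) = J"
  by (simp add: matrix_def vec_eq_iff matrix_vector_mult_def axis_def if_distrib[of "\<lambda>y. _ * y"] cong: if_cong)

lemma jacobian_eqI: "(F has_derivative (\<lambda>v. J *v v)) (at p) \<Longrightarrow> jacobian F (at p) = J"
  unfolding jacobian_def by (metis frechet_derivative_at matrix_of_mult)

lemma cdiff_on_jacobian: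
  assumes "cdiff_on F U" "p \<in> U"
  shows "(F has_derivative (\<lambda>v. jacobian F (at p) *v v)) (at p)"
  using assms jacobian_eqI unfolding cdiff_on_def by metis

lemma cdiff_on_continuous: "cdiff_on F U \<Longrightarrow> continuous_on U F"
  by (meson cdiff_on_jacobian continuous_at_imp_continuous_on has_derivative_continuous)

lemma curve_has_derivative:
  fixes h :: "complex \<Rightarrow> complex^'n"
  assumes "\<And>i. ((\<lambda>z. h z $ i) has_field_derivative d $ i) (at z)"
  shows "(h has_derivative (\<lambda>k. k *s d)) (at z)"
proof -
  have bl: "bounded_linear (\<lambda>c::complex. c *s (axis i 1 :: complex^'n))" for i :: 'n
    by (auto simp: linear_conv_bounded_linear[symmetric] linear_iff vec_eq_iff algebra_simps axis_def)
  have "((\<lambda>z. \<Sum>i\<in>UNIV. h z $ i *s axis i 1) has_derivative (\<lambda>k. \<Sum>i\<in>UNIV. (k * d $ i) *s axis i 1)) (at z)"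
    by (intro has_derivative_sum bounded_linear.has_derivative[OF bl])
      (use assms in \<open>simp add: has_field_derivative_def mult.commute[of "d $ _"]  mult_commute_abs\<close>)
  moreover have "(\<Sum>i\<in>UNIV. (k * d $ i) *s axis i 1) = k *s d" for k :: complex
    using basis_expansion[of "k *s d"] by simp
  ultimately show ?thesis by (simp add: basis_expansion)
qed

lemma cdiff_on_curve:
  fixes h :: "complex \<Rightarrow> complex^'n"
  assumes F: "cdiff_on F U" and "h z \<in> U"
    and h: "\<And>i. ((\<lambda>z. h z $ i) has_field_derivative d $ i) (at z)"
  shows "((\<lambda>z. F (h z) $ i) has_field_derivative (jacobian F (at (h z)) *v d) $ i) (at z)"
proof -
  have "((\<lambda>z. F (h z)) has_derivative (\<lambda>k. jacobian F (at (h z)) *v (k *s d))) (at z)"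
    using has_derivative_compose[OF curve_has_derivative[OF h] cdiff_on_jacobian[OF F assms(2)]] .
  then have "((\<lambda>z. F (h z) $ i) has_derivative (\<lambda>k. (jacobian F (at (h z)) *v (k *s d)) $ i)) (at z)"
    by (rule bounded_linear.has_derivative[OF bounded_linear_vec_nth])
  then show ?thesis
    by (simp add: has_field_derivative_def vector_scalar_commute mult_commute_abs)
qed

lemma cdiff_on_curve_holomorphic:
  assumes "cdiff_on F U" "holo_curve h S" "open S" "h ` S \<subseteq> U"
  shows "holo_curve (\<lambda>z. F (h z)) S"
  unfolding holo_curve_def
proof (intro allI, subst holomorphic_on_open[OF assms(3)], safe)
  fix i z assume z: "z \<in> S"
  have "((\<lambda>z. h z $ i) has_field_derivative (\<chi> i. deriv (\<lambda>z. h z $ i) z) $ i) (at z)" for i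
    using assms(2) holomorphic_derivI[OF _ assms(3) z] by (simp add: holo_curve_def)
  from cdiff_on_curve[OF assms(1) _ this] z assms(4)
  show "\<exists>f'. ((\<lambda>z. F (h z) $ i) has_field_derivative f') (at z)" by blast
qed

text \<open>Cauchy's inequality on discs of radius \<open>\<rho> / 2\<close> about points of the
  closed unit disc, all of which stay inside \<open>ball 0 \<rho>\<close>. Applied to a map along a
  complex line, it bounds the remainder at parameter 1.\<close>

lemma holomorphic_taylor_one:
  assumes g: "g holomorphic_on ball 0 \<rho>" and B: "\<And>z. z \<in> ball 0 \<rho> \<Longrightarrow> norm (g z) \<le> B" and \<rho>: "\<rho> > 4"
  shows "norm (g 1 - g 0 - deriv g 0) \<le> 8 * B / \<rho>\<^sup>2" "norm (deriv g 0) \<le> 2 * B / \<rho>"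
proof -
  have C: "norm ((deriv ^^ n) g x) \<le> fact n * B / (\<rho>/2) ^ n" if "x \<in> cball 0 1" for x n
  proof (rule Cauchy_inequality)
    have sub: "cball x (\<rho>/2) \<subseteq> ball 0 \<rho>"
    proof
      fix y assume "y \<in> cball x (\<rho>/2)"
      then have "norm y \<le> norm x + \<rho>/2" using norm_triangle_sub[of y x] by (simp add: dist_norm norm_minus_commute)
      then show "y \<in> ball 0 \<rho>" using that \<rho> by simp
    qed
    show "g holomorphic_on ball x (\<rho>/2)" using g sub ball_subset_cball holomorphic_on_subset by (metis order_trans)
    show "continuous_on (cball x (\<rho>/2)) g"
      using g sub holomorphic_on_imp_continuous_on continuous_on_subset by blast
    show "0 < \<rho>/2" using \<rho> by simp
    fix y assume "norm (x - y) = \<rho>/2"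
    then have "y \<in> cball x (\<rho>/2)" by (simp add: dist_norm)
    then show "norm (g y) \<le> B" using sub B by blast
  qed
  show "norm (deriv g 0) \<le> 2 * B / \<rho>" using C[of 0 1] by (simp add: mult.commute)
  have "norm ((deriv ^^ 0) g 1 - (\<Sum>i\<le>1. (deriv ^^ i) g 0 * (1 - 0) ^ i / fact i))
      \<le> (8 * B / \<rho>\<^sup>2) * norm (1 - 0 :: complex) ^ (Suc 1) / fact 1"
  proof (rule complex_Taylor[where S = "cball 0 1"])
    fix i x assume x: "x \<in> cball (0::complex) 1"
    have xb: "x \<in> ball 0 \<rho>" using x \<rho> by simp
    have "((deriv ^^ i) g has_field_derivative (deriv ^^ Suc i) g x) (at x)"
      using holomorphic_derivI[OF holomorphic_higher_deriv[OF g open_ball] open_ball xb] by simp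
    then show "((deriv ^^ i) g has_field_derivative (deriv ^^ Suc i) g x) (at x within cball 0 1)"
      by (rule has_field_derivative_at_within)
    show "norm ((deriv ^^ Suc 1) g x) \<le> 8 * B / \<rho>\<^sup>2"
      using C[OF x, of 2] by (simp add: numeral_2_eq_2 power_divide field_simps)
  qed auto
  then show "norm (g 1 - g 0 - deriv g 0) \<le> 8 * B / \<rho>\<^sup>2" by (simp add: algebra_simps)
qed

text \<open>Second-order Taylor bounds, uniform in the base point, from Cauchy's inequality on complex
  lines; no regularity of the Jacobian is presupposed.\<close>

lemma cdiff_on_quadratic:
  fixes F :: "complex^'n \<Rightarrow> complex^'m"
  assumes F: "cdiff_on F U" and p: "p \<in> U"
  obtains r C where "r > 0" "C > 0" "ball p (2 * r) \<subseteq> U"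
    "\<And>x v. x \<in> ball p r \<Longrightarrow> norm v < r \<Longrightarrow>
       norm (F (x + v) - F x - jacobian F (at x) *v v) \<le> C * (norm v)\<^sup>2"
    "\<And>x v. x \<in> ball p r \<Longrightarrow> norm v < r \<Longrightarrow> norm (jacobian F (at x) *v v) \<le> C * norm v"
proof -
  obtain R where R: "R > 0" "cball p R \<subseteq> U"
    using F p unfolding cdiff_on_def by (meson open_contains_cball)
  have "compact (F ` cball p R)"
    by (intro compact_continuous_image continuous_on_subset[OF cdiff_on_continuous[OF F]] R) auto
  then obtain B where B: "B > 0" "\<And>y. y \<in> cball p R \<Longrightarrow> norm (F y) \<le> B"
    using compact_imp_bounded bounded_pos by (metis imageI)
  define r where "r = R / 8"
  define C where "C = real CARD('m) * (32 * B / R\<^sup>2 + 4 * B / R) + 1"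
  have Cnn: "real CARD('m) * (32 * B / R\<^sup>2) \<le> C" "real CARD('m) * (4 * B / R) \<le> C" "C > 0"
    using R B by (auto simp: C_def distrib_left intro: add_nonneg_pos)
  have main: "norm ((F (x + v) - F x - jacobian F (at x) *v v) $ i) \<le> 32 * B / R\<^sup>2 * (norm v)\<^sup>2 \<and>
        norm ((jacobian F (at x) *v v) $ i) \<le> 4 * B / R * norm v"
    if x: "x \<in> ball p r" and v: "norm v < r" "v \<noteq> 0" for x v i
  proof -
    \<comment> \<open>The line \<open>x + s *s v\<close> stays in \<open>cball p R\<close> while
      \<open>norm s < \<rho>\<close>, and the choice of \<open>r\<close> as an eighth of
      \<open>R\<close> makes \<open>\<rho>\<close> larger than 4. Inserting this
      \<open>\<rho>\<close> into the one-variable estimates produces the two main summands of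
      \<open>C\<close>.\<close>
    define \<rho> where "\<rho> = R / 2 / norm v"
    have \<rho>: "\<rho> > 4" using v R by (auto simp: \<rho>_def r_def field_simps)
    have inb: "x + s *s v \<in> cball p R" if "s \<in> ball 0 \<rho>" for s
    proof -
      have "norm s * norm v < \<rho> * norm v" using that v by (intro mult_strict_right_mono) auto
      then have "norm (s *s v) < R / 2" using v by (simp add: norm_vector_smult \<rho>_def)
      moreover have "dist p (x + s *s v) \<le> dist p x + norm (s *s v)"
        by (rule dist_add_le)
      ultimately show ?thesis using x R by (simp add: r_def)
    qed
    define g where "g s = F (x + s *s v) $ i" for s
    have dg: "(g has_field_derivative (jacobian F (at (x + s *s v)) *v v) $ i) (at s)" if "s \<in> ball 0 \<rho>" for s
      unfolding g_def
      by (rule cdiff_on_curve[OF F]) (use inb[OF that] R in \<open>auto intro!: derivative_eq_intros\<close>)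
    then have hol: "g holomorphic_on ball 0 \<rho>"
        unfolding holomorphic_on_open[OF open_ball] by blast
    have bd: "norm (g s) \<le> B" if "s \<in> ball 0 \<rho>" for s
      using B(2)[OF inb[OF that]] Finite_Cartesian_Product.norm_nth_le[of "F (x + s *s v)" i]
      by (auto simp: g_def)
    have d0: "deriv g 0 = (jacobian F (at x) *v v) $ i"
      using dg[of 0] \<rho> by (auto intro!: DERIV_imp_deriv)
    show ?thesis
      using holomorphic_taylor_one[OF hol bd \<rho>] unfolding d0 using v R
      by (auto simp: g_def \<rho>_def power_divide field_simps)
  qed
  show thesis
  proof (rule that[of r C])
    show "ball p (2 * r) \<subseteq> U" using R by (auto simp: r_def)
    fix x v assume x: "x \<in> ball p r" and v: "norm (v :: complex^'n) < r"
    show "norm (F (x + v) - F x - jacobian F (at x) *v v) \<le> C * (norm v)\<^sup>2"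
    proof (cases "v = 0")
      case False
      have "norm (F (x + v) - F x - jacobian F (at x) *v v) \<le> real CARD('m) * (32 * B / R\<^sup>2 * (norm v)\<^sup>2)"
        by (rule norm_vec_bound) (use main[OF x v False] in blast)
      also have "\<dots> \<le> C * (norm v)\<^sup>2" using Cnn(1) mult_right_mono[OF Cnn(1), of "(norm v)\<^sup>2"] by simp
      finally show ?thesis .
    qed simp
    show "norm (jacobian F (at x) *v v) \<le> C * norm v"
    proof (cases "v = 0")
      case False
      have "norm (jacobian F (at x) *v v) \<le> real CARD('m) * (4 * B / R * norm v)"
        by (rule norm_vec_bound) (use main[OF x v False] in blast)
      also have "\<dots> \<le> C * norm v" using mult_right_mono[OF Cnn(2), of "norm v"] by simp
      finally show ?thesis .
    qed simp
  qed (use R Cnn in \<open>auto simp: r_def\<close>)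
qed

text \<open>By the quadratic estimate, difference quotients converge to the partial derivatives
  uniformly near \<open>p\<close>; limit theorems then give continuity of the Jacobian and its
  holomorphy along curves. The steps \<open>r / (n + 2)\<close> are less than \<open>r\<close> for
  every \<open>n\<close>, as the estimate requires.\<close>

lemma jacobian_entry_uniform_limit:
  fixes F :: "complex^'n \<Rightarrow> complex^'m"
  assumes F: "cdiff_on F U" and p: "p \<in> U"
  shows "\<exists>r e. r > 0 \<and> ball p (2 * r) \<subseteq> U \<and> (\<forall>n::nat. 0 < e n \<and> e n < r) \<and>
    uniform_limit (ball p r) (\<lambda>n x. (F (x + axis j (of_real (e n))) $ i - F x $ i) / of_real (e n))
      (\<lambda>x. jacobian F (at x) $ i $ j) sequentially"
proof -
  from cdiff_on_quadratic[OF F p] obtain r C where r: "r > 0" "C > 0" "ball p (2 * r) \<subseteq> U"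
    and q: "\<And>x v. x \<in> ball p r \<Longrightarrow> norm v < r \<Longrightarrow>
       norm (F (x + v) - F x - jacobian F (at x) *v v) \<le> C * (norm v)\<^sup>2" by metis
  define e where "e n = r / real (n + 2)" for n
  have e: "0 < e n \<and> e n < r" for n using r by (auto simp: e_def divide_less_eq)
  have bd: "norm ((F (x + axis j (of_real (e n))) $ i - F x $ i) / of_real (e n) - jacobian F (at x) $ i $ j)
      \<le> C * e n" if x: "x \<in> ball p r" for x n
  proof -
    define v where "v = (axis j (of_real (e n)) :: complex^'n)"
    have nv: "norm v = e n" using e[of n] by (simp add: v_def norm_axis)
    have Jv: "(jacobian F (at x) *v v) $ i = jacobian F (at x) $ i $ j * of_real (e n)"
      by (simp add: v_def matrix_vector_mult_def axis_def if_distrib[of "\<lambda>y. _ * y"] cong: if_cong)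
    have "norm ((F (x + v) - F x - jacobian F (at x) *v v) $ i) \<le> C * (e n)\<^sup>2"
      using q[OF x, of v] e[of n] order_trans[OF Finite_Cartesian_Product.norm_nth_le] by (metis nv)
    then have "norm (F (x + v) $ i - F x $ i - jacobian F (at x) $ i $ j * of_real (e n)) / e n \<le> C * (e n)\<^sup>2 / e n"
      using e[of n] by (intro divide_right_mono) (auto simp: Jv)
    moreover have "(F (x + v) $ i - F x $ i) / of_real (e n) - jacobian F (at x) $ i $ j =
        (F (x + v) $ i - F x $ i - jacobian F (at x) $ i $ j * of_real (e n)) / of_real (e n)"
      using e[of n] by (simp add: field_simps)
    ultimately show ?thesis using e[of n] by (simp add: v_def norm_divide power2_eq_square)
  qed
  have "(\<lambda>n. C * e n) \<longlonglongrightarrow> C * 0"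
    unfolding e_def by (intro tendsto_mult tendsto_const real_tendsto_divide_at_top[OF tendsto_const])
      (rule filterlim_compose[OF filterlim_real_sequentially filterlim_add_const_nat_at_top])
  then have lim: "(\<lambda>n. C * e n) \<longlonglongrightarrow> 0" by simp
  have "uniform_limit (ball p r) (\<lambda>n x. (F (x + axis j (of_real (e n))) $ i - F x $ i) / of_real (e n))
      (\<lambda>x. jacobian F (at x) $ i $ j) sequentially"
  proof (rule uniform_limitI)
    fix \<epsilon> :: real assume "\<epsilon> > 0"
    then have "\<forall>\<^sub>F n in sequentially. C * e n < \<epsilon>" using lim by (simp add: order_tendsto_iff)
    then show "\<forall>\<^sub>F n in sequentially. \<forall>x\<in>ball p r. dist ((F (x + axis j (of_real (e n))) $ i - F x $ i) / of_real (e n)) (jacobian F (at x) $ i $ j) < \<epsilon>"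
    proof eventually_elim
      case (elim n)
      show ?case
      proof
        fix x assume "x \<in> ball p r"
        from le_less_trans[OF bd[OF this] elim]
        show "dist ((F (x + axis j (of_real (e n))) $ i - F x $ i) / of_real (e n)) (jacobian F (at x) $ i $ j) < \<epsilon>"
          by (simp only: dist_norm)
      qed
    qed
  qed
  then show ?thesis using r e by blast
qed

lemma jacobian_entry_curve_holomorphic:
  fixes h :: "complex \<Rightarrow> complex^'n"
  assumes F: "cdiff_on F U" and h: "holo_curve h S" and S: "open S" and hS: "h ` S \<subseteq> U"
  shows "(\<lambda>z. jacobian F (at (h z)) $ i $ j) holomorphic_on S"
proof -
  have "\<exists>d>0. (\<lambda>z. jacobian F (at (h z)) $ i $ j) holomorphic_on ball z0 d" if z0: "z0 \<in> S" for z0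
  proof -
    have hz0: "h z0 \<in> U" using z0 hS by blast
    from jacobian_entry_uniform_limit[OF F hz0, of j i]
    obtain r e where r: "r > 0" "ball (h z0) (2 * r) \<subseteq> U"
      and e': "\<forall>n::nat. 0 < e n \<and> e n < r"
      and ul: "uniform_limit (ball (h z0) r) (\<lambda>n x. (F (x + axis j (of_real (e n))) $ i - F x $ i) / of_real (e n))
      (\<lambda>x. jacobian F (at x) $ i $ j) sequentially"
      by (elim exE conjE)
    note e = e'[rule_format]
    have "continuous_on S h"
    proof -
      have "continuous_on S (\<lambda>z. \<chi> i. h z $ i)"
        using h unfolding holo_curve_def by (intro continuous_on_vec_lambda holomorphic_on_imp_continuous_on) auto
      then show ?thesis by (simp add: vec_lambda_eta)
    qed
    then have "open (S \<inter> h -` ball (h z0) r)" using S by (simp add: continuous_open_preimage)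
    then obtain d where d: "d > 0" "ball z0 d \<subseteq> S \<inter> h -` ball (h z0) r"
      using z0 r by (meson IntI centre_in_ball openE vimageI)
    have holb: "holo_curve h (ball z0 d)"
      using h d unfolding holo_curve_def by (meson holomorphic_on_subset le_infE)
    have hol: "(\<lambda>z. (F (h z + axis j (of_real (e n))) $ i - F (h z) $ i) / of_real (e n)) holomorphic_on ball z0 d" for n
    proof -
      have "holo_curve (\<lambda>z. h z + axis j (of_real (e n))) (ball z0 d)"
        using holb by (auto simp: holo_curve_def intro!: holomorphic_intros)
      moreover have "(\<lambda>z. h z + axis j (of_real (e n))) ` ball z0 d \<subseteq> U"
      proof safe
        fix z assume "z \<in> ball z0 d"
        then have "h z \<in> ball (h z0) r" using d by auto
        moreover have "dist (h z0) (h z + axis j (of_real (e n))) \<le> dist (h z0) (h z) + norm (axis j (of_real (e n)) :: complex^'n)"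
          by (rule dist_add_le)
        ultimately show "h z + axis j (of_real (e n)) \<in> U" using e[of n] r by (auto simp: subset_eq norm_axis)
      qed
      ultimately have 1: "holo_curve (\<lambda>z. F (h z + axis j (of_real (e n)))) (ball z0 d)"
        using cdiff_on_curve_holomorphic[OF F _ open_ball] by blast
      have 2: "holo_curve (\<lambda>z. F (h z)) (ball z0 d)"
        by (rule cdiff_on_curve_holomorphic[OF F holb open_ball]) (use d hS in auto)
      show ?thesis using 1 2 unfolding holo_curve_def by (intro holomorphic_intros) (use e[of n] in auto)
    qed
    have ul2: "uniform_limit (ball z0 d) (\<lambda>n z. (F (h z + axis j (of_real (e n))) $ i - F (h z) $ i) / of_real (e n))
      (\<lambda>z. jacobian F (at (h z)) $ i $ j) sequentially"
      using uniform_limit_compose'[OF ul, of h "ball z0 d"] d by auto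
    have "(\<lambda>z. jacobian F (at (h z)) $ i $ j) holomorphic_on ball z0 d"
    proof (rule holomorphic_uniform_sequence[OF open_ball, where f = "\<lambda>n z. (F (h z + axis j (of_real (e n))) $ i - F (h z) $ i) / of_real (e n)"])
      fix x assume "x \<in> ball z0 d"
      then obtain da where "da > 0" "cball x da \<subseteq> ball z0 d" by (meson open_ball open_contains_cball)
      then show "\<exists>da>0. cball x da \<subseteq> ball z0 d \<and> uniform_limit (cball x da) (\<lambda>n z. (F (h z + axis j (of_real (e n))) $ i - F (h z) $ i) / of_real (e n))
          (\<lambda>z. jacobian F (at (h z)) $ i $ j) sequentially"
        using uniform_limit_on_subset[OF ul2] by blast
    qed (rule hol)
    then show ?thesis using d by blast
  qed
  then show ?thesis
    by (meson S analytic_on_open analytic_on_def)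
qed

lemma jacobian_entry_continuous:
  fixes F :: "complex^'n \<Rightarrow> complex^'m"
  assumes F: "cdiff_on F U"
  shows "continuous_on U (\<lambda>x. jacobian F (at x) $ i $ j)"
proof -
  have "isCont (\<lambda>x. jacobian F (at x) $ i $ j) p" if p: "p \<in> U" for p
  proof -
    from jacobian_entry_uniform_limit[OF F p, of j i]
    obtain r e where r: "r > 0" "ball p (2 * r) \<subseteq> U"
      and e': "\<forall>n::nat. 0 < e n \<and> e n < r"
      and ul: "uniform_limit (ball p r) (\<lambda>n x. (F (x + axis j (of_real (e n))) $ i - F x $ i) / of_real (e n))
      (\<lambda>x. jacobian F (at x) $ i $ j) sequentially"
      by (elim exE conjE)
    note e = e'[rule_format]
    have "continuous_on (ball p r) (\<lambda>x. (F (x + axis j (of_real (e n))) $ i - F x $ i) / of_real (e n))" for n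
    proof -
      have "(\<lambda>x. x + axis j (of_real (e n))) ` ball p r \<subseteq> U"
      proof safe
        fix x assume "x \<in> ball p r"
        moreover have "dist p (x + axis j (of_real (e n))) \<le> dist p x + norm (axis j (of_real (e n)) :: complex^'n)"
          by (rule dist_add_le)
        ultimately show "x + axis j (of_real (e n)) \<in> U" using e[of n] r by (auto simp: subset_eq norm_axis)
      qed
      then have 1: "continuous_on (ball p r) (\<lambda>x. F (x + axis j (of_real (e n))))"
        by (intro continuous_on_compose2[OF cdiff_on_continuous[OF F]] continuous_intros)
      have 2: "continuous_on (ball p r) F"
        by (rule continuous_on_subset[OF cdiff_on_continuous[OF F]]) (use r in auto)
      show ?thesis by (intro continuous_on_divide continuous_on_diff continuous_on_component 1 2 continuous_on_const)
        (use e[of n] in auto)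
    qed
    then have "continuous_on (ball p r) (\<lambda>x. jacobian F (at x) $ i $ j)"
      by (intro uniform_limit_theorem[OF _ ul]) auto
    then show ?thesis using r by (simp add: continuous_on_eq_continuous_at)
  qed
  then show ?thesis by (simp add: continuous_at_imp_continuous_on)
qed

section \<open>Real points of a complexification\<close>

lemma complex_vec_nth [simp]: "complex_vec x $ i = of_real (x $ i)"
  by (simp add: complex_vec_def)

lemma complex_vec_add: "complex_vec (x + y) = complex_vec x + complex_vec y"
  and complex_vec_diff: "complex_vec (x - y) = complex_vec x - complex_vec y"
  and complex_vec_scaleR: "complex_vec (c *\<^sub>R x) = c *\<^sub>R complex_vec x"
  by (auto simp: vec_eq_iff scaleR_conv_of_real[of _ "complex_of_real _"])

lemma norm_complex_vec [simp]: "norm (complex_vec x) = norm x"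
  by (simp add: norm_vec_def)

lemma bounded_linear_complex_vec: "bounded_linear complex_vec"
  by (simp add: linear_conv_bounded_linear[symmetric] linear_iff complex_vec_add complex_vec_scaleR)

lemma has_derivative_vecI:
  fixes f :: "'b::real_normed_vector \<Rightarrow> 'a::real_normed_vector^'n"
  assumes "\<And>i. ((\<lambda>x. f x $ i) has_derivative (\<lambda>v. D v $ i)) (at x)"
  shows "(f has_derivative D) (at x)"
proof -
  have bl: "bounded_linear (axis i :: 'a \<Rightarrow> 'a^'n)" for i :: 'n
    by (rule bounded_linear_intro[of _ 1]) (auto simp: vec_eq_iff axis_def norm_axis[unfolded axis_def])
  have "((\<lambda>x. \<Sum>i\<in>UNIV. axis i (f x $ i)) has_derivative (\<lambda>v. \<Sum>i\<in>UNIV. axis i (D v $ i))) (at x)"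
    by (intro has_derivative_sum bounded_linear.has_derivative[OF bl] assms)
  moreover have "(\<Sum>i\<in>UNIV. axis i (x $ i)) = x" for x :: "'a^'n"
    by (simp add: vec_eq_iff axis_def)
  ultimately show ?thesis by simp
qed

text \<open>At real points the imaginary part of \<open>F\<close> is identically zero, hence so is
  its derivative along real directions, and the complex Jacobian matrix has real entries. The
  dimensions are left open because charts of the surface are complexified as well as the vector
  field.\<close>

lemma real_restriction_jacobian:
  fixes V :: "real^'n \<Rightarrow> real^'m" and F :: "complex^'n \<Rightarrow> complex^'m"
  assumes F: "cdiff_on F U" and xU: "complex_vec x \<in> U"
    and FV: "\<And>y. complex_vec y \<in> U \<Longrightarrow> F (complex_vec y) = complex_vec (V y)"
  shows "(V has_derivative (\<lambda>v. jacobian V (at x) *v v)) (at x)"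
    and "jacobian F (at (complex_vec x)) $ i $ j = of_real (jacobian V (at x) $ i $ j)"
proof -
  define S where "S = {y :: real^'n. complex_vec y \<in> U}"
  have "open U" using F by (simp add: cdiff_on_def)
  then have S: "open S" "x \<in> S" unfolding S_def using xU
    using continuous_open_preimage[of UNIV complex_vec U] linear_continuous_on[OF bounded_linear_complex_vec, of UNIV]
    by (auto simp: vimage_def)
  define J where "J = jacobian F (at (complex_vec x))"
  have d0: "((\<lambda>x. F (complex_vec x)) has_derivative (\<lambda>v. J *v complex_vec v)) (at x)"
    unfolding J_def
    by (rule has_derivative_compose[OF bounded_linear.has_derivative[OF bounded_linear_complex_vec has_derivative_ident]
        cdiff_on_jacobian[OF F xU]])
  have d: "((\<lambda>x. complex_vec (V x)) has_derivative (\<lambda>v. J *v complex_vec v)) (at x)"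
    by (rule has_derivative_transform_within_open[OF d0 S]) (simp add: S_def FV)
  have di: "((\<lambda>x. of_real (V x $ i)) has_derivative (\<lambda>v. (J *v complex_vec v) $ i)) (at x)" for i
    using bounded_linear.has_derivative[OF bounded_linear_vec_nth d, of i] by simp
  have "((\<lambda>x. Im (of_real (V x $ i))) has_derivative (\<lambda>v. Im ((J *v complex_vec v) $ i))) (at x)" for i
    using bounded_linear.has_derivative[OF bounded_linear_Im di] .
  then have "((\<lambda>x. 0) has_derivative (\<lambda>v. Im ((J *v complex_vec v) $ i))) (at x)" for i by simp
  then have im: "Im ((J *v complex_vec v) $ i) = 0" for i v
    using has_derivative_unique[OF _ has_derivative_const] by metis
  have "(J *v complex_vec (axis j 1)) $ i = J $ i $ j" for i j
    by (simp add: matrix_vector_mult_def axis_def if_distrib[of "\<lambda>y. _ * y"] if_distrib[of complex_of_real] cong: if_cong)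
  then have imJ: "Im (J $ i $ j) = 0" for i j using im by metis
  define K where "K = (\<chi> i j. Re (J $ i $ j))"
  have JK: "J $ i $ j = of_real (K $ i $ j)" for i j using imJ by (simp add: K_def complex_eq_iff)
  have "((\<lambda>x. Re (of_real (V x $ i))) has_derivative (\<lambda>v. Re ((J *v complex_vec v) $ i))) (at x)" for i
    using bounded_linear.has_derivative[OF bounded_linear_Re di] .
  moreover have "Re ((J *v complex_vec v) $ i) = (K *v v) $ i" for v i
    by (simp add: matrix_vector_mult_def JK)
  ultimately have "((\<lambda>x. V x $ i) has_derivative (\<lambda>v. (K *v v) $ i)) (at x)" for i by simp
  then have VK: "(V has_derivative (\<lambda>v. K *v v)) (at x)" by (rule has_derivative_vecI)
  then have "jacobian V (at x) = K" by (rule jacobian_eqI)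
  then show "(V has_derivative (\<lambda>v. jacobian V (at x) *v v)) (at x)"
    and "jacobian F (at (complex_vec x)) $ i $ j = of_real (jacobian V (at x) $ i $ j)"
    using VK JK by (simp_all add: J_def)
qed

lemma complexification_jacobian:
  assumes "complexification V U F"
  shows "(V has_derivative (\<lambda>v. jacobian V (at x) *v v)) (at x)"
    and "jacobian F (at (complex_vec x)) $ i $ j = of_real (jacobian V (at x) $ i $ j)"
proof -
  have F: "cdiff_on F U" using assms by (auto simp: complexification_def cdiff_on_def)
  have xU: "complex_vec x \<in> U" and FV: "complex_vec y \<in> U \<Longrightarrow> F (complex_vec y) = complex_vec (V y)" for y
    using assms by (auto simp: complexification_def)
  show "(V has_derivative (\<lambda>v. jacobian V (at x) *v v)) (at x)"
    and "jacobian F (at (complex_vec x)) $ i $ j = of_real (jacobian V (at x) $ i $ j)"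
    using real_restriction_jacobian[OF F xU FV] by blast+
qed

lemma complexification_mult_real:
  assumes "complexification V U F"
  shows "jacobian F (at (complex_vec x)) *v complex_vec v = complex_vec (jacobian V (at x) *v v)"
  by (simp add: vec_eq_iff matrix_vector_mult_def complexification_jacobian(2)[OF assms])

lemma complexification_quadratic:
  assumes c: "complexification V U F"
  obtains r C where "r > 0" "C > 0"
    "\<And>x v. x \<in> ball p r \<Longrightarrow> norm v < r \<Longrightarrow>
       norm (V (x + v) - V x - jacobian V (at x) *v v) \<le> C * (norm v)\<^sup>2"
    "\<And>x v. x \<in> ball p r \<Longrightarrow> norm v < r \<Longrightarrow> norm (jacobian V (at x) *v v) \<le> C * norm v"
proof -
  have F: "cdiff_on F U" using c by (auto simp: complexification_def cdiff_on_def)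
  have pU: "complex_vec p \<in> U" and FV: "\<And>x. F (complex_vec x) = complex_vec (V x)"
    using c by (auto simp: complexification_def)
  from cdiff_on_quadratic[OF F pU] obtain r C where r: "r > 0" "C > 0"
    and q: "\<And>x v. x \<in> ball (complex_vec p) r \<Longrightarrow> norm v < r \<Longrightarrow>
       norm (F (x + v) - F x - jacobian F (at x) *v v) \<le> C * (norm v)\<^sup>2"
      "\<And>x v. x \<in> ball (complex_vec p) r \<Longrightarrow> norm v < r \<Longrightarrow> norm (jacobian F (at x) *v v) \<le> C * norm v" by metis
  show thesis
  proof (rule that[OF r])
    fix x v :: "real^4" assume "x \<in> ball p r" "norm v < r"
    then have xv: "complex_vec x \<in> ball (complex_vec p) r" "norm (complex_vec v) < r"
      by (auto simp: dist_norm complex_vec_diff[symmetric])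
    show "norm (V (x + v) - V x - jacobian V (at x) *v v) \<le> C * (norm v)\<^sup>2"
      using q(1)[OF xv] by (simp add: complex_vec_add[symmetric] complex_vec_diff[symmetric] FV complexification_mult_real[OF c])
    show "norm (jacobian V (at x) *v v) \<le> C * norm v"
      using q(2)[OF xv] by (simp add: complexification_mult_real[OF c])
  qed
qed

section \<open>Ordinary differential equations\<close>

lemma gronwall_real:
  fixes m m' :: "real \<Rightarrow> real"
  assumes "a \<le> b" "\<And>t. t \<in> {a..b} \<Longrightarrow> (m has_real_derivative m' t) (at t)"
    "\<And>t. t \<in> {a..b} \<Longrightarrow> \<bar>m' t\<bar> \<le> c * m t"
  shows "m b \<le> m a * exp (c * (b - a))" "m a \<le> m b * exp (c * (b - a))"
proof -
  have "m b * exp (-c * b) \<le> m a * exp (-c * a)"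
  proof (rule DERIV_nonpos_imp_nonincreasing[OF assms(1), of "\<lambda>t. m t * exp (-c * t)"])
    fix t assume t: "a \<le> t" "t \<le> b"
    have "((\<lambda>t. m t * exp (-c * t)) has_real_derivative (m' t - c * m t) * exp (-c * t)) (at t)"
      using assms(2)[of t] t by (auto intro!: derivative_eq_intros simp: algebra_simps)
    moreover have "(m' t - c * m t) * exp (-c * t) \<le> 0"
      using assms(3)[of t] t by (intro mult_nonpos_nonneg) auto
    ultimately show "\<exists>y. ((\<lambda>t. m t * exp (-c * t)) has_real_derivative y) (at t) \<and> y \<le> 0" by blast
  qed
  then have "m b * exp (-c * b) * exp (c * b) \<le> m a * exp (-c * a) * exp (c * b)"
    by (rule mult_right_mono) simp
  then show "m b \<le> m a * exp (c * (b - a))"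
    by (simp add: mult.assoc exp_add[symmetric] algebra_simps)
  have "m a * exp (c * a) \<le> m b * exp (c * b)"
  proof (rule DERIV_nonneg_imp_nondecreasing[OF assms(1), of "\<lambda>t. m t * exp (c * t)"])
    fix t assume t: "a \<le> t" "t \<le> b"
    have "((\<lambda>t. m t * exp (c * t)) has_real_derivative (m' t + c * m t) * exp (c * t)) (at t)"
      using assms(2)[of t] t by (auto intro!: derivative_eq_intros simp: algebra_simps)
    moreover have "0 \<le> (m' t + c * m t) * exp (c * t)"
      using assms(3)[of t] t by (intro mult_nonneg_nonneg) auto
    ultimately show "\<exists>y. ((\<lambda>t. m t * exp (c * t)) has_real_derivative y) (at t) \<and> 0 \<le> y" by blast
  qed
  then have "m a * exp (c * a) * exp (-c * a) \<le> m b * exp (c * b) * exp (-c * a)"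
    by (rule mult_right_mono) simp
  then show "m a \<le> m b * exp (c * (b - a))"
    by (simp add: mult.assoc exp_add[symmetric] algebra_simps)
qed

text \<open>The squared norm is used because the norm itself is not differentiable at 0. The error
  enters as the summand \<open>e\<^sup>2\<close>, and the mixed term
  \<open>2 * norm (u t) * e\<close> is absorbed by the extra 1 in the exponent. The times
  \<open>s\<close> and \<open>t\<close> may come in either order.\<close>

lemma gronwall_norm:
  fixes u u' :: "real \<Rightarrow> 'a::real_inner"
  assumes ab: "s \<in> {a..b}" "t \<in> {a..b}"
    and d: "\<And>t. t \<in> {a..b} \<Longrightarrow> (u has_vector_derivative u' t) (at t)"
    and n: "\<And>t. t \<in> {a..b} \<Longrightarrow> norm (u' t) \<le> K * norm (u t) + e" and K: "K \<ge> 0" "e \<ge> 0"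
  shows "(norm (u t))\<^sup>2 + e\<^sup>2 \<le> ((norm (u s))\<^sup>2 + e\<^sup>2) * exp ((2 * K + 1) * \<bar>t - s\<bar>)"
proof -
  define m where "m t = u t \<bullet> u t + e\<^sup>2" for t
  have dm: "(m has_real_derivative 2 * (u t \<bullet> u' t)) (at t)" if "t \<in> {a..b}" for t
  proof -
    have "(m has_derivative (\<lambda>h. u t \<bullet> (h *\<^sub>R u' t) + (h *\<^sub>R u' t) \<bullet> u t + 0)) (at t)"
      unfolding m_def using d[OF that] unfolding has_vector_derivative_def
      by (intro has_derivative_add has_derivative_inner has_derivative_const)
    moreover have "(\<lambda>h. u t \<bullet> (h *\<^sub>R u' t) + (h *\<^sub>R u' t) \<bullet> u t + 0) = (*) (2 * (u t \<bullet> u' t))"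
      by (auto simp: inner_commute fun_eq_iff)
    ultimately show ?thesis unfolding has_field_derivative_def by metis
  qed
  have bm: "\<bar>2 * (u t \<bullet> u' t)\<bar> \<le> (2 * K + 1) * m t" if "t \<in> {a..b}" for t
  proof -
    have "\<bar>u t \<bullet> u' t\<bar> \<le> norm (u t) * norm (u' t)" by (rule Cauchy_Schwarz_ineq2)
    also have "\<dots> \<le> norm (u t) * (K * norm (u t) + e)" by (intro mult_left_mono n that) simp
    also have "\<dots> = K * (norm (u t))\<^sup>2 + norm (u t) * e" by (simp add: power2_eq_square algebra_simps)
    finally have "\<bar>2 * (u t \<bullet> u' t)\<bar> \<le> 2 * K * (norm (u t))\<^sup>2 + 2 * norm (u t) * e" by simp
    also have "2 * norm (u t) * e \<le> (norm (u t))\<^sup>2 + e\<^sup>2" by (rule sum_squares_bound)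
    also have "2 * K * (norm (u t))\<^sup>2 + ((norm (u t))\<^sup>2 + e\<^sup>2) \<le> (2 * K + 1) * m t"
      using K by (simp add: m_def power2_norm_eq_inner algebra_simps)
    finally show ?thesis by simp
  qed
  have m: "m t = (norm (u t))\<^sup>2 + e\<^sup>2" for t by (simp add: m_def power2_norm_eq_inner)
  show ?thesis
  proof (cases "s \<le> t")
    case True
    have "m t \<le> m s * exp ((2 * K + 1) * (t - s))"
      by (rule gronwall_real(1)[OF True dm bm]) (use ab in auto)
    then show ?thesis using True by (simp add: m)
  next
    case False
    have "m t \<le> m s * exp ((2 * K + 1) * (s - t))"
      by (rule gronwall_real(2)[OF _ dm bm]) (use ab False in auto)
    then show ?thesis using False by (simp add: m)
  qed
qed

text \<open>The zero set is closed, and open by Gronwall's inequality. The constant may depend on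
  the point, which covers coefficients unbounded on \<open>I\<close> as well as differences of
  solutions of nonlinear equations.\<close>

lemma ode_unique_zero:
  fixes u u' :: "real \<Rightarrow> 'a::real_inner"
  assumes I: "open I" "connected I" and t0: "t0 \<in> I" "u t0 = 0"
    and d: "\<And>t. t \<in> I \<Longrightarrow> (u has_vector_derivative u' t) (at t)"
    and loc: "\<And>s. s \<in> I \<Longrightarrow> \<exists>K. \<forall>\<^sub>F t in nhds s. norm (u' t) \<le> K * norm (u t)"
    and t: "t \<in> I"
  shows "u t = 0"
proof -
  define Z where "Z = {t\<in>I. u t = 0}"
  have "continuous_on I u"
    using d by (meson continuous_at_imp_continuous_on has_vector_derivative_continuous)
  then have "closedin (top_of_set I) Z" unfolding Z_def
    by (rule continuous_closedin_preimage_constant)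
  moreover have "openin (top_of_set I) Z"
  proof -
    have "\<exists>\<delta>>0. ball s \<delta> \<subseteq> Z" if s: "s \<in> Z" for s
    proof -
      have sI: "s \<in> I" "u s = 0" using s by (auto simp: Z_def)
      from loc[OF sI(1)] obtain K where "\<forall>\<^sub>F t in nhds s. norm (u' t) \<le> K * norm (u t)" by blast
      then have "\<forall>\<^sub>F t in nhds s. norm (u' t) \<le> K * norm (u t) \<and> t \<in> I"
        using I sI by (simp add: eventually_conj eventually_nhds_in_open)
      then obtain \<delta> where \<delta>: "\<delta> > 0" "\<And>t. dist t s < \<delta> \<Longrightarrow> norm (u' t) \<le> K * norm (u t) \<and> t \<in> I"
        unfolding eventually_nhds_metric by blast
      have "u t = 0" if "t \<in> ball s \<delta>" for t
      proof -
        have "(norm (u t))\<^sup>2 + 0\<^sup>2 \<le> ((norm (u s))\<^sup>2 + 0\<^sup>2) * exp ((2 * \<bar>K\<bar> + 1) * \<bar>t - s\<bar>)"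
        proof (rule gronwall_norm[where a="min s t" and b="max s t" and u'=u'])
          fix x assume "x \<in> {min s t..max s t}"
          then have "dist x s < \<delta>" using that by (auto simp: dist_real_def min_def max_def split: if_splits)
          note x = \<delta>(2)[OF this]
          show "(u has_vector_derivative u' x) (at x)" using d x by blast
          have "K * norm (u x) \<le> \<bar>K\<bar> * norm (u x)" by (intro mult_right_mono) auto
          then show "norm (u' x) \<le> \<bar>K\<bar> * norm (u x) + 0" using x by linarith
        qed auto
        then show ?thesis using sI by simp
      qed
      then have "ball s \<delta> \<subseteq> Z" using \<delta>(2) by (auto simp: Z_def dist_commute)
      then show ?thesis using \<delta>(1) by blast
    qed
    then have "open Z" by (simp add: open_contains_ball)
    moreover have "Z \<subseteq> I" by (auto simp: Z_def)
    ultimately show ?thesis by (simp add: open_subset)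
  qed
  ultimately have "Z = {} \<or> Z = I" using I(2) unfolding connected_clopen by blast
  then show ?thesis using t0 t by (auto simp: Z_def)
qed

text \<open>Picard's theorem with one time span for all initial points of a ball, so that a whole
  curve of points can be moved by the flow.\<close>

lemma picard_local:
  fixes V :: "'a::euclidean_space \<Rightarrow> 'a"
  assumes r: "r > 0" and L: "L-lipschitz_on (cball p (2 * r)) V"
  obtains \<delta> where "\<delta> > 0" "\<And>x0. x0 \<in> cball p r \<Longrightarrow> \<exists>x. x 0 = x0 \<and>
      (\<forall>t\<in>{-\<delta><..<\<delta>}. (x has_vector_derivative V (x t)) (at t) \<and> x t \<in> cball p (2 * r))"
proof -
  define S where "S = cball p (2 * r)"
  have S: "convex S" "closed S" "S \<noteq> {}" "compact S" using r by (auto simp: S_def)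
  \<comment> \<open>Composition with the nearest-point projection extends \<open>V\<close> from the
    ball to a bounded, globally Lipschitz field. The fixed point operator is thereby defined on all
    bounded continuous functions; that its fixed point stays in \<open>S\<close> is shown
    afterwards.\<close>
  define G where "G y = V (closest_point S y)" for y
  have L0: "L \<ge> 0" using L by (rule lipschitz_on_nonneg)
  have contG: "continuous_on UNIV G" unfolding G_def
    by (rule continuous_on_compose2[OF lipschitz_on_continuous_on[OF L[folded S_def]]])
      (use S in \<open>auto intro!: continuous_on_closest_point closest_point_in_set\<close>)
  have lipG: "dist (G x) (G y) \<le> L * dist x y" for x y
  proof -
    have "dist (G x) (G y) \<le> L * dist (closest_point S x) (closest_point S y)"
      unfolding G_def by (rule lipschitz_onD[OF L[folded S_def]]) (use S in \<open>auto intro: closest_point_in_set\<close>)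
    also have "\<dots> \<le> L * dist x y" using L0 S by (intro mult_left_mono closest_point_lipschitz) auto
    finally show ?thesis .
  qed
  have "bounded (V ` S)"
    by (intro compact_imp_bounded compact_continuous_image lipschitz_on_continuous_on[OF L[folded S_def]] S)
  then obtain B where B: "B > 0" "\<And>y. y \<in> S \<Longrightarrow> norm (V y) \<le> B" using bounded_pos by (metis imageI)
  have bG: "norm (G y) \<le> B" for y unfolding G_def by (rule B(2)) (use S in \<open>auto intro: closest_point_in_set\<close>)
  \<comment> \<open>The first bound keeps solutions within distance \<open>r\<close> of their
    initial point, through \<open>4 * \<delta> * B \<le> r\<close>; the second makes the operator
    contract by 1/2.\<close>
  define \<delta> where "\<delta> = min (r / (4 * B)) (1 / (8 * (L + 1)))"
  have \<delta>: "\<delta> > 0" using r B L0 by (simp add: \<delta>_def)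
  have B4: "4 * B > 0" and L8: "8 * (L + 1) > 0" using B(1) L0 by auto
  have "\<delta> \<le> r / (4 * B)" "\<delta> \<le> 1 / (8 * (L + 1))" unfolding \<delta>_def by (rule min.cobounded1, rule min.cobounded2)
  then have "\<delta> * (4 * B) \<le> r" "\<delta> * (8 * (L + 1)) \<le> 1"
    unfolding pos_le_divide_eq[OF B4] pos_le_divide_eq[OF L8] .
  moreover have "\<delta> * (4 * B) = 4 * \<delta> * B" "\<delta> * (8 * (L + 1)) = 2 * (4 * \<delta> * L) + 8 * \<delta>"
    by (simp_all add: distrib_left)
  ultimately have \<delta>B: "4 * \<delta> * B \<le> r" and \<delta>L: "4 * \<delta> * L \<le> 1/2" using \<delta> by linarith+
  \<comment> \<open>Clamping the time makes the candidates functions on the whole line, where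
    bounded continuous functions form a complete space.\<close>
  define c where "c t = max (-\<delta>) (min \<delta> t)" for t
  have c: "c t \<in> {-\<delta>..\<delta>}" for t using \<delta> by (auto simp: c_def)
  have contc: "continuous_on UNIV c" unfolding c_def by (intro continuous_intros)
  \<comment> \<open>Integration starts at the left end of the interval, so that integrals never run
    backwards; subtracting \<open>W u 0\<close> moves the initial time to 0.\<close>
  define W where "W u t = integral {-\<delta>..t} (\<lambda>s. G (apply_bcontfun u s))" for u t
  have contu: "continuous_on A (\<lambda>s. G (apply_bcontfun u s))" for u and A :: "real set"
    by (rule continuous_on_compose2[OF contG]) auto
  have W_le: "norm (W u t) \<le> B * (2 * \<delta>)" if "t \<in> {-\<delta>..\<delta>}" for u t
  proof -
    have "norm (W u t) \<le> B * (t - (-\<delta>))" unfolding W_def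
      by (rule integral_bound) (use that contu bG in auto)
    also have "\<dots> \<le> B * (2 * \<delta>)" using that B by (intro mult_left_mono) auto
    finally show ?thesis .
  qed
  have W_diff: "norm (W u t - W v t) \<le> L * dist u v * (2 * \<delta>)" if "t \<in> {-\<delta>..\<delta>}" for u v t
  proof -
    have "W u t - W v t = integral {-\<delta>..t} (\<lambda>s. G (apply_bcontfun u s) - G (apply_bcontfun v s))" unfolding W_def
      by (rule integral_diff[symmetric]) (auto intro!: integrable_continuous_real contu)
    also have "norm \<dots> \<le> L * dist u v * (t - (-\<delta>))"
    proof (rule integral_bound)
      show "continuous_on {-\<delta>..t} (\<lambda>s. G (apply_bcontfun u s) - G (apply_bcontfun v s))"
        by (intro continuous_intros contu)
      fix s
      have "norm (G (apply_bcontfun u s) - G (apply_bcontfun v s)) \<le> L * dist (apply_bcontfun u s) (apply_bcontfun v s)"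
        using lipG by (simp add: dist_norm)
      also have "\<dots> \<le> L * dist u v" by (intro mult_left_mono dist_bounded L0)
      finally show "norm (G (apply_bcontfun u s) - G (apply_bcontfun v s)) \<le> L * dist u v" .
    qed (use that in auto)
    also have "\<dots> \<le> L * dist u v * (2 * \<delta>)" using that L0 by (intro mult_left_mono) auto
    finally show ?thesis .
  qed
  have dW: "(W u has_vector_derivative G (apply_bcontfun u t)) (at t within {-\<delta>..\<delta>})" if "t \<in> {-\<delta>..\<delta>}" for u t
    unfolding W_def by (rule integral_has_vector_derivative[OF contu that])
  have contW: "continuous_on {-\<delta>..\<delta>} (W u)" for u
    using dW by (meson continuous_on_eq_continuous_within has_vector_derivative_continuous)
  have 0: "0 \<in> {-\<delta>..\<delta>}" "c 0 = 0" using \<delta> by (auto simp: c_def)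
  have main: "\<exists>x. x 0 = x0 \<and> (\<forall>t\<in>{-\<delta><..<\<delta>}. (x has_vector_derivative V (x t)) (at t) \<and> x t \<in> S)"
    if x0: "x0 \<in> cball p r" for x0
  proof -
    define T where "T u = Bcontfun (\<lambda>t. x0 + W u (c t) - W u 0)" for u
    have Wc: "continuous_on UNIV (\<lambda>t. W u (c t))" for u
      by (rule continuous_on_compose2[OF contW contc]) (use c in auto)
    have bd: "norm (W u (c t) - W u 0) \<le> r" for u t
    proof -
      have "norm (W u (c t) - W u 0) \<le> norm (W u (c t)) + norm (W u 0)" by (rule norm_triangle_ineq4)
      also have "\<dots> \<le> B * (2 * \<delta>) + B * (2 * \<delta>)" by (intro add_mono W_le c 0)
      also have "\<dots> \<le> r" using \<delta>B by (simp add: algebra_simps)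
      finally show ?thesis .
    qed
    have "(\<lambda>t. x0 + W u (c t) - W u 0) \<in> bcontfun" for u
    proof (rule bcontfun_normI)
      show "continuous_on UNIV (\<lambda>t. x0 + W u (c t) - W u 0)" by (intro continuous_intros Wc)
      fix t
      have "norm (x0 + W u (c t) - W u 0) \<le> norm x0 + norm (W u (c t) - W u 0)"
        by (metis add_diff_eq norm_triangle_ineq)
      then show "norm (x0 + W u (c t) - W u 0) \<le> norm x0 + r" using bd[of u t] by linarith
    qed
    then have T: "apply_bcontfun (T u) t = x0 + W u (c t) - W u 0" for u t
      by (simp add: T_def Bcontfun_inverse)
    have "\<exists>!u. T u = u"
    proof (rule banach_fix_type[of "1/2"], simp, simp, intro allI)
      fix u v
      show "dist (T u) (T v) \<le> 1/2 * dist u v"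
      proof (rule dist_bound)
        fix t
        have "dist (apply_bcontfun (T u) t) (apply_bcontfun (T v) t) = norm ((W u (c t) - W v (c t)) - (W u 0 - W v 0))"
          by (simp add: T dist_norm algebra_simps)
        also have "\<dots> \<le> norm (W u (c t) - W v (c t)) + norm (W u 0 - W v 0)" by (rule norm_triangle_ineq4)
        also have "\<dots> \<le> L * dist u v * (2 * \<delta>) + L * dist u v * (2 * \<delta>)" by (intro add_mono W_diff c 0)
        also have "\<dots> = (4 * \<delta> * L) * dist u v" by simp
        also have "\<dots> \<le> 1/2 * dist u v" using \<delta>L by (intro mult_right_mono) auto
        finally show "dist (apply_bcontfun (T u) t) (apply_bcontfun (T v) t) \<le> 1/2 * dist u v" .
      qed
    qed
    then obtain u where u: "T u = u" by blast
    define x where "x = apply_bcontfun u"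
    define w where "w = W u"
    have xt: "x t = x0 + w (c t) - w 0" for t using T[of u t] u by (simp add: x_def w_def)
    have inS: "x t \<in> S" for t
    proof -
      have "dist p (x t) \<le> dist p x0 + dist x0 (x t)" by (rule dist_triangle)
      also have "dist x0 (x t) = norm (w (c t) - w 0)"
        unfolding xt by (simp add: dist_norm norm_minus_commute algebra_simps)
      also have "\<dots> \<le> r" unfolding w_def by (rule bd)
      finally show ?thesis using x0 by (simp add: S_def)
    qed
    have "(x has_vector_derivative V (x t)) (at t)" if t: "t \<in> {-\<delta><..<\<delta>}" for t
    proof -
      have "(w has_vector_derivative G (x t)) (at t within {-\<delta>..\<delta>})"
        unfolding w_def x_def by (rule dW) (use t in auto)
      moreover have "at t within {-\<delta>..\<delta>} = at t"
        by (rule at_within_Icc_at) (use t in auto)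
      ultimately have "(w has_vector_derivative G (x t)) (at t)" by (simp only:)
      then have "((\<lambda>t. x0 + w t - w 0) has_vector_derivative (0 + G (x t) - 0)) (at t)"
        by (intro has_vector_derivative_diff has_vector_derivative_add has_vector_derivative_const)
      then have "(x has_vector_derivative (0 + G (x t) - 0)) (at t)"
        by (rule has_vector_derivative_transform_within_open[of _ _ _ "{-\<delta><..<\<delta>}"])
          (use t in \<open>auto simp: xt c_def min_def max_def\<close>)
      then show ?thesis using inS by (simp add: G_def closest_point_self)
    qed
    then show ?thesis using inS 0 by (intro exI[of _ x]) (auto simp: xt)
  qed
  show thesis using that[OF \<delta>] main unfolding S_def by blast
qed

section \<open>Linear systems with holomorphic coefficients on simply connected domains\<close>

fun lin_ode_coeff :: "('n \<Rightarrow> 'n::finite \<Rightarrow> nat \<Rightarrow> complex) \<Rightarrow> ('n \<Rightarrow> complex) \<Rightarrow> nat \<Rightarrow> 'n \<Rightarrow> complex" where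
  "lin_ode_coeff a c 0 i = c i"
| "lin_ode_coeff a c (Suc n) i = (\<Sum>k\<le>n. \<Sum>j\<in>UNIV. lin_ode_coeff a c k j * a i j (n - k)) / of_nat (Suc n)"

text \<open>The recursion for \<open>lin_ode_coeff\<close> is comparison of coefficients in y' = A
  y. The geometric decay of \<open>a\<close> bounds the convolution by a fixed multiple
  \<open>N\<close> of the wanted size, and division by \<open>Suc n\<close> compensates for it once
  \<open>Suc n\<close> exceeds \<open>N\<close>; the choice of \<open>C\<close> covers the finitely
  many earlier coefficients.\<close>

lemma lin_ode_coeff_bound:
  fixes a :: "'n \<Rightarrow> 'n::finite \<Rightarrow> nat \<Rightarrow> complex"
  assumes r: "0 < r" "r < r0" and M: "\<And>i j n. norm (a i j n) \<le> M / r0 ^ n"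
  shows "\<exists>C. \<forall>n i. norm (lin_ode_coeff a c n i) \<le> C / r ^ n"
proof -
  define y where "y n i = lin_ode_coeff a c n i" for n i
  define q where "q = r / r0"
  have q: "0 < q" "q < 1" using r by (auto simp: q_def)
  have M0: "M \<ge> 0" using M[of undefined undefined 0] by (auto intro: order_trans[OF norm_ge_zero])
  define N where "N = real CARD('n) * M * r / (1 - q)"
  obtain n0 :: nat where n0: "real n0 \<ge> N" using real_arch_simple by blast
  define C where "C = (\<Sum>n\<le>n0. \<Sum>i\<in>UNIV. norm (y n i) * r ^ n)"
  have C0: "C \<ge> 0" unfolding C_def using r by (intro sum_nonneg) auto
  have "\<forall>i. norm (y n i) \<le> C / r ^ n" for n
  proof (induction n rule: less_induct)
    case (less n)
    show ?case
    proof (cases "n \<le> n0")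
      case True
      show ?thesis
      proof
        fix i
        have "norm (y n i) * r ^ n \<le> (\<Sum>i\<in>UNIV. norm (y n i) * r ^ n)"
          using r by (intro member_le_sum) auto
        also have "\<dots> \<le> C" unfolding C_def using r True
          by (intro member_le_sum[of n "{..n0}" "\<lambda>n. \<Sum>i\<in>UNIV. norm (y n i) * r ^ n"]) (auto intro!: sum_nonneg)
        finally show "norm (y n i) \<le> C / r ^ n" using r by (simp add: field_simps)
      qed
    next
      case False
      then obtain m where m: "n = Suc m" "n0 \<le> m" by (cases n) auto
      show ?thesis
      proof
        fix i
        have "norm (\<Sum>k\<le>m. \<Sum>j\<in>UNIV. y k j * a i j (m - k)) \<le> (\<Sum>k\<le>m. \<Sum>j\<in>(UNIV::'n set). C * M / r ^ m * q ^ (m - k))"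
        proof (intro sum_norm_le)
          fix k j assume k: "k \<in> {..m}"
          have "norm (y k j * a i j (m - k)) \<le> (C / r ^ k) * (M / r0 ^ (m - k))"
            unfolding norm_mult using less.IH[of k] k m M C0 r by (intro mult_mono) auto
          also have "\<dots> = C * M / r ^ m * q ^ (m - k)"
          proof -
            have "r ^ m = r ^ k * r ^ (m - k)" using k by (simp add: power_add[symmetric])
            then show ?thesis using r by (simp add: q_def power_divide field_simps)
          qed
          finally show "norm (y k j * a i j (m - k)) \<le> C * M / r ^ m * q ^ (m - k)" .
        qed
        also have "\<dots> = real CARD('n) * (C * M / r ^ m) * (\<Sum>k\<le>m. q ^ (m - k))"
          unfolding sum_constant sum_distrib_left by (intro sum.cong refl) (simp only: mult.assoc)
        also have "\<dots> \<le> real CARD('n) * (C * M / r ^ m) * (1 / (1 - q))"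
        proof (rule mult_left_mono)
          have "(\<Sum>k\<le>m. q ^ (m - k)) = (\<Sum>k\<le>m. q ^ k)"
            by (rule sum.reindex_bij_witness[of _ "\<lambda>k. m - k" "\<lambda>k. m - k"]) auto
          also have "\<dots> = (1 - q ^ Suc m) / (1 - q)" using q sum_gp_basic[of q m] by (simp add: eq_divide_eq mult.commute del: power_Suc)
          also have "\<dots> \<le> 1 / (1 - q)" using q by (intro divide_right_mono) auto
          finally show "(\<Sum>k\<le>m. q ^ (m - k)) \<le> 1 / (1 - q)" .
        qed (use C0 M0 r in auto)
        also have "\<dots> = C * N / r ^ Suc m" using r q by (simp add: N_def field_simps)
        finally have "norm (\<Sum>k\<le>m. \<Sum>j\<in>UNIV. y k j * a i j (m - k)) \<le> C * N / r ^ Suc m" .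
        also have "\<dots> \<le> C * of_nat (Suc m) / r ^ Suc m"
          using C0 r n0 m by (intro divide_right_mono mult_left_mono) auto
        finally have "norm (\<Sum>k\<le>m. \<Sum>j\<in>UNIV. y k j * a i j (m - k)) / of_nat (Suc m) \<le> C * of_nat (Suc m) / r ^ Suc m / of_nat (Suc m)"
          by (rule divide_right_mono) simp
        then have "norm (\<Sum>k\<le>m. \<Sum>j\<in>UNIV. y k j * a i j (m - k)) / of_nat (Suc m) \<le> C / r ^ Suc m"
          by simp
        then show "norm (y n i) \<le> C / r ^ n"
          by (simp add: m y_def norm_divide del: of_nat_Suc power_Suc)
      qed
    qed
  qed
  then show ?thesis unfolding y_def by blast
qed

text \<open>The coefficients of the formal solution are bounded by a multiple of
  \<open>1 / r ^ n\<close> for every \<open>r < 1\<close>, so the series converges on the full disc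
  on which \<open>A\<close> is holomorphic.\<close>

lemma lin_ode_ball:
  fixes A :: "'n::finite \<Rightarrow> 'n \<Rightarrow> complex \<Rightarrow> complex" and c :: "complex^'n"
  assumes A: "\<And>i j. A i j holomorphic_on ball 0 1"
  shows "\<exists>y :: complex \<Rightarrow> complex^'n. y 0 = c \<and>
    (\<forall>z\<in>ball 0 1. \<forall>i. ((\<lambda>z. y z $ i) has_field_derivative (\<Sum>j\<in>UNIV. A i j z * y z $ j)) (at z))"
proof -
  define a where "a i j n = (deriv ^^ n) (A i j) 0 / fact n" for i j n
  define fA where "fA i j = Abs_fps (a i j)" for i j
  have sums: "(\<lambda>n. a i j n * z ^ n) sums A i j z" if "z \<in> ball 0 1" for i j z
    using holomorphic_power_series[OF A that] by (simp add: a_def)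
  define fy where "fy i = Abs_fps (\<lambda>n. lin_ode_coeff a (\<lambda>i. c $ i) n i)" for i
  have radA: "ereal (norm z) < fps_conv_radius (fA i j)" if "z \<in> ball 0 1" for z i j
  proof -
    obtain r where r: "norm z < r" "r < 1" using \<open>z \<in> ball 0 1\<close> dense[of "norm z" 1] by auto
    then have r0: "0 < r" using norm_ge_zero[of z] by linarith
    have "summable (\<lambda>n. fps_nth (fA i j) n * of_real r ^ n)"
      using sums[of "of_real r" i j] r r0 by (auto simp: fA_def sums_iff)
    from conv_radius_geI[OF this] r r0 show ?thesis
      by (auto simp: fps_conv_radius_def intro: less_le_trans[of _ "ereal r"])
  qed
  have rady: "ereal (norm z) < fps_conv_radius (fy i)" if "z \<in> ball 0 1" for z i
  proof -
    \<comment> \<open>Radii \<open>norm z < z' < r < r0 < 1\<close>: the coefficients of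
      \<open>A\<close> are bounded at \<open>r0\<close>, those of the solution at \<open>r\<close>,
      and the series is summed at \<open>z'\<close>.\<close>
    obtain z' where z': "norm z < z'" "z' < 1" using \<open>z \<in> ball 0 1\<close> dense[of "norm z" 1] by auto
    obtain r where r: "z' < r" "r < 1" using z' dense by blast
    obtain r0 where r0: "r < r0" "r0 < 1" using r dense by blast
    have pos: "0 < z'" "0 < r" "0 < r0" using z' r r0 norm_ge_zero[of z] by linarith+
    have "\<exists>M. \<forall>n. norm (a i j n) \<le> M / r0 ^ n" for i j
    proof -
      have "(\<lambda>n. a i j n * of_real r0 ^ n) \<longlonglongrightarrow> 0"
        using sums[of "of_real r0" i j] r0 pos by (intro summable_LIMSEQ_zero) (auto simp: sums_iff)
      then have "Bseq (\<lambda>n. a i j n * of_real r0 ^ n)" by (meson convergentI convergent_imp_Bseq)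
      then obtain M where "\<And>n. norm (a i j n * of_real r0 ^ n) \<le> M" unfolding Bseq_def by blast
      then show ?thesis using pos by (intro exI[of _ M]) (auto simp: norm_mult norm_power field_simps)
    qed
    then obtain M where M: "\<And>i j n. norm (a i j n) \<le> M i j / r0 ^ n" by metis
    define MM where "MM = (\<Sum>i\<in>UNIV. \<Sum>j\<in>UNIV. \<bar>M i j\<bar>)"
    have bM: "norm (a i j n) \<le> MM / r0 ^ n" for i j n
    proof -
      have "M i j \<le> \<bar>M i j\<bar>" by simp
      also have "\<dots> \<le> (\<Sum>j\<in>UNIV. \<bar>M i j\<bar>)" by (rule member_le_sum) auto
      also have "\<dots> \<le> MM" unfolding MM_def by (rule member_le_sum[of i UNIV "\<lambda>i. \<Sum>j\<in>UNIV. \<bar>M i j\<bar>"]) (auto intro: sum_nonneg)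
      finally have "M i j / r0 ^ n \<le> MM / r0 ^ n" using pos by (intro divide_right_mono) auto
      then show ?thesis using M[of i j n] by linarith
    qed
    from lin_ode_coeff_bound[of r r0 a, OF pos(2) r0(1) bM] obtain C where
      C: "\<And>n i. norm (lin_ode_coeff a (\<lambda>i. c $ i) n i) \<le> C / r ^ n" by blast
    have "summable (\<lambda>n. fps_nth (fy i) n * of_real z' ^ n)"
    proof (rule summable_comparison_test')
      show "summable (\<lambda>n. C * (z' / r) ^ n)" using pos r by (intro summable_mult summable_geometric) auto
      fix n
      have "norm (fps_nth (fy i) n * of_real z' ^ n) \<le> C / r ^ n * z' ^ n"
        using mult_right_mono[OF C[of n i], of "z' ^ n"] pos by (simp add: fy_def norm_mult norm_power)
      then show "norm (fps_nth (fy i) n * of_real z' ^ n) \<le> C * (z' / r) ^ n" by (simp add: power_divide)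
    qed
    from conv_radius_geI[OF this] z' pos show ?thesis
      by (auto simp: fps_conv_radius_def intro: less_le_trans[of _ "ereal z'"])
  qed
  have evA: "eval_fps (fA i j) z = A i j z" if "z \<in> ball 0 1" for i j z
    using sums[OF that] by (simp add: eval_fps_def fA_def sums_iff)
  have dy: "fps_deriv (fy i) = (\<Sum>j\<in>UNIV. fy j * fA i j)" for i
  proof (rule fps_ext)
    fix n
    have "fps_nth (fps_deriv (fy i)) n = (\<Sum>k\<le>n. \<Sum>j\<in>UNIV. lin_ode_coeff a (\<lambda>i. c $ i) k j * a i j (n - k))"
      by (simp add: fy_def del: of_nat_Suc)
    also have "\<dots> = fps_nth (\<Sum>j\<in>UNIV. fy j * fA i j) n"
      by (subst sum.swap) (simp add: fps_sum_nth fps_mult_nth fy_def fA_def atLeast0AtMost)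
    finally show "fps_nth (fps_deriv (fy i)) n = fps_nth (\<Sum>j\<in>UNIV. fy j * fA i j) n" .
  qed
  have evsum: "eval_fps (\<Sum>j\<in>J. fy j * fA i j) z = (\<Sum>j\<in>J. A i j z * eval_fps (fy j) z) \<and>
      ereal (norm z) < fps_conv_radius (\<Sum>j\<in>J. fy j * fA i j)" if "z \<in> ball 0 1" "finite J" for J i z
    using that(2)
  proof (induction J rule: finite_induct)
    case (insert j J)
    have r1: "ereal (norm z) < fps_conv_radius (fy j * fA i j)"
      using fps_conv_radius_mult[of "fy j" "fA i j"] radA[OF that(1), of i j] rady[OF that(1), of j]
      by (meson less_le_trans min_less_iff_conj)
    have "ereal (norm z) < fps_conv_radius (fy j * fA i j + (\<Sum>j\<in>J. fy j * fA i j))"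
      using fps_conv_radius_add[of "fy j * fA i j" "\<Sum>j\<in>J. fy j * fA i j"] r1 insert.IH
      by (meson less_le_trans min_less_iff_conj)
    then show ?case using insert r1 radA[OF that(1), of i j] rady[OF that(1), of j] evA[OF that(1), of i j]
      by (simp add: eval_fps_add eval_fps_mult mult.commute)
  qed simp
  define y where "y z = (\<chi> i. eval_fps (fy i) z)" for z
  show ?thesis
  proof (intro exI[of _ y] conjI ballI allI)
    show "y 0 = c" by (simp add: y_def vec_eq_iff eval_fps_at_0 fy_def)
    fix z :: complex and i assume z: "z \<in> ball 0 1"
    have "(eval_fps (fy i) has_field_derivative eval_fps (fps_deriv (fy i)) z) (at z)"
      by (rule has_field_derivative_eval_fps[OF rady[OF z]])
    then show "((\<lambda>z. y z $ i) has_field_derivative (\<Sum>j\<in>UNIV. A i j z * y z $ j)) (at z)"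
      using evsum[OF z finite[of UNIV], of i] by (simp add: y_def dy)
  qed
qed

text \<open>The Riemann mapping theorem reduces the case of a simply connected domain to the disc.\<close>

lemma lin_ode_simply_connected:
  fixes A :: "'n::finite \<Rightarrow> 'n \<Rightarrow> complex \<Rightarrow> complex" and c :: "complex^'n"
  assumes S: "open S" "simply_connected S" "S \<noteq> UNIV" "t0 \<in> S" and A: "\<And>i j. A i j holomorphic_on S"
  shows "\<exists>Y :: complex \<Rightarrow> complex^'n. Y t0 = c \<and>
    (\<forall>z\<in>S. \<forall>i. ((\<lambda>z. Y z $ i) has_field_derivative (\<Sum>j\<in>UNIV. A i j z * Y z $ j)) (at z))"
proof -
  from S Riemann_mapping_theorem[of S] obtain f g where fg: "f holomorphic_on S" "g holomorphic_on ball 0 1"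
     "\<And>z. z \<in> S \<Longrightarrow> f z \<in> ball 0 1 \<and> g (f z) = z" "\<And>z. z \<in> ball 0 1 \<Longrightarrow> g z \<in> S \<and> f (g z) = z"
    by blast
  from ball_biholomorphism_exists[of "f t0"] fg(3)[OF S(4)] obtain h k where hk: "h (f t0) = 0"
    "h holomorphic_on ball 0 1" "h ` ball 0 1 \<subseteq> ball 0 1" "k holomorphic_on ball 0 1" "k ` ball 0 1 \<subseteq> ball 0 1"
    "\<And>z. z \<in> ball 0 1 \<Longrightarrow> h (k z) = z" "\<And>z. z \<in> ball 0 1 \<Longrightarrow> k (h z) = z" by metis
  \<comment> \<open>The automorphism \<open>h\<close> of the disc moves the image of
    \<open>t0\<close> to the centre, where the power series takes its initial value;
    \<open>G\<close> is the inverse of \<open>P\<close>.\<close>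
  define P where "P z = h (f z)" for z
  define G where "G u = g (k u)" for u
  have fS: "f ` S \<subseteq> ball 0 1" using fg(3) by blast
  have P: "P holomorphic_on S"
    using holomorphic_on_compose_gen[OF fg(1) hk(2) fS] unfolding P_def[abs_def] o_def .
  have G: "G holomorphic_on ball 0 1"
    using holomorphic_on_compose_gen[OF hk(4) fg(2) hk(5)] unfolding G_def[abs_def] o_def .
  have PS: "P z \<in> ball 0 1" "G (P z) = z" if z: "z \<in> S" for z
  proof -
    have fz: "f z \<in> ball 0 1" using fg(3) z by blast
    then show "P z \<in> ball 0 1" unfolding P_def using hk(3) by blast
    show "G (P z) = z" unfolding P_def G_def hk(7)[OF fz] using fg(3) z by blast
  qed
  have GS: "G u \<in> S" if "u \<in> ball 0 1" for u
    using that fg(4) hk(5) unfolding G_def by blast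
  define B where "B i j u = deriv G u * A i j (G u)" for i j u
  have hB: "B i j holomorphic_on ball 0 1" for i j
  proof -
    have "G ` ball 0 1 \<subseteq> S" using GS by blast
    from holomorphic_on_compose_gen[OF G A[of i j] this]
    have "(\<lambda>u. A i j (G u)) holomorphic_on ball 0 1" unfolding o_def .
    with holomorphic_deriv[OF G open_ball] show ?thesis unfolding B_def by (rule holomorphic_on_mult)
  qed
  from lin_ode_ball[of B c, OF hB] obtain y where y: "y 0 = c"
    "\<And>z i. z \<in> ball 0 1 \<Longrightarrow> ((\<lambda>z. y z $ i) has_field_derivative (\<Sum>j\<in>UNIV. B i j z * y z $ j)) (at z)" by blast
  show ?thesis
  proof (intro exI[of _ "\<lambda>z. y (P z)"] conjI ballI allI)
    show "y (P t0) = c" using y(1) hk(1) by (simp add: P_def)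
    fix z i assume z: "z \<in> S"
    have dP: "(P has_field_derivative deriv P z) (at z)" by (rule holomorphic_derivI[OF P S(1) z])
    have dG: "(G has_field_derivative deriv G (P z)) (at (P z))"
      by (rule holomorphic_derivI[OF G open_ball]) (use PS[OF z] in auto)
    have "((\<lambda>z. G (P z)) has_field_derivative deriv G (P z) * deriv P z) (at z)"
      by (rule DERIV_chain2[OF dG dP])
    then have "((\<lambda>z. z) has_field_derivative deriv G (P z) * deriv P z) (at z)"
      by (rule has_field_derivative_transform_within_open[OF _ S(1) z]) (use PS in auto)
    then have 1: "deriv G (P z) * deriv P z = 1" using DERIV_unique DERIV_ident by blast
    have "((\<lambda>z. y (P z) $ i) has_field_derivative (\<Sum>j\<in>UNIV. B i j (P z) * y (P z) $ j) * deriv P z) (at z)"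
      by (rule DERIV_chain2[OF y(2) dP]) (use PS[OF z] in auto)
    moreover have "(\<Sum>j\<in>UNIV. B i j (P z) * y (P z) $ j) * deriv P z = (\<Sum>j\<in>UNIV. A i j z * y (P z) $ j)"
      unfolding B_def PS(2)[OF z] sum_distrib_right
    proof (rule sum.cong[OF refl])
      fix j
      show "deriv G (P z) * A i j z * y (P z) $ j * deriv P z = A i j z * y (P z) $ j"
        using arg_cong[OF 1, of "\<lambda>c. c * (A i j z * y (P z) $ j)"] by (simp add: mult_ac)
    qed
    ultimately show "((\<lambda>z. y (P z) $ i) has_field_derivative (\<Sum>j\<in>UNIV. A i j z * y (P z) $ j)) (at z)" by simp
  qed
qed

section \<open>The two ends of the surface\<close>

lemma identity_from_reals:
  assumes S: "open S" "connected S" and f: "f holomorphic_on S" and g: "g holomorphic_on S"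
    and c: "complex_of_real c \<in> S" and ev: "\<forall>\<^sub>F t in at c. f (of_real t) = g (of_real t)" and w: "w \<in> S"
  shows "f w = g w"
proof -
  obtain d where d: "d > 0" "\<And>t. t \<noteq> c \<Longrightarrow> dist t c < d \<Longrightarrow> f (of_real t) = g (of_real t)"
    using ev unfolding eventually_at by blast
  define T where "T = {z\<in>S. f z - g z = 0}"
  have "of_real c islimpt T"
    unfolding islimpt_approachable
  proof (intro allI impI)
    fix e :: real assume e: "e > 0"
    obtain r where r: "r > 0" "ball (of_real c) r \<subseteq> S" using S c open_contains_ball by blast
    define t where "t = c + min (min (d/2) (e/2)) (r/2)"
    have t: "t \<noteq> c" "dist t c < d" "dist t c < e" "dist t c < r" using d(1) e r by (auto simp: t_def dist_real_def min_def)
    then have "of_real t \<in> S" using r by (auto simp: dist_commute dist_of_real subset_eq)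
    then show "\<exists>x'\<in>T. x' \<noteq> of_real c \<and> dist x' (of_real c) < e"
      using t d(2)[OF t(1,2)] by (intro bexI[of _ "of_real t"]) (auto simp: T_def dist_of_real)
  qed
  then have "(\<lambda>z. f z - g z) w = 0"
    by (intro analytic_continuation[of "\<lambda>z. f z - g z" S T "of_real c" w] holomorphic_intros f g S c w) (auto simp: T_def)
  then show ?thesis by simp
qed

lemma has_vector_derivative_vec:
  fixes u :: "real \<Rightarrow> 'a::real_normed_vector^'n"
  assumes "\<And>i. ((\<lambda>t. u t $ i) has_vector_derivative d $ i) (at t)"
  shows "(u has_vector_derivative d) (at t)"
proof -
  have bl: "bounded_linear (axis i :: 'a \<Rightarrow> 'a^'n)" for i :: 'n
    by (rule bounded_linear_intro[of _ 1]) (auto simp: vec_eq_iff axis_def norm_axis[unfolded axis_def])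
  have "((\<lambda>t. \<Sum>i\<in>UNIV. axis i (u t $ i)) has_vector_derivative (\<Sum>i\<in>UNIV. axis i (d $ i))) (at t)"
    by (intro has_vector_derivative_sum bounded_linear.has_vector_derivative[OF bl] assms)
  moreover have "(\<Sum>i\<in>UNIV. axis i (x $ i)) = x" for x :: "'a^'n"
    by (simp add: vec_eq_iff axis_def)
  ultimately show ?thesis by simp
qed

lemma has_vector_derivative_nth:
  "(u has_vector_derivative d) (at t) \<Longrightarrow> ((\<lambda>t. u t $ i) has_vector_derivative d $ i) (at t)"
  by (rule bounded_linear.has_vector_derivative[OF bounded_linear_vec_nth])

lemma has_vector_derivative_along_line:
  fixes Y :: "complex \<Rightarrow> complex^'n"
  assumes "\<And>i. ((\<lambda>z. Y z $ i) has_field_derivative d $ i) (at (z + of_real s * w))"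
  shows "((\<lambda>s. Y (z + of_real s * w)) has_vector_derivative (w *s d)) (at s)"
proof (rule has_vector_derivative_vec)
  fix i
  have "((\<lambda>s. z + of_real s * w) has_vector_derivative w) (at s)"
    by (auto intro!: derivative_eq_intros simp: has_vector_derivative_def scaleR_conv_of_real)
  from field_vector_diff_chain_at[OF this assms[of i]]
  show "((\<lambda>s. Y (z + of_real s * w) $ i) has_vector_derivative (w *s d) $ i) (at s)"
    by (simp add: o_def)
qed

lemma norm_matrix_vector_bound:
  fixes J :: "complex^'n^'m"
  assumes "\<And>i j. norm (J $ i $ j) \<le> b"
  shows "norm (J *v v) \<le> real CARD('m) * (real CARD('n) * b) * norm v"
proof -
  have "norm ((J *v v) $ i) \<le> real CARD('n) * b * norm v" for i
  proof -
    have "norm ((J *v v) $ i) \<le> (\<Sum>j\<in>UNIV. norm (J $ i $ j * v $ j))"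
      by (simp add: matrix_vector_mult_def norm_sum)
    also have "\<dots> \<le> (\<Sum>j\<in>(UNIV::'n set). b * norm v)"
      unfolding norm_mult using assms order_trans[OF norm_ge_zero assms]
      by (intro sum_mono mult_mono Finite_Cartesian_Product.norm_nth_le) auto
    finally show ?thesis by simp
  qed
  from norm_vec_bound[OF this] show ?thesis by (simp add: mult.assoc)
qed

text \<open>Pluecker coordinates of the plane spanned by \<open>x\<close> and \<open>y\<close>: a
  change of basis of the plane multiplies all of them by its determinant.\<close>

definition pl :: "complex^'n \<Rightarrow> complex^'n \<Rightarrow> 'n \<Rightarrow> 'n \<Rightarrow> complex" where
  "pl x y i j = x $ i * y $ j - x $ j * y $ i"

lemma isCont_eventually_dist: "isCont f s \<Longrightarrow> d > 0 \<Longrightarrow> \<forall>\<^sub>F t in nhds s. dist (f t) (f s) < d"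
  unfolding isCont_def tendsto_at_iff_tendsto_nhds by (rule tendstoD)

text \<open>One treatment for both ends: the sign of \<open>lam\<close> is left open, and agreement
  of \<open>h\<close> with the orbit is demanded near one real time \<open>c\<close> instead of at
  infinity. Time is the coordinate on the universal covering of the punctured disc, a half-plane
  \<open>H\<close> with covering map \<open>e\<close>.\<close>

locale end_chart =
  fixes V :: "real^4 \<Rightarrow> real^4" and U F xh and lam \<rho> :: real and h :: "complex \<Rightarrow> complex^4" and c :: real
  assumes cx: "complexification V U F" and sol: "solves_on V xh UNIV"
    and lam: "lam \<noteq> 0" and \<rho>: "\<rho> > 0" and h: "holo_curve h (ball 0 \<rho>)" and hU: "h ` ball 0 \<rho> \<subseteq> U"
    and c: "exp (lam * c) < \<rho>"
    and ev: "\<forall>\<^sub>F t in at c. complex_vec (xh t) = h (exp (of_real lam * of_real t))"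
begin

definition e :: "complex \<Rightarrow> complex" where "e t = exp (of_real lam * t)"

definition H :: "complex set" where "H = {t. norm (e t) < \<rho>}"

text \<open>Translation by \<open>per\<close> is the deck transformation of the covering
  \<open>e\<close>; passing from \<open>Y t\<close> to \<open>Y (t + per)\<close> is continuation
  once around the centre.\<close>

definition per :: complex where "per = 2 * of_real pi * \<i> / of_real lam"

definition A :: "complex \<Rightarrow> complex^4^4" where "A t = jacobian F (at (h (e t)))"

lemma F: "cdiff_on F U" using cx by (auto simp: complexification_def cdiff_on_def)

lemma FV: "F (complex_vec x) = complex_vec (V x)" and xU: "complex_vec x \<in> U"
  using cx by (auto simp: complexification_def)

lemma norm_e: "norm (e t) = exp (lam * Re t)" by (simp add: e_def)

lemma H_half_plane: "H = {t. lam * Re t < ln \<rho>}"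
proof -
  have "exp x < \<rho> \<longleftrightarrow> x < ln \<rho>" for x using \<rho> exp_less_cancel_iff[of x "ln \<rho>"] by simp
  then show ?thesis by (simp add: H_def norm_e)
qed

lemma open_H: "open H" unfolding H_half_plane
  by (intro open_Collect_less continuous_intros)

lemma convex_H: "convex H"
proof -
  have "H = {t. inner (of_real lam) t < ln \<rho>}" unfolding H_half_plane by (simp add: inner_complex_def)
  then show ?thesis by (simp add: convex_halfspace_lt)
qed

lemma connected_H: "connected H" using convex_H by (rule convex_connected)

lemma H_real_interval: "open {t::real. of_real t \<in> H}" "connected {t::real. of_real t \<in> H}"
proof -
  have "{t::real. of_real t \<in> H} = {t. lam * t < ln \<rho>}" unfolding H_half_plane by simp
  moreover have "open {t::real. lam * t < ln \<rho>}" by (intro open_Collect_less continuous_intros)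
  moreover have "convex {t::real. lam * t < ln \<rho>}"
    using convex_halfspace_lt[of lam "ln \<rho>"] by (simp add: inner_real_def)
  ultimately show "open {t::real. of_real t \<in> H}" "connected {t::real. of_real t \<in> H}"
    using convex_connected by auto
qed

lemma cH: "of_real c \<in> H" using c by (simp add: H_def norm_e)

lemma e_per: "e (t + per) = e t"
  using lam exp_two_pi_i by (simp add: e_def per_def distrib_left exp_add)

lemma H_per: "t + per \<in> H \<longleftrightarrow> t \<in> H" by (simp add: H_def e_per)

lemma e_holo: "e holomorphic_on S" unfolding e_def[abs_def] by (intro holomorphic_intros)

lemma e_img: "t \<in> H \<Longrightarrow> e t \<in> ball 0 \<rho>" by (simp add: H_def)

lemma he_holo: "holo_curve (\<lambda>t. h (e t)) H"
  using h holomorphic_on_compose_gen[OF e_holo[of H], of _ "ball 0 \<rho>"] e_img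
  unfolding holo_curve_def o_def by blast

lemma he_U: "t \<in> H \<Longrightarrow> h (e t) \<in> U" using e_img hU by blast

lemma A_holo: "(\<lambda>t. A t $ i $ j) holomorphic_on H"
  unfolding A_def by (rule jacobian_entry_curve_holomorphic[OF F he_holo open_H]) (use he_U in auto)

lemma A_per: "A (t + per) = A t" by (simp add: A_def e_per)

lemma xh_deriv: "(xh has_vector_derivative V (xh t)) (at t)" using sol by (simp add: solves_on_def)

lemma xh_c_deriv: "((\<lambda>t. complex_vec (xh t)) has_vector_derivative F (complex_vec (xh t))) (at t)"
  using bounded_linear.has_vector_derivative[OF bounded_linear_complex_vec xh_deriv] by (simp add: FV)

text \<open>On real times near \<open>c\<close> this is the equation of the orbit; both sides are
  holomorphic on \<open>H\<close>, so the identity theorem extends it.\<close>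

lemma he_deriv:
  assumes "t \<in> H" shows "((\<lambda>t. h (e t) $ i) has_field_derivative F (h (e t)) $ i) (at t)"
proof -
  define g where "g t = h (e t) $ i" for t
  have g: "g holomorphic_on H" using he_holo unfolding holo_curve_def g_def by blast
  have Fg: "(\<lambda>t. F (h (e t)) $ i) holomorphic_on H"
    using cdiff_on_curve_holomorphic[OF F he_holo open_H] he_U unfolding holo_curve_def by blast
  have "\<forall>\<^sub>F s in at c. complex_of_real s \<in> H \<and> complex_vec (xh s) = h (e (of_real s))"
    using ev eventually_at_in_open'[OF H_real_interval(1), of c] cH
    by (auto simp: e_def elim: eventually_elim2)
  then obtain S where S: "open S" "c \<in> S" "\<And>s. s \<in> S \<Longrightarrow> s \<noteq> c \<Longrightarrow> complex_of_real s \<in> H \<and> complex_vec (xh s) = h (e (of_real s))"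
    unfolding eventually_at_topological by blast
  have eq: "deriv g (of_real s) = F (h (e (of_real s))) $ i" if s: "s \<in> S" "s \<noteq> c" for s
  proof -
    have "(g has_field_derivative deriv g (of_real s)) (at (of_real s))"
      using holomorphic_derivI[OF g open_H] S(3)[OF s] by blast
    then have 1: "((\<lambda>s. g (of_real s)) has_vector_derivative deriv g (of_real s)) (at s)"
      by (rule has_vector_derivative_real_field)
    have "((\<lambda>t. complex_vec (xh t) $ i) has_vector_derivative F (complex_vec (xh s)) $ i) (at s)"
      by (rule has_vector_derivative_nth[OF xh_c_deriv])
    then have "((\<lambda>s. g (of_real s)) has_vector_derivative F (complex_vec (xh s)) $ i) (at s)"
      by (rule has_vector_derivative_transform_within_open[of _ _ _ "S - {c}"])
        (use S s in \<open>auto simp: g_def\<close>)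
    then show ?thesis using 1 S(3)[OF s] vector_derivative_unique_at by metis
  qed
  have "\<forall>\<^sub>F s in at c. deriv g (of_real s) = F (h (e (of_real s))) $ i"
    unfolding eventually_at_topological using S(1,2) eq by blast
  from identity_from_reals[OF open_H connected_H holomorphic_deriv[OF g open_H] Fg cH this assms]
  have "deriv g t = F (h (e t)) $ i" .
  with holomorphic_derivI[OF g open_H assms] show ?thesis by (simp add: g_def[abs_def])
qed

text \<open>The orbit is a priori only a differentiable function, which puts the identity theorem
  out of reach. Both sides solve the same autonomous equation, and uniqueness carries their
  agreement from \<open>c\<close> along all real times in \<open>H\<close>.\<close>

lemma xh_eq: assumes "of_real t \<in> H" shows "complex_vec (xh t) = h (e (of_real t))"
proof -
  define I where "I = {t::real. of_real t \<in> H}"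
  define u where "u t = h (e (of_real t)) - complex_vec (xh t)" for t :: real
  define u' where "u' t = F (h (e (of_real t))) - F (complex_vec (xh t))" for t :: real
  have hd: "((\<lambda>t. h (e (of_real t))) has_vector_derivative F (h (e (of_real t)))) (at t)" if "t \<in> I" for t
    by (rule has_vector_derivative_vec, rule has_vector_derivative_real_field)
      (use he_deriv that in \<open>auto simp: I_def\<close>)
  have ud: "(u has_vector_derivative u' t) (at t)" if "t \<in> I" for t
    unfolding u_def u'_def by (intro has_vector_derivative_diff hd that xh_c_deriv)
  have ev': "\<forall>\<^sub>F s in at c. u s = 0" using ev by eventually_elim (simp add: u_def e_def)
  have contu: "isCont u t" if "t \<in> I" for t using ud[OF that] by (rule has_vector_derivative_continuous)
  have "u \<midarrow>c\<rightarrow> 0" using ev' by (rule tendsto_eventually)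
  then have uc: "u c = 0" using contu[of c] cH LIM_unique unfolding isCont_def I_def by blast
  have contF: "isCont (\<lambda>s. F (g s)) s" if "isCont g s" "g s \<in> U" for g and s :: real
    using isCont_o2[OF that(1)] cdiff_on_continuous[OF F] F that(2)
    by (auto simp: cdiff_on_def continuous_on_eq_continuous_at)
  have "u t = 0"
  proof (rule ode_unique_zero[of I c u u'])
    show "open I" "connected I" unfolding I_def by (rule H_real_interval)+
    show "c \<in> I" "t \<in> I" using cH assms by (auto simp: I_def)
    show "\<exists>K. \<forall>\<^sub>F t in nhds s. norm (u' t) \<le> K * norm (u t)" if s: "s \<in> I" for s
    \<comment> \<open>Near a time with \<open>u s \<noteq> 0\<close> continuity alone bounds
      \<open>u'\<close> by a multiple of \<open>u\<close>; where the two curves meet, the local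
      Lipschitz estimate for \<open>F\<close> does.\<close>
    proof (cases "u s = 0")
      case False
      have contu': "isCont u' s" unfolding u'_def
        using has_vector_derivative_continuous[OF hd[OF s]] has_vector_derivative_continuous[OF xh_c_deriv[of s]] he_U s xU
        by (intro continuous_diff contF) (auto simp: I_def)
      have "\<forall>\<^sub>F t in nhds s. dist (u' t) (u' s) < 1" by (rule isCont_eventually_dist[OF contu']) simp
      moreover have "\<forall>\<^sub>F t in nhds s. dist (u t) (u s) < norm (u s) / 2"
        by (rule isCont_eventually_dist[OF contu[OF s]]) (use False in simp)
      ultimately have "\<forall>\<^sub>F t in nhds s. norm (u' t) \<le> ((norm (u' s) + 1) / (norm (u s) / 2)) * norm (u t)"
      proof eventually_elim
        case (elim t)
        have 1: "norm (u' t) \<le> norm (u' s) + 1" using elim(1) norm_triangle_sub[of "u' t" "u' s"] by (simp add: dist_norm)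
        have 2: "norm (u s) / 2 \<le> norm (u t)" using elim(2) norm_triangle_sub[of "u s" "u t"] by (simp add: dist_norm norm_minus_commute)
        have "norm (u' s) + 1 = ((norm (u' s) + 1) / (norm (u s) / 2)) * (norm (u s) / 2)" using False by simp
        also have "\<dots> \<le> ((norm (u' s) + 1) / (norm (u s) / 2)) * norm (u t)"
          using 2 by (intro mult_left_mono) auto
        finally show ?case using 1 by simp
      qed
      then show ?thesis by blast
    next
      case True
      from cdiff_on_quadratic[OF F xU[of "xh s"]] obtain r C where r: "r > 0" "C > 0"
        and q: "\<And>x v. x \<in> ball (complex_vec (xh s)) r \<Longrightarrow> norm v < r \<Longrightarrow>
           norm (F (x + v) - F x - jacobian F (at x) *v v) \<le> C * (norm v)\<^sup>2"
          "\<And>x v. x \<in> ball (complex_vec (xh s)) r \<Longrightarrow> norm v < r \<Longrightarrow> norm (jacobian F (at x) *v v) \<le> C * norm v" by metis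
      have "\<forall>\<^sub>F t in nhds s. dist (u t) (u s) < r"
        by (rule isCont_eventually_dist[OF contu[OF s] r(1)])
      moreover have "\<forall>\<^sub>F t in nhds s. dist (complex_vec (xh t)) (complex_vec (xh s)) < r"
        by (rule isCont_eventually_dist[OF has_vector_derivative_continuous[OF xh_c_deriv[of s]] r(1)])
      ultimately have "\<forall>\<^sub>F t in nhds s. norm (u' t) \<le> (C * r + C) * norm (u t)"
      proof eventually_elim
        case (elim t)
        have nu: "norm (u t) < r" using elim(1) True by (simp add: dist_norm)
        have xb: "complex_vec (xh t) \<in> ball (complex_vec (xh s)) r" using elim(2) by (simp add: dist_commute)
        have "u' t = (F (complex_vec (xh t) + u t) - F (complex_vec (xh t)) - jacobian F (at (complex_vec (xh t))) *v u t) + jacobian F (at (complex_vec (xh t))) *v u t"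
          by (simp add: u'_def u_def)
        then have "norm (u' t) \<le> C * (norm (u t))\<^sup>2 + C * norm (u t)"
          using q[OF xb nu] by (metis norm_triangle_mono)
        also have "C * (norm (u t))\<^sup>2 \<le> C * (r * norm (u t))"
          unfolding power2_eq_square using nu r by (intro mult_left_mono mult_right_mono) auto
        finally show ?case by (simp add: algebra_simps)
      qed
      then show ?thesis by blast
    qed
  qed (use uc ud in auto)
  then show ?thesis by (simp add: u_def)
qed

lemma A_real: "of_real t \<in> H \<Longrightarrow> A (of_real t) $ i $ j = of_real (jacobian V (at (xh t)) $ i $ j)"
  unfolding A_def xh_eq[symmetric] by (rule complexification_jacobian(2)[OF cx])

text \<open>The entries are holomorphic in z up to the centre of the disc, hence bounded on smaller
  closed discs. In terms of time this is a bound up to infinity; it reflects that the equation in z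
  has at most a simple pole.\<close>

lemma A_bounded:
  assumes "\<rho>' < \<rho>"
  shows "\<exists>K\<ge>0. \<forall>t v. norm (e t) \<le> \<rho>' \<longrightarrow> norm (A t *v v) \<le> K * norm v"
proof -
  have "\<exists>b. \<forall>z\<in>cball 0 \<rho>'. norm (jacobian F (at (h z)) $ i $ j) \<le> b" for i j
  proof -
    have "(\<lambda>z. jacobian F (at (h z)) $ i $ j) holomorphic_on ball 0 \<rho>"
      by (rule jacobian_entry_curve_holomorphic[OF F h open_ball hU])
    then have "continuous_on (cball 0 \<rho>') (\<lambda>z. jacobian F (at (h z)) $ i $ j)"
      by (rule holomorphic_on_imp_continuous_on[OF holomorphic_on_subset]) (use assms in auto)
    then have "bounded ((\<lambda>z. jacobian F (at (h z)) $ i $ j) ` cball 0 \<rho>')"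
      by (intro compact_imp_bounded compact_continuous_image) auto
    then show ?thesis unfolding bounded_iff by blast
  qed
  then obtain b where b: "\<And>i j z. z \<in> cball 0 \<rho>' \<Longrightarrow> norm (jacobian F (at (h z)) $ i $ j) \<le> b i j" by metis
  define B where "B = (\<Sum>i\<in>UNIV. \<Sum>j\<in>UNIV. \<bar>b i j\<bar>)"
  have bB: "b i j \<le> B" for i j
  proof -
    have "b i j \<le> \<bar>b i j\<bar>" by simp
    also have "\<dots> \<le> (\<Sum>j\<in>UNIV. \<bar>b i j\<bar>)" by (rule member_le_sum) auto
    also have "\<dots> \<le> B" unfolding B_def by (rule member_le_sum[of i UNIV "\<lambda>i. \<Sum>j\<in>UNIV. \<bar>b i j\<bar>"]) (auto intro: sum_nonneg)
    finally show ?thesis .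
  qed
  have B0: "B \<ge> 0" unfolding B_def by (intro sum_nonneg) auto
  show ?thesis
  proof (intro exI[of _ "real CARD(4) * (real CARD(4) * B)"] conjI allI impI)
    show "0 \<le> real CARD(4) * (real CARD(4) * B)" using B0 by simp
    fix t v assume "norm (e t) \<le> \<rho>'"
    then have "norm (A t $ i $ j) \<le> B" for i j
      unfolding A_def using b[of "e t" i j] bB[of i j] by (simp add: dist_norm)
    then show "norm (A t *v v) \<le> real CARD(4) * (real CARD(4) * B) * norm v"
      by (rule norm_matrix_vector_bound)
  qed
qed

section \<open>Solutions over the half-plane and their growth\<close>

definition VEsol :: "(complex \<Rightarrow> complex^4) \<Rightarrow> bool" where
  "VEsol Y \<longleftrightarrow> (\<forall>t\<in>H. \<forall>i. ((\<lambda>t. Y t $ i) has_field_derivative (A t *v Y t) $ i) (at t))"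

lemma VEsol_exists:
  assumes "t1 \<in> H" shows "\<exists>Y. VEsol Y \<and> Y t1 = y0"
proof -
  have "H \<noteq> UNIV"
  proof -
    have "of_real ((ln \<rho> + 1) / lam) \<notin> H" using lam by (simp add: H_half_plane)
    then show ?thesis by blast
  qed
  from lin_ode_simply_connected[OF open_H convex_imp_simply_connected[OF convex_H] this assms, of "\<lambda>i j t. A t $ i $ j" y0]
  show ?thesis using A_holo unfolding VEsol_def matrix_vector_mult_def by auto
qed

lemma VEsol_holo: "VEsol Y \<Longrightarrow> (\<lambda>t. Y t $ i) holomorphic_on H"
  unfolding VEsol_def holomorphic_on_open[OF open_H] by blast

lemma VEsol_shift: assumes "VEsol Y" shows "VEsol (\<lambda>t. Y (t + per))"
  unfolding VEsol_def
proof (intro ballI allI)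
  fix t i assume "t \<in> H"
  then have "((\<lambda>t. Y t $ i) has_field_derivative (A t *v Y (t + per)) $ i) (at (t + per))"
    using assms unfolding VEsol_def by (metis H_per A_per)
  then show "((\<lambda>t. Y (t + per) $ i) has_field_derivative (A t *v Y (t + per)) $ i) (at t)"
    by (simp add: DERIV_shift)
qed

lemma VEsol_combination:
  assumes "VEsol Y0" "VEsol Y" "VEsol Z" shows "VEsol (\<lambda>t. Y0 t - a *s Y t - b *s Z t)"
  using assms unfolding VEsol_def
  by (auto intro!: derivative_eq_intros simp: matrix_vector_mult_diff_distrib vector_scalar_commute)

lemma VEsol_real:
  assumes "VEsol Y" "of_real t \<in> H"
  shows "((\<lambda>t. Y (of_real t)) has_vector_derivative A (of_real t) *v Y (of_real t)) (at t)"
  by (rule has_vector_derivative_vec, rule has_vector_derivative_real_field)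
    (use assms in \<open>auto simp: VEsol_def\<close>)

lemma real_solution_unique:
  assumes I: "open I" "connected I" "I \<subseteq> {t. of_real t \<in> H}"
    and u: "\<And>t. t \<in> I \<Longrightarrow> (u has_vector_derivative A (of_real t) *v u t) (at t)"
    and z: "t1 \<in> I" "u t1 = 0" and t: "t \<in> I"
  shows "u t = 0"
proof (rule ode_unique_zero[OF I(1,2) z u])
  fix s assume s: "s \<in> I"
  then have "of_real s \<in> H" using I by blast
  then obtain \<rho>' where \<rho>': "norm (e (of_real s)) < \<rho>'" "\<rho>' < \<rho>" unfolding H_def using dense by blast
  from A_bounded[OF \<rho>'(2)] obtain K where K: "\<And>t v. norm (e t) \<le> \<rho>' \<Longrightarrow> norm (A t *v v) \<le> K * norm v" by blast
  have "open {t::real. norm (e (of_real t)) < \<rho>'}"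
    unfolding e_def by (intro open_Collect_less continuous_intros)
  then have "\<forall>\<^sub>F t in nhds s. t \<in> {t::real. norm (e (of_real t)) < \<rho>'}"
    using \<rho>' by (intro eventually_nhds_in_open) auto
  then have "\<forall>\<^sub>F t in nhds s. norm (A (of_real t) *v u t) \<le> K * norm (u t)"
    by eventually_elim (use K in auto)
  then show "\<exists>K. \<forall>\<^sub>F t in nhds s. norm (A (of_real t) *v u t) \<le> K * norm (u t)" by blast
qed (use t in auto)

lemma VEsol_zero:
  assumes Y: "VEsol Y" and z: "of_real t1 \<in> H" "Y (of_real t1) = 0" and t: "t \<in> H"
  shows "Y t = 0"
proof -
  have r: "Y (of_real s) = 0" if "of_real s \<in> H" for s
    by (rule real_solution_unique[OF H_real_interval order_refl, of "\<lambda>s. Y (of_real s)" t1])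
      (use VEsol_real[OF Y] z that in auto)
  have "\<forall>\<^sub>F s in at c. Y (of_real s) $ i = 0" for i
    using eventually_at_in_open'[OF H_real_interval(1), of c] cH by (auto simp: r elim: eventually_mono)
  then have "Y t $ i = 0" for i
    using identity_from_reals[OF open_H connected_H VEsol_holo[OF Y] holomorphic_on_const cH _ t, of i 0] by simp
  then show ?thesis by (simp add: vec_eq_iff)
qed

text \<open>The period strip contains one preimage of every point of the punctured disc; solutions grow at
  most exponentially in \<open>Re t\<close> there, that is, polynomially in \<open>1 / z\<close>.\<close>

definition moderate :: "(complex \<Rightarrow> complex) \<Rightarrow> real \<Rightarrow> bool" where
  "moderate g \<rho>' \<longleftrightarrow> (\<exists>C\<ge>0. \<exists>N\<ge>0. \<forall>t. norm (e t) \<le> \<rho>' \<longrightarrow> \<bar>Im t\<bar> \<le> pi / \<bar>lam\<bar> \<longrightarrow> norm (g t) \<le> C * exp (N * \<bar>Re t\<bar>))"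

lemma moderate_mult: assumes "moderate f \<rho>'" "moderate g \<rho>'" shows "moderate (\<lambda>t. f t * g t) \<rho>'"
proof -
  obtain C N where f: "C \<ge> 0" "N \<ge> 0" "\<And>t. norm (e t) \<le> \<rho>' \<Longrightarrow> \<bar>Im t\<bar> \<le> pi / \<bar>lam\<bar> \<Longrightarrow> norm (f t) \<le> C * exp (N * \<bar>Re t\<bar>)"
    using assms(1) unfolding moderate_def by blast
  obtain C' N' where g: "C' \<ge> 0" "N' \<ge> 0" "\<And>t. norm (e t) \<le> \<rho>' \<Longrightarrow> \<bar>Im t\<bar> \<le> pi / \<bar>lam\<bar> \<Longrightarrow> norm (g t) \<le> C' * exp (N' * \<bar>Re t\<bar>)"
    using assms(2) unfolding moderate_def by blast
  have "norm (f t * g t) \<le> (C * C') * exp ((N + N') * \<bar>Re t\<bar>)" if "norm (e t) \<le> \<rho>'" "\<bar>Im t\<bar> \<le> pi / \<bar>lam\<bar>" for t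
  proof -
    have "norm (f t * g t) \<le> (C * exp (N * \<bar>Re t\<bar>)) * (C' * exp (N' * \<bar>Re t\<bar>))"
      unfolding norm_mult using f g that by (intro mult_mono) auto
    then show ?thesis by (simp add: exp_add algebra_simps)
  qed
  then show ?thesis unfolding moderate_def using f g by (intro exI[of _ "C * C'"] conjI exI[of _ "N + N'"]) auto
qed

lemma moderate_diff: assumes "moderate f \<rho>'" "moderate g \<rho>'" shows "moderate (\<lambda>t. f t - g t) \<rho>'"
proof -
  obtain C N where f: "C \<ge> 0" "N \<ge> 0" "\<And>t. norm (e t) \<le> \<rho>' \<Longrightarrow> \<bar>Im t\<bar> \<le> pi / \<bar>lam\<bar> \<Longrightarrow> norm (f t) \<le> C * exp (N * \<bar>Re t\<bar>)"
    using assms(1) unfolding moderate_def by blast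
  obtain C' N' where g: "C' \<ge> 0" "N' \<ge> 0" "\<And>t. norm (e t) \<le> \<rho>' \<Longrightarrow> \<bar>Im t\<bar> \<le> pi / \<bar>lam\<bar> \<Longrightarrow> norm (g t) \<le> C' * exp (N' * \<bar>Re t\<bar>)"
    using assms(2) unfolding moderate_def by blast
  have "norm (f t - g t) \<le> (C + C') * exp ((N + N') * \<bar>Re t\<bar>)" if "norm (e t) \<le> \<rho>'" "\<bar>Im t\<bar> \<le> pi / \<bar>lam\<bar>" for t
  proof -
    have "norm (f t - g t) \<le> C * exp (N * \<bar>Re t\<bar>) + C' * exp (N' * \<bar>Re t\<bar>)"
      using f(3)[OF that] g(3)[OF that] norm_triangle_ineq4[of "f t" "g t"] by linarith
    also have "\<dots> \<le> C * exp ((N + N') * \<bar>Re t\<bar>) + C' * exp ((N + N') * \<bar>Re t\<bar>)"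
      using f g by (intro add_mono mult_left_mono) (auto simp: mult_right_mono)
    finally show ?thesis by (simp add: distrib_right)
  qed
  then show ?thesis unfolding moderate_def using f g by (intro exI[of _ "C + C'"] conjI exI[of _ "N + N'"]) auto
qed

lemma moderate_exp: "moderate (\<lambda>t. exp (s * t)) \<rho>'"
proof -
  have "norm (exp (s * t)) \<le> exp (norm s * (pi / \<bar>lam\<bar>)) * exp (norm s * \<bar>Re t\<bar>)" if "\<bar>Im t\<bar> \<le> pi / \<bar>lam\<bar>" for t
  proof -
    have "Re (s * t) \<le> norm s * norm t" using complex_Re_le_cmod[of "s * t"] by (simp add: norm_mult)
    also have "\<dots> \<le> norm s * (\<bar>Re t\<bar> + pi / \<bar>lam\<bar>)"
      using cmod_le[of t] that by (intro mult_left_mono) auto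
    finally show ?thesis by (simp add: exp_add[symmetric] algebra_simps)
  qed
  then show ?thesis unfolding moderate_def by (intro exI[of _ "exp (norm s * (pi / \<bar>lam\<bar>))"] conjI exI[of _ "norm s"]) auto
qed

text \<open>Gronwall's inequality along a horizontal segment, whose length is controlled by the real
  part of \<open>t\<close>, followed by a vertical one, which has length at most
  \<open>pi / \<bar>lam\<bar>\<close> in the strip.\<close>

lemma moderate_VEsol:
  assumes Y: "VEsol Y" and \<rho>': "0 < \<rho>'" "\<rho>' < \<rho>"
  shows "moderate (\<lambda>t. Y t $ i) \<rho>'"
proof -
  from A_bounded[OF \<rho>'(2)] obtain K where K: "K \<ge> 0" "\<And>t v. norm (e t) \<le> \<rho>' \<Longrightarrow> norm (A t *v v) \<le> K * norm v" by blast
  define c1 where "c1 = ln \<rho>' / lam"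
  have eR: "norm (e t) \<le> \<rho>' \<longleftrightarrow> lam * Re t \<le> ln \<rho>'" for t
    unfolding norm_e using \<rho>'(1) by (metis exp_le_cancel_iff exp_ln)
  have inH: "t \<in> H" if "norm (e t) \<le> \<rho>'" for t using that \<rho>' by (simp add: H_def)
  define L where "L = 2 * K + 1"
  define C where "C = norm (Y (of_real c1)) * exp (L * (\<bar>c1\<bar> + pi / \<bar>lam\<bar>))"
  have L: "L \<ge> 1" using K by (simp add: L_def)
  have "norm (Y t) \<le> C * exp (L * \<bar>Re t\<bar>)" if t: "norm (e t) \<le> \<rho>'" "\<bar>Im t\<bar> \<le> pi / \<bar>lam\<bar>" for t
  proof -
    define x y where "x = Re t" and "y = Im t"
    have seg: "lam * s \<le> ln \<rho>'" if "s \<in> {min c1 x..max c1 x}" for s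
    proof -
      have "lam * c1 \<le> ln \<rho>'" "lam * x \<le> ln \<rho>'" using lam t(1) eR by (auto simp: c1_def x_def)
      moreover have "lam * s \<le> max (lam * c1) (lam * x)"
      proof (cases "lam > 0")
        case True
        then have "lam * s \<le> lam * max c1 x" using that by (intro mult_left_mono) auto
        also have "\<dots> \<le> max (lam * c1) (lam * x)" by (auto simp: max_def)
        finally show ?thesis .
      next
        case False
        then have "lam * s \<le> lam * min c1 x" using that by (intro mult_left_mono_neg) auto
        also have "\<dots> \<le> max (lam * c1) (lam * x)" by (auto simp: min_def)
        finally show ?thesis .
      qed
      ultimately show ?thesis by simp
    qed
    have 1: "(norm (Y (of_real x)))\<^sup>2 + 0\<^sup>2 \<le> ((norm (Y (of_real c1)))\<^sup>2 + 0\<^sup>2) * exp ((2 * K + 1) * \<bar>x - c1\<bar>)"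
    proof (rule gronwall_norm[where a="min c1 x" and b="max c1 x" and u'="\<lambda>s. A (of_real s) *v Y (of_real s)"])
      fix s assume "s \<in> {min c1 x..max c1 x}"
      then have es: "norm (e (of_real s)) \<le> \<rho>'" using seg eR by simp
      show "((\<lambda>s. Y (of_real s)) has_vector_derivative A (of_real s) *v Y (of_real s)) (at s)"
        by (rule VEsol_real[OF Y inH[OF es]])
      show "norm (A (of_real s) *v Y (of_real s)) \<le> K * norm (Y (of_real s)) + 0" using K(2)[OF es] by simp
    qed (use K in auto)
    have 2: "(norm (Y (of_real x + of_real y * \<i>)))\<^sup>2 + 0\<^sup>2 \<le> ((norm (Y (of_real x + of_real 0 * \<i>)))\<^sup>2 + 0\<^sup>2) * exp ((2 * K + 1) * \<bar>y - 0\<bar>)"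
    proof (rule gronwall_norm[where a="min 0 y" and b="max 0 y" and u'="\<lambda>s. \<i> *s (A (of_real x + of_real s * \<i>) *v Y (of_real x + of_real s * \<i>))"])
      fix s assume "s \<in> {min 0 y..max 0 y}"
      have es: "norm (e (of_real x + of_real s * \<i>)) \<le> \<rho>'" using t(1) unfolding norm_e by (simp add: x_def)
      show "((\<lambda>s. Y (of_real x + of_real s * \<i>)) has_vector_derivative \<i> *s (A (of_real x + of_real s * \<i>) *v Y (of_real x + of_real s * \<i>))) (at s)"
        by (rule has_vector_derivative_along_line) (use Y inH[OF es] in \<open>auto simp: VEsol_def\<close>)
      show "norm (\<i> *s (A (of_real x + of_real s * \<i>) *v Y (of_real x + of_real s * \<i>))) \<le> K * norm (Y (of_real x + of_real s * \<i>)) + 0"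
        using K(2)[OF es] by (simp add: norm_vector_smult)
    qed (use K in auto)
    have tt: "of_real x + of_real y * \<i> = t" by (simp add: x_def y_def complex_eq_iff)
    have "(norm (Y t))\<^sup>2 \<le> (norm (Y (of_real c1)))\<^sup>2 * exp (L * \<bar>x - c1\<bar>) * exp (L * \<bar>y\<bar>)"
    proof -
      have a: "(norm (Y (of_real x)))\<^sup>2 \<le> (norm (Y (of_real c1)))\<^sup>2 * exp (L * \<bar>x - c1\<bar>)" using 1 by (simp add: L_def)
      have b: "(norm (Y t))\<^sup>2 \<le> (norm (Y (of_real x)))\<^sup>2 * exp (L * \<bar>y\<bar>)" using 2 unfolding tt by (simp add: L_def)
      show ?thesis by (rule order_trans[OF b mult_right_mono[OF a]]) simp
    qed
    also have "\<dots> = (norm (Y (of_real c1)))\<^sup>2 * exp (L * (\<bar>x - c1\<bar> + \<bar>y\<bar>))"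
      by (simp add: distrib_left exp_add mult.assoc)
    also have "\<dots> \<le> (norm (Y (of_real c1)))\<^sup>2 * exp (2 * (L * (\<bar>x\<bar> + \<bar>c1\<bar> + pi / \<bar>lam\<bar>)))"
    proof (rule mult_left_mono)
      have "\<bar>x - c1\<bar> + \<bar>y\<bar> \<le> 2 * (\<bar>x\<bar> + \<bar>c1\<bar> + pi / \<bar>lam\<bar>)" using t(2) by (simp add: y_def)
      then have "L * (\<bar>x - c1\<bar> + \<bar>y\<bar>) \<le> L * (2 * (\<bar>x\<bar> + \<bar>c1\<bar> + pi / \<bar>lam\<bar>))" using L by (intro mult_left_mono) auto
      then show "exp (L * (\<bar>x - c1\<bar> + \<bar>y\<bar>)) \<le> exp (2 * (L * (\<bar>x\<bar> + \<bar>c1\<bar> + pi / \<bar>lam\<bar>)))"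
        unfolding mult.left_commute[of L 2] by (simp only: exp_le_cancel_iff)
    qed simp
    also have "\<dots> = (C * exp (L * \<bar>Re t\<bar>))\<^sup>2"
      by (simp add: C_def power_mult_distrib exp_double[symmetric] x_def) (simp add: algebra_simps exp_add)
    finally show ?thesis by (rule power2_le_imp_le) (simp add: C_def)
  qed
  then have "norm (Y t $ i) \<le> C * exp (L * \<bar>Re t\<bar>)" if "norm (e t) \<le> \<rho>'" "\<bar>Im t\<bar> \<le> pi / \<bar>lam\<bar>" for t
    using that Finite_Cartesian_Product.norm_nth_le[of "Y t" i] order_trans by blast
  then show ?thesis unfolding moderate_def using L by (intro exI[of _ C] conjI exI[of _ L]) (auto simp: C_def)
qed

section \<open>Descent to the punctured disc\<close>

lemma periodic_int:
  assumes q: "\<And>t. t \<in> H \<Longrightarrow> q (t + per) = q t" and t: "t \<in> H"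
  shows "t + of_int n * per \<in> H \<and> q (t + of_int n * per) = q t"
proof (induction n rule: int_induct[where k=0])
  case base
  show ?case using t by simp
next
  case (step1 n)
  then show ?case using q[of "t + of_int n * per"] H_per[of "t + of_int n * per"]
    by (simp add: algebra_simps)
next
  case (step2 n)
  have "t + of_int (n - 1) * per \<in> H" using step2 H_per[of "t + of_int (n - 1) * per"]
    by (simp add: algebra_simps)
  then show ?case using q[of "t + of_int (n - 1) * per"] step2 by (simp add: algebra_simps)
qed

lemma periodic_cong:
  assumes q: "\<And>t. t \<in> H \<Longrightarrow> q (t + per) = q t" and t: "t \<in> H" and eq: "e t = e t'"
  shows "q t = q t'"
proof -
  from eq[symmetric, unfolded e_def exp_eq] obtain n :: int
    where n: "of_real lam * t' = of_real lam * t + (of_int (2 * n) * pi) * \<i>" by (elim exE)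
  have "of_real lam * (t + of_int n * per) = of_real lam * t'"
    using lam unfolding n by (simp add: per_def distrib_left)
  then have "t' = t + of_int n * per" using lam by simp
  then show ?thesis using periodic_int[of q, OF q t, of n] by simp
qed

lemma e_Ln: "z \<noteq> 0 \<Longrightarrow> e (Ln z / of_real lam) = z" using lam by (simp add: e_def)

text \<open>A periodic function is a function of \<open>e t\<close>. Moderate growth bounds
  \<open>z ^ n * Q z\<close> near 0 for a suitable \<open>n\<close>, so by Riemann's theorem on
  removable singularities \<open>Q\<close> has at most a pole at the centre.\<close>

lemma lift_periodic:
  assumes q: "q holomorphic_on H" and qp: "\<And>t. t \<in> H \<Longrightarrow> q (t + per) = q t"
    and mo: "moderate q \<rho>'" and \<rho>': "0 < \<rho>'" "\<rho>' < \<rho>"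
  shows "\<exists>Q. Q meromorphic_on ball 0 \<rho> \<and> (\<forall>t\<in>H. Q (e t) = q t)"
proof -
  define Q where "Q z = q (Ln z / of_real lam)" for z
  have LnH: "Ln z / of_real lam \<in> H" if "z \<in> ball 0 \<rho>" "z \<noteq> 0" for z
    using that by (simp add: H_def e_Ln)
  have Qe: "Q (e t) = q t" if "t \<in> H" for t
    unfolding Q_def by (rule periodic_cong[of q, OF qp that, symmetric]) (simp add: e_Ln, simp add: e_def)
  have holQ: "Q holomorphic_on ball 0 \<rho> - {0}"
  proof -
    have "\<exists>d>0. Q holomorphic_on ball z0 d" if z0: "z0 \<in> ball 0 \<rho> - {0}" for z0
    proof -
      define d where "d = min (norm z0) (\<rho> - norm z0)"
      have d: "d > 0" using z0 by (auto simp: d_def)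
      define t0 where "t0 = Ln z0 / of_real lam"
      \<comment> \<open>A local inverse of \<open>e\<close> through \<open>t0\<close>. Unlike the
        principal logarithm it is holomorphic near \<open>z0\<close> even on the cut, and by
        periodicity it yields the same \<open>Q\<close>.\<close>
      define \<phi> where "\<phi> z = t0 + Ln (z / z0) / of_real lam" for z
      have zz: "z / z0 \<notin> \<real>\<^sub>\<le>\<^sub>0" "z \<noteq> 0" "z \<in> ball 0 \<rho>" if "z \<in> ball z0 d" for z
      proof -
        have n: "norm (z - z0) < norm z0" "norm (z - z0) < \<rho> - norm z0" using that by (auto simp: d_def dist_norm norm_minus_commute)
        have "norm (z / z0 - 1) < 1" using n z0 by (simp add: divide_simps norm_divide diff_divide_distrib[symmetric] flip: norm_divide) (simp add: norm_divide divide_simps)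
        then have "Re (z / z0) > 0" using abs_Re_le_cmod[of "z / z0 - 1"] by auto
        then show "z / z0 \<notin> \<real>\<^sub>\<le>\<^sub>0" using complex_nonpos_Reals_iff by auto
        then show "z \<noteq> 0" by auto
        show "z \<in> ball 0 \<rho>" using n norm_triangle_sub[of z z0] by simp
      qed
      have e\<phi>: "e (\<phi> z) = z" if "z \<in> ball z0 d" for z
        using zz[OF that] z0 lam by (simp add: e_def \<phi>_def t0_def distrib_left exp_add)
      have \<phi>H: "\<phi> z \<in> H" if "z \<in> ball z0 d" for z using e\<phi>[OF that] zz(3)[OF that] by (simp add: H_def)
      have "\<phi> holomorphic_on ball z0 d" unfolding \<phi>_def
        using zz z0 lam by (intro holomorphic_intros) auto
      then have "(q \<circ> \<phi>) holomorphic_on ball z0 d"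
        by (rule holomorphic_on_compose_gen[OF _ q]) (use \<phi>H in auto)
      moreover have "(q \<circ> \<phi>) z = Q z" if "z \<in> ball z0 d" for z
        using Qe[OF \<phi>H[OF that]] e\<phi>[OF that] by simp
      ultimately have "Q holomorphic_on ball z0 d" by (rule holomorphic_transform)
      then show ?thesis using d by blast
    qed
    then have "Q analytic_on ball 0 \<rho> - {0}" unfolding analytic_on_def by blast
    then show ?thesis by (rule analytic_imp_holomorphic)
  qed
  obtain C N where CN: "C \<ge> 0" "N \<ge> 0" "\<And>t. norm (e t) \<le> \<rho>' \<Longrightarrow> \<bar>Im t\<bar> \<le> pi / \<bar>lam\<bar> \<Longrightarrow> norm (q t) \<le> C * exp (N * \<bar>Re t\<bar>)"
    using mo unfolding moderate_def by blast
  \<comment> \<open>At a preimage of z, where \<open>\<bar>Re t\<bar>\<close> equals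
    \<open>- ln (norm z) / \<bar>lam\<bar>\<close>, the exponential growth bound becomes a power of
    \<open>1 / norm z\<close> with exponent \<open>N / \<bar>lam\<bar>\<close>.\<close>
  obtain n :: nat where n: "real n \<ge> N / \<bar>lam\<bar>" using real_arch_simple by blast
  have bd: "norm (z ^ n * Q z) \<le> C" if z: "z \<noteq> 0" "norm z \<le> \<rho>'" "norm z \<le> 1" for z
  proof -
    define t where "t = Ln z / of_real lam"
    have et: "e t = z" unfolding t_def by (rule e_Ln[OF z(1)])
    have lz: "ln (norm z) \<le> 0" using z by simp
    have Im: "\<bar>Im t\<bar> \<le> pi / \<bar>lam\<bar>"
    proof -
      have "\<bar>Im (Ln z)\<bar> \<le> pi" using Im_Ln_le_pi[OF z(1)] mpi_less_Im_Ln[OF z(1)] by linarith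
      then show ?thesis by (simp add: t_def abs_divide divide_right_mono)
    qed
    have Re: "\<bar>Re t\<bar> = - ln (norm z) / \<bar>lam\<bar>" using z lz by (simp add: t_def abs_divide)
    have "norm (Q z) \<le> C * exp (N * \<bar>Re t\<bar>)" using CN(3)[of t] et z Im by (simp add: Q_def t_def)
    also have "N * \<bar>Re t\<bar> = (N / \<bar>lam\<bar>) * (- ln (norm z))" unfolding Re by simp
    also have "\<dots> \<le> real n * (- ln (norm z))" using n lz by (intro mult_right_mono) auto
    finally have "norm (Q z) \<le> C * exp (real n * (- ln (norm z)))" using CN by (simp add: mult_left_mono)
    then have "norm z ^ n * norm (Q z) \<le> norm z ^ n * (C * exp (real n * (- ln (norm z))))" by (intro mult_left_mono) auto
    also have "exp (real n * (- ln (norm z))) = inverse (norm z ^ n)"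
      using z by (simp add: exp_minus exp_of_nat_mult)
    also have "norm z ^ n * (C * inverse (norm z ^ n)) = C" using z by simp
    finally show ?thesis by (simp add: norm_mult norm_power)
  qed
  have "\<forall>\<^sub>F z in at 0. z \<in> ball 0 (min \<rho>' 1) - {0}" using \<rho>' by (intro eventually_at_in_open) auto
  then have "\<forall>\<^sub>F z in at 0. norm (z ^ n * Q z) \<le> C" by eventually_elim (use bd in auto)
  moreover have hol2: "(\<lambda>z. z ^ n * Q z) holomorphic_on ball 0 \<rho> - {0}" by (intro holomorphic_intros holQ)
  ultimately obtain g where g: "g holomorphic_on ball 0 \<rho>" "\<And>z. z \<in> ball 0 \<rho> - {0} \<Longrightarrow> g z = z ^ n * Q z"
    using holomorphic_on_extend_bounded[OF hol2] \<rho> by auto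
  have "(\<lambda>z. g z / z ^ n) meromorphic_on ball 0 \<rho>"
    using g(1) by (intro meromorphic_intros analytic_on_imp_meromorphic_on) (auto simp: analytic_on_open)
  moreover have "\<forall>\<^sub>F w in at z. g w / w ^ n = Q w" if z: "z \<in> ball 0 \<rho>" for z
  proof -
    have "\<forall>\<^sub>F w in at z. w \<in> ball 0 \<rho>" using z by (intro eventually_at_in_open') auto
    moreover have "\<forall>\<^sub>F w in at z. w \<noteq> 0"
    proof (cases "z = 0")
      case True
      then show ?thesis by (simp add: eventually_at_filter)
    next
      case False
      then have "\<forall>\<^sub>F w in at z. w \<in> - {0}" by (intro eventually_at_in_open') auto
      then show ?thesis by simp
    qed
    ultimately show ?thesis by eventually_elim (simp add: g)
  qed
  ultimately have "Q meromorphic_on ball 0 \<rho>" using meromorphic_on_cong[of "ball 0 \<rho>" "\<lambda>z. g z / z ^ n" Q] by blast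
  then show ?thesis using Qe by blast
qed

text \<open>When continuation maps the plane to itself, all Pluecker coordinates acquire the same
  determinant \<delta>. The exponent \<open>s\<close> is chosen so that exp(s t) acquires its
  inverse over one period; the products are then periodic and descend to the disc. By uniqueness it
  is enough to know the continuation at one real time.\<close>

lemma plucker_meromorphic:
  assumes Y: "VEsol Y1" "VEsol Y2" and t1: "of_real t1 \<in> H"
    and s1: "Y1 (of_real t1 + per) = a1 *s Y1 (of_real t1) + b1 *s Y2 (of_real t1)"
    and s2: "Y2 (of_real t1 + per) = a2 *s Y1 (of_real t1) + b2 *s Y2 (of_real t1)"
  shows "\<exists>s P. (\<forall>i j. P i j meromorphic_on ball 0 \<rho>) \<and> (\<forall>t\<in>H. \<forall>i j. P i j (e t) = exp (s * t) * pl (Y1 t) (Y2 t) i j)"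
proof -
  have sh1: "Y1 (t + per) = a1 *s Y1 t + b1 *s Y2 t" and sh2: "Y2 (t + per) = a2 *s Y1 t + b2 *s Y2 t" if t: "t \<in> H" for t
    using VEsol_zero[OF VEsol_combination[OF VEsol_shift[OF Y(1)] Y, of a1 b1] t1 _ t]
      VEsol_zero[OF VEsol_combination[OF VEsol_shift[OF Y(2)] Y, of a2 b2] t1 _ t] s1 s2
    by (simp_all add: algebra_simps)
  define \<delta> where "\<delta> = a1 * b2 - b1 * a2"
  define p where "p i j t = pl (Y1 t) (Y2 t) i j" for i j t
  have pp: "p i j (t + per) = \<delta> * p i j t" if "t \<in> H" for i j t
    unfolding p_def pl_def sh1[OF that] sh2[OF that] by (simp add: \<delta>_def algebra_simps)
  obtain \<rho>' where \<rho>': "0 < \<rho>'" "\<rho>' < \<rho>" using \<rho> dense by blast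
  show ?thesis
  proof (cases "\<delta> = 0")
    case True
    have "p i j t = 0" if "t \<in> H" for i j t
      using pp[of "t - per" i j] that H_per[of "t - per"] True by simp
    then show ?thesis by (intro exI[of _ 0] exI[of _ "\<lambda>i j z. 0"]) (auto simp: p_def)
  next
    case False
    define s where "s = - Ln \<delta> / per"
    have per0: "per \<noteq> 0" using lam by (simp add: per_def)
    have es: "exp (s * per) * \<delta> = 1" using per0 False by (simp add: s_def exp_minus)
    define q where "q i j t = exp (s * t) * p i j t" for i j t
    have "\<exists>Q. Q meromorphic_on ball 0 \<rho> \<and> (\<forall>t\<in>H. Q (e t) = q i j t)" for i j
    proof (rule lift_periodic[OF _ _ _ \<rho>'])
      show "q i j holomorphic_on H" unfolding q_def p_def pl_def
        by (intro holomorphic_intros VEsol_holo Y)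
      show "q i j (t + per) = q i j t" if "t \<in> H" for t
        using es by (simp add: q_def pp[OF that] distrib_left exp_add mult_ac)
      show "moderate (q i j) \<rho>'" unfolding q_def p_def pl_def
        by (intro moderate_mult moderate_diff moderate_exp moderate_VEsol Y \<rho>')
    qed
    then obtain P where "\<And>i j. P i j meromorphic_on ball 0 \<rho> \<and> (\<forall>t\<in>H. P i j (e t) = q i j t)" by metis
    then show ?thesis by (intro exI[of _ s] exI[of _ P]) (auto simp: q_def p_def)
  qed
qed

end

section \<open>Bounded solutions and an indefinite quadratic form\<close>

text \<open>A symmetric bilinear form, diagonal with weights \<open>sg\<close> in the coordinates
  \<open>W *v v\<close>.\<close>

definition qf :: "(4 \<Rightarrow> real) \<Rightarrow> real^4^4 \<Rightarrow> real^4 \<Rightarrow> real^4 \<Rightarrow> real" where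
  "qf sg W v w = (\<Sum>i\<in>UNIV. sg i * (W *v v) $ i * (W *v w) $ i)"

lemma matrix_vector_bounded: "\<exists>K>0. \<forall>v. norm ((M :: real^'n^'m) *v v) \<le> K * norm v"
  using bounded_linear.pos_bounded[OF matrix_vector_mul_bounded_linear[of M]] by (auto simp: mult.commute)

lemma qf_bound: "\<exists>C>0. \<forall>v w. \<bar>qf sg W v w\<bar> \<le> C * norm v * norm w"
proof -
  obtain K where K: "K > 0" "\<And>v. norm (W *v v) \<le> K * norm v" using matrix_vector_bounded by blast
  define C where "C = (\<Sum>i\<in>UNIV. \<bar>sg i\<bar>) * K\<^sup>2 + 1"
  have "\<bar>qf sg W v w\<bar> \<le> C * norm v * norm w" for v w
  proof -
    have "\<bar>qf sg W v w\<bar> \<le> (\<Sum>i\<in>UNIV. \<bar>sg i\<bar> * (K * norm v) * (K * norm w))"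
      unfolding qf_def
    proof (intro order_trans[OF sum_abs] sum_mono)
      fix i
      have "\<bar>(W *v v) $ i\<bar> \<le> K * norm v" "\<bar>(W *v w) $ i\<bar> \<le> K * norm w"
        using component_le_norm_cart[of "W *v v" i] component_le_norm_cart[of "W *v w" i] K(2)[of v] K(2)[of w] by linarith+
      then show "\<bar>sg i * (W *v v) $ i * (W *v w) $ i\<bar> \<le> \<bar>sg i\<bar> * (K * norm v) * (K * norm w)"
        unfolding abs_mult using K(1) by (intro mult_mono) auto
    qed
    also have "\<dots> = (\<Sum>i\<in>UNIV. \<bar>sg i\<bar>) * (K * norm v) * (K * norm w)"
      by (simp only: sum_distrib_right)
    also have "\<dots> = (\<Sum>i\<in>UNIV. \<bar>sg i\<bar>) * K\<^sup>2 * (norm v * norm w)"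
      by (simp add: power2_eq_square)
    also have "\<dots> \<le> C * (norm v * norm w)" unfolding C_def by (intro mult_right_mono) auto
    finally show ?thesis by (simp add: mult.assoc)
  qed
  moreover have "C > 0" unfolding C_def by (intro add_nonneg_pos mult_nonneg_nonneg sum_nonneg) auto
  ultimately show ?thesis by blast
qed

lemma qf_add_right: "qf sg W v (w + w') = qf sg W v w + qf sg W v w'"
  by (simp add: qf_def matrix_vector_right_distrib distrib_left sum.distrib)

lemma qf_scaleR_right: "qf sg W v (c *\<^sub>R w) = c * qf sg W v w"
  by (simp add: qf_def matrix_vector_mult_scaleR sum_distrib_left mult_ac)

lemma qf_uminus: "qf (\<lambda>i. - sg i) W v w = - qf sg W v w" "qf sg W v (- w) = - qf sg W v w"
  using qf_scaleR_right[of sg W v "-1" w] by (simp_all add: qf_def sum_negf)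

lemma qf_deriv:
  assumes "(\<xi> has_vector_derivative d) (at t)"
  shows "((\<lambda>t. qf sg W (\<xi> t) (\<xi> t)) has_real_derivative 2 * qf sg W (\<xi> t) d) (at t)"
proof -
  have "((\<lambda>t. (W *v \<xi> t) $ i) has_real_derivative (W *v d) $ i) (at t)" for i
    using bounded_linear.has_vector_derivative[OF bounded_linear_vec_nth
        bounded_linear.has_vector_derivative[OF matrix_vector_mul_bounded_linear assms], of W i]
    by (simp add: has_real_derivative_iff_has_vector_derivative)
  then have "((\<lambda>t. qf sg W (\<xi> t) (\<xi> t)) has_real_derivative
     (\<Sum>i\<in>UNIV. sg i * (W *v \<xi> t) $ i * (W *v d) $ i + sg i * (W *v d) $ i * (W *v \<xi> t) $ i)) (at t)"
    unfolding qf_def by (auto intro!: derivative_eq_intros sum.cong)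
  moreover have "(\<Sum>i\<in>UNIV. sg i * (W *v \<xi> t) $ i * (W *v d) $ i + sg i * (W *v d) $ i * (W *v \<xi> t) $ i) = 2 * qf sg W (\<xi> t) d"
    unfolding qf_def sum_distrib_left by (rule sum.cong) auto
  ultimately show ?thesis by simp
qed

text \<open>For large times the form increases along solutions, at a rate bounded below by a
  multiple of the squared norm. Once it is nonnegative on a nonzero solution it becomes positive,
  and from there it grows at least linearly, which boundedness excludes. The time \<open>T\<close>
  is common to all solutions, so that linear combinations can be treated at one and the same
  time.\<close>

lemma bounded_solution_negative:
  fixes A :: "real \<Rightarrow> real^4^4"
  assumes c: "c > 0" "\<And>v. c * (norm v)\<^sup>2 \<le> 2 * qf sg W v (A0 *v v)"
    and conv: "\<And>\<eta>. \<eta> > 0 \<Longrightarrow> \<forall>\<^sub>F t in at_top. \<forall>v. norm (A t *v v - A0 *v v) \<le> \<eta> * norm v"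
  shows "\<exists>T\<ge>T0. \<forall>\<xi>. (\<forall>t\<ge>T0. (\<xi> has_vector_derivative A t *v \<xi> t) (at t)) \<longrightarrow> bounded (\<xi> ` {T0..}) \<longrightarrow>
           (\<forall>t\<ge>T. \<xi> t \<noteq> 0 \<longrightarrow> qf sg W (\<xi> t) (\<xi> t) < 0)"
proof -
  obtain C where C: "C > 0" "\<And>v w. \<bar>qf sg W v w\<bar> \<le> C * norm v * norm w" using qf_bound by blast
  \<comment> \<open>With this tolerance, replacing \<open>A0\<close> by \<open>A t\<close> costs at
    most half of the constant \<open>c\<close>.\<close>
  have "c / (4 * C) > 0" using c C by simp
  from conv[OF this] obtain T1 where T1: "\<And>t v. t \<ge> T1 \<Longrightarrow> norm (A t *v v - A0 *v v) \<le> c / (4 * C) * norm v"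
    unfolding eventually_at_top_linorder by blast
  define T where "T = max T0 T1"
  have key: "c / 2 * (norm v)\<^sup>2 \<le> 2 * qf sg W v (A t *v v)" if "t \<ge> T" for t v
  proof -
    have "qf sg W v (A t *v v) = qf sg W v (A0 *v v) + qf sg W v (A t *v v - A0 *v v)"
      by (simp add: qf_add_right[symmetric])
    moreover have "\<bar>qf sg W v (A t *v v - A0 *v v)\<bar> \<le> C * norm v * (c / (4 * C) * norm v)"
      using C T1[of t v] that by (intro order_trans[OF C(2)] mult_left_mono) (auto simp: T_def)
    moreover have "C * norm v * (c / (4 * C) * norm v) = c / 4 * (norm v)\<^sup>2" using C by (simp add: power2_eq_square)
    ultimately show ?thesis using c(2)[of v] by (simp add: abs_le_iff)
  qed
  show ?thesis
  proof (intro exI[of _ T] conjI allI impI)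
    show "T0 \<le> T" by (simp add: T_def)
    fix \<xi> t1
    assume sol: "\<forall>t\<ge>T0. (\<xi> has_vector_derivative A t *v \<xi> t) (at t)" and bd: "bounded (\<xi> ` {T0..})"
      and t1: "T \<le> t1" "\<xi> t1 \<noteq> 0"
    show "qf sg W (\<xi> t1) (\<xi> t1) < 0"
    proof (rule ccontr)
      assume "\<not> ?thesis"
      then have q1: "qf sg W (\<xi> t1) (\<xi> t1) \<ge> 0" by simp
      define q where "q t = qf sg W (\<xi> t) (\<xi> t)" for t
      have dq: "(q has_real_derivative 2 * qf sg W (\<xi> t) (A t *v \<xi> t)) (at t)" if "t \<ge> T" for t
        unfolding q_def by (rule qf_deriv) (use sol that in \<open>auto simp: T_def\<close>)
      have mono: "q s \<le> q t" if "T \<le> s" "s \<le> t" for s t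
      proof (rule DERIV_nonneg_imp_nondecreasing[OF that(2)])
        fix x assume "s \<le> x" "x \<le> t"
        then have x: "x \<ge> T" using that by simp
        have "0 \<le> c / 2 * (norm (\<xi> x))\<^sup>2" using c by simp
        then show "\<exists>y. (q has_real_derivative y) (at x) \<and> 0 \<le> y"
          using dq[OF x] key[OF x, of "\<xi> x"] order_trans by blast
      qed
      have "2 * qf sg W (\<xi> t1) (A t1 *v \<xi> t1) > 0"
      proof -
        have "0 < c / 2 * (norm (\<xi> t1))\<^sup>2" using c t1 by simp
        then show ?thesis using key[OF t1(1), of "\<xi> t1"] by linarith
      qed
      from DERIV_pos_inc_right[OF dq[OF t1(1)] this] obtain d where d: "d > 0" "\<And>h. 0 < h \<Longrightarrow> h < d \<Longrightarrow> q t1 < q (t1 + h)" by blast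
      \<comment> \<open>The form may be 0 at \<open>t1\<close>, but its derivative is positive
        there; at \<open>t2\<close> its value is positive.\<close>
      define t2 where "t2 = t1 + d / 2"
      have t2: "t2 \<ge> T" "q t2 > 0" using d(2)[of "d/2"] d(1) t1 q1 by (auto simp: t2_def q_def)
      obtain B where B: "\<And>t. t \<ge> T0 \<Longrightarrow> norm (\<xi> t) \<le> B" using bd unfolding bounded_iff by auto
      have qB: "q t \<le> C * B\<^sup>2" if "t \<ge> T0" for t
      proof -
        have "q t \<le> C * norm (\<xi> t) * norm (\<xi> t)" using C(2)[of "\<xi> t" "\<xi> t"] by (simp add: q_def abs_le_iff)
        also have "\<dots> = C * (norm (\<xi> t))\<^sup>2" by (simp add: power2_eq_square)
        also have "\<dots> \<le> C * B\<^sup>2" using C B[OF that] by (intro mult_left_mono power_mono) auto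
        finally show ?thesis .
      qed
      define \<kappa> where "\<kappa> = c / 2 * (q t2 / C)"
      have \<kappa>: "\<kappa> > 0" using c C t2 by (simp add: \<kappa>_def)
      have grow: "\<kappa> \<le> 2 * qf sg W (\<xi> t) (A t *v \<xi> t)" if "t \<ge> t2" for t
      proof -
        have "q t2 \<le> q t" using mono[OF t2(1) that] .
        also have "q t \<le> C * (norm (\<xi> t))\<^sup>2" using C(2)[of "\<xi> t" "\<xi> t"] by (simp add: q_def abs_le_iff power2_eq_square mult.assoc)
        finally have "q t2 / C \<le> (norm (\<xi> t))\<^sup>2" using C by (simp add: field_simps)
        then have "\<kappa> \<le> c / 2 * (norm (\<xi> t))\<^sup>2" unfolding \<kappa>_def using c by (intro mult_left_mono) auto
        then show ?thesis using key[of t "\<xi> t"] that t2 by linarith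
      qed
      define t where "t = t2 + (C * B\<^sup>2 + 1) / \<kappa>"
      have CB: "C * B\<^sup>2 \<ge> 0" using C by simp
      have tt: "t2 \<le> t" using CB \<kappa> by (simp add: t_def)
      have "q t2 - \<kappa> * t2 \<le> q t - \<kappa> * t"
      proof (rule DERIV_nonneg_imp_nondecreasing[OF tt, of "\<lambda>t. q t - \<kappa> * t"])
        fix x assume x: "t2 \<le> x" "x \<le> t"
        then have "T \<le> x" using t2 by simp
        from dq[OF this] have "((\<lambda>t. q t - \<kappa> * t) has_real_derivative 2 * qf sg W (\<xi> x) (A x *v \<xi> x) - \<kappa>) (at x)"
          by (auto intro!: derivative_eq_intros)
        then show "\<exists>y. ((\<lambda>t. q t - \<kappa> * t) has_real_derivative y) (at x) \<and> 0 \<le> y"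
          using grow[OF x(1)] by fastforce
      qed
      moreover have "\<kappa> * t = \<kappa> * t2 + (C * B\<^sup>2 + 1)" using \<kappa> by (simp add: t_def distrib_left)
      ultimately have "q t > C * B\<^sup>2" using t2 by linarith
      moreover have "t \<ge> T0" using tt t2 by (simp add: T_def)
      ultimately show False using qB by force
    qed
  qed
qed

lemma two_by_two_kernel:
  fixes a b c d :: real
  assumes "a * d - b * c = 0"
  shows "\<exists>x y. (x \<noteq> 0 \<or> y \<noteq> 0) \<and> a * x + b * y = 0 \<and> c * x + d * y = 0"
proof -
  consider "a \<noteq> 0 \<or> b \<noteq> 0" | "a = 0" "b = 0" "c \<noteq> 0 \<or> d \<noteq> 0" | "a = 0" "b = 0" "c = 0" "d = 0" by blast
  then show ?thesis
  proof cases
    case 1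
    then show ?thesis using assms by (intro exI[of _ b] exI[of _ "-a"]) (auto simp: algebra_simps)
  next
    case 2
    then show ?thesis by (intro exI[of _ d] exI[of _ "-c"]) auto
  next
    case 3
    then show ?thesis by (intro exI[of _ 1]) auto
  qed
qed

text \<open>A form with at most two negative weights cannot be negative definite in dimension three:
  it is nonnegative on vectors whose coordinates \<open>i\<close> and \<open>j\<close> vanish, so a
  vector of the span with this property is 0. The two coordinates thus determine a vector of the
  span, and Cramer's rule expresses \<open>x3\<close>.\<close>

lemma negative_plane_span:
  fixes x1 x2 x3 :: "real^4"
  assumes neg: "\<And>a b c. a *\<^sub>R x1 + b *\<^sub>R x2 + c *\<^sub>R x3 \<noteq> 0 \<Longrightarrow>
       qf sg W (a *\<^sub>R x1 + b *\<^sub>R x2 + c *\<^sub>R x3) (a *\<^sub>R x1 + b *\<^sub>R x2 + c *\<^sub>R x3) < 0"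
    and sg: "\<And>k. k \<noteq> i \<Longrightarrow> k \<noteq> j \<Longrightarrow> sg k \<ge> 0"
    and indep: "\<And>a b. a *\<^sub>R x1 + b *\<^sub>R x2 = 0 \<Longrightarrow> a = 0 \<and> b = 0"
  shows "\<exists>a b. x3 = a *\<^sub>R x1 + b *\<^sub>R x2"
proof -
  have nn: "qf sg W v v \<ge> 0" if "(W *v v) $ i = 0" "(W *v v) $ j = 0" for v
    unfolding qf_def
  proof (rule sum_nonneg)
    fix k show "0 \<le> sg k * (W *v v) $ k * (W *v v) $ k"
    proof (cases "k = i \<or> k = j")
      case False
      then show ?thesis using sg[of k] by (simp add: mult.assoc)
    qed (use that in auto)
  qed
  have zero: "a *\<^sub>R x1 + b *\<^sub>R x2 + c *\<^sub>R x3 = 0"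
    if "\<And>k. k = i \<or> k = j \<Longrightarrow> a * (W *v x1) $ k + b * (W *v x2) $ k + c * (W *v x3) $ k = 0" for a b c
  proof -
    have "(W *v (a *\<^sub>R x1 + b *\<^sub>R x2 + c *\<^sub>R x3)) $ k = 0" if "k = i \<or> k = j" for k
      using \<open>\<And>k. k = i \<or> k = j \<Longrightarrow> a * (W *v x1) $ k + b * (W *v x2) $ k + c * (W *v x3) $ k = 0\<close>[OF that]
      by (simp add: matrix_vector_right_distrib matrix_vector_mult_scaleR)
    then show ?thesis using nn[of "a *\<^sub>R x1 + b *\<^sub>R x2 + c *\<^sub>R x3"] neg[of a b c] by force
  qed
  define p q r s where "p = (W *v x1) $ i" and "q = (W *v x2) $ i" and "r = (W *v x1) $ j" and "s = (W *v x2) $ j"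
  have D: "p * s - q * r \<noteq> 0"
  proof
    assume "p * s - q * r = 0"
    from two_by_two_kernel[OF this] obtain a b where ab: "a \<noteq> 0 \<or> b \<noteq> 0" "p * a + q * b = 0" "r * a + s * b = 0" by blast
    have "a *\<^sub>R x1 + b *\<^sub>R x2 + 0 *\<^sub>R x3 = 0"
      by (rule zero) (use ab in \<open>auto simp: p_def q_def r_def s_def mult.commute\<close>)
    then show False using indep[of a b] ab by simp
  qed
  define u w where "u = (W *v x3) $ i" and "w = (W *v x3) $ j"
  define a b where "a = (u * s - q * w) / (p * s - q * r)" and "b = (p * w - u * r) / (p * s - q * r)"
  have "p * a + q * b = u" "r * a + s * b = w"
    unfolding a_def b_def using D by (simp_all add: divide_simps) (simp_all add: algebra_simps)
  then have "(- a) *\<^sub>R x1 + (- b) *\<^sub>R x2 + 1 *\<^sub>R x3 = 0"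
    by (intro zero) (auto simp: p_def q_def r_def s_def u_def w_def mult.commute)
  then have "x3 = a *\<^sub>R x1 + b *\<^sub>R x2" by (simp add: algebra_simps)
  then show ?thesis by blast
qed

text \<open>In a basis in which \<open>A0\<close> is triangular with small off-diagonal entries, the indefinite form given by
  the signs of the eigenvalues increases along the flow of \<open>A0\<close>.\<close>

lemma lyapunov_form_exists:
  fixes A0 :: "real^4^4"
  assumes char: "\<forall>s. det (mat s - A0) = (s - l1) * (s - l2) * (s - l3) * (s - l4)"
    and l: "l1 \<le> l2" "l2 < 0" "0 < l3" "l3 \<le> l4"
  shows "\<exists>W c. c > 0 \<and> (\<forall>v. c * (norm v)\<^sup>2 \<le> 2 * qf (\<lambda>i. if i = 1 \<or> i = 2 then -1 else 1) W v (A0 *v v))"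
proof -
  define l where "l i = (if i = 1 then l1 else if i = 2 then l2 else if i = 3 then l3 else l4)" for i :: 4
  define sg :: "4 \<Rightarrow> real" where "sg i = (if i = 1 \<or> i = 2 then -1 else 1)" for i
  have l_eq: "l 1 = l1" "l 2 = l2" "l 3 = l3" "l 4 = l4" by (simp_all add: l_def)
  have "(\<Prod>i\<in>UNIV. s - l i) = (s - l 1) * (s - l 2) * (s - l 3) * (s - l 4)" for s
    unfolding UNIV_4 by (simp add: mult.assoc)
  then have "det (mat s - A0) = (\<Prod>i\<in>UNIV. s - l i)" for s
    using char by (simp only: l_eq)
  from triangularize_split[of A0 l, OF this] obtain P B where P: "invertible P" and PA: "P ** A0 = B ** P"
    and B: "upper_tri B" "\<And>i. B $ i $ i = l i" by blast
  define m where "m = min (- l2) l3"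
  have m: "m > 0" using assms by (simp add: m_def)
  have sgl: "sg i * l i \<ge> m" for i using assms by (auto simp: sg_def l_def m_def)
  have sg1: "\<bar>sg i\<bar> = 1" for i by (simp add: sg_def)
  define b where "b = (\<Sum>i\<in>UNIV. \<Sum>j\<in>UNIV. \<bar>B $ i $ j\<bar>)"
  have b0: "b \<ge> 0" unfolding b_def by (intro sum_nonneg) auto
  have bB: "\<bar>B $ i $ j\<bar> \<le> b" for i j
  proof -
    have "\<bar>B $ i $ j\<bar> \<le> (\<Sum>j\<in>UNIV. \<bar>B $ i $ j\<bar>)" by (rule member_le_sum) auto
    also have "\<dots> \<le> b" unfolding b_def by (rule member_le_sum[of i UNIV "\<lambda>i. \<Sum>j\<in>UNIV. \<bar>B $ i $ j\<bar>"]) (auto intro: sum_nonneg)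
    finally show ?thesis .
  qed
  \<comment> \<open>Rescaling the basis by powers of \<epsilon> multiplies each entry above the
    diagonal by at least one factor \<epsilon>. The choice makes the total contribution of these
    entries, at most \<open>4 * (b * \<epsilon>)\<close> times the sum of squares, cost only half of
    the spectral gap \<open>m\<close>.\<close>
  define \<epsilon> where "\<epsilon> = min 1 (m / (8 * (b + 1)))"
  have \<epsilon>: "0 < \<epsilon>" "\<epsilon> \<le> 1" using m b0 by (auto simp: \<epsilon>_def)
  have "\<epsilon> \<le> m / (8 * (b + 1))" by (simp add: \<epsilon>_def)
  then have "\<epsilon> * (8 * (b + 1)) \<le> m" using b0 by (subst (asm) pos_le_divide_eq) auto
  then have \<epsilon>b: "4 * (b * \<epsilon>) \<le> m / 2" using \<epsilon> by (simp add: algebra_simps)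
  define r where "r i = card {..<i}" for i :: 4
  have r: "r i < r j" if "i < j" for i j unfolding r_def using that by (intro psubset_card_mono) auto
  define W where "W = (\<chi> i j. (1 / \<epsilon> ^ r i) * P $ i $ j)"
  have Wv: "(W *v v) $ i = (1 / \<epsilon> ^ r i) * (P *v v) $ i" for v i
    by (simp add: W_def matrix_vector_mult_def sum_distrib_left mult.assoc)
  have WA: "(W *v (A0 *v v)) $ i = (\<Sum>j\<in>UNIV. B $ i $ j * (\<epsilon> ^ r j / \<epsilon> ^ r i) * (W *v v) $ j)" for v i
  proof -
    have "(P *v (A0 *v v)) $ i = (B *v (P *v v)) $ i" by (simp add: matrix_vector_mul_assoc PA)
    also have "\<dots> = (\<Sum>j\<in>UNIV. B $ i $ j * \<epsilon> ^ r j * (W *v v) $ j)"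
      unfolding matrix_vector_mult_def[of B] using \<epsilon> by (simp add: Wv mult.assoc)
    finally show ?thesis unfolding Wv[of "A0 *v v"] sum_distrib_left by (simp add: sum_distrib_left mult_ac)
  qed
  have main: "m / 2 * (\<Sum>i\<in>UNIV. ((W *v v) $ i)\<^sup>2) \<le> qf sg W v (A0 *v v)" for v
  proof -
    define w where "w i = (W *v v) $ i" for i
    have bnd: "sg i * w i * (B $ i $ j * (\<epsilon> ^ r j / \<epsilon> ^ r i) * w j) \<ge> (if i = j then m * (w i)\<^sup>2 else 0) - b * \<epsilon> * ((w i)\<^sup>2 / 2 + (w j)\<^sup>2 / 2)" for i j
    proof (cases i j rule: linorder_cases)
      case less
      have e1: "\<epsilon> ^ r j / \<epsilon> ^ r i = \<epsilon> ^ (r j - r i)" using r[OF less] \<epsilon> by (simp add: power_diff)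
      have e2: "\<epsilon> ^ (r j - r i) \<le> \<epsilon>" using r[OF less] \<epsilon> power_decreasing[of 1 "r j - r i" \<epsilon>] by simp
      have "\<bar>sg i * w i * (B $ i $ j * (\<epsilon> ^ r j / \<epsilon> ^ r i) * w j)\<bar> = \<bar>B $ i $ j\<bar> * \<epsilon> ^ (r j - r i) * (\<bar>w i\<bar> * \<bar>w j\<bar>)"
        unfolding e1 using \<epsilon> by (simp add: abs_mult sg1)
      also have "\<dots> \<le> b * \<epsilon> * ((w i)\<^sup>2 / 2 + (w j)\<^sup>2 / 2)"
      proof (intro mult_mono bB e2)
        have "2 * \<bar>w i\<bar> * \<bar>w j\<bar> \<le> \<bar>w i\<bar>\<^sup>2 + \<bar>w j\<bar>\<^sup>2" by (rule sum_squares_bound)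
        then show "\<bar>w i\<bar> * \<bar>w j\<bar> \<le> (w i)\<^sup>2 / 2 + (w j)\<^sup>2 / 2" by simp
      qed (use \<epsilon> b0 in auto)
      finally have fin: "\<bar>sg i * w i * (B $ i $ j * (\<epsilon> ^ r j / \<epsilon> ^ r i) * w j)\<bar> \<le> b * \<epsilon> * ((w i)\<^sup>2 / 2 + (w j)\<^sup>2 / 2)" .
      have "i \<noteq> j" using less by simp
      then show ?thesis unfolding if_not_P[OF \<open>i \<noteq> j\<close>] using fin by linarith
    next
      case equal
      have "m * (w i)\<^sup>2 \<le> (sg i * l i) * (w i)\<^sup>2" by (intro mult_right_mono sgl) auto
      moreover have "0 \<le> b * \<epsilon> * ((w i)\<^sup>2 / 2 + (w j)\<^sup>2 / 2)" using b0 \<epsilon> by simp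
      moreover have "sg i * w i * (B $ i $ i * (\<epsilon> ^ r i / \<epsilon> ^ r i) * w i) = (sg i * l i) * (w i)\<^sup>2"
        using \<epsilon> by (simp add: B(2) power2_eq_square)
      moreover have ij: "j = i" using equal by simp
      ultimately show ?thesis unfolding ij by (simp only: if_True refl)
    next
      case greater
      then have "B $ i $ j = 0" using B(1) by (simp add: upper_tri_def)
      moreover have "0 \<le> b * \<epsilon> * ((w i)\<^sup>2 / 2 + (w j)\<^sup>2 / 2)" using b0 \<epsilon> by simp
      moreover have ij: "i \<noteq> j" using greater by simp
      ultimately show ?thesis unfolding if_not_P[OF ij] by simp
    qed
    define \<Sigma> where "\<Sigma> = (\<Sum>i\<in>UNIV. (w i)\<^sup>2)"
    have "qf sg W v (A0 *v v) = (\<Sum>i\<in>UNIV. \<Sum>j\<in>UNIV. sg i * w i * (B $ i $ j * (\<epsilon> ^ r j / \<epsilon> ^ r i) * w j))"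
      by (simp add: qf_def WA w_def sum_distrib_left)
    also have "\<dots> \<ge> (\<Sum>i\<in>UNIV. \<Sum>j\<in>UNIV. (if i = j then m * (w i)\<^sup>2 else 0) - b * \<epsilon> * ((w i)\<^sup>2 / 2 + (w j)\<^sup>2 / 2))"
      by (intro sum_mono bnd)
    also have "(\<Sum>i\<in>UNIV. \<Sum>j\<in>UNIV. (if i = j then m * (w i)\<^sup>2 else 0) - b * \<epsilon> * ((w i)\<^sup>2 / 2 + (w j)\<^sup>2 / 2))
        = m * \<Sigma> - 4 * (b * \<epsilon>) * \<Sigma>"
      by (simp add: sum_subtractf sum.distrib sum_distrib_left[symmetric] sum_divide_distrib[symmetric] \<Sigma>_def)
    also have "m * \<Sigma> - 4 * (b * \<epsilon>) * \<Sigma> \<ge> m * \<Sigma> - m / 2 * \<Sigma>"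
      using mult_right_mono[OF \<epsilon>b, of \<Sigma>] by (simp add: \<Sigma>_def sum_nonneg)
    finally show ?thesis by (simp add: \<Sigma>_def w_def algebra_simps)
  qed
  have nsq: "(\<Sum>i\<in>UNIV. (x $ i)\<^sup>2) = (norm x)\<^sup>2" for x :: "real^4"
    by (simp add: norm_vec_def L2_set_def sum_nonneg)
  define Dm where "Dm = (\<chi> i j. if i = j then \<epsilon> ^ r i else 0)"
  have Dm: "(Dm *v x) $ i = \<epsilon> ^ r i * x $ i" for x i
    by (simp add: Dm_def matrix_vector_mult_def if_distrib[of "\<lambda>y. y * _"] cong: if_cong)
  \<comment> \<open>A left inverse of \<open>W\<close>; its bound turns the estimate in the
    coordinates \<open>W *v v\<close> into one in terms of \<open>norm v\<close>.\<close>
  define Wi where "Wi = matrix_inv P ** Dm"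
  have WiW: "Wi *v (W *v v) = v" for v
  proof -
    have "Dm *v (W *v v) = P *v v" using \<epsilon> by (simp add: vec_eq_iff Dm Wv)
    then show ?thesis unfolding Wi_def by (simp add: matrix_vector_mul_assoc[symmetric])
        (simp add: matrix_vector_mul_assoc matrix_inv_mult[OF P])
  qed
  obtain K where K: "K > 0" "\<And>x. norm (Wi *v x) \<le> K * norm x" using matrix_vector_bounded by blast
  have "m / K\<^sup>2 * (norm v)\<^sup>2 \<le> 2 * qf sg W v (A0 *v v)" for v
  proof -
    have "norm v \<le> K * norm (W *v v)" using K(2)[of "W *v v"] by (simp add: WiW)
    then have "(norm v)\<^sup>2 \<le> (K * norm (W *v v))\<^sup>2" by (rule power_mono) simp
    then have "m / K\<^sup>2 * (norm v)\<^sup>2 \<le> m / K\<^sup>2 * (K * norm (W *v v))\<^sup>2" using m by (intro mult_left_mono) auto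
    also have "\<dots> = m * (norm (W *v v))\<^sup>2" using K by (simp add: power_mult_distrib)
    also have "\<dots> \<le> 2 * qf sg W v (A0 *v v)" using main[of v] by (simp add: nsq)
    finally show ?thesis .
  qed
  moreover have "m / K\<^sup>2 > 0" using m K by simp
  ultimately show ?thesis unfolding sg_def[abs_def] by blast
qed

section \<open>Invariance of the tangent planes\<close>

lemma complexification_estimates:
  fixes V :: "real^4 \<Rightarrow> real^4"
  assumes c: "complexification V U F"
  shows "\<exists>r>0. \<exists>C>0. (\<forall>x\<in>ball p r. \<forall>v. norm v < r \<longrightarrow> norm (V (x + v) - V x - jacobian V (at x) *v v) \<le> C * (norm v)\<^sup>2) \<and>
     (\<forall>x\<in>ball p r. \<forall>v. norm (jacobian V (at x) *v v) \<le> C * norm v)"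
proof -
  obtain r C where r: "r > 0" "C > 0"
    and q: "\<And>x v. x \<in> ball p r \<Longrightarrow> norm v < r \<Longrightarrow> norm (V (x + v) - V x - jacobian V (at x) *v v) \<le> C * (norm v)\<^sup>2"
    and j: "\<And>x v. x \<in> ball p r \<Longrightarrow> norm v < r \<Longrightarrow> norm (jacobian V (at x) *v v) \<le> C * norm v"
    using complexification_quadratic[OF c, of p thesis] by blast
  have "norm (jacobian V (at x) *v v) \<le> C * norm v" if x: "x \<in> ball p r" for x v
  proof (cases "v = 0")
    case False
    define k where "k = r / (2 * norm v)"
    have k: "k > 0" using r False by (simp add: k_def)
    have "norm (k *\<^sub>R v) < r" using r False by (simp add: k_def)
    from j[OF x this] have "k * norm (jacobian V (at x) *v v) \<le> k * (C * norm v)"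
      using k by (simp add: matrix_vector_mult_scaleR mult_ac)
    then show ?thesis using k by simp
  qed simp
  then show ?thesis using r q by blast
qed

lemma tangent_transport_local:
  fixes V :: "real^4 \<Rightarrow> real^4"
  assumes cx: "complexification V U F" and sol: "solves_on V xh UNIV" and inv: "flow_invariant V M"
    and \<tau>: "solves_VE V xh \<tau>"
  shows "\<exists>\<delta>>0. \<forall>t'\<in>ball t0 \<delta>. \<forall>t\<in>ball t0 \<delta>.
           \<tau> t' \<in> tangent_space M (xh t') \<longrightarrow> \<tau> t \<in> tangent_space M (xh t)"
proof -
  define p where "p = xh t0"
  obtain r C where r: "r > 0" "C > 0"
    and q: "\<And>x v. x \<in> ball p r \<Longrightarrow> norm v < r \<Longrightarrow> norm (V (x + v) - V x - jacobian V (at x) *v v) \<le> C * (norm v)\<^sup>2"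
    and j: "\<And>x v. x \<in> ball p r \<Longrightarrow> norm (jacobian V (at x) *v v) \<le> C * norm v"
    using complexification_estimates[OF cx, of p] by blast
  \<comment> \<open>Any two points of \<open>cball p (2 * \<rho>)\<close> are closer than
    \<open>r\<close>, as the quadratic estimate demands.\<close>
  define \<rho> where "\<rho> = r / 8"
  have \<rho>: "\<rho> > 0" "cball p (2 * \<rho>) \<subseteq> ball p r" using r by (auto simp: \<rho>_def)
  define L where "L = C * r + C"
  have L: "L > 0" using r by (simp add: L_def add_pos_pos)
  have lip: "norm (V y - V x) \<le> L * norm (y - x)" if "x \<in> cball p (2 * \<rho>)" "y \<in> cball p (2 * \<rho>)" for x y
  proof -
    have "dist x y \<le> 4 * \<rho>" using that dist_triangle2[of x y p] by (simp add: dist_commute)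
    then have n: "norm (y - x) < r" using r by (simp add: \<rho>_def dist_norm norm_minus_commute)
    have x: "x \<in> ball p r" using that \<rho> by blast
    have "V y - V x = (V (x + (y - x)) - V x - jacobian V (at x) *v (y - x)) + jacobian V (at x) *v (y - x)" by simp
    then have "norm (V y - V x) \<le> C * (norm (y - x))\<^sup>2 + C * norm (y - x)"
      using q[OF x n] j[OF x] by (metis norm_triangle_mono)
    also have "C * (norm (y - x))\<^sup>2 \<le> C * (r * norm (y - x))"
      unfolding power2_eq_square using n r by (intro mult_left_mono mult_right_mono) auto
    finally show ?thesis by (simp add: L_def algebra_simps)
  qed
  have "L-lipschitz_on (cball p (2 * \<rho>)) V"
    using lip L by (intro lipschitz_onI) (auto simp: dist_norm)
  from picard_local[OF \<rho>(1) this] obtain \<delta>1 where \<delta>1: "\<delta>1 > 0"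
    and pic: "\<And>x0. x0 \<in> cball p \<rho> \<Longrightarrow> \<exists>x. x 0 = x0 \<and>
      (\<forall>t\<in>{-\<delta>1<..<\<delta>1}. (x has_vector_derivative V (x t)) (at t) \<and> x t \<in> cball p (2 * \<rho>))" by blast
  have dxh: "(xh has_vector_derivative V (xh t)) (at t)" for t using sol by (simp add: solves_on_def)
  have dtau: "(\<tau> has_vector_derivative jacobian V (at (xh t)) *v \<tau> t) (at t)" for t using \<tau> by (simp add: solves_VE_def)
  have "isCont xh t0" using dxh has_vector_derivative_continuous by blast
  then obtain \<delta>2 where \<delta>2: "\<delta>2 > 0" "\<And>t. dist t t0 < \<delta>2 \<Longrightarrow> dist (xh t) p < \<rho> / 2"
    unfolding continuous_at_eps_delta p_def using \<rho>(1) by (metis half_gt_zero)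
  define \<delta> where "\<delta> = min \<delta>2 (\<delta>1 / 4)"
  have \<delta>: "\<delta> > 0" using \<delta>1 \<delta>2 by (simp add: \<delta>_def)
  have main: "\<tau> t \<in> tangent_space M (xh t)"
    if t': "t' \<in> ball t0 \<delta>" and t: "t \<in> ball t0 \<delta>" and tan: "\<tau> t' \<in> tangent_space M (xh t')" for t t'
  proof -
    obtain \<gamma> e where e: "e > 0" and \<gamma>: "\<gamma> ` {-e<..<e} \<subseteq> M" "\<gamma> 0 = xh t'" "(\<gamma> has_vector_derivative \<tau> t') (at 0)"
      using tan unfolding tangent_space_def by blast
    have xhb: "dist (xh x) p < \<rho> / 2" if "x \<in> {min t t'..max t t'}" for x
    proof (rule \<delta>2(2))
      have "\<bar>x - t0\<bar> < \<delta>2" using that t t' by (auto simp: dist_real_def \<delta>_def abs_less_iff min_def max_def split: if_splits)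
      then show "dist x t0 < \<delta>2" by (simp add: dist_real_def)
    qed
    have "isCont \<gamma> 0" using \<gamma>(3) has_vector_derivative_continuous by blast
    then obtain e1 where e1: "e1 > 0" "\<And>s. dist s 0 < e1 \<Longrightarrow> dist (\<gamma> s) (\<gamma> 0) < \<rho> / 2"
      unfolding continuous_at_eps_delta using \<rho>(1) by (metis half_gt_zero)
    define e2 where "e2 = min e e1"
    have e2: "e2 > 0" using e e1 by (simp add: e2_def)
    have \<gamma>b: "\<gamma> s \<in> cball p \<rho>" if "\<bar>s\<bar> < e2" for s
    proof -
      have "dist (\<gamma> s) (xh t') < \<rho> / 2" using e1(2)[of s] that \<gamma>(2) by (simp add: e2_def)
      moreover have "dist (xh t') p < \<rho> / 2" by (rule xhb) auto
      ultimately have "dist (\<gamma> s) p < \<rho>" using dist_triangle_half_l by (metis dist_commute)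
      then show ?thesis by (simp add: dist_commute)
    qed
    have "\<exists>Y. \<forall>s. \<bar>s\<bar> < e2 \<longrightarrow> Y s 0 = \<gamma> s \<and>
      (\<forall>\<theta>\<in>{-\<delta>1<..<\<delta>1}. (Y s has_vector_derivative V (Y s \<theta>)) (at \<theta>) \<and> Y s \<theta> \<in> cball p (2 * \<rho>))"
      using pic \<gamma>b by (intro choice) blast
    then obtain Y where Y0: "\<And>s. \<bar>s\<bar> < e2 \<Longrightarrow> Y s 0 = \<gamma> s"
      and dY: "\<And>s \<theta>. \<bar>s\<bar> < e2 \<Longrightarrow> \<theta> \<in> {-\<delta>1<..<\<delta>1} \<Longrightarrow> (Y s has_vector_derivative V (Y s \<theta>)) (at \<theta>)"
      and Yb: "\<And>s \<theta>. \<bar>s\<bar> < e2 \<Longrightarrow> \<theta> \<in> {-\<delta>1<..<\<delta>1} \<Longrightarrow> Y s \<theta> \<in> cball p (2 * \<rho>)" by blast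
    define d where "d = t - t'"
    have dd: "\<theta> \<in> {-\<delta>1<..<\<delta>1}" "t' + \<theta> \<in> {min t t'..max t t'}" if "\<theta> \<in> {min 0 d..max 0 d}" for \<theta>
      using that t t' \<delta>1 by (auto simp: d_def \<delta>_def dist_real_def abs_less_iff min_def max_def split: if_splits)
    define Kc where "Kc = exp ((2 * L + 1) * \<bar>d\<bar>)"
    have Kc: "Kc \<ge> 1" using L by (simp add: Kc_def)
    \<comment> \<open>The difference between the flow line through \<open>\<gamma> s\<close> and the
      orbit; Gronwall's inequality bounds it by its initial value.\<close>
    define u where "u s \<theta> = Y s \<theta> - xh (t' + \<theta>)" for s \<theta>
    have sh: "((\<lambda>\<theta>. t' + \<theta>) has_vector_derivative 1) (at \<theta>)" for \<theta>
      using has_vector_derivative_add[OF has_vector_derivative_const[of t'] has_vector_derivative_id] by simp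
    have dxh': "((\<lambda>\<theta>. xh (t' + \<theta>)) has_vector_derivative V (xh (t' + \<theta>))) (at \<theta>)"
      and dtau': "((\<lambda>\<theta>. \<tau> (t' + \<theta>)) has_vector_derivative jacobian V (at (xh (t' + \<theta>))) *v \<tau> (t' + \<theta>)) (at \<theta>)" for \<theta>
      using vector_diff_chain_at[OF sh dxh, of \<theta>] vector_diff_chain_at[OF sh dtau, of \<theta>] by (simp_all add: o_def)
    have du: "(u s has_vector_derivative V (Y s \<theta>) - V (xh (t' + \<theta>))) (at \<theta>)"
      if "\<bar>s\<bar> < e2" "\<theta> \<in> {min 0 d..max 0 d}" for s \<theta>
      unfolding u_def by (intro has_vector_derivative_diff dY dd that dxh')
    have xhc: "xh (t' + \<theta>) \<in> cball p (2 * \<rho>)" if "\<theta> \<in> {min 0 d..max 0 d}" for \<theta>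
      using xhb[OF dd(2)[OF that]] \<rho>(1) by (simp add: dist_commute)
    have ub: "(norm (u s \<theta>))\<^sup>2 \<le> (norm (u s 0))\<^sup>2 * Kc" if s: "\<bar>s\<bar> < e2" and \<theta>: "\<theta> \<in> {min 0 d..max 0 d}" for s \<theta>
    proof -
      have "(norm (u s \<theta>))\<^sup>2 + 0\<^sup>2 \<le> ((norm (u s 0))\<^sup>2 + 0\<^sup>2) * exp ((2 * L + 1) * \<bar>\<theta> - 0\<bar>)"
      proof (rule gronwall_norm[where a="min 0 d" and b="max 0 d"])
        fix x assume x: "x \<in> {min 0 d..max 0 d}"
        show "(u s has_vector_derivative V (Y s x) - V (xh (t' + x))) (at x)" by (rule du[OF s x])
        show "norm (V (Y s x) - V (xh (t' + x))) \<le> L * norm (u s x) + 0"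
          unfolding u_def using lip[OF xhc[OF x] Yb[OF s dd(1)[OF x]]] by simp
      qed (use \<theta> L in auto)
      also have "\<dots> \<le> ((norm (u s 0))\<^sup>2 + 0\<^sup>2) * Kc"
        unfolding Kc_def using \<theta> L by (intro mult_left_mono) (auto simp: min_def max_def split: if_splits)
      finally show ?thesis by simp
    qed
    have u0: "u s 0 = \<gamma> s - \<gamma> 0" if "\<bar>s\<bar> < e2" for s using Y0[OF that] \<gamma>(2) by (simp add: u_def)
    \<comment> \<open>The error of the linear approximation
      \<open>s *\<^sub>R \<tau> (t' + \<theta>)\<close> to \<open>u\<close>. It solves the
      variational equation up to a term of size \<open>E s\<close>, quadratic in the initial
      difference; hence it is o(s) at time \<open>d\<close> because it is o(s) initially.\<close>
    define w where "w s \<theta> = u s \<theta> - s *\<^sub>R \<tau> (t' + \<theta>)" for s \<theta>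
    have dw: "(w s has_vector_derivative V (Y s \<theta>) - V (xh (t' + \<theta>)) - s *\<^sub>R (jacobian V (at (xh (t' + \<theta>))) *v \<tau> (t' + \<theta>))) (at \<theta>)"
      if "\<bar>s\<bar> < e2" "\<theta> \<in> {min 0 d..max 0 d}" for s \<theta>
      unfolding w_def using du[OF that]
      by (intro has_vector_derivative_diff bounded_linear.has_vector_derivative[OF bounded_linear_scaleR_right] dtau')
    define E where "E s = C * ((norm (u s 0))\<^sup>2 * Kc)" for s
    have wb: "(norm (w s d))\<^sup>2 \<le> ((norm (w s 0))\<^sup>2 + (E s)\<^sup>2) * exp ((2 * C + 1) * \<bar>d\<bar>)" if s: "\<bar>s\<bar> < e2" for s
    proof -
      have "(norm (w s d))\<^sup>2 + (E s)\<^sup>2 \<le> ((norm (w s 0))\<^sup>2 + (E s)\<^sup>2) * exp ((2 * C + 1) * \<bar>d - 0\<bar>)"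
      proof (rule gronwall_norm[where a="min 0 d" and b="max 0 d"])
        fix x assume x: "x \<in> {min 0 d..max 0 d}"
        show "(w s has_vector_derivative V (Y s x) - V (xh (t' + x)) - s *\<^sub>R (jacobian V (at (xh (t' + x))) *v \<tau> (t' + x))) (at x)"
          by (rule dw[OF s x])
        define y where "y = xh (t' + x)"
        have yb: "y \<in> ball p r" "y \<in> cball p (2 * \<rho>)" using xhc[OF x] \<rho>(2) by (auto simp: y_def)
        have Yy: "Y s x = y + u s x" by (simp add: u_def y_def)
        have "dist (Y s x) y \<le> 4 * \<rho>" using Yb[OF s dd(1)[OF x]] yb(2) dist_triangle2[of "Y s x" y p] by (simp add: dist_commute)
        then have un: "norm (u s x) < r" using r by (simp add: Yy dist_norm \<rho>_def)
        have "V (Y s x) - V y - s *\<^sub>R (jacobian V (at y) *v \<tau> (t' + x)) =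
            (V (y + u s x) - V y - jacobian V (at y) *v u s x) + jacobian V (at y) *v w s x"
          unfolding Yy w_def by (simp add: matrix_vector_mult_diff_distrib matrix_vector_mult_scaleR)
        also have "norm \<dots> \<le> C * (norm (u s x))\<^sup>2 + C * norm (w s x)"
          by (intro norm_triangle_mono q j yb un)
        also have "\<dots> \<le> E s + C * norm (w s x)" unfolding E_def using ub[OF s x] r by simp
        finally show "norm (V (Y s x) - V (xh (t' + x)) - s *\<^sub>R (jacobian V (at (xh (t' + x))) *v \<tau> (t' + x))) \<le> C * norm (w s x) + E s"
          by (simp add: y_def)
      qed (use r Kc in \<open>auto simp: E_def\<close>)
      then show ?thesis by (smt (verit) zero_le_power2)
    qed
    define G where "G = sqrt (exp ((2 * C + 1) * \<bar>d\<bar>))"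
    have wb': "norm (w s d) \<le> G * (norm (w s 0) + E s)" if s: "\<bar>s\<bar> < e2" for s
    proof -
      have E0: "E s \<ge> 0" using r Kc by (simp add: E_def)
      have "(norm (w s 0))\<^sup>2 + (E s)\<^sup>2 \<le> (norm (w s 0) + E s)\<^sup>2" using E0 by (simp add: power2_sum)
      then have "((norm (w s 0))\<^sup>2 + (E s)\<^sup>2) * exp ((2 * C + 1) * \<bar>d\<bar>) \<le> (norm (w s 0) + E s)\<^sup>2 * exp ((2 * C + 1) * \<bar>d\<bar>)"
        by (rule mult_right_mono) simp
      also have "\<dots> = (G * (norm (w s 0) + E s))\<^sup>2" by (simp add: G_def power_mult_distrib)
      finally have "(norm (w s d))\<^sup>2 \<le> (G * (norm (w s 0) + E s))\<^sup>2" using wb[OF s] by linarith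
      then show ?thesis using E0 by (intro power2_le_imp_le[of "norm (w s d)"]) (auto simp: G_def)
    qed
    have gamlim: "((\<lambda>s. norm (\<gamma> s - \<gamma> 0 - s *\<^sub>R \<tau> t') / norm s) \<longlongrightarrow> 0) (at 0)"
      using \<gamma>(3) unfolding has_vector_derivative_def has_derivative_iff_norm by simp
    have gamb: "((\<lambda>s. norm (\<gamma> s - \<gamma> 0) / norm s) \<longlongrightarrow> norm (\<tau> t')) (at 0)"
    proof -
      have "((\<lambda>s. norm (\<gamma> s - \<gamma> 0) / norm s - norm (\<tau> t')) \<longlongrightarrow> 0) (at 0)"
      proof (rule Lim_null_comparison[OF _ gamlim])
        have "\<forall>\<^sub>F s in at 0. s \<noteq> (0::real)" by (simp add: eventually_at_filter)
        then show "\<forall>\<^sub>F s in at 0. norm (norm (\<gamma> s - \<gamma> 0) / norm s - norm (\<tau> t')) \<le> norm (\<gamma> s - \<gamma> 0 - s *\<^sub>R \<tau> t') / norm s"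
        proof eventually_elim
          case (elim s)
          have "norm (\<gamma> s - \<gamma> 0) / norm s - norm (\<tau> t') = (norm (\<gamma> s - \<gamma> 0) - norm (s *\<^sub>R \<tau> t')) / norm s"
            using elim by (simp add: diff_divide_distrib)
          then have "norm (norm (\<gamma> s - \<gamma> 0) / norm s - norm (\<tau> t')) = \<bar>norm (\<gamma> s - \<gamma> 0) - norm (s *\<^sub>R \<tau> t')\<bar> / norm s"
            by (simp add: abs_divide)
          also have "\<dots> \<le> norm (\<gamma> s - \<gamma> 0 - s *\<^sub>R \<tau> t') / norm s"
            by (intro divide_right_mono norm_triangle_ineq3) simp
          finally show ?case .
        qed
      qed
      then show ?thesis by (rule LIM_zero_cancel)
    qed
    have lim0: "((\<lambda>s. G * (norm (\<gamma> s - \<gamma> 0 - s *\<^sub>R \<tau> t') / norm s + C * Kc * ((norm (\<gamma> s - \<gamma> 0) / norm s) * (norm (\<gamma> s - \<gamma> 0) / norm s) * norm s))) \<longlongrightarrow>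
        G * (0 + C * Kc * (norm (\<tau> t') * norm (\<tau> t') * norm (0::real)))) (at 0)"
      by (intro tendsto_intros gamlim gamb)
    have lim00: "G * (0 + C * Kc * (norm (\<tau> t') * norm (\<tau> t') * norm (0::real))) = 0" by simp
    \<comment> \<open>The image of the curve \<gamma> under the flow for time \<open>d\<close>; the
      constant continuation outside the small interval serves only to make the function
      total.\<close>
    define g where "g s = (if \<bar>s\<bar> < e2 then Y s d else xh t)" for s
    have d_in: "d \<in> {min 0 d..max 0 d}" by auto
    have w0: "w 0 0 = 0" using u0[of 0] e2 by (simp add: w_def)
    have g0: "g 0 = xh t"
    proof -
      have "norm (w 0 d) \<le> G * (norm (w 0 0) + E 0)" using wb'[of 0] e2 by simp
      also have "\<dots> = 0" using u0[of 0] e2 by (simp add: w0 E_def)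
      finally show ?thesis using e2 by (simp add: g_def w_def u_def d_def)
    qed
    have "((\<lambda>s. norm (g s - g 0 - (s - 0) *\<^sub>R \<tau> t) / norm (s - 0)) \<longlongrightarrow> 0) (at 0)"
    proof (rule tendsto_sandwich[OF _ _ tendsto_const lim0[unfolded lim00]])
      show "\<forall>\<^sub>F s in at 0. 0 \<le> norm (g s - g 0 - (s - 0) *\<^sub>R \<tau> t) / norm (s - 0)" by simp
      have "\<forall>\<^sub>F s in at 0. s \<in> ball (0::real) e2 - {0}" using e2 by (intro eventually_at_in_open) auto
      then show "\<forall>\<^sub>F s in at 0. norm (g s - g 0 - (s - 0) *\<^sub>R \<tau> t) / norm (s - 0) \<le>
          G * (norm (\<gamma> s - \<gamma> 0 - s *\<^sub>R \<tau> t') / norm s + C * Kc * ((norm (\<gamma> s - \<gamma> 0) / norm s) * (norm (\<gamma> s - \<gamma> 0) / norm s) * norm s))"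
      proof eventually_elim
        case (elim s)
        then have s: "\<bar>s\<bar> < e2" "s \<noteq> 0" by auto
        have "g s - g 0 - (s - 0) *\<^sub>R \<tau> t = w s d" using s g0 by (simp add: g_def w_def u_def d_def)
        then have "norm (g s - g 0 - (s - 0) *\<^sub>R \<tau> t) / norm (s - 0) \<le> G * (norm (w s 0) + E s) / \<bar>s\<bar>"
          using wb'[OF s(1)] by (simp add: divide_right_mono)
        also have "w s 0 = \<gamma> s - \<gamma> 0 - s *\<^sub>R \<tau> t'" using u0[OF s(1)] by (simp add: w_def)
        also have "E s = C * Kc * (norm (\<gamma> s - \<gamma> 0) * norm (\<gamma> s - \<gamma> 0))" using u0[OF s(1)] by (simp add: E_def power2_eq_square)
        also have "G * (norm (\<gamma> s - \<gamma> 0 - s *\<^sub>R \<tau> t') + C * Kc * (norm (\<gamma> s - \<gamma> 0) * norm (\<gamma> s - \<gamma> 0))) / \<bar>s\<bar> =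
          G * (norm (\<gamma> s - \<gamma> 0 - s *\<^sub>R \<tau> t') / norm s + C * Kc * ((norm (\<gamma> s - \<gamma> 0) / norm s) * (norm (\<gamma> s - \<gamma> 0) / norm s) * norm s))"
        proof -
          have "norm s \<noteq> 0" using s by simp
          then show ?thesis by (simp add: field_simps del: real_norm_def) (simp add: algebra_simps)
        qed
        finally show ?case .
      qed
    qed
    then have dg: "(g has_vector_derivative \<tau> t) (at 0)"
      unfolding has_vector_derivative_def has_derivative_iff_norm by (simp add: bounded_linear_scaleR_left)
    have gM: "g s \<in> M" if "s \<in> {-e2<..<e2}" for s
    proof -
      have s: "\<bar>s\<bar> < e2" using that by auto
      have "Y s ` {-\<delta>1<..<\<delta>1} \<subseteq> M"
      proof (rule inv[unfolded flow_invariant_def, rule_format, of 0])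
        show "0 \<in> {-\<delta>1<..<\<delta>1} \<and> solves_on V (Y s) {-\<delta>1<..<\<delta>1} \<and> Y s 0 \<in> M"
          using \<delta>1 dY[OF s] Y0[OF s] \<gamma>(1) that unfolding solves_on_def by (auto simp: e2_def)
      qed
      then show ?thesis using s dd(1)[OF d_in] by (auto simp: g_def)
    qed
    show ?thesis unfolding tangent_space_def using e2 gM g0 dg by blast
  qed
  show ?thesis using \<delta> main by blast
qed

lemma tangent_transport:
  fixes V :: "real^4 \<Rightarrow> real^4"
  assumes cx: "complexification V U F" and sol: "solves_on V xh UNIV" and inv: "flow_invariant V M"
    and \<tau>: "solves_VE V xh \<tau>" and t1: "\<tau> t1 \<in> tangent_space M (xh t1)"
  shows "\<tau> t \<in> tangent_space M (xh t)"
proof -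
  define Z where "Z = {t. \<tau> t \<in> tangent_space M (xh t)}"
  have loc: "\<exists>\<delta>>0. \<forall>t'\<in>ball t0 \<delta>. \<forall>t\<in>ball t0 \<delta>. t' \<in> Z \<longrightarrow> t \<in> Z" for t0
    using tangent_transport_local[OF cx sol inv \<tau>, of t0] by (simp add: Z_def)
  have "open Z" unfolding open_contains_ball
  proof
    fix t0 assume "t0 \<in> Z"
    moreover obtain \<delta> where "\<delta> > 0" "\<forall>t'\<in>ball t0 \<delta>. \<forall>t\<in>ball t0 \<delta>. t' \<in> Z \<longrightarrow> t \<in> Z" using loc by blast
    ultimately show "\<exists>e>0. ball t0 e \<subseteq> Z" by (metis centre_in_ball subsetI)
  qed
  moreover have "open (- Z)" unfolding open_contains_ball
  proof
    fix t0 assume "t0 \<in> - Z"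
    moreover obtain \<delta> where "\<delta> > 0" "\<forall>t'\<in>ball t0 \<delta>. \<forall>t\<in>ball t0 \<delta>. t' \<in> Z \<longrightarrow> t \<in> Z" using loc by blast
    ultimately show "\<exists>e>0. ball t0 e \<subseteq> - Z" by (metis centre_in_ball subsetI ComplI ComplD)
  qed
  ultimately have "Z = {} \<or> Z = UNIV" using clopen[of Z] by (simp add: closed_def)
  then show ?thesis using t1 by (auto simp: Z_def)
qed

section \<open>Real analytic surfaces as holomorphic graphs\<close>

text \<open>Termwise differentiation over an unordered index set: finitely many terms are
  differentiated directly, and the mean value inequality bounds the contribution of the others by
  the tail of the majorant \<open>m\<close>.\<close>

lemma has_derivative_infsum:
  fixes f :: "'i \<Rightarrow> 'a::real_normed_vector \<Rightarrow> 'b::banach"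
  assumes S: "open S" "convex S"
    and d: "\<And>\<alpha> z. \<alpha> \<in> I \<Longrightarrow> z \<in> S \<Longrightarrow> (f \<alpha> has_derivative f' \<alpha> z) (at z)"
    and b: "\<And>\<alpha> z v. \<alpha> \<in> I \<Longrightarrow> z \<in> S \<Longrightarrow> norm (f' \<alpha> z v) \<le> m \<alpha> * norm v"
    and m: "m summable_on I" and m0: "\<And>\<alpha>. \<alpha> \<in> I \<Longrightarrow> m \<alpha> \<ge> 0"
    and s: "\<And>z. z \<in> S \<Longrightarrow> (\<lambda>\<alpha>. f \<alpha> z) summable_on I" and z: "z \<in> S"
  shows "((\<lambda>z. infsum (\<lambda>\<alpha>. f \<alpha> z) I) has_derivative (\<lambda>v. infsum (\<lambda>\<alpha>. f' \<alpha> z v) I)) (at z)"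
proof -
  have abs: "(\<lambda>\<alpha>. norm (f' \<alpha> z v)) summable_on J" if "J \<subseteq> I" for v J
    by (rule Infinite_Sum.abs_summable_on_comparison_test'[where g="\<lambda>\<alpha>. m \<alpha> * norm v"])
      (use b z that m in \<open>auto intro!: summable_on_cmult_left intro: summable_on_subset_banach\<close>)
  have sm: "(\<lambda>\<alpha>. f' \<alpha> z v) summable_on J" if "J \<subseteq> I" for v J
    using Infinite_Sum.abs_summable_summable[OF abs[OF that]] .
  have lin: "linear (f' \<alpha> z)" if "\<alpha> \<in> I" for \<alpha> using has_derivative_linear[OF d[OF that z]] .
  define L where "L v = infsum (\<lambda>\<alpha>. f' \<alpha> z v) I" for v
  have "linear L"
  proof (rule linearI)
    fix v w
    have "L (v + w) = infsum (\<lambda>\<alpha>. f' \<alpha> z v + f' \<alpha> z w) I" unfolding L_def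
      by (rule infsum_cong) (use lin in \<open>auto simp: linear_add\<close>)
    also have "\<dots> = L v + L w" unfolding L_def by (intro infsum_add sm) auto
    finally show "L (v + w) = L v + L w" .
  next
    fix c v
    have "L (c *\<^sub>R v) = infsum (\<lambda>\<alpha>. c *\<^sub>R f' \<alpha> z v) I" unfolding L_def
      by (rule infsum_cong) (use lin in \<open>auto simp: linear_cmul\<close>)
    then show "L (c *\<^sub>R v) = c *\<^sub>R L v" unfolding L_def by (simp add: infsum_scaleR_right)
  qed
  have Lb: "norm (L v) \<le> infsum m I * norm v" for v
  proof -
    have "norm (L v) \<le> infsum (\<lambda>\<alpha>. norm (f' \<alpha> z v)) I" unfolding L_def by (rule norm_infsum_bound[OF abs]) simp
    also have "\<dots> \<le> infsum (\<lambda>\<alpha>. m \<alpha> * norm v) I"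
      by (rule infsum_mono) (use abs[of I v] b z m in \<open>auto intro!: summable_on_cmult_left\<close>)
    also have "\<dots> = infsum m I * norm v" by (rule infsum_cmult_left')
    finally show ?thesis .
  qed
  have bl: "bounded_linear L"
    using \<open>linear L\<close> Lb by (intro bounded_linear_intro[of L "infsum m I"]) (auto simp: linear_add linear_cmul mult.commute)
  obtain r where r: "r > 0" "ball z r \<subseteq> S" using S z open_contains_ball by blast
  define G where "G z = infsum (\<lambda>\<alpha>. f \<alpha> z) I" for z
  have "\<forall>e>0. \<exists>d>0. \<forall>y. norm (y - z) < d \<longrightarrow> norm (G y - G z - L (y - z)) \<le> e * norm (y - z)"
  proof (intro allI impI)
    fix e :: real assume e: "e > 0"
    obtain J where J: "finite J" "J \<subseteq> I" "dist (sum m J) (infsum m I) \<le> e / 4"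
      using infsum_finite_approximation[OF m, of "e/4"] e by auto
    have mI: "infsum m I = infsum m J + infsum m (I - J)"
      using infsum_Un_disjoint[of m J "I - J"] J m summable_on_subset_banach[OF m] by (simp add: Un_absorb1)
    have tail: "infsum m (I - J) \<le> e / 4" using J(1,3) mI by (simp add: dist_real_def)
    have "((\<lambda>z. \<Sum>\<alpha>\<in>J. f \<alpha> z) has_derivative (\<lambda>v. \<Sum>\<alpha>\<in>J. f' \<alpha> z v)) (at z)"
      by (intro has_derivative_sum d z) (use J in auto)
    then obtain d1 where d1: "d1 > 0" "\<And>y. norm (y - z) < d1 \<Longrightarrow>
        norm ((\<Sum>\<alpha>\<in>J. f \<alpha> y) - (\<Sum>\<alpha>\<in>J. f \<alpha> z) - (\<Sum>\<alpha>\<in>J. f' \<alpha> z (y - z))) \<le> e / 2 * norm (y - z)"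
      unfolding has_derivative_at_alt using e half_gt_zero by blast
    show "\<exists>d>0. \<forall>y. norm (y - z) < d \<longrightarrow> norm (G y - G z - L (y - z)) \<le> e * norm (y - z)"
    proof (intro exI[of _ "min d1 r"] conjI allI impI)
      show "min d1 r > 0" using d1 r by simp
      fix y assume y: "norm (y - z) < min d1 r"
      then have yS: "y \<in> S" using r by (auto simp: dist_norm norm_minus_commute)
      define g where "g \<alpha> = f \<alpha> y - f \<alpha> z - f' \<alpha> z (y - z)" for \<alpha>
      have gb: "norm (g \<alpha>) \<le> m \<alpha> * (2 * norm (y - z))" if \<alpha>: "\<alpha> \<in> I" for \<alpha>
      proof -
        have "norm (f \<alpha> y - f \<alpha> z) \<le> m \<alpha> * norm (y - z)"
        proof (rule differentiable_bound[OF S(2)])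
          fix x assume x: "x \<in> S"
          show "(f \<alpha> has_derivative f' \<alpha> x) (at x within S)" by (rule has_derivative_at_withinI[OF d[OF \<alpha> x]])
          show "onorm (f' \<alpha> x) \<le> m \<alpha>" by (rule onorm_bound[OF m0[OF \<alpha>] b[OF \<alpha> x]])
        qed (use yS z in auto)
        then have "norm (g \<alpha>) \<le> m \<alpha> * norm (y - z) + m \<alpha> * norm (y - z)"
          unfolding g_def using b[OF \<alpha> z, of "y - z"] norm_triangle_ineq4[of "f \<alpha> y - f \<alpha> z" "f' \<alpha> z (y - z)"] by linarith
        then show ?thesis by simp
      qed
      have gabs: "(\<lambda>\<alpha>. norm (g \<alpha>)) summable_on J'" if "J' \<subseteq> I" for J'
        by (rule Infinite_Sum.abs_summable_on_comparison_test'[where g="\<lambda>\<alpha>. m \<alpha> * (2 * norm (y - z))"])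
          (use gb that m in \<open>auto intro!: summable_on_cmult_left intro: summable_on_subset_banach\<close>)
      have gs: "g summable_on J'" if "J' \<subseteq> I" for J' using Infinite_Sum.abs_summable_summable[OF gabs[OF that]] .
      have "G y = infsum (\<lambda>\<alpha>. g \<alpha> + (f \<alpha> z + f' \<alpha> z (y - z))) I" unfolding G_def g_def by simp
      also have "\<dots> = infsum g I + infsum (\<lambda>\<alpha>. f \<alpha> z + f' \<alpha> z (y - z)) I"
        by (intro infsum_add gs summable_on_add s z sm) auto
      also have "infsum (\<lambda>\<alpha>. f \<alpha> z + f' \<alpha> z (y - z)) I = G z + L (y - z)"
        unfolding G_def L_def by (intro infsum_add s z sm) auto
      finally have "G y - G z - L (y - z) = infsum g I" by simp
      also have "\<dots> = infsum g J + infsum g (I - J)"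
        using infsum_Un_disjoint[of g J "I - J"] J gs by (simp add: Un_absorb1)
      also have "infsum g J = (\<Sum>\<alpha>\<in>J. f \<alpha> y) - (\<Sum>\<alpha>\<in>J. f \<alpha> z) - (\<Sum>\<alpha>\<in>J. f' \<alpha> z (y - z))"
        using J(1) by (simp add: g_def sum_subtractf)
      finally have "norm (G y - G z - L (y - z)) \<le> e / 2 * norm (y - z) + norm (infsum g (I - J))"
        using d1(2)[of y] y norm_triangle_ineq order_trans by (smt (verit) min_less_iff_conj)
      also have "norm (infsum g (I - J)) \<le> infsum (\<lambda>\<alpha>. norm (g \<alpha>)) (I - J)"
        by (rule norm_infsum_bound[OF gabs]) simp
      also have "\<dots> \<le> infsum (\<lambda>\<alpha>. m \<alpha> * (2 * norm (y - z))) (I - J)"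
        by (rule infsum_mono) (use gabs[of "I - J"] gb m in \<open>auto intro!: summable_on_cmult_left intro: summable_on_subset_banach\<close>)
      also have "\<dots> = infsum m (I - J) * (2 * norm (y - z))" by (rule infsum_cmult_left')
      also have "\<dots> \<le> e / 4 * (2 * norm (y - z))" using tail by (intro mult_right_mono) auto
      finally show "norm (G y - G z - L (y - z)) \<le> e * norm (y - z)" by (simp add: algebra_simps)
    qed
  qed
  then have "(G has_derivative L) (at z)" using bl by (simp add: has_derivative_at_alt)
  then show ?thesis by (simp add: G_def[abs_def] L_def[abs_def])
qed

lemma nat_le_two_power: "real n \<le> 2 ^ n"
  using less_exp[of n] of_nat_mono[of n "2 ^ n", where 'a=real] by simp

lemma clinear_eq_matrix:
  fixes L :: "complex^'n \<Rightarrow> complex^'m"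
  assumes "\<And>v w. L (v + w) = L v + L w" "\<And>c v. L (c *s v) = c *s L v"
  shows "L v = (\<chi> i j. L (axis j 1) $ i) *v v"
proof -
  have L0: "L 0 = 0" using assms(2)[of 0 0] by simp
  have "L (\<Sum>j\<in>J. v $ j *s axis j 1) = (\<Sum>j\<in>J. v $ j *s L (axis j 1))" for J
    by (induction J rule: infinite_finite_induct) (auto simp: L0 assms)
  from this[of UNIV] have "L v = (\<Sum>j\<in>UNIV. v $ j *s L (axis j 1))" by (simp add: basis_expansion)
  then show ?thesis by (simp add: vec_eq_iff matrix_vector_mult_def mult.commute)
qed

text \<open>The real power series is evaluated at complex arguments. Its convergence at one real
  point with all increments equal to \<rho> is absolute and provides a majorant at complex points
  with increments of modulus at most \<rho>. Termwise differentiation gives a complex linear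
  derivative.\<close>

lemma real_analytic_complexify:
  fixes \<phi> :: "real^'n \<Rightarrow> real^'m"
  assumes an: "real_analytic_on \<phi> W" and w0: "w0 \<in> W"
  shows "\<exists>\<Phi> N. cdiff_on \<Phi> N \<and> complex_vec w0 \<in> N \<and> (\<forall>w. complex_vec w \<in> N \<longrightarrow> \<Phi> (complex_vec w) = complex_vec (\<phi> w))"
proof -
  define I where "I = (Basis :: (real^'n) set) \<rightarrow>\<^sub>E (UNIV :: nat set)"
  obtain c :: "(real^'n \<Rightarrow> nat) \<Rightarrow> real^'m" and r where r: "r > 0" and
    sum: "\<And>x. x \<in> ball w0 r \<Longrightarrow> ((\<lambda>\<alpha>. (\<Prod>b\<in>Basis. ((x - w0) \<bullet> b) ^ \<alpha> b) *\<^sub>R c \<alpha>) has_sum \<phi> x) I"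
    using an w0 unfolding real_analytic_on_def I_def by blast
  define ex where "ex \<alpha> j = \<alpha> (axis j 1)" for \<alpha> :: "real^'n \<Rightarrow> nat" and j :: 'n
  have prodB: "(\<Prod>b\<in>Basis. (y \<bullet> b) ^ \<alpha> b) = (\<Prod>j\<in>UNIV. (y $ j) ^ ex \<alpha> j)" for y :: "real^'n" and \<alpha>
  proof -
    have B: "(Basis :: (real^'n) set) = range (\<lambda>j. axis j 1)" by (auto simp: Basis_vec_def)
    have inj: "inj (\<lambda>j::'n. axis j (1::real))" by (auto simp: inj_on_def axis_eq_axis)
    show ?thesis unfolding B prod.reindex[OF inj] by (simp add: ex_def inner_axis)
  qed
  \<comment> \<open>Small enough for the vector with all coordinates \<rho> to lie within the radius
    of convergence \<open>r\<close>.\<close>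
  define \<rho> where "\<rho> = r / (real CARD('n) + 1)"
  have \<rho>: "\<rho> > 0" using r by (simp add: \<rho>_def add_pos_pos)
  define mm where "mm i \<alpha> = \<bar>c \<alpha> $ i\<bar> * (\<Prod>j\<in>UNIV. \<rho> ^ ex \<alpha> j)" for i \<alpha>
  have mm: "mm i summable_on I" for i
  proof -
    define x where "x = w0 + (\<chi> j. \<rho>)"
    have "norm (\<chi> j. \<rho> :: real^'n) \<le> real CARD('n) * \<rho>" by (rule norm_vec_bound) (use \<rho> in auto)
    also have "\<dots> < r" using r by (simp add: \<rho>_def field_simps)
    finally have "x \<in> ball w0 r" by (simp add: x_def dist_norm)
    from has_sum_bounded_linear[OF bounded_linear_vec_nth[of i] sum[OF this]]
    have "((\<lambda>\<alpha>. (\<Prod>j\<in>UNIV. \<rho> ^ ex \<alpha> j) * c \<alpha> $ i) has_sum \<phi> x $ i) I"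
      unfolding prodB by (simp add: x_def)
    then have "(\<lambda>\<alpha>. (\<Prod>j\<in>UNIV. \<rho> ^ ex \<alpha> j) * c \<alpha> $ i) summable_on I"
      by (rule has_sum_imp_summable)
    then have "(\<lambda>\<alpha>. norm ((\<Prod>j\<in>UNIV. \<rho> ^ ex \<alpha> j) * c \<alpha> $ i)) summable_on I"
      by (rule summable_on_iff_abs_summable_on_real[THEN iffD1])
    moreover have "norm ((\<Prod>j\<in>UNIV. \<rho> ^ ex \<alpha> j) * c \<alpha> $ i) = mm i \<alpha>" for \<alpha>
    proof -
      have "0 \<le> (\<Prod>j\<in>UNIV. \<rho> ^ ex \<alpha> j)" using \<rho> by (intro prod_nonneg) auto
      then show ?thesis unfolding mm_def real_norm_def abs_mult by (simp only: abs_of_nonneg mult.commute)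
    qed
    ultimately show ?thesis by simp
  qed
  have mm0: "mm i \<alpha> \<ge> 0" for i \<alpha> using \<rho> by (simp add: mm_def prod_nonneg)
  \<comment> \<open>Halving the radius pays for the exponents produced by differentiation, since
    \<open>n \<le> 2 ^ n\<close>.\<close>
  define \<sigma> where "\<sigma> = \<rho> / 2"
  have \<sigma>: "\<sigma> > 0" using \<rho> by (simp add: \<sigma>_def)
  define N where "N = ball (complex_vec w0 :: complex^'n) \<sigma>"
  have N: "norm (z $ j - of_real (w0 $ j)) \<le> \<sigma>" if "z \<in> N" for z j
    using Finite_Cartesian_Product.norm_nth_le[of "z - complex_vec w0" j] that by (simp add: N_def dist_norm norm_minus_commute)
  define f where "f i \<alpha> z = of_real (c \<alpha> $ i) * (\<Prod>j\<in>UNIV. (z $ j - of_real (w0 $ j)) ^ ex \<alpha> j)" for i \<alpha> and z :: "complex^'n"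
  define f' where "f' i \<alpha> z v = of_real (c \<alpha> $ i) * (\<Sum>j\<in>UNIV. (of_nat (ex \<alpha> j) * v $ j * (z $ j - of_real (w0 $ j)) ^ (ex \<alpha> j - 1)) *
      (\<Prod>k\<in>UNIV - {j}. (z $ k - of_real (w0 $ k)) ^ ex \<alpha> k))" for i \<alpha> and z v :: "complex^'n"
  have df: "(f i \<alpha> has_derivative f' i \<alpha> z) (at z)" for i \<alpha> z
    unfolding f_def f'_def
  proof (intro has_derivative_mult_right has_derivative_prod)
    fix j
    have "((\<lambda>z::complex^'n. z $ j - of_real (w0 $ j)) has_derivative (\<lambda>v. v $ j)) (at z)"
      by (auto intro!: derivative_eq_intros bounded_linear.has_derivative[OF bounded_linear_vec_nth])
    from has_derivative_power[OF this, of "ex \<alpha> j"]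
    show "((\<lambda>z::complex^'n. (z $ j - of_real (w0 $ j)) ^ ex \<alpha> j) has_derivative
       (\<lambda>v. of_nat (ex \<alpha> j) * v $ j * (z $ j - of_real (w0 $ j)) ^ (ex \<alpha> j - 1))) (at z)" .
  qed
  have fb: "norm (f i \<alpha> z) \<le> mm i \<alpha>" if "z \<in> N" for i \<alpha> z
  proof -
    have "norm (z $ j - of_real (w0 $ j)) \<le> \<rho>" for j using N[OF that, of j] \<rho> by (simp add: \<sigma>_def)
    then show ?thesis unfolding f_def mm_def norm_mult prod_norm[symmetric] norm_power norm_of_real
      by (intro mult_left_mono prod_mono conjI power_mono) auto
  qed
  have f'b: "norm (f' i \<alpha> z v) \<le> (real CARD('n) / \<sigma> * mm i \<alpha>) * norm v" if z: "z \<in> N" for i \<alpha> z v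
  proof -
    have tb: "norm ((of_nat (ex \<alpha> j) * v $ j * (z $ j - of_real (w0 $ j)) ^ (ex \<alpha> j - 1)) *
      (\<Prod>k\<in>UNIV - {j}. (z $ k - of_real (w0 $ k)) ^ ex \<alpha> k)) \<le> (1 / \<sigma>) * (\<Prod>j\<in>UNIV. \<rho> ^ ex \<alpha> j) * norm v" for j
    proof -
      have a: "real (ex \<alpha> j) * norm ((z $ j - of_real (w0 $ j)) ^ (ex \<alpha> j - 1)) \<le> (1 / \<sigma>) * \<rho> ^ ex \<alpha> j"
      proof (cases "ex \<alpha> j")
        case (Suc n)
        have "norm ((z $ j - of_real (w0 $ j)) ^ n) \<le> \<sigma> ^ n" unfolding norm_power by (intro power_mono N z) simp
        then have "real (Suc n) * norm ((z $ j - of_real (w0 $ j)) ^ n) \<le> 2 ^ Suc n * \<sigma> ^ n"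
          using nat_le_two_power[of "Suc n"] by (intro mult_mono) auto
        also have "\<dots> = (1 / \<sigma>) * \<rho> ^ Suc n" using \<sigma> by (simp add: \<sigma>_def power_divide)
        finally show ?thesis by (simp add: Suc)
      qed (use \<sigma> in simp)
      have b: "norm (\<Prod>k\<in>UNIV - {j}. (z $ k - of_real (w0 $ k)) ^ ex \<alpha> k) \<le> (\<Prod>k\<in>UNIV - {j}. \<rho> ^ ex \<alpha> k)"
      proof -
        have "norm (z $ j - of_real (w0 $ j)) \<le> \<rho>" for j using N[OF z, of j] \<rho> by (simp add: \<sigma>_def)
        then show ?thesis unfolding prod_norm[symmetric] norm_power by (intro prod_mono conjI power_mono) auto
      qed
      have "norm ((of_nat (ex \<alpha> j) * v $ j * (z $ j - of_real (w0 $ j)) ^ (ex \<alpha> j - 1)) *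
        (\<Prod>k\<in>UNIV - {j}. (z $ k - of_real (w0 $ k)) ^ ex \<alpha> k)) =
        (real (ex \<alpha> j) * norm ((z $ j - of_real (w0 $ j)) ^ (ex \<alpha> j - 1))) * norm (\<Prod>k\<in>UNIV - {j}. (z $ k - of_real (w0 $ k)) ^ ex \<alpha> k) * norm (v $ j)"
        by (simp add: norm_mult)
      also have "\<dots> \<le> ((1 / \<sigma>) * \<rho> ^ ex \<alpha> j) * (\<Prod>k\<in>UNIV - {j}. \<rho> ^ ex \<alpha> k) * norm v"
        by (rule mult_mono[OF mult_mono[OF a b] Finite_Cartesian_Product.norm_nth_le])
          (use \<sigma> \<rho> in \<open>auto intro!: mult_nonneg_nonneg prod_nonneg divide_nonneg_nonneg\<close>)
      also have "\<rho> ^ ex \<alpha> j * (\<Prod>k\<in>UNIV - {j}. \<rho> ^ ex \<alpha> k) = (\<Prod>j\<in>UNIV. \<rho> ^ ex \<alpha> j)"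
        by (rule prod.remove[symmetric]) auto
      then have "((1 / \<sigma>) * \<rho> ^ ex \<alpha> j) * (\<Prod>k\<in>UNIV - {j}. \<rho> ^ ex \<alpha> k) * norm v = (1 / \<sigma>) * (\<Prod>j\<in>UNIV. \<rho> ^ ex \<alpha> j) * norm v"
        by (metis mult.assoc)
      finally show ?thesis .
    qed
    have "norm (f' i \<alpha> z v) \<le> \<bar>c \<alpha> $ i\<bar> * (\<Sum>j\<in>(UNIV::'n set). (1 / \<sigma>) * (\<Prod>j\<in>UNIV. \<rho> ^ ex \<alpha> j) * norm v)"
      unfolding f'_def norm_mult by (intro mult_mono sum_norm_le tb) (auto intro: sum_nonneg)
    also have "\<dots> = (real CARD('n) / \<sigma> * mm i \<alpha>) * norm v" by (simp add: mm_def)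
    finally show ?thesis .
  qed
  have fs: "(\<lambda>\<alpha>. f i \<alpha> z) summable_on I" if "z \<in> N" for i z
    by (rule Infinite_Sum.abs_summable_summable[OF Infinite_Sum.abs_summable_on_comparison_test'[OF mm[of i]]]) (use fb that in auto)
  have f's: "(\<lambda>\<alpha>. f' i \<alpha> z v) summable_on I" if "z \<in> N" for i z v
  proof -
    have "(\<lambda>\<alpha>. (real CARD('n) / \<sigma> * mm i \<alpha>) * norm v) summable_on I"
      by (intro summable_on_cmult_left summable_on_cmult_right mm)
    from Infinite_Sum.abs_summable_on_comparison_test'[OF this f'b[OF that]] show ?thesis
      by (rule Infinite_Sum.abs_summable_summable)
  qed
  define \<Phi> where "\<Phi> z = (\<chi> i. infsum (\<lambda>\<alpha>. f i \<alpha> z) I)" for z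
  have d\<Phi>: "(\<Phi> has_derivative (\<lambda>v. \<chi> i. infsum (\<lambda>\<alpha>. f' i \<alpha> z v) I)) (at z)" if z: "z \<in> N" for z
  proof (rule has_derivative_vecI)
    fix i
    have "((\<lambda>z. infsum (\<lambda>\<alpha>. f i \<alpha> z) I) has_derivative (\<lambda>v. infsum (\<lambda>\<alpha>. f' i \<alpha> z v) I)) (at z)"
    proof (rule has_derivative_infsum[of N I "f i" "f' i" "\<lambda>\<alpha>. real CARD('n) / \<sigma> * mm i \<alpha>"])
      show "(\<lambda>\<alpha>. real CARD('n) / \<sigma> * mm i \<alpha>) summable_on I" by (intro summable_on_cmult_right mm)
      show "open N" by (simp add: N_def)
      show "convex N" by (simp add: N_def)
      show "0 \<le> real CARD('n) / \<sigma> * mm i \<alpha>" for \<alpha> using mm0 \<sigma> by simp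
    qed (use df f'b fs z in blast)+
    then show "((\<lambda>z. \<Phi> z $ i) has_derivative (\<lambda>v. (\<chi> i. infsum (\<lambda>\<alpha>. f' i \<alpha> z v) I) $ i)) (at z)" by (simp add: \<Phi>_def)
  qed
  have "cdiff_on \<Phi> N"
    unfolding cdiff_on_def
  proof (intro conjI ballI)
    show "open N" by (simp add: N_def)
    fix z assume z: "z \<in> N"
    define L where "L v = (\<chi> i. infsum (\<lambda>\<alpha>. f' i \<alpha> z v) I)" for v
    have "L v = (\<chi> i j. L (axis j 1) $ i) *v v" for v
    proof (rule clinear_eq_matrix)
      show "L (v + w) = L v + L w" for v w
        using linear_add[OF has_derivative_linear[OF d\<Phi>[OF z]]] by (simp add: L_def)
      fix a v
      have "f' i \<alpha> z (a *s v) = a * f' i \<alpha> z v" for i \<alpha>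
        by (simp add: f'_def sum_distrib_left mult_ac)
      then show "L (a *s v) = a *s L v" by (simp add: L_def vec_eq_iff infsum_cmult_right')
    qed
    then have "L = (\<lambda>v. (\<chi> i j. L (axis j 1) $ i) *v v)" by blast
    moreover have "(\<Phi> has_derivative L) (at z)" using d\<Phi>[OF z] unfolding L_def .
    ultimately have "(\<Phi> has_derivative (\<lambda>v. (\<chi> i j. L (axis j 1) $ i) *v v)) (at z)" by simp
    then show "\<exists>J. (\<Phi> has_derivative (\<lambda>v. J *v v)) (at z)" by (rule exI)
  qed
  moreover have "complex_vec w0 \<in> N" using \<sigma> by (simp add: N_def)
  moreover have "\<Phi> (complex_vec w) = complex_vec (\<phi> w)" if w: "complex_vec w \<in> N" for w
  proof -
    have "dist w0 w < \<sigma>" using w by (simp add: N_def dist_norm complex_vec_diff[symmetric])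
    also have "\<sigma> \<le> r" using r by (simp add: \<sigma>_def \<rho>_def field_simps)
    finally have wb: "w \<in> ball w0 r" by simp
    have "((\<lambda>\<alpha>. (\<Prod>j\<in>UNIV. (w $ j - w0 $ j) ^ ex \<alpha> j) * c \<alpha> $ i) has_sum \<phi> w $ i) I" for i
      using has_sum_bounded_linear[OF bounded_linear_vec_nth[of i] sum[OF wb]] by (simp add: prodB)
    from has_sum_of_real[OF this, where 'a=complex]
    have "((\<lambda>\<alpha>. f i \<alpha> (complex_vec w)) has_sum of_real (\<phi> w $ i)) I" for i
      by (simp add: f_def mult.commute)
    then show ?thesis by (simp add: \<Phi>_def vec_eq_iff infsumI)
  qed
  ultimately show ?thesis by blast
qed

section \<open>Charts and tangent vectors of an analytic surface\<close>

lemma complex_matrix_vector_scaleR: "(B :: complex^'n^'m) *v (c *\<^sub>R v) = c *\<^sub>R (B *v v)"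
  by (simp add: matrix_vector_mult_def vec_eq_iff scaleR_sum_right)

text \<open>If all minors vanished, the rows would be proportional to a nonzero one, from which a
  kernel vector can be read off.\<close>

lemma injective_two_columns_minor:
  fixes J :: "real^2^4"
  assumes "inj (\<lambda>v. J *v v)"
  shows "\<exists>k l. J $ k $ 1 * J $ l $ 2 - J $ l $ 1 * J $ k $ 2 \<noteq> 0"
proof (rule ccontr)
  assume "\<not> ?thesis"
  then have z: "J $ k $ 1 * J $ l $ 2 = J $ l $ 1 * J $ k $ 2" for k l by simp
  have ker: "v = 0" if "J *v v = 0" for v using injD[OF assms, of v 0] that by simp
  have "\<exists>k. J $ k $ 1 \<noteq> 0"
  proof (rule ccontr)
    assume "\<not> ?thesis"
    then have "J *v axis 1 1 = 0" by (simp add: vec_eq_iff matrix_vector_mult_basis column_def)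
    from ker[OF this] show False by (simp add: axis_eq_0_iff)
  qed
  then obtain k where k: "J $ k $ 1 \<noteq> 0" by blast
  define v :: "real^2" where "v = (\<chi> i. if i = 1 then J $ k $ 2 else - J $ k $ 1)"
  have "J *v v = 0" using z[of k] by (simp add: vec_eq_iff matrix_vector_mult_def v_def sum_2 mult.commute)
  from ker[OF this] have "v $ 2 = 0" by simp
  then show False using k by (simp add: v_def)
qed

lemma surface_chart:
  assumes M: "analytic_surface M" and p: "p \<in> M"
  shows "\<exists>U W \<phi> (\<psi> :: real^4 \<Rightarrow> real^2) \<Phi> N. open U \<and> p \<in> U \<and> open W \<and> homeomorphism W (M \<inter> U) \<phi> \<psi> \<and>
    cdiff_on \<Phi> N \<and> complex_vec (\<psi> p) \<in> N \<and> (\<forall>w. complex_vec w \<in> N \<longrightarrow> \<Phi> (complex_vec w) = complex_vec (\<phi> w)) \<and>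
    (\<phi> has_derivative (\<lambda>v. jacobian \<phi> (at (\<psi> p)) *v v)) (at (\<psi> p)) \<and> inj (\<lambda>v. jacobian \<phi> (at (\<psi> p)) *v v)"
proof -
  obtain U W \<phi> \<psi> where U: "open U" "p \<in> U" "open W" and an: "real_analytic_on \<phi> W"
    and hom: "homeomorphism W (M \<inter> U) \<phi> (\<psi> :: real^4 \<Rightarrow> real^2)" and inj: "\<forall>w\<in>W. inj (frechet_derivative \<phi> (at w))"
    using M p unfolding analytic_surface_def by meson
  have w0: "\<psi> p \<in> W" using hom p U(2) unfolding homeomorphism_def by blast
  obtain \<Phi> N where \<Phi>: "cdiff_on \<Phi> N" "complex_vec (\<psi> p) \<in> N" "\<And>w. complex_vec w \<in> N \<Longrightarrow> \<Phi> (complex_vec w) = complex_vec (\<phi> w)"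
    using real_analytic_complexify[OF an w0] by blast
  have d: "(\<phi> has_derivative (\<lambda>v. jacobian \<phi> (at (\<psi> p)) *v v)) (at (\<psi> p))"
    by (rule real_restriction_jacobian(1)[OF \<Phi>])
  moreover have "frechet_derivative \<phi> (at (\<psi> p)) = (\<lambda>v. jacobian \<phi> (at (\<psi> p)) *v v)"
    using frechet_derivative_at[OF d] by simp
  then have "inj (\<lambda>v. jacobian \<phi> (at (\<psi> p)) *v v)" using inj w0 by metis
  ultimately show ?thesis using U hom \<Phi> by blast
qed

text \<open>The tangent space contains the image of the injective derivative of a chart, which is
  two-dimensional and does not fit into the line spanned by \<open>x\<close>.\<close>

lemma surface_tangent_vectors:
  assumes M: "analytic_surface M" and p: "p \<in> M"
  shows "\<exists>v\<in>tangent_space M p. \<forall>a. v \<noteq> a *\<^sub>R x \<or> x = 0 \<and> v \<noteq> 0"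
proof -
  obtain U W \<phi> \<psi> \<Phi> N where U: "open U" "p \<in> U" "open W" and hom: "homeomorphism W (M \<inter> U) \<phi> (\<psi> :: real^4 \<Rightarrow> real^2)"
    and \<Phi>: "cdiff_on \<Phi> N" "complex_vec (\<psi> p) \<in> N" "\<And>w. complex_vec w \<in> N \<Longrightarrow> \<Phi> (complex_vec w) = complex_vec (\<phi> w)"
    and d: "(\<phi> has_derivative (\<lambda>v. jacobian \<phi> (at (\<psi> p)) *v v)) (at (\<psi> p))" and inj: "inj (\<lambda>v. jacobian \<phi> (at (\<psi> p)) *v v)"
    using surface_chart[OF M p] by blast
  define w0 where "w0 = \<psi> p"
  define J where "J = jacobian \<phi> (at w0)"
  have w0: "w0 \<in> W" "\<phi> w0 = p" using hom p U(2) unfolding homeomorphism_def w0_def by auto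
  have tan: "J *v c \<in> tangent_space M p" for c
  proof -
    define \<gamma> where "\<gamma> s = \<phi> (w0 + s *\<^sub>R c)" for s
    have "((\<lambda>s. w0 + s *\<^sub>R c) has_derivative (\<lambda>s. s *\<^sub>R c)) (at 0)" by (auto intro!: derivative_eq_intros)
    moreover have "(\<phi> has_derivative (\<lambda>v. J *v v)) (at (w0 + 0 *\<^sub>R c))" using d by (simp add: w0_def J_def)
    ultimately have "(\<gamma> has_derivative (\<lambda>s. J *v (s *\<^sub>R c))) (at 0)" unfolding \<gamma>_def by (rule has_derivative_compose)
    then have dg: "(\<gamma> has_vector_derivative J *v c) (at 0)"
      by (simp add: has_vector_derivative_def matrix_vector_mult_scaleR)
    have "open ((\<lambda>s. w0 + s *\<^sub>R c) -` W)" using U(3) by (intro open_vimage) (auto intro!: continuous_intros)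
    moreover have "0 \<in> (\<lambda>s. w0 + s *\<^sub>R c) -` W" using w0 by simp
    ultimately obtain e where e: "e > 0" "ball 0 e \<subseteq> (\<lambda>s. w0 + s *\<^sub>R c) -` W" using open_contains_ball by blast
    have "\<gamma> ` {-e<..<e} \<subseteq> M"
    proof safe
      fix s assume "s \<in> {-e<..<e}"
      then have "w0 + s *\<^sub>R c \<in> W" using e by (auto simp: subset_eq dist_real_def abs_less_iff)
      then show "\<gamma> s \<in> M" using hom unfolding \<gamma>_def homeomorphism_def by blast
    qed
    then show ?thesis unfolding tangent_space_def using e(1) dg w0(2) by (auto simp: \<gamma>_def intro!: exI[of _ \<gamma>] exI[of _ e])
  qed
  have ker: "v = 0" if "J *v v = 0" for v using injD[OF inj, of v 0] that by (simp add: J_def w0_def)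
  show ?thesis
  proof (rule ccontr)
    assume "\<not> ?thesis"
    then have all: "\<exists>a. v = a *\<^sub>R x \<and> (x = 0 \<longrightarrow> v = 0)" if "v \<in> tangent_space M p" for v using that by auto
    obtain a b where a: "J *v axis 1 1 = a *\<^sub>R x" and b: "J *v axis 2 1 = b *\<^sub>R x" using all[OF tan] by metis
    have "J *v (b *\<^sub>R axis 1 1 - a *\<^sub>R axis 2 1) = 0"
      by (simp add: matrix_vector_mult_diff_distrib matrix_vector_mult_scaleR a b)
    from ker[OF this] have "(b *\<^sub>R axis 1 1 - a *\<^sub>R axis 2 1 :: real^2) $ 2 = 0" by simp
    then have "a = 0" by (simp add: axis_def)
    then have "J *v axis 1 1 = 0" using a by simp
    from ker[OF this] show False by (simp add: axis_eq_0_iff)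
  qed
qed

text \<open>Near a point the surface is a graph over two of the coordinates; \<open>Gk\<close> and \<open>Gl\<close> are the
  partial derivatives of the complexified graph function.\<close>

lemma surface_graph:
  assumes M: "analytic_surface M" and p: "p \<in> M"
  shows "\<exists>k l \<rho>. \<exists>Gk Gl :: 4 \<Rightarrow> complex \<Rightarrow> complex \<Rightarrow> complex. \<rho> > 0 \<and>
    (\<forall>S x y i. open S \<longrightarrow> x holomorphic_on S \<longrightarrow> y holomorphic_on S \<longrightarrow>
       (\<forall>z\<in>S. norm (x z - of_real (p $ k)) < \<rho> \<and> norm (y z - of_real (p $ l)) < \<rho>) \<longrightarrow>
       (\<lambda>z. Gk i (x z) (y z)) holomorphic_on S \<and> (\<lambda>z. Gl i (x z) (y z)) holomorphic_on S) \<and>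
    (\<forall>q\<in>M. dist q p < \<rho> \<longrightarrow> (\<forall>v\<in>tangent_space M q. \<forall>i. of_real (v $ i) =
       Gk i (of_real (q $ k)) (of_real (q $ l)) * of_real (v $ k) + Gl i (of_real (q $ k)) (of_real (q $ l)) * of_real (v $ l)))"
proof -
  obtain U W \<phi> \<psi> \<Phi> N where U: "open U" "p \<in> U" "open W" and hom: "homeomorphism W (M \<inter> U) \<phi> (\<psi> :: real^4 \<Rightarrow> real^2)"
    and \<Phi>: "cdiff_on \<Phi> N" "complex_vec (\<psi> p) \<in> N" "\<And>w. complex_vec w \<in> N \<Longrightarrow> \<Phi> (complex_vec w) = complex_vec (\<phi> w)"
    and d: "(\<phi> has_derivative (\<lambda>v. jacobian \<phi> (at (\<psi> p)) *v v)) (at (\<psi> p))" and inj: "inj (\<lambda>v. jacobian \<phi> (at (\<psi> p)) *v v)"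
    using surface_chart[OF M p] by blast
  define w0 where "w0 = complex_vec (\<psi> p)"
  obtain k l where kl: "jacobian \<phi> (at (\<psi> p)) $ k $ 1 * jacobian \<phi> (at (\<psi> p)) $ l $ 2 - jacobian \<phi> (at (\<psi> p)) $ l $ 1 * jacobian \<phi> (at (\<psi> p)) $ k $ 2 \<noteq> 0"
    using injective_two_columns_minor[OF inj] by blast
  define J where "J z = jacobian \<Phi> (at z)" for z
  define d where "d z = J z $ k $ 1 * J z $ l $ 2 - J z $ l $ 1 * J z $ k $ 2" for z
  have d0: "d w0 \<noteq> 0"
  proof -
    have "J w0 $ i $ j = of_real (jacobian \<phi> (at (\<psi> p)) $ i $ j)" for i j
      unfolding J_def w0_def by (rule real_restriction_jacobian(2)[OF \<Phi>])
    then have "d w0 = of_real (jacobian \<phi> (at (\<psi> p)) $ k $ 1 * jacobian \<phi> (at (\<psi> p)) $ l $ 2 - jacobian \<phi> (at (\<psi> p)) $ l $ 1 * jacobian \<phi> (at (\<psi> p)) $ k $ 2)"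
      by (simp add: d_def)
    then show ?thesis using kl by (simp only: of_real_eq_0_iff not_False_eq_True)
  qed
  define pr where "pr y = (\<chi> j::2. if j = 1 then y $ k else y $ l)" for y :: "complex^4"
  define Q where "Q z = (\<chi> j::2. if j = 1 then J z $ k else J z $ l)" for z
  \<comment> \<open>The complexified chart followed by projection to the coordinates
    \<open>k\<close> and \<open>l\<close>. Its Jacobian determinant \<open>d\<close> does not vanish
    at \<open>w0\<close>, so it is locally invertible, and these two coordinates become parameters
    of the surface.\<close>
  define \<Psi> where "\<Psi> z = pr (\<Phi> z)" for z
  have d\<Psi>: "(\<Psi> has_derivative (\<lambda>v. Q z *v v)) (at z)" if z: "z \<in> N" for z
  proof (rule has_derivative_vecI)
    fix j
    have "((\<lambda>z. \<Phi> z $ i) has_derivative (\<lambda>v. (J z *v v) $ i)) (at z)" for i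
      unfolding J_def by (rule bounded_linear.has_derivative[OF bounded_linear_vec_nth cdiff_on_jacobian[OF \<Phi>(1) z]])
    then show "((\<lambda>x. \<Psi> x $ j) has_derivative (\<lambda>v. (Q z *v v) $ j)) (at z)"
      by (cases "j = 1") (simp_all add: \<Psi>_def pr_def Q_def matrix_vector_mult_def)
  qed
  have detQ: "det (Q z) = d z" for z by (simp add: det_2 Q_def d_def)
  have N: "open N" using \<Phi>(1) by (simp add: cdiff_on_def)
  define f' where "f' z = Blinfun (\<lambda>v. Q z *v v)" for z
  have f': "blinfun_apply (f' z) = (\<lambda>v. Q z *v v)" for z
    unfolding f'_def by (rule bounded_linear_Blinfun_apply) simp
  have contJ: "continuous_on N (\<lambda>z. J z $ i $ j)" for i j unfolding J_def by (rule jacobian_entry_continuous[OF \<Phi>(1)])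
  have "continuous_on N f'"
  proof (rule continuous_on_blinfun_componentwise)
    fix i :: "complex^2"
    have E: "(\<lambda>z. blinfun_apply (f' z) i) = (\<lambda>z. \<chi> j. if j = 1 then \<Sum>m\<in>UNIV. J z $ k $ m * i $ m else \<Sum>m\<in>UNIV. J z $ l $ m * i $ m)"
      by (auto simp: f' matrix_vector_mult_def Q_def vec_eq_iff)
    have C: "continuous_on N (\<lambda>z. if j = 1 then \<Sum>m\<in>UNIV. J z $ k $ m * i $ m else \<Sum>m\<in>UNIV. J z $ l $ m * i $ m)" for j :: 2
      by (cases "j = 1") (auto intro!: continuous_intros contJ)
    show "continuous_on N (\<lambda>z. blinfun_apply (f' z) i)" unfolding E by (rule continuous_on_vec_lambda) (rule C)
  qed
  moreover have "\<And>z. z \<in> N \<Longrightarrow> (\<Psi> has_derivative blinfun_apply (f' z)) (at z)" using d\<Psi> by (simp add: f')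
  moreover have w0N: "w0 \<in> N" using \<Phi>(2) by (simp add: w0_def)
  moreover have "Blinfun (\<lambda>v. matrix_inv (Q w0) *v v) o\<^sub>L f' w0 = id_blinfun"
  proof (rule blinfun_eqI)
    fix v
    have "invertible (Q w0)" using d0 by (simp add: invertible_det_nz detQ)
    then show "blinfun_apply (Blinfun (\<lambda>v. matrix_inv (Q w0) *v v) o\<^sub>L f' w0) v = blinfun_apply id_blinfun v"
      by (simp add: f' bounded_linear_Blinfun_apply matrix_vector_mul_assoc matrix_inv_mult)
  qed
  ultimately obtain U' V' \<theta> g' where UV: "open U'" "U' \<subseteq> N" "w0 \<in> U'" "open V'" "\<Psi> w0 \<in> V'"
    and hom2: "homeomorphism U' V' \<Psi> \<theta>" and d\<theta>: "\<And>y. y \<in> V' \<Longrightarrow> (\<theta> has_derivative (g' y)) (at y)"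
    and g': "\<And>y. y \<in> V' \<Longrightarrow> g' y = inv_into UNIV (blinfun_apply (f' (\<theta> y)))"
    and bij: "\<And>y. y \<in> V' \<Longrightarrow> bij (blinfun_apply (f' (\<theta> y)))"
    using inverse_function_theorem[OF N] by metis
  have invQ: "invertible (Q (\<theta> y))" if y: "y \<in> V'" for y
  proof -
    have "inj ((*v) (Q (\<theta> y)))" using bij[OF y] by (simp add: f' bij_is_inj)
    then show ?thesis using matrix_left_invertible_injective[of "Q (\<theta> y)"] invertible_left_inverse[of "Q (\<theta> y)"] by blast
  qed
  have g'Q: "g' y = (\<lambda>v. matrix_inv (Q (\<theta> y)) *v v)" if y: "y \<in> V'" for y
    unfolding g'[OF y] f'
    by (rule inv_equality) (simp_all add: matrix_vector_mul_assoc matrix_inv_mult[OF invQ[OF y]])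
  \<comment> \<open>The derivative of the inverse map is again multiplication by a complex matrix,
    which is complex differentiability.\<close>
  have cd\<theta>: "cdiff_on \<theta> V'" unfolding cdiff_on_def using UV(4) d\<theta> g'Q by metis
  have \<theta>N: "\<theta> y \<in> N" if "y \<in> V'" for y using hom2 UV(2) that unfolding homeomorphism_def by blast
  have dnz: "d (\<theta> y) \<noteq> 0" if "y \<in> V'" for y using invQ[OF that] by (simp add: invertible_det_nz detQ)
  define vec2 where "vec2 x y = (\<chi> j::2. if j = 1 then x else y)" for x y :: complex
  \<comment> \<open>By Cramer's rule, \<open>Gk\<close> and \<open>Gl\<close> are the two columns of
    \<open>J z\<close> times the inverse of the 2 by 2 matrix \<open>Q z\<close>.\<close>
  define Gk where "Gk i x y = (let z = \<theta> (vec2 x y) in (J z $ i $ 1 * J z $ l $ 2 - J z $ l $ 1 * J z $ i $ 2) / d z)" for i x y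
  define Gl where "Gl i x y = (let z = \<theta> (vec2 x y) in (J z $ k $ 1 * J z $ i $ 2 - J z $ i $ 1 * J z $ k $ 2) / d z)" for i x y
  have \<phi>\<psi>: "\<phi> (\<psi> q) = q" if "q \<in> M \<inter> U" for q using hom that unfolding homeomorphism_def by blast
  have \<Psi>w0: "\<Psi> w0 = vec2 (of_real (p $ k)) (of_real (p $ l))"
    using \<phi>\<psi>[of p] p U(2) by (simp add: \<Psi>_def pr_def vec2_def w0_def \<Phi>(3)[OF \<Phi>(2)] vec_eq_iff)
  obtain e where e: "e > 0" "ball (\<Psi> w0) e \<subseteq> V'" using UV(4,5) open_contains_ball by blast
  have vV: "vec2 x y \<in> V'" if "norm (x - of_real (p $ k)) < e / 2" "norm (y - of_real (p $ l)) < e / 2" for x y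
  proof -
    have "norm (vec2 x y - \<Psi> w0) \<le> (\<Sum>j\<in>UNIV. norm ((vec2 x y - \<Psi> w0) $ j))" unfolding norm_vec_def by (rule L2_set_le_sum) simp
    also have "\<dots> < e" using that by (simp add: sum_2 \<Psi>w0 vec2_def)
    finally show ?thesis using e(2) by (auto simp: dist_norm norm_minus_commute)
  qed
  have hol: "(\<lambda>z. Gk i (x z) (y z)) holomorphic_on S \<and> (\<lambda>z. Gl i (x z) (y z)) holomorphic_on S"
    if S: "open S" "x holomorphic_on S" "y holomorphic_on S"
      "\<forall>z\<in>S. norm (x z - of_real (p $ k)) < e / 2 \<and> norm (y z - of_real (p $ l)) < e / 2" for S x y i
  proof -
    have c1: "holo_curve (\<lambda>z. vec2 (x z) (y z)) S" unfolding holo_curve_def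
    proof
      fix j :: 2 show "(\<lambda>z. vec2 (x z) (y z) $ j) holomorphic_on S" using S by (cases "j = 1") (simp_all add: vec2_def)
    qed
    have c1V: "(\<lambda>z. vec2 (x z) (y z)) ` S \<subseteq> V'" using vV S(4) by blast
    have c2: "holo_curve (\<lambda>z. \<theta> (vec2 (x z) (y z))) S" by (rule cdiff_on_curve_holomorphic[OF cd\<theta> c1 S(1) c1V])
    have JJ: "(\<lambda>z. J (\<theta> (vec2 (x z) (y z))) $ i $ j) holomorphic_on S" for i j unfolding J_def
      by (rule jacobian_entry_curve_holomorphic[OF \<Phi>(1) c2 S(1)]) (use \<theta>N c1V in blast)
    show ?thesis unfolding Gk_def Gl_def Let_def
      using dnz c1V by (intro conjI holomorphic_on_divide holomorphic_on_diff holomorphic_on_mult JJ) (auto simp: d_def[abs_def] intro!: holomorphic_intros JJ)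
  qed
  have contpsi: "continuous_on (M \<inter> U) (\<lambda>q. complex_vec (\<psi> q))"
  proof (rule continuous_on_compose2[OF linear_continuous_on[OF bounded_linear_complex_vec] _ subset_UNIV])
    show "continuous_on (M \<inter> U) \<psi>" using hom by (simp add: homeomorphism_def)
  qed
  have "openin (top_of_set (M \<inter> U)) (M \<inter> U \<inter> (\<lambda>q. complex_vec (\<psi> q)) -` U')"
    by (rule continuous_openin_preimage_gen[OF contpsi UV(1)])
  \<comment> \<open>Points of \<open>M\<close> close to \<open>p\<close> in space must have close
    parameters; this is where continuity of the inverse chart, that is, the embedding of the
    surface, enters.\<close>
  then obtain T where T: "open T" "M \<inter> U \<inter> (\<lambda>q. complex_vec (\<psi> q)) -` U' = M \<inter> U \<inter> T" unfolding openin_open by blast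
  have pT: "p \<in> U \<inter> T" using T(2) p U(2) UV(3) by (auto simp: w0_def)
  obtain e' where e': "e' > 0" "ball p e' \<subseteq> U \<inter> T" using U(1) T(1) pT open_contains_ball[of "U \<inter> T"] by blast
  have inv\<theta>: "complex_vec (\<psi> q) = \<theta> (vec2 (of_real (q $ k)) (of_real (q $ l))) \<and> vec2 (of_real (q $ k)) (of_real (q $ l)) \<in> V'"
    if q: "q \<in> M" "dist q p < e'" for q
  proof -
    have "q \<in> ball p e'" using q(2) by (simp add: dist_commute)
    then have UT: "q \<in> U \<inter> T" using e'(2) by blast
    then have qU: "q \<in> M \<inter> U" using q(1) by blast
    have "q \<in> M \<inter> U \<inter> (\<lambda>q. complex_vec (\<psi> q)) -` U'" unfolding T(2) using UT q(1) by blast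
    then have qU': "complex_vec (\<psi> q) \<in> U'" by simp
    have "complex_vec (\<psi> q) \<in> N" using UV(2) qU' by blast
    from \<Phi>(3)[OF this] have "\<Psi> (complex_vec (\<psi> q)) = vec2 (of_real (q $ k)) (of_real (q $ l))"
      using \<phi>\<psi>[OF qU] by (simp add: \<Psi>_def pr_def vec2_def vec_eq_iff)
    moreover have "\<theta> (\<Psi> (complex_vec (\<psi> q))) = complex_vec (\<psi> q)" using hom2 qU' unfolding homeomorphism_def by blast
    moreover have "\<Psi> (complex_vec (\<psi> q)) \<in> V'" using hom2 qU' unfolding homeomorphism_def by blast
    ultimately show ?thesis by metis
  qed
  have tan: "of_real (v $ i) = Gk i (of_real (q $ k)) (of_real (q $ l)) * of_real (v $ k) + Gl i (of_real (q $ k)) (of_real (q $ l)) * of_real (v $ l)"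
    if q: "q \<in> M" "dist q p < e'" and v: "v \<in> tangent_space M q" for q v i
  proof -
    obtain \<gamma> \<epsilon> where \<gamma>: "\<epsilon> > 0" "\<gamma> ` {-\<epsilon><..<\<epsilon>} \<subseteq> M" "\<gamma> 0 = q" "(\<gamma> has_vector_derivative v) (at 0)"
      using v unfolding tangent_space_def by blast
    \<comment> \<open>The coordinates \<open>k\<close> and \<open>l\<close> of the curve \<gamma>
      recover the whole curve through the complexified chart; differentiation of this identity at 0
      gives the relation for its velocity.\<close>
    define Y where "Y s = vec2 (of_real (\<gamma> s $ k)) (of_real (\<gamma> s $ l))" for s
    have dY: "(Y has_vector_derivative vec2 (of_real (v $ k)) (of_real (v $ l))) (at 0)"
      unfolding has_vector_derivative_def
    proof (rule has_derivative_vecI)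
      fix j :: 2
      have "((\<lambda>s. complex_of_real (\<gamma> s $ i)) has_derivative (\<lambda>h. of_real ((h *\<^sub>R v) $ i))) (at 0)" for i
        using \<gamma>(4) unfolding has_vector_derivative_def
        by (intro bounded_linear.has_derivative[OF bounded_linear_of_real] bounded_linear.has_derivative[OF bounded_linear_vec_nth])
      then show "((\<lambda>s. Y s $ j) has_derivative (\<lambda>h. (h *\<^sub>R vec2 (of_real (v $ k)) (of_real (v $ l))) $ j)) (at 0)"
        by (cases "j = 1") (simp_all add: Y_def vec2_def scaleR_conv_of_real[where 'a=complex])
    qed
    define z where "z = \<theta> (Y 0)"
    have Y0: "Y 0 \<in> V'" "Y 0 = vec2 (of_real (q $ k)) (of_real (q $ l))" using inv\<theta>[OF q] \<gamma>(3) by (auto simp: Y_def)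
    define u where "u = matrix_inv (Q z) *v vec2 (of_real (v $ k)) (of_real (v $ l))"
    have "((\<lambda>s. \<theta> (Y s)) has_derivative (\<lambda>h. matrix_inv (Q z) *v (h *\<^sub>R vec2 (of_real (v $ k)) (of_real (v $ l))))) (at 0)"
      using has_derivative_compose[OF dY[unfolded has_vector_derivative_def] d\<theta>[OF Y0(1)]] unfolding g'Q[OF Y0(1)] z_def .
    from has_derivative_compose[OF this, of \<Phi> "\<lambda>v. J z *v v"]
    have "((\<lambda>s. \<Phi> (\<theta> (Y s))) has_derivative (\<lambda>h. J z *v (matrix_inv (Q z) *v (h *\<^sub>R vec2 (of_real (v $ k)) (of_real (v $ l)))))) (at 0)"
      using cdiff_on_jacobian[OF \<Phi>(1) \<theta>N[OF Y0(1)]] unfolding z_def J_def .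
    then have 1: "((\<lambda>s. \<Phi> (\<theta> (Y s))) has_vector_derivative J z *v u) (at 0)"
      by (simp add: has_vector_derivative_def u_def complex_matrix_vector_scaleR)
    have "isCont \<gamma> 0" using \<gamma>(4) has_vector_derivative_continuous by blast
    then have "\<forall>\<^sub>F s in nhds 0. dist (\<gamma> s) (\<gamma> 0) < e' - dist q p"
      unfolding isCont_def tendsto_at_iff_tendsto_nhds using q(2) by (intro tendstoD) auto
    then obtain \<epsilon>2 where \<epsilon>2: "\<epsilon>2 > 0" "\<And>s. dist s 0 < \<epsilon>2 \<Longrightarrow> dist (\<gamma> s) q < e' - dist q p"
      unfolding eventually_nhds_metric \<gamma>(3) by blast
    define S where "S = {- min \<epsilon> \<epsilon>2<..<min \<epsilon> \<epsilon>2}"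
    have S: "open S" "0 \<in> S" using \<gamma>(1) \<epsilon>2(1) by (auto simp: S_def)
    have eqS: "\<Phi> (\<theta> (Y s)) = complex_vec (\<gamma> s)" if s: "s \<in> S" for s
    proof -
      have gM: "\<gamma> s \<in> M" using \<gamma>(2) s by (auto simp: S_def)
      have "dist s 0 < \<epsilon>2" using s by (auto simp: S_def dist_real_def abs_less_iff)
      then have gd: "dist (\<gamma> s) p < e'" using \<epsilon>2(2)[of s] dist_triangle[of "\<gamma> s" p q] by linarith
      have i: "complex_vec (\<psi> (\<gamma> s)) = \<theta> (Y s)" "Y s \<in> V'" using inv\<theta>[OF gM gd] by (auto simp: Y_def)
      have "\<gamma> s \<in> ball p e'" using gd by (simp add: dist_commute)
      then have gU: "\<gamma> s \<in> M \<inter> U" using gM e'(2) by blast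
      have "complex_vec (\<psi> (\<gamma> s)) \<in> N" using i \<theta>N by simp
      from \<Phi>(3)[OF this] show ?thesis using i \<phi>\<psi>[OF gU] by simp
    qed
    have "((\<lambda>s. complex_vec (\<gamma> s)) has_vector_derivative J z *v u) (at 0)"
      by (rule has_vector_derivative_transform_within_open[OF 1 S]) (rule eqS)
    moreover have "((\<lambda>s. complex_vec (\<gamma> s)) has_vector_derivative complex_vec v) (at 0)"
      by (rule bounded_linear.has_vector_derivative[OF bounded_linear_complex_vec \<gamma>(4)])
    ultimately have "complex_vec v = J z *v u" by (rule vector_derivative_unique_at[rotated])
    then have vi: "of_real (v $ i) = J z $ i $ 1 * u $ 1 + J z $ i $ 2 * u $ 2" for i
      by (simp add: vec_eq_iff matrix_vector_mult_def sum_2)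
    have dz: "d z \<noteq> 0" using dnz[OF Y0(1)] by (simp add: z_def)
    have "of_real (v $ i) * d z = (J z $ i $ 1 * J z $ l $ 2 - J z $ l $ 1 * J z $ i $ 2) * of_real (v $ k) +
        (J z $ k $ 1 * J z $ i $ 2 - J z $ i $ 1 * J z $ k $ 2) * of_real (v $ l)"
      unfolding vi d_def by (simp add: algebra_simps)
    then have "of_real (v $ i) = ((J z $ i $ 1 * J z $ l $ 2 - J z $ l $ 1 * J z $ i $ 2) * of_real (v $ k) +
        (J z $ k $ 1 * J z $ i $ 2 - J z $ i $ 1 * J z $ k $ 2) * of_real (v $ l)) / d z"
      using dz by (simp add: eq_divide_eq)
    then show ?thesis unfolding Gk_def Gl_def Let_def Y0(2)[symmetric] z_def[symmetric] by (simp add: add_divide_distrib)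
  qed
  have h: "(\<lambda>z. Gk i (x z) (y z)) holomorphic_on S \<and> (\<lambda>z. Gl i (x z) (y z)) holomorphic_on S"
    if "open S" "x holomorphic_on S" "y holomorphic_on S"
      "\<forall>z\<in>S. norm (x z - of_real (p $ k)) < min (e / 2) e' \<and> norm (y z - of_real (p $ l)) < min (e / 2) e'" for S x y i
    by (rule hol[OF that(1-3)]) (use that(4) in \<open>simp add: min_less_iff_conj\<close>)
  have t: "of_real (v $ i) = Gk i (of_real (q $ k)) (of_real (q $ l)) * of_real (v $ k) + Gl i (of_real (q $ k)) (of_real (q $ l)) * of_real (v $ l)"
    if "q \<in> M" "dist q p < min (e / 2) e'" "v \<in> tangent_space M q" for q v i
    by (rule tan[OF that(1) _ that(3)]) (use that(2) in simp)
  have pos: "min (e / 2) e' > 0" using e e' by simp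
  have H: "\<forall>S x y i. open S \<longrightarrow> x holomorphic_on S \<longrightarrow> y holomorphic_on S \<longrightarrow>
      (\<forall>z\<in>S. norm (x z - of_real (p $ k)) < min (e / 2) e' \<and> norm (y z - of_real (p $ l)) < min (e / 2) e') \<longrightarrow>
      (\<lambda>z. Gk i (x z) (y z)) holomorphic_on S \<and> (\<lambda>z. Gl i (x z) (y z)) holomorphic_on S"
    by (intro allI impI, rule h, assumption+)
  have T: "\<forall>q\<in>M. dist q p < min (e / 2) e' \<longrightarrow> (\<forall>v\<in>tangent_space M q. \<forall>i. of_real (v $ i) =
      Gk i (of_real (q $ k)) (of_real (q $ l)) * of_real (v $ k) + Gl i (of_real (q $ k)) (of_real (q $ l)) * of_real (v $ l))"
    by (intro allI ballI impI, rule t, assumption+)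
  show ?thesis
    by (rule exI[of _ k], rule exI[of _ l], rule exI[of _ "min (e / 2) e'"], rule exI[of _ Gk], rule exI[of _ Gl],
        rule conjI[OF pos conjI[OF H T]])
qed

section \<open>Solutions bounded at one end of the orbit\<close>

lemma jacobian_difference_bound:
  assumes cx: "complexification V U F" and x: "(x \<longlongrightarrow> p) \<F>" and \<eta>: "\<eta> > 0"
  shows "\<forall>\<^sub>F t in \<F>. \<forall>v. norm (jacobian V (at (x t)) *v v - jacobian V (at p) *v v) \<le> \<eta> * norm v"
proof -
  have F: "cdiff_on F U" using cx by (auto simp: complexification_def cdiff_on_def)
  have pU: "complex_vec y \<in> U" for y using cx by (simp add: complexification_def)
  have U: "open U" using cx by (simp add: complexification_def)
  have lim: "((\<lambda>t. complex_vec (x t)) \<longlongrightarrow> complex_vec p) \<F>"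
    by (rule bounded_linear.tendsto[OF bounded_linear_complex_vec x])
  have "\<forall>\<^sub>F t in \<F>. norm (jacobian F (at (complex_vec (x t))) $ i $ j - jacobian F (at (complex_vec p)) $ i $ j) < \<eta> / 16" for i j
  proof -
    have "isCont (\<lambda>z. jacobian F (at z) $ i $ j) (complex_vec p)"
      using jacobian_entry_continuous[OF F] U pU by (simp add: continuous_on_eq_continuous_at)
    from tendstoD[OF isCont_tendsto_compose[OF this lim], of "\<eta> / 16"] \<eta> show ?thesis by (simp add: dist_norm)
  qed
  then have "\<forall>\<^sub>F t in \<F>. \<forall>i j. norm (jacobian F (at (complex_vec (x t))) $ i $ j - jacobian F (at (complex_vec p)) $ i $ j) < \<eta> / 16"
    by (simp add: eventually_all_finite)
  then show ?thesis
  proof (rule eventually_mono)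
    fix t assume b: "\<forall>i j. norm (jacobian F (at (complex_vec (x t))) $ i $ j - jacobian F (at (complex_vec p)) $ i $ j) < \<eta> / 16"
    show "\<forall>v. norm (jacobian V (at (x t)) *v v - jacobian V (at p) *v v) \<le> \<eta> * norm v"
    proof
      fix v
      have "norm (jacobian V (at (x t)) *v v - jacobian V (at p) *v v) =
        norm ((jacobian F (at (complex_vec (x t))) - jacobian F (at (complex_vec p))) *v complex_vec v)"
        using complexification_mult_real[OF cx] by (simp add: matrix_vector_mult_diff_rdistrib complex_vec_diff[symmetric])
      also have "\<dots> \<le> real CARD(4) * (real CARD(4) * (\<eta> / 16)) * norm (complex_vec v)"
        by (rule norm_matrix_vector_bound) (use b less_imp_le in auto)
      finally show "norm (jacobian V (at (x t)) *v v - jacobian V (at p) *v v) \<le> \<eta> * norm v" by simp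
    qed
  qed
qed

abbreviation sgn_form :: "4 \<Rightarrow> real" where "sgn_form \<equiv> (\<lambda>i. if i = 1 \<or> i = 2 then -1 else 1)"

lemma bounded_VE_solutions_negative:
  assumes cx: "complexification V U F"
    and c: "c > 0" "\<And>v. c * (norm v)\<^sup>2 \<le> 2 * qf sg W v (jacobian V (at 0) *v v)"
    and x: "(x \<longlongrightarrow> 0) at_top"
  shows "\<exists>T\<ge>T0. \<forall>\<xi>. (\<forall>t\<ge>T0. (\<xi> has_vector_derivative jacobian V (at (x t)) *v \<xi> t) (at t)) \<longrightarrow> bounded (\<xi> ` {T0..}) \<longrightarrow>
           (\<forall>t\<ge>T. \<xi> t \<noteq> 0 \<longrightarrow> qf sg W (\<xi> t) (\<xi> t) < 0)"
  by (rule bounded_solution_negative[OF c jacobian_difference_bound[OF cx x]])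

text \<open>Reversal of time changes the sign of the coefficient matrix, and the form with opposite
  weights increases along the reversed equation.\<close>

lemma bounded_VE_solutions_positive:
  assumes cx: "complexification V U F"
    and c: "c > 0" "\<And>v. c * (norm v)\<^sup>2 \<le> 2 * qf sg W v (jacobian V (at 0) *v v)"
    and x: "(x \<longlongrightarrow> 0) at_bot"
  shows "\<exists>T\<le>T0. \<forall>\<xi>. (\<forall>t\<le>T0. (\<xi> has_vector_derivative jacobian V (at (x t)) *v \<xi> t) (at t)) \<longrightarrow> bounded (\<xi> ` {..T0}) \<longrightarrow>
           (\<forall>t\<le>T. \<xi> t \<noteq> 0 \<longrightarrow> qf (\<lambda>i. - sg i) W (\<xi> t) (\<xi> t) < 0)"
proof -
  have um: "(- A) *v v = - (A *v v)" for A :: "real^4^4" and v by (simp add: matrix_vector_mult_def vec_eq_iff sum_negf)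
  have "\<exists>T\<ge>-T0. \<forall>\<xi>. (\<forall>t\<ge>-T0. (\<xi> has_vector_derivative (- jacobian V (at (x (-t)))) *v \<xi> t) (at t)) \<longrightarrow> bounded (\<xi> ` {-T0..}) \<longrightarrow>
           (\<forall>t\<ge>T. \<xi> t \<noteq> 0 \<longrightarrow> qf (\<lambda>i. - sg i) W (\<xi> t) (\<xi> t) < 0)"
  proof (rule bounded_solution_negative[OF c(1)])
    show "c * (norm v)\<^sup>2 \<le> 2 * qf (\<lambda>i. - sg i) W v ((- jacobian V (at 0)) *v v)" for v
      using c(2)[of v] by (simp add: um qf_uminus)
    have "((\<lambda>t. x (- t)) \<longlongrightarrow> 0) at_top" using x by (simp add: filterlim_at_bot_mirror)
    from jacobian_difference_bound[OF cx this]
    show "\<forall>\<^sub>F t in at_top. \<forall>v. norm ((- jacobian V (at (x (- t)))) *v v - (- jacobian V (at 0)) *v v) \<le> \<eta> * norm v" if "\<eta> > 0" for \<eta>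
      using that by (simp add: um norm_minus_commute)
  qed
  then obtain T where T: "T \<ge> -T0" "\<And>\<xi> t. (\<And>t. t\<ge>-T0 \<Longrightarrow> (\<xi> has_vector_derivative (- jacobian V (at (x (-t)))) *v \<xi> t) (at t)) \<Longrightarrow>
      bounded (\<xi> ` {-T0..}) \<Longrightarrow> t \<ge> T \<Longrightarrow> \<xi> t \<noteq> 0 \<Longrightarrow> qf (\<lambda>i. - sg i) W (\<xi> t) (\<xi> t) < 0"
    by blast
  show ?thesis
  proof (intro exI[of _ "-T"] conjI allI impI)
    show "- T \<le> T0" using T(1) by simp
    fix \<xi> t assume d: "\<forall>t\<le>T0. (\<xi> has_vector_derivative jacobian V (at (x t)) *v \<xi> t) (at t)"
      and b: "bounded (\<xi> ` {..T0})" and t: "t \<le> - T" "\<xi> t \<noteq> 0"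
    define \<zeta> where "\<zeta> s = \<xi> (- s)" for s
    have "qf (\<lambda>i. - sg i) W (\<zeta> (- t)) (\<zeta> (- t)) < 0"
    proof (rule T(2))
      fix s assume s: "s \<ge> - T0"
      have n: "((\<lambda>s. - s) has_vector_derivative -1) (at s)"
        by (auto intro!: derivative_eq_intros simp: has_real_derivative_iff_has_vector_derivative[symmetric])
      have "(\<xi> has_vector_derivative jacobian V (at (x (-s))) *v \<xi> (-s)) (at (-s))" using d s by auto
      from vector_diff_chain_at[OF n this]
      have "((\<xi> \<circ> (\<lambda>s. - s)) has_vector_derivative (-1) *\<^sub>R (jacobian V (at (x (-s))) *v \<xi> (-s))) (at s)" .
      then show "(\<zeta> has_vector_derivative (- jacobian V (at (x (- s)))) *v \<zeta> s) (at s)"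
        by (simp add: um \<zeta>_def[abs_def] o_def)
    next
      have "\<zeta> ` {-T0..} = \<xi> ` {..T0}" by (force simp: \<zeta>_def image_iff intro: bexI[of _ "- _"])
      then show "bounded (\<zeta> ` {-T0..})" using b by simp
    qed (use t in \<open>auto simp: \<zeta>_def\<close>)
    then show "qf (\<lambda>i. - sg i) W (\<xi> t) (\<xi> t) < 0" by (simp add: \<zeta>_def)
  qed
qed

text \<open>Cramer's rule in a plane given as a graph over the coordinates \<open>k\<close> and
  \<open>l\<close>; the coefficients are quotients of minors.\<close>

lemma pl_solve:
  fixes x y z :: "complex^'n"
  assumes z: "\<And>i. z $ i = g i * z $ k + h i * z $ l" and x: "\<And>i. x $ i = g i * x $ k + h i * x $ l"
    and y: "\<And>i. y $ i = g i * y $ k + h i * y $ l" and p: "pl x y k l \<noteq> 0"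
  shows "z = (pl z y k l / pl x y k l) *s x + (pl x z k l / pl x y k l) *s y"
proof -
  have "pl x y k l * z $ i = pl z y k l * x $ i + pl x z k l * y $ i" for i
    unfolding z[of i] x[of i] y[of i] pl_def by (simp add: algebra_simps)
  then have "z $ i = (pl z y k l * x $ i + pl x z k l * y $ i) / pl x y k l" for i
    using p by (simp add: eq_divide_eq mult.commute)
  then show ?thesis by (simp add: vec_eq_iff add_divide_distrib)
qed

section \<open>Continuation of planes of solutions by the period\<close>

context end_chart
begin

text \<open>The real times from \<open>t0\<close> towards the singular point, in the direction given
  by the sign of \<open>lam\<close>.\<close>

definition tail :: "real \<Rightarrow> real set" where "tail t0 = {t. lam * t \<le> lam * t0}"

lemma tail_H: "of_real t0 \<in> H \<Longrightarrow> t \<in> tail t0 \<Longrightarrow> of_real t \<in> H"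
  by (simp add: tail_def H_half_plane)

text \<open>The segments from \<open>t\<close> to \<open>t + per\<close> have constant real part and
  a common length, and \<open>A\<close> is bounded uniformly on all of them. Hence continuation by
  the period preserves boundedness at the end.\<close>

lemma shift_bound:
  assumes Y: "VEsol Y" and t0: "of_real t0 \<in> H"
  shows "\<exists>C. \<forall>t\<in>tail t0. norm (Y (of_real t + per)) \<le> C * norm (Y (of_real t))"
proof -
  define \<rho>' where "\<rho>' = norm (e (of_real t0))"
  have "\<rho>' < \<rho>" using t0 by (simp add: \<rho>'_def H_def)
  from A_bounded[OF this] obtain K where K: "K \<ge> 0" "\<And>t v. norm (e t) \<le> \<rho>' \<Longrightarrow> norm (A t *v v) \<le> K * norm v" by blast
  define L where "L = norm per * K"
  have L: "L \<ge> 0" using K by (simp add: L_def)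
  have "norm (Y (of_real t + per)) \<le> sqrt (exp (2 * L + 1)) * norm (Y (of_real t))" if t: "t \<in> tail t0" for t
  proof -
    have "Re per = 0" by (simp add: per_def Re_divide_of_real)
    then have Re: "Re (of_real t + of_real s * per) = t" for s by simp
    have ne: "norm (e (of_real t + of_real s * per)) \<le> \<rho>'" for s
      using t unfolding norm_e Re \<rho>'_def tail_def by simp
    have inH: "of_real t + of_real s * per \<in> H" for s using ne \<open>\<rho>' < \<rho>\<close> order.strict_trans1 by (auto simp: H_def)
    have d: "((\<lambda>s. Y (of_real t + of_real s * per)) has_vector_derivative
        per *s (A (of_real t + of_real s * per) *v Y (of_real t + of_real s * per))) (at s)" for s
      using Y inH by (intro has_vector_derivative_along_line) (simp add: VEsol_def)
    have "(norm (Y (of_real t + of_real 1 * per)))\<^sup>2 + 0\<^sup>2 \<le>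
       ((norm (Y (of_real t + of_real 0 * per)))\<^sup>2 + 0\<^sup>2) * exp ((2 * L + 1) * \<bar>1 - 0\<bar>)"
    proof (rule gronwall_norm[of 0 0 1 1])
      fix s :: real
      show "norm (per *s (A (of_real t + of_real s * per) *v Y (of_real t + of_real s * per))) \<le>
         L * norm (Y (of_real t + of_real s * per)) + 0"
        using mult_left_mono[OF K(2)[OF ne], of "norm per"] by (simp add: norm_vector_smult L_def mult.assoc)
    qed (use d L in auto)
    then have "(norm (Y (of_real t + per)))\<^sup>2 \<le> (sqrt (exp (2 * L + 1)) * norm (Y (of_real t)))\<^sup>2"
      by (simp add: power_mult_distrib mult.commute)
    then show ?thesis by (rule power2_le_imp_le) simp
  qed
  then show ?thesis by blast
qed

lemma VEsol_Re_Im: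
  assumes Y: "VEsol Y" and t: "of_real t \<in> H"
  shows "((\<lambda>t. \<chi> i. Re (Y (of_real t) $ i)) has_vector_derivative jacobian V (at (xh t)) *v (\<chi> i. Re (Y (of_real t) $ i))) (at t)"
    and "((\<lambda>t. \<chi> i. Im (Y (of_real t) $ i)) has_vector_derivative jacobian V (at (xh t)) *v (\<chi> i. Im (Y (of_real t) $ i))) (at t)"
proof -
  have d: "((\<lambda>t. Y (of_real t) $ i) has_vector_derivative (A (of_real t) *v Y (of_real t)) $ i) (at t)" for i
    by (rule has_vector_derivative_nth[OF VEsol_real[OF Y t]])
  have r: "Re ((A (of_real t) *v y) $ i) = (jacobian V (at (xh t)) *v (\<chi> i. Re (y $ i))) $ i"
    and m: "Im ((A (of_real t) *v y) $ i) = (jacobian V (at (xh t)) *v (\<chi> i. Im (y $ i))) $ i" for y i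
    by (simp_all add: matrix_vector_mult_def A_real[OF t])
  show "((\<lambda>t. \<chi> i. Re (Y (of_real t) $ i)) has_vector_derivative jacobian V (at (xh t)) *v (\<chi> i. Re (Y (of_real t) $ i))) (at t)"
    by (rule has_vector_derivative_vec) (use bounded_linear.has_vector_derivative[OF bounded_linear_Re d] in \<open>simp add: r\<close>)
  show "((\<lambda>t. \<chi> i. Im (Y (of_real t) $ i)) has_vector_derivative jacobian V (at (xh t)) *v (\<chi> i. Im (Y (of_real t) $ i))) (at t)"
    by (rule has_vector_derivative_vec) (use bounded_linear.has_vector_derivative[OF bounded_linear_Im d] in \<open>simp add: m\<close>)
qed

text \<open>Real and imaginary part of the continued solution are bounded and solve the real
  equation, whose coefficients are real at real times. At \<open>t1\<close> the form is negative on
  nonzero combinations of \<open>\<xi>1\<close>, \<open>\<xi>2\<close> and either part, which leaves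
  room for two dimensions only.\<close>

lemma bounded_plane_shift:
  assumes t0: "of_real t0 \<in> H" and t1: "t1 \<in> tail t0"
    and neg: "\<And>\<xi>. (\<And>t. t \<in> tail t0 \<Longrightarrow> (\<xi> has_vector_derivative jacobian V (at (xh t)) *v \<xi> t) (at t)) \<Longrightarrow>
       bounded (\<xi> ` tail t0) \<Longrightarrow> \<xi> t1 \<noteq> 0 \<Longrightarrow> qf sg W (\<xi> t1) (\<xi> t1) < 0"
    and sg: "\<And>k. k \<noteq> i \<Longrightarrow> k \<noteq> j \<Longrightarrow> sg k \<ge> 0"
    and \<xi>: "\<And>t. t \<in> tail t0 \<Longrightarrow> (\<xi>1 has_vector_derivative jacobian V (at (xh t)) *v \<xi>1 t) (at t)"
      "\<And>t. t \<in> tail t0 \<Longrightarrow> (\<xi>2 has_vector_derivative jacobian V (at (xh t)) *v \<xi>2 t) (at t)"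
    and b: "bounded (\<xi>1 ` tail t0)" "bounded (\<xi>2 ` tail t0)"
    and ind: "\<And>a b. a *\<^sub>R \<xi>1 t1 + b *\<^sub>R \<xi>2 t1 = 0 \<Longrightarrow> a = 0 \<and> b = 0"
    and Y: "VEsol Y" "bounded ((\<lambda>t. Y (of_real t)) ` tail t0)"
  shows "\<exists>a b. Y (of_real t1 + per) = a *s complex_vec (\<xi>1 t1) + b *s complex_vec (\<xi>2 t1)"
proof -
  define Z where "Z t = Y (t + per)" for t
  have Z: "VEsol Z" unfolding Z_def by (rule VEsol_shift[OF Y(1)])
  obtain C where C: "\<And>t. t \<in> tail t0 \<Longrightarrow> norm (Z (of_real t)) \<le> C * norm (Y (of_real t))"
    using shift_bound[OF Y(1) t0] by (auto simp: Z_def)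
  obtain B where B: "\<And>t. t \<in> tail t0 \<Longrightarrow> norm (Y (of_real t)) \<le> B" using Y(2) by (auto simp: bounded_iff)
  have ZB: "norm (Z (of_real t)) \<le> \<bar>C\<bar> * B" if "t \<in> tail t0" for t
  proof -
    have "C * norm (Y (of_real t)) \<le> \<bar>C\<bar> * norm (Y (of_real t))" by (intro mult_right_mono) auto
    then show ?thesis using C[OF that] mult_left_mono[OF B[OF that], of "\<bar>C\<bar>"] by simp
  qed
  have "\<exists>a b. \<zeta> t1 = a *\<^sub>R \<xi>1 t1 + b *\<^sub>R \<xi>2 t1"
    if \<zeta>: "\<And>t. t \<in> tail t0 \<Longrightarrow> (\<zeta> has_vector_derivative jacobian V (at (xh t)) *v \<zeta> t) (at t)" and bz: "bounded (\<zeta> ` tail t0)" for \<zeta>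
  proof (rule negative_plane_span[OF _ sg ind])
    fix a b c assume nz: "a *\<^sub>R \<xi>1 t1 + b *\<^sub>R \<xi>2 t1 + c *\<^sub>R \<zeta> t1 \<noteq> 0"
    show "qf sg W (a *\<^sub>R \<xi>1 t1 + b *\<^sub>R \<xi>2 t1 + c *\<^sub>R \<zeta> t1) (a *\<^sub>R \<xi>1 t1 + b *\<^sub>R \<xi>2 t1 + c *\<^sub>R \<zeta> t1) < 0"
    proof (rule neg[of "\<lambda>t. a *\<^sub>R \<xi>1 t + b *\<^sub>R \<xi>2 t + c *\<^sub>R \<zeta> t"])
      show "((\<lambda>t. a *\<^sub>R \<xi>1 t + b *\<^sub>R \<xi>2 t + c *\<^sub>R \<zeta> t) has_vector_derivative
        jacobian V (at (xh t)) *v (a *\<^sub>R \<xi>1 t + b *\<^sub>R \<xi>2 t + c *\<^sub>R \<zeta> t)) (at t)" if "t \<in> tail t0" for t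
      proof -
        have "((\<lambda>t. r *\<^sub>R u t) has_vector_derivative r *\<^sub>R d) (at t)" if "(u has_vector_derivative d) (at t)" for r and u :: "real \<Rightarrow> real^4" and d
          by (rule bounded_linear.has_vector_derivative[OF bounded_linear_scaleR_right that])
        then have "((\<lambda>t. a *\<^sub>R \<xi>1 t + b *\<^sub>R \<xi>2 t + c *\<^sub>R \<zeta> t) has_vector_derivative
          a *\<^sub>R (jacobian V (at (xh t)) *v \<xi>1 t) + b *\<^sub>R (jacobian V (at (xh t)) *v \<xi>2 t) + c *\<^sub>R (jacobian V (at (xh t)) *v \<zeta> t)) (at t)"
          using \<xi>(1)[OF that] \<xi>(2)[OF that] \<zeta>[OF that] by (intro has_vector_derivative_add) auto
        then show ?thesis by (simp add: matrix_vector_right_distrib matrix_vector_mult_scaleR)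
      qed
      show "bounded ((\<lambda>t. a *\<^sub>R \<xi>1 t + b *\<^sub>R \<xi>2 t + c *\<^sub>R \<zeta> t) ` tail t0)"
        using b bz by (intro bounded_plus_comp bounded_scaleR_comp)
    qed (use nz in auto)
  qed
  note sp = this
  have br: "bounded ((\<lambda>t. \<chi> i. g (Z (of_real t) $ i)) ` tail t0)" if g: "\<And>z. norm (g z) \<le> norm z" for g :: "complex \<Rightarrow> real"
  proof -
    have "norm (\<chi> i. g (Z (of_real t) $ i)) \<le> real CARD(4) * (\<bar>C\<bar> * B)" if "t \<in> tail t0" for t
    proof (rule norm_vec_bound)
      fix i
      have "norm (g (Z (of_real t) $ i)) \<le> norm (Z (of_real t) $ i)" by (rule g)
      also have "\<dots> \<le> \<bar>C\<bar> * B" using Finite_Cartesian_Product.norm_nth_le[of "Z (of_real t)" i] ZB[OF that] by linarith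
      finally show "norm ((\<chi> i. g (Z (of_real t) $ i)) $ i) \<le> \<bar>C\<bar> * B" by simp
    qed
    then show ?thesis unfolding bounded_iff by blast
  qed
  obtain a b where ab: "(\<chi> i. Re (Z (of_real t1) $ i)) = a *\<^sub>R \<xi>1 t1 + b *\<^sub>R \<xi>2 t1"
    using sp[OF VEsol_Re_Im(1)[OF Z tail_H[OF t0]] br[of Re]] by (auto simp: abs_Re_le_cmod)
  obtain a' b' where ab': "(\<chi> i. Im (Z (of_real t1) $ i)) = a' *\<^sub>R \<xi>1 t1 + b' *\<^sub>R \<xi>2 t1"
    using sp[OF VEsol_Re_Im(2)[OF Z tail_H[OF t0]] br[of Im]] by (auto simp: abs_Im_le_cmod)
  have "Z (of_real t1) = Complex a a' *s complex_vec (\<xi>1 t1) + Complex b b' *s complex_vec (\<xi>2 t1)"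
    using ab ab' by (simp add: vec_eq_iff complex_eq_iff)
  then show ?thesis unfolding Z_def by blast
qed

text \<open>The relations expressing all components through those with indices \<open>k\<close> and
  \<open>l\<close> extend from real times to a half-plane. Their coefficients are functions of
  \<open>e t\<close>, hence the same at \<open>t1\<close> and after one period, so the continued
  solutions lie in the same plane.\<close>

lemma graph_plane_shift:
  assumes \<rho>': "0 < \<rho>'" "\<rho>' \<le> \<rho>" and t1: "norm (e (of_real t1)) < \<rho>'"
    and g: "\<And>i. g i holomorphic_on ball 0 \<rho>'" "\<And>i. g' i holomorphic_on ball 0 \<rho>'"
    and Y: "VEsol Y1" "VEsol Y2"
    and r1: "\<And>t i. norm (e (of_real t)) < \<rho>' \<Longrightarrow> Y1 (of_real t) $ i = g i (e (of_real t)) * Y1 (of_real t) $ k + g' i (e (of_real t)) * Y1 (of_real t) $ l"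
    and r2: "\<And>t i. norm (e (of_real t)) < \<rho>' \<Longrightarrow> Y2 (of_real t) $ i = g i (e (of_real t)) * Y2 (of_real t) $ k + g' i (e (of_real t)) * Y2 (of_real t) $ l"
    and p: "pl (Y1 (of_real t1)) (Y2 (of_real t1)) k l \<noteq> 0"
  shows "\<exists>a b. Y1 (of_real t1 + per) = a *s Y1 (of_real t1) + b *s Y2 (of_real t1)"
    and "\<exists>a b. Y2 (of_real t1 + per) = a *s Y1 (of_real t1) + b *s Y2 (of_real t1)"
proof -
  define H' where "H' = {t. norm (e t) < \<rho>'}"
  have H'eq: "H' = {t. lam * Re t < ln \<rho>'}" unfolding H'_def norm_e using \<rho>' by (auto simp: ln_less_cancel_iff[symmetric] simp del: ln_less_cancel_iff)
  have H'H: "H' \<subseteq> H" using \<rho>' by (auto simp: H'_def H_def)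
  have "open H'" unfolding H'eq by (intro open_Collect_less continuous_intros)
  have "convex H'"
  proof -
    have "H' = {t. inner (of_real lam) t < ln \<rho>'}" unfolding H'eq by (simp add: inner_complex_def)
    then show ?thesis by (simp add: convex_halfspace_lt)
  qed
  then have conn: "connected H'" by (rule convex_connected)
  have t1': "of_real t1 \<in> H'" using t1 by (simp add: H'_def)
  have ho: "(\<lambda>t. f (e t)) holomorphic_on H'" if "f holomorphic_on ball 0 \<rho>'" for f
    by (rule holomorphic_on_compose_gen[OF e_holo that, of H', unfolded o_def]) (auto simp: H'_def)
  have ext: "Y w $ i = g i (e w) * Y w $ k + g' i (e w) * Y w $ l" if Y: "VEsol Y" and w: "w \<in> H'"
    and r: "\<And>t i. norm (e (of_real t)) < \<rho>' \<Longrightarrow> Y (of_real t) $ i = g i (e (of_real t)) * Y (of_real t) $ k + g' i (e (of_real t)) * Y (of_real t) $ l" for Y w i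
  proof (rule identity_from_reals[OF \<open>open H'\<close> conn _ _ t1' _ w])
    have Yh: "(\<lambda>t. Y t $ j) holomorphic_on H'" for j using VEsol_holo[OF Y] H'H holomorphic_on_subset by blast
    show "(\<lambda>w. Y w $ i) holomorphic_on H'" by (rule Yh)
    show "(\<lambda>w. g i (e w) * Y w $ k + g' i (e w) * Y w $ l) holomorphic_on H'" by (intro holomorphic_intros ho g Yh)
    have "open (of_real -` H' :: real set)" using \<open>open H'\<close> by (intro open_vimage) (auto intro!: continuous_intros)
    then have "\<forall>\<^sub>F t in nhds t1. t \<in> of_real -` H'" using t1' by (intro eventually_nhds_in_open) auto
    then show "\<forall>\<^sub>F t in at t1. Y (of_real t) $ i = g i (e (of_real t)) * Y (of_real t) $ k + g' i (e (of_real t)) * Y (of_real t) $ l"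
      unfolding eventually_at_filter by (rule eventually_mono) (auto simp: H'_def intro!: r)
  qed
  have t2: "of_real t1 + per \<in> H'" using t1 by (simp add: H'_def e_per)
  have e2: "e (of_real t1 + per) = e (of_real t1)" by (rule e_per)
  show "\<exists>a b. Y1 (of_real t1 + per) = a *s Y1 (of_real t1) + b *s Y2 (of_real t1)"
    by (intro exI) (rule pl_solve[OF ext[OF Y(1) t2 r1, unfolded e2] ext[OF Y(1) t1' r1] ext[OF Y(2) t1' r2] p])
  show "\<exists>a b. Y2 (of_real t1 + per) = a *s Y1 (of_real t1) + b *s Y2 (of_real t1)"
    by (intro exI) (rule pl_solve[OF ext[OF Y(2) t2 r2, unfolded e2] ext[OF Y(1) t1' r1] ext[OF Y(2) t1' r2] p])
qed

end

section \<open>Solutions along the orbit\<close>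

locale desing_orbit =
  fixes V :: "real^4 \<Rightarrow> real^4" and xh and M :: "(real^4) set" and U F and \<Gamma> :: desing
  assumes cx: "complexification V U F" and homoclinic: "homoclinic_orbit V xh"
    and nbhd: "desingularized_nbhd V xh M U \<Gamma>"
begin

lemma sol: "solves_on V xh UNIV"
  and xh_limits: "(xh \<longlongrightarrow> 0) at_top" "(xh \<longlongrightarrow> 0) at_bot"
  using homoclinic by (auto simp: homoclinic_orbit_def)

lemma lam_signs: "lam_minus \<Gamma> < 0" "0 < lam_plus \<Gamma>" and rad_pos: "rad_minus \<Gamma> > 0" "rad_plus \<Gamma> > 0"
  and param_curve: "holomorphic_curve_on (param \<Gamma> c) (chart_dom \<Gamma> c)" "param \<Gamma> c ` chart_dom \<Gamma> c \<subseteq> U"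
  and h_0: "h_minus \<Gamma> 0 = 0" "h_plus \<Gamma> 0 = 0"
  and ends: "\<forall>\<^sub>F t in at_top. complex_vec (xh t) = h_minus \<Gamma> (glue_minus \<Gamma> (of_real t))"
    "\<forall>\<^sub>F t in at_bot. complex_vec (xh t) = h_plus \<Gamma> (glue_plus \<Gamma> (of_real t))"
  and disjoint_ends: "\<not> (exp (lam_minus \<Gamma> * t) < rad_minus \<Gamma> \<and> exp (lam_plus \<Gamma> * t) < rad_plus \<Gamma>)"
  and middle: "exp (lam_minus \<Gamma> * t) \<ge> rad_minus \<Gamma> \<Longrightarrow> exp (lam_plus \<Gamma> * t) \<ge> rad_plus \<Gamma> \<Longrightarrow> complex_of_real t \<in> Sigma_t \<Gamma>"
  and Sigma: "open (Sigma_t \<Gamma>)" "simply_connected (Sigma_t \<Gamma>)"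
  and x_t_real: "complex_of_real t \<in> Sigma_t \<Gamma> \<Longrightarrow> x_t \<Gamma> (of_real t) = complex_vec (xh t)"
  and overlaps: "simply_connected (overlap_minus \<Gamma>)" "inj_on (glue_minus \<Gamma>) (overlap_minus \<Gamma>)"
    "simply_connected (overlap_plus \<Gamma>)" "inj_on (glue_plus \<Gamma>) (overlap_plus \<Gamma>)"
  using nbhd unfolding desingularized_nbhd_def by auto

text \<open>Real times greater than \<open>b\<close> belong to the disc of the chart
  \<open>Minus\<close>, those less than \<open>a\<close> to the disc of \<open>Plus\<close>; the
  times from \<open>a\<close> to \<open>b\<close> belong to the time chart.\<close>

definition b where "b = ln (rad_minus \<Gamma>) / lam_minus \<Gamma>"

definition a where "a = ln (rad_plus \<Gamma>) / lam_plus \<Gamma>"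

lemma b_iff: "exp (lam_minus \<Gamma> * t) < rad_minus \<Gamma> \<longleftrightarrow> b < t"
proof -
  have "exp (lam_minus \<Gamma> * t) < rad_minus \<Gamma> \<longleftrightarrow> lam_minus \<Gamma> * t < ln (rad_minus \<Gamma>)"
    using rad_pos(1) by (metis exp_less_cancel_iff exp_ln)
  then show ?thesis using lam_signs(1) by (simp add: b_def divide_less_eq mult.commute)
qed

lemma a_iff: "exp (lam_plus \<Gamma> * t) < rad_plus \<Gamma> \<longleftrightarrow> t < a"
proof -
  have "exp (lam_plus \<Gamma> * t) < rad_plus \<Gamma> \<longleftrightarrow> lam_plus \<Gamma> * t < ln (rad_plus \<Gamma>)"
    using rad_pos(2) by (metis exp_less_cancel_iff exp_ln)
  then show ?thesis using lam_signs(2) by (simp add: a_def less_divide_eq mult.commute)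
qed

lemma a_le_b: "a \<le> b"
proof (rule ccontr)
  assume "\<not> a \<le> b"
  then obtain t where "b < t" "t < a" using dense[of b a] by auto
  then show False using disjoint_ends[of t] a_iff b_iff by blast
qed

definition cm where "cm = (SOME c. b < c \<and> (\<forall>\<^sub>F t in at c. complex_vec (xh t) = h_minus \<Gamma> (exp (of_real (lam_minus \<Gamma>) * of_real t))))"

definition cp where "cp = (SOME c. c < a \<and> (\<forall>\<^sub>F t in at c. complex_vec (xh t) = h_plus \<Gamma> (exp (of_real (lam_plus \<Gamma>) * of_real t))))"

lemma cm: "b < cm" "\<forall>\<^sub>F t in at cm. complex_vec (xh t) = h_minus \<Gamma> (exp (of_real (lam_minus \<Gamma>) * of_real t))"
proof -
  obtain N where N: "\<And>t. t \<ge> N \<Longrightarrow> complex_vec (xh t) = h_minus \<Gamma> (exp (of_real (lam_minus \<Gamma>) * of_real t))"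
    using ends(1) unfolding eventually_at_top_linorder glue_minus_def by blast
  define c where "c = max N b + 1"
  have "\<forall>\<^sub>F t in at c. t \<in> {N<..}" by (rule eventually_at_in_open') (auto simp: c_def)
  then have "\<forall>\<^sub>F t in at c. complex_vec (xh t) = h_minus \<Gamma> (exp (of_real (lam_minus \<Gamma>) * of_real t))"
    by (rule eventually_mono) (auto intro: N)
  then have "\<exists>c. b < c \<and> (\<forall>\<^sub>F t in at c. complex_vec (xh t) = h_minus \<Gamma> (exp (of_real (lam_minus \<Gamma>) * of_real t)))"
    by (intro exI[of _ c]) (auto simp: c_def)
  from someI_ex[OF this] show "b < cm" "\<forall>\<^sub>F t in at cm. complex_vec (xh t) = h_minus \<Gamma> (exp (of_real (lam_minus \<Gamma>) * of_real t))"
    unfolding cm_def by blast+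
qed

lemma cp: "cp < a" "\<forall>\<^sub>F t in at cp. complex_vec (xh t) = h_plus \<Gamma> (exp (of_real (lam_plus \<Gamma>) * of_real t))"
proof -
  obtain N where N: "\<And>t. t \<le> N \<Longrightarrow> complex_vec (xh t) = h_plus \<Gamma> (exp (of_real (lam_plus \<Gamma>) * of_real t))"
    using ends(2) unfolding eventually_at_bot_linorder glue_plus_def by blast
  define c where "c = min N a - 1"
  have "\<forall>\<^sub>F t in at c. t \<in> {..<N}" by (rule eventually_at_in_open') (auto simp: c_def)
  then have "\<forall>\<^sub>F t in at c. complex_vec (xh t) = h_plus \<Gamma> (exp (of_real (lam_plus \<Gamma>) * of_real t))"
    by (rule eventually_mono) (auto intro: N)
  then have "\<exists>c. c < a \<and> (\<forall>\<^sub>F t in at c. complex_vec (xh t) = h_plus \<Gamma> (exp (of_real (lam_plus \<Gamma>) * of_real t)))"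
    by (intro exI[of _ c]) (auto simp: c_def)
  from someI_ex[OF this] show "cp < a" "\<forall>\<^sub>F t in at cp. complex_vec (xh t) = h_plus \<Gamma> (exp (of_real (lam_plus \<Gamma>) * of_real t))"
    unfolding cp_def by blast+
qed

end

sublocale desing_orbit \<subseteq> minus: end_chart V U F xh "lam_minus \<Gamma>" "rad_minus \<Gamma>" "h_minus \<Gamma>" cm
proof unfold_locales
  show "complexification V U F" by (rule cx)
  show "solves_on V xh UNIV" by (rule sol)
  show "holo_curve (h_minus \<Gamma>) (ball 0 (rad_minus \<Gamma>))"
    using param_curve(1)[of Minus] by (simp add: holo_curve_def holomorphic_curve_on_def)
  show "h_minus \<Gamma> ` ball 0 (rad_minus \<Gamma>) \<subseteq> U" using param_curve(2)[of Minus] by simp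
  show "exp (lam_minus \<Gamma> * cm) < rad_minus \<Gamma>" using cm(1) by (simp add: b_iff)
qed (use lam_signs rad_pos cm(2) in auto)

sublocale desing_orbit \<subseteq> plus: end_chart V U F xh "lam_plus \<Gamma>" "rad_plus \<Gamma>" "h_plus \<Gamma>" cp
proof unfold_locales
  show "complexification V U F" by (rule cx)
  show "solves_on V xh UNIV" by (rule sol)
  show "holo_curve (h_plus \<Gamma>) (ball 0 (rad_plus \<Gamma>))"
    using param_curve(1)[of Plus] by (simp add: holo_curve_def holomorphic_curve_on_def)
  show "h_plus \<Gamma> ` ball 0 (rad_plus \<Gamma>) \<subseteq> U" using param_curve(2)[of Plus] by simp
  show "exp (lam_plus \<Gamma> * cp) < rad_plus \<Gamma>" using cp(1) by (simp add: a_iff)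
qed (use lam_signs rad_pos cp(2) in auto)

context desing_orbit
begin

lemma glue_eq: "glue_minus \<Gamma> t = minus.e t" "glue_plus \<Gamma> t = plus.e t"
  by (simp_all add: glue_minus_def glue_plus_def minus.e_def plus.e_def)

lemma overlap_eq: "overlap_minus \<Gamma> = Sigma_t \<Gamma> \<inter> minus.H" "overlap_plus \<Gamma> = Sigma_t \<Gamma> \<inter> plus.H"
  by (auto simp: overlap_minus_def overlap_plus_def minus.H_def plus.H_def glue_eq)

lemma minus_real: "of_real t \<in> minus.H \<longleftrightarrow> b < t" by (simp add: minus.H_def minus.norm_e b_iff)

lemma plus_real: "of_real t \<in> plus.H \<longleftrightarrow> t < a" by (simp add: plus.H_def plus.norm_e a_iff)

lemma middle_Sigma: "a \<le> t \<Longrightarrow> t \<le> b \<Longrightarrow> complex_of_real t \<in> Sigma_t \<Gamma>"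
  using middle a_iff b_iff by (meson not_less)

text \<open>The time chart is open and contains the closed interval from \<open>a\<close> to
  \<open>b\<close>, so it reaches beyond both endpoints; there it meets the two discs.\<close>

lemma Sigma_real_margin: "\<exists>\<delta>>0. \<forall>t\<in>{a - \<delta><..<b + \<delta>}. complex_of_real t \<in> Sigma_t \<Gamma>"
proof -
  define S where "S = (of_real -` Sigma_t \<Gamma> :: real set)"
  have S: "open S" unfolding S_def using Sigma(1) by (intro open_vimage) (auto intro!: continuous_intros)
  have ab: "a \<in> S" "b \<in> S" using middle_Sigma a_le_b by (auto simp: S_def)
  obtain \<delta>1 \<delta>2 where d: "\<delta>1 > 0" "ball a \<delta>1 \<subseteq> S" "\<delta>2 > 0" "ball b \<delta>2 \<subseteq> S"
    using S ab open_contains_ball by meson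
  show ?thesis
  proof (intro exI[of _ "min \<delta>1 \<delta>2"] conjI ballI)
    fix t assume t: "t \<in> {a - min \<delta>1 \<delta>2<..<b + min \<delta>1 \<delta>2}"
    consider "t < a" | "a \<le> t" "t \<le> b" | "b < t" by linarith
    then show "complex_of_real t \<in> Sigma_t \<Gamma>"
    proof cases
      case 1
      then have "t \<in> ball a \<delta>1" using t by (auto simp: dist_real_def)
      then show ?thesis using d(2) by (auto simp: S_def)
    next
      case 3
      then have "t \<in> ball b \<delta>2" using t by (auto simp: dist_real_def)
      then show ?thesis using d(4) by (auto simp: S_def)
    qed (rule middle_Sigma)
  qed (use d in auto)
qed

definition \<delta> where "\<delta> = (SOME \<delta>. \<delta> > 0 \<and> (\<forall>t\<in>{a - \<delta><..<b + \<delta>}. complex_of_real t \<in> Sigma_t \<Gamma>))"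

lemma \<delta>: "\<delta> > 0" "a - \<delta> < t \<Longrightarrow> t < b + \<delta> \<Longrightarrow> complex_of_real t \<in> Sigma_t \<Gamma>"
proof -
  have "\<delta> > 0 \<and> (\<forall>t\<in>{a - \<delta><..<b + \<delta>}. complex_of_real t \<in> Sigma_t \<Gamma>)"
    unfolding \<delta>_def by (rule someI_ex[OF Sigma_real_margin])
  then show "\<delta> > 0" "a - \<delta> < t \<Longrightarrow> t < b + \<delta> \<Longrightarrow> complex_of_real t \<in> Sigma_t \<Gamma>" by auto
qed

definition bm where "bm = b + \<delta> / 2"

definition ap where "ap = a - \<delta> / 2"

lemma bm: "b < bm" "bm < b + \<delta>" "a - \<delta> < bm" "of_real bm \<in> overlap_minus \<Gamma>"
proof -
  show 1: "b < bm" "bm < b + \<delta>" "a - \<delta> < bm" using \<delta>(1) a_le_b by (auto simp: bm_def)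
  show "of_real bm \<in> overlap_minus \<Gamma>" using 1 \<delta>(2)[OF 1(3,2)] by (simp add: overlap_eq minus_real)
qed

lemma ap: "ap < a" "a - \<delta> < ap" "ap < b + \<delta>" "of_real ap \<in> overlap_plus \<Gamma>"
proof -
  show 1: "ap < a" "a - \<delta> < ap" "ap < b + \<delta>" using \<delta>(1) a_le_b by (auto simp: ap_def)
  show "of_real ap \<in> overlap_plus \<Gamma>" using 1 \<delta>(2)[OF 1(2,3)] by (simp add: overlap_eq plus_real)
qed

lemma b_Sigma: "complex_of_real b \<in> Sigma_t \<Gamma>" using middle_Sigma a_le_b by blast

lemma charts: "surface_charts \<Gamma> (of_real bm) (of_real ap) (of_real b)"
  by unfold_locales (use lam_signs rad_pos Sigma overlaps bm ap b_Sigma in \<open>auto intro: simply_connected_imp_connected\<close>)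

text \<open>In the whole plane the overlap would contain two points differing by a period, at which
  the gluing map has equal values. Excluding this makes the Riemann mapping theorem applicable to
  the time chart.\<close>

lemma Sigma_not_UNIV: "Sigma_t \<Gamma> \<noteq> UNIV"
proof
  assume S: "Sigma_t \<Gamma> = UNIV"
  define p where "p = complex_of_real bm + minus.per"
  have bmH: "complex_of_real bm \<in> minus.H" using bm(1) by (simp add: minus_real)
  then have "p \<in> overlap_minus \<Gamma>" using minus.H_per S by (simp add: p_def overlap_eq)
  moreover have "glue_minus \<Gamma> p = glue_minus \<Gamma> (of_real bm)" by (simp add: glue_eq p_def minus.e_per)
  ultimately have "p = of_real bm" using overlaps(2) bm(4) by (auto dest: inj_onD)
  then show False using lam_signs by (simp add: p_def minus.per_def)
qed

lemma x_t_curve: "holo_curve (x_t \<Gamma>) (Sigma_t \<Gamma>)" and x_t_U: "x_t \<Gamma> ` Sigma_t \<Gamma> \<subseteq> U"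
  using param_curve[of Time] by (simp_all add: holo_curve_def holomorphic_curve_on_def)

lemma near_real: "open S \<Longrightarrow> complex_of_real c \<in> S \<Longrightarrow> \<forall>\<^sub>F t in at c. of_real t \<in> S"
proof -
  assume S: "open S" "complex_of_real c \<in> S"
  have "open (of_real -` S :: real set)" using S by (intro open_vimage) (auto intro!: continuous_intros)
  then have "\<forall>\<^sub>F t in at c. t \<in> of_real -` S" using S by (intro eventually_at_in_open') auto
  then show ?thesis by simp
qed

lemma identity_near_real:
  assumes "open S" "connected S" "f holomorphic_on S" "g holomorphic_on S" "complex_of_real c \<in> S"
    "open S'" "complex_of_real c \<in> S'" "\<And>t. of_real t \<in> S \<Longrightarrow> of_real t \<in> S' \<Longrightarrow> f (of_real t) = g (of_real t)" "w \<in> S"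
  shows "f w = g w"
proof (rule identity_from_reals[OF assms(1-5) _ assms(9)])
  show "\<forall>\<^sub>F t in at c. f (of_real t) = g (of_real t)"
    using near_real[OF assms(1,5)] near_real[OF assms(6,7)] by eventually_elim (rule assms(8))
qed

lemma conn_overlap: "connected (overlap_minus \<Gamma>)" "connected (overlap_plus \<Gamma>)"
  and open_overlap: "open (overlap_minus \<Gamma>)" "open (overlap_plus \<Gamma>)"
  using overlaps simply_connected_imp_connected Sigma(1) minus.open_H plus.open_H by (auto simp: overlap_eq)

text \<open>The parametrizations are compatible with the gluing because both restrict to the real
  orbit and the overlap is connected.\<close>

lemma x_t_minus: assumes "t \<in> overlap_minus \<Gamma>" shows "x_t \<Gamma> t = h_minus \<Gamma> (minus.e t)"
proof -
  have "x_t \<Gamma> t $ i = h_minus \<Gamma> (minus.e t) $ i" for i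
  proof (rule identity_near_real[OF open_overlap(1) conn_overlap(1) _ _ bm(4) open_overlap(1) bm(4) _ assms])
    show "(\<lambda>t. x_t \<Gamma> t $ i) holomorphic_on overlap_minus \<Gamma>"
      using x_t_curve unfolding holo_curve_def overlap_eq by (meson holomorphic_on_subset inf_le1)
    show "(\<lambda>t. h_minus \<Gamma> (minus.e t) $ i) holomorphic_on overlap_minus \<Gamma>"
      using minus.he_holo unfolding holo_curve_def overlap_eq by (meson holomorphic_on_subset inf_le2)
  qed (auto simp: overlap_eq x_t_real minus.xh_eq[symmetric])
  then show ?thesis by (simp add: vec_eq_iff)
qed

lemma x_t_plus: assumes "t \<in> overlap_plus \<Gamma>" shows "x_t \<Gamma> t = h_plus \<Gamma> (plus.e t)"
proof -
  have "x_t \<Gamma> t $ i = h_plus \<Gamma> (plus.e t) $ i" for i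
  proof (rule identity_near_real[OF open_overlap(2) conn_overlap(2) _ _ ap(4) open_overlap(2) ap(4) _ assms])
    show "(\<lambda>t. x_t \<Gamma> t $ i) holomorphic_on overlap_plus \<Gamma>"
      using x_t_curve unfolding holo_curve_def overlap_eq by (meson holomorphic_on_subset inf_le1)
    show "(\<lambda>t. h_plus \<Gamma> (plus.e t) $ i) holomorphic_on overlap_plus \<Gamma>"
      using plus.he_holo unfolding holo_curve_def overlap_eq by (meson holomorphic_on_subset inf_le2)
  qed (auto simp: overlap_eq x_t_real plus.xh_eq[symmetric])
  then show ?thesis by (simp add: vec_eq_iff)
qed

definition At :: "complex \<Rightarrow> complex^4^4" where "At t = jacobian F (at (x_t \<Gamma> t))"

lemma At_holo: "(\<lambda>t. At t $ i $ j) holomorphic_on Sigma_t \<Gamma>"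
  unfolding At_def by (rule jacobian_entry_curve_holomorphic[OF minus.F x_t_curve Sigma(1) x_t_U])

lemma At_minus: "t \<in> overlap_minus \<Gamma> \<Longrightarrow> At t = minus.A t" by (simp add: At_def minus.A_def x_t_minus)

lemma At_plus: "t \<in> overlap_plus \<Gamma> \<Longrightarrow> At t = plus.A t" by (simp add: At_def plus.A_def x_t_plus)

lemma At_real: "complex_of_real t \<in> Sigma_t \<Gamma> \<Longrightarrow> At (of_real t) $ i $ j = of_real (jacobian V (at (xh t)) $ i $ j)"
  by (simp add: At_def x_t_real complexification_jacobian(2)[OF cx])

section \<open>Solutions of the variational equation in the three charts\<close>

definition TS :: "(complex \<Rightarrow> complex^4) \<Rightarrow> bool" where
  "TS Y \<longleftrightarrow> (\<forall>t\<in>Sigma_t \<Gamma>. \<forall>i. ((\<lambda>t. Y t $ i) has_field_derivative (At t *v Y t) $ i) (at t))"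

lemma TS_exists: "\<exists>Y. TS Y \<and> Y (of_real b) = y0"
  using lin_ode_simply_connected[OF Sigma Sigma_not_UNIV b_Sigma, of "\<lambda>i j t. At t $ i $ j" y0] At_holo
  by (auto simp: TS_def matrix_vector_mult_def)

lemma TS_holo: "TS Y \<Longrightarrow> (\<lambda>t. Y t $ i) holomorphic_on Sigma_t \<Gamma>"
  using Sigma(1) unfolding TS_def holomorphic_on_open[OF Sigma(1)] by blast

lemma TS_deriv: "TS Y \<Longrightarrow> t \<in> Sigma_t \<Gamma> \<Longrightarrow> ((\<lambda>t. Y t $ i) has_field_derivative (At t *v Y t) $ i) (at t)"
  by (simp add: TS_def)

lemma TS_real:
  assumes Y: "TS Y" and t: "complex_of_real t \<in> Sigma_t \<Gamma>"
  shows "((\<lambda>t. Y (of_real t)) has_vector_derivative At (of_real t) *v Y (of_real t)) (at t)"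
proof -
  have "((\<lambda>s. Y (0 + of_real s * 1)) has_vector_derivative 1 *s (At (of_real t) *v Y (of_real t))) (at t)"
    by (rule has_vector_derivative_along_line) (use TS_deriv[OF Y t] in simp)
  then show ?thesis by simp
qed

lemma xh_cont: "isCont xh t"
  using sol unfolding solves_on_def by (meson UNIV_I has_vector_derivative_continuous)

lemma jacobian_locally_bounded: "\<exists>K\<ge>0. \<forall>\<^sub>F t in nhds s. \<forall>v. norm (jacobian V (at (xh t)) *v v) \<le> K * norm v"
proof -
  obtain r C where r: "r > 0" "C > 0" "\<forall>x\<in>ball (xh s) r. \<forall>v. norm (jacobian V (at x) *v v) \<le> C * norm v"
    using complexification_estimates[OF cx, of "xh s"] by blast
  have "\<forall>\<^sub>F t in nhds s. dist (xh t) (xh s) < r" by (rule isCont_eventually_dist[OF xh_cont r(1)])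
  then have "\<forall>\<^sub>F t in nhds s. \<forall>v. norm (jacobian V (at (xh t)) *v v) \<le> C * norm v"
    by (rule eventually_mono) (use r(3) in \<open>auto simp: dist_commute\<close>)
  then show ?thesis using r(2) less_imp_le by blast
qed

lemma real_VE_unique:
  assumes I: "open I" "connected I" and u: "\<And>t. t \<in> I \<Longrightarrow> (u has_vector_derivative jacobian V (at (xh t)) *v u t) (at t)"
    and z: "t1 \<in> I" "u t1 = 0" and t: "t \<in> I"
  shows "u t = 0"
proof (rule ode_unique_zero[OF I z u _ t])
  show "\<exists>K. \<forall>\<^sub>F t in nhds s. norm (jacobian V (at (xh t)) *v u t) \<le> K * norm (u t)" for s
    using jacobian_locally_bounded[of s] by (auto elim!: eventually_mono)
qed auto

lemma complex_VE_unique: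
  assumes I: "open I" "connected I"
    and u: "\<And>t. t \<in> I \<Longrightarrow> (u has_vector_derivative B t *v u t) (at t)"
    and B: "\<And>t i j. t \<in> I \<Longrightarrow> B t $ i $ j = complex_of_real (jacobian V (at (xh t)) $ i $ j)"
    and z: "t1 \<in> I" "u t1 = 0" and t: "t \<in> I"
  shows "u t = 0"
proof -
  have d: "((\<lambda>t. u t $ i) has_vector_derivative (B t *v u t) $ i) (at t)" if "t \<in> I" for t i
    by (rule has_vector_derivative_nth[OF u[OF that]])
  have r: "Re ((B t *v y) $ i) = (jacobian V (at (xh t)) *v (\<chi> i. Re (y $ i))) $ i"
    and m: "Im ((B t *v y) $ i) = (jacobian V (at (xh t)) *v (\<chi> i. Im (y $ i))) $ i" if "t \<in> I" for t y i
    by (simp_all add: matrix_vector_mult_def B[OF that])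
  have "(\<chi> i. Re (u t $ i)) = 0"
  proof (rule real_VE_unique[OF I _ z(1) _ t])
    show "((\<lambda>t. \<chi> i. Re (u t $ i)) has_vector_derivative jacobian V (at (xh t)) *v (\<chi> i. Re (u t $ i))) (at t)" if "t \<in> I" for t
      by (rule has_vector_derivative_vec) (use bounded_linear.has_vector_derivative[OF bounded_linear_Re d[OF that]] in \<open>simp add: r[OF that]\<close>)
  qed (simp add: z vec_eq_iff)
  moreover have "(\<chi> i. Im (u t $ i)) = 0"
  proof (rule real_VE_unique[OF I _ z(1) _ t])
    show "((\<lambda>t. \<chi> i. Im (u t $ i)) has_vector_derivative jacobian V (at (xh t)) *v (\<chi> i. Im (u t $ i))) (at t)" if "t \<in> I" for t
      by (rule has_vector_derivative_vec) (use bounded_linear.has_vector_derivative[OF bounded_linear_Im d[OF that]] in \<open>simp add: m[OF that]\<close>)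
  qed (simp add: z vec_eq_iff)
  ultimately show ?thesis by (simp add: vec_eq_iff complex_eq_iff)
qed

lemma complex_VE_eq:
  assumes I: "open I" "connected I"
    and u: "\<And>t. t \<in> I \<Longrightarrow> (u has_vector_derivative B t *v u t) (at t)"
    and v: "\<And>t. t \<in> I \<Longrightarrow> (v has_vector_derivative B t *v v t) (at t)"
    and B: "\<And>t i j. t \<in> I \<Longrightarrow> B t $ i $ j = complex_of_real (jacobian V (at (xh t)) $ i $ j)"
    and z: "t1 \<in> I" "u t1 = v t1" and t: "t \<in> I"
  shows "u t = v t"
proof -
  have "u t - v t = 0"
  proof (rule complex_VE_unique[OF I _ B z(1) _ t])
    show "((\<lambda>t. u t - v t) has_vector_derivative B t *v (u t - v t)) (at t)" if "t \<in> I" for t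
      using has_vector_derivative_diff[OF u[OF that] v[OF that]] by (simp add: matrix_vector_mult_diff_distrib)
  qed (use z in auto)
  then show ?thesis by simp
qed

lemma complex_vec_solution:
  assumes d: "(\<eta> has_vector_derivative jacobian V (at (xh t)) *v \<eta> t) (at t)"
    and B: "\<And>i j. B $ i $ j = complex_of_real (jacobian V (at (xh t)) $ i $ j)"
  shows "((\<lambda>t. complex_vec (\<eta> t)) has_vector_derivative B *v complex_vec (\<eta> t)) (at t)"
proof -
  have "complex_vec (jacobian V (at (xh t)) *v \<eta> t) = B *v complex_vec (\<eta> t)"
    by (simp add: vec_eq_iff matrix_vector_mult_def B)
  then show ?thesis using bounded_linear.has_vector_derivative[OF bounded_linear_complex_vec d] by simp
qed

text \<open>One solution seen in the three charts. Over the discs it is multivalued, so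
  \<open>Ym\<close> and \<open>Yp\<close> are functions of time on the half-planes; on the overlaps
  they agree with \<open>Yt\<close> as functions of \<open>t\<close>.\<close>

definition extends :: "(real \<Rightarrow> real^4) \<Rightarrow> (complex \<Rightarrow> complex^4) \<Rightarrow> (complex \<Rightarrow> complex^4) \<Rightarrow> (complex \<Rightarrow> complex^4) \<Rightarrow> bool" where
  "extends \<eta> Yt Ym Yp \<longleftrightarrow> TS Yt \<and> minus.VEsol Ym \<and> plus.VEsol Yp \<and>
     (\<forall>t. a - \<delta> < t \<longrightarrow> t < b + \<delta> \<longrightarrow> Yt (of_real t) = complex_vec (\<eta> t)) \<and>
     (\<forall>t>b. Ym (of_real t) = complex_vec (\<eta> t)) \<and> (\<forall>t<a. Yp (of_real t) = complex_vec (\<eta> t)) \<and>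
     (\<forall>t\<in>overlap_minus \<Gamma>. Yt t = Ym t) \<and> (\<forall>t\<in>overlap_plus \<Gamma>. Yt t = Yp t)"

lemma glue_solutions:
  assumes Y: "TS Yt" "minus.VEsol Ym" "plus.VEsol Yp"
    and r: "\<And>t. a - \<delta> < t \<Longrightarrow> t < b + \<delta> \<Longrightarrow> b < t \<Longrightarrow> Yt (of_real t) = Ym (of_real t)"
      "\<And>t. a - \<delta> < t \<Longrightarrow> t < b + \<delta> \<Longrightarrow> t < a \<Longrightarrow> Yt (of_real t) = Yp (of_real t)"
  shows "t \<in> overlap_minus \<Gamma> \<Longrightarrow> Yt t = Ym t" "t \<in> overlap_plus \<Gamma> \<Longrightarrow> Yt t = Yp t"
proof -
  define S where "S = {t. a - \<delta> < Re t \<and> Re t < b + \<delta>}"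
  have S: "open S" unfolding S_def by (intro open_Collect_conj open_Collect_less continuous_intros)
  have Sm: "of_real bm \<in> S" "of_real ap \<in> S" using bm ap by (auto simp: S_def)
  { fix t i assume t: "t \<in> overlap_minus \<Gamma>"
    have "Yt t $ i = Ym t $ i"
    proof (rule identity_near_real[OF open_overlap(1) conn_overlap(1) _ _ bm(4) S Sm(1) _ t])
      show "(\<lambda>t. Yt t $ i) holomorphic_on overlap_minus \<Gamma>"
        using TS_holo[OF Y(1)] by (rule holomorphic_on_subset) (simp add: overlap_eq)
      show "(\<lambda>t. Ym t $ i) holomorphic_on overlap_minus \<Gamma>"
        using minus.VEsol_holo[OF Y(2)] by (rule holomorphic_on_subset) (simp add: overlap_eq)
    qed (simp add: S_def overlap_eq minus_real r) }
  then show "t \<in> overlap_minus \<Gamma> \<Longrightarrow> Yt t = Ym t" by (simp add: vec_eq_iff)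
  { fix t i assume t: "t \<in> overlap_plus \<Gamma>"
    have "Yt t $ i = Yp t $ i"
    proof (rule identity_near_real[OF open_overlap(2) conn_overlap(2) _ _ ap(4) S Sm(2) _ t])
      show "(\<lambda>t. Yt t $ i) holomorphic_on overlap_plus \<Gamma>"
        using TS_holo[OF Y(1)] by (rule holomorphic_on_subset) (simp add: overlap_eq)
      show "(\<lambda>t. Yp t $ i) holomorphic_on overlap_plus \<Gamma>"
        using plus.VEsol_holo[OF Y(3)] by (rule holomorphic_on_subset) (simp add: overlap_eq)
    qed (simp add: S_def overlap_eq plus_real r) }
  then show "t \<in> overlap_plus \<Gamma> \<Longrightarrow> Yt t = Yp t" by (simp add: vec_eq_iff)
qed

text \<open>The time chart and the two half-planes are simply connected, so each carries a solution
  with a prescribed initial value. Uniqueness on the real line identifies it with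
  \<open>\<eta>\<close>, and the identity theorem yields agreement on the overlaps.\<close>

lemma VE_extends:
  assumes \<eta>: "solves_VE V xh \<eta>"
  shows "\<exists>Yt Ym Yp. extends \<eta> Yt Ym Yp"
proof -
  have d: "(\<eta> has_vector_derivative jacobian V (at (xh t)) *v \<eta> t) (at t)" for t using \<eta> by (simp add: solves_VE_def)
  obtain Yt where Yt: "TS Yt" "Yt (of_real b) = complex_vec (\<eta> b)" using TS_exists by blast
  obtain Ym where Ym: "minus.VEsol Ym" "Ym (of_real cm) = complex_vec (\<eta> cm)" using minus.VEsol_exists[OF minus.cH] by blast
  obtain Yp where Yp: "plus.VEsol Yp" "Yp (of_real cp) = complex_vec (\<eta> cp)" using plus.VEsol_exists[OF plus.cH] by blast
  have t: "Yt (of_real t) = complex_vec (\<eta> t)" if "a - \<delta> < t" "t < b + \<delta>" for t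
  proof (rule complex_VE_eq[of "{a - \<delta><..<b + \<delta>}" _ "\<lambda>t. At (of_real t)" _ b])
    fix t assume "t \<in> {a - \<delta><..<b + \<delta>}"
    then have S: "complex_of_real t \<in> Sigma_t \<Gamma>" using \<delta>(2) by simp
    show "((\<lambda>t. Yt (of_real t)) has_vector_derivative At (of_real t) *v Yt (of_real t)) (at t)" by (rule TS_real[OF Yt(1) S])
    show "((\<lambda>t. complex_vec (\<eta> t)) has_vector_derivative At (of_real t) *v complex_vec (\<eta> t)) (at t)"
      by (rule complex_vec_solution[OF d At_real[OF S]])
    show "At (of_real t) $ i $ j = of_real (jacobian V (at (xh t)) $ i $ j)" for i j by (rule At_real[OF S])
  qed (use that \<delta>(1) a_le_b Yt in auto)
  have m: "Ym (of_real t) = complex_vec (\<eta> t)" if "b < t" for t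
  proof (rule complex_VE_eq[of "{b<..}" _ "\<lambda>t. minus.A (of_real t)" _ cm])
    fix t assume "t \<in> {b<..}"
    then have S: "complex_of_real t \<in> minus.H" by (simp add: minus_real)
    show "((\<lambda>t. Ym (of_real t)) has_vector_derivative minus.A (of_real t) *v Ym (of_real t)) (at t)" by (rule minus.VEsol_real[OF Ym(1) S])
    show "((\<lambda>t. complex_vec (\<eta> t)) has_vector_derivative minus.A (of_real t) *v complex_vec (\<eta> t)) (at t)"
      by (rule complex_vec_solution[OF d minus.A_real[OF S]])
    show "minus.A (of_real t) $ i $ j = of_real (jacobian V (at (xh t)) $ i $ j)" for i j by (rule minus.A_real[OF S])
  qed (use that cm Ym in auto)
  have p: "Yp (of_real t) = complex_vec (\<eta> t)" if "t < a" for t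
  proof (rule complex_VE_eq[of "{..<a}" _ "\<lambda>t. plus.A (of_real t)" _ cp])
    fix t assume "t \<in> {..<a}"
    then have S: "complex_of_real t \<in> plus.H" by (simp add: plus_real)
    show "((\<lambda>t. Yp (of_real t)) has_vector_derivative plus.A (of_real t) *v Yp (of_real t)) (at t)" by (rule plus.VEsol_real[OF Yp(1) S])
    show "((\<lambda>t. complex_vec (\<eta> t)) has_vector_derivative plus.A (of_real t) *v complex_vec (\<eta> t)) (at t)"
      by (rule complex_vec_solution[OF d plus.A_real[OF S]])
    show "plus.A (of_real t) $ i $ j = of_real (jacobian V (at (xh t)) $ i $ j)" for i j by (rule plus.A_real[OF S])
  qed (use that cp Yp in auto)
  have "extends \<eta> Yt Ym Yp"
    unfolding extends_def
  proof (intro conjI allI ballI impI)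
    show "Yt t = Ym t" if "t \<in> overlap_minus \<Gamma>" for t
      by (rule glue_solutions(1)[OF Yt(1) Ym(1) Yp(1) _ _ that]) (simp_all add: t m p)
    show "Yt t = Yp t" if "t \<in> overlap_plus \<Gamma>" for t
      by (rule glue_solutions(2)[OF Yt(1) Ym(1) Yp(1) _ _ that]) (simp_all add: t m p)
  qed (fact Yt(1) Ym(1) Yp(1) | (rule t m p, assumption+))+
  then show ?thesis by blast
qed

text \<open>Global existence for the real equation is read off from the complex one: solutions on
  the three simply connected domains are matched along the real line, and the real part is
  taken.\<close>

lemma VE_exists: "\<exists>\<eta>. solves_VE V xh \<eta> \<and> \<eta> b = y0"
proof -
  obtain Yt where Yt: "TS Yt" "Yt (of_real b) = complex_vec y0" using TS_exists by blast
  have bmH: "of_real bm \<in> minus.H" and apH: "of_real ap \<in> plus.H" using bm ap by (simp_all add: minus_real plus_real)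
  obtain Ym where Ym: "minus.VEsol Ym" "Ym (of_real bm) = Yt (of_real bm)" using minus.VEsol_exists[OF bmH] by blast
  obtain Yp where Yp: "plus.VEsol Yp" "Yp (of_real ap) = Yt (of_real ap)" using plus.VEsol_exists[OF apH] by blast
  have m: "Yt (of_real t) = Ym (of_real t)" if "b < t" "t < b + \<delta>" for t
  proof (rule complex_VE_eq[of "{b<..<b + \<delta>}" _ "\<lambda>t. At (of_real t)" _ bm])
    fix t assume t: "t \<in> {b<..<b + \<delta>}"
    then have S: "complex_of_real t \<in> Sigma_t \<Gamma>" "complex_of_real t \<in> minus.H" using \<delta> a_le_b by (auto simp: minus_real)
    show "((\<lambda>t. Yt (of_real t)) has_vector_derivative At (of_real t) *v Yt (of_real t)) (at t)" by (rule TS_real[OF Yt(1) S(1)])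
    show "((\<lambda>t. Ym (of_real t)) has_vector_derivative At (of_real t) *v Ym (of_real t)) (at t)"
      using minus.VEsol_real[OF Ym(1) S(2)] S by (simp add: At_minus overlap_eq)
    show "At (of_real t) $ i $ j = of_real (jacobian V (at (xh t)) $ i $ j)" for i j by (rule At_real[OF S(1)])
  qed (use that bm Ym in auto)
  have p: "Yt (of_real t) = Yp (of_real t)" if "a - \<delta> < t" "t < a" for t
  proof (rule complex_VE_eq[of "{a - \<delta><..<a}" _ "\<lambda>t. At (of_real t)" _ ap])
    fix t assume t: "t \<in> {a - \<delta><..<a}"
    then have S: "complex_of_real t \<in> Sigma_t \<Gamma>" "complex_of_real t \<in> plus.H" using \<delta> a_le_b by (auto simp: plus_real)
    show "((\<lambda>t. Yt (of_real t)) has_vector_derivative At (of_real t) *v Yt (of_real t)) (at t)" by (rule TS_real[OF Yt(1) S(1)])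
    show "((\<lambda>t. Yp (of_real t)) has_vector_derivative At (of_real t) *v Yp (of_real t)) (at t)"
      using plus.VEsol_real[OF Yp(1) S(2)] S by (simp add: At_plus overlap_eq)
    show "At (of_real t) $ i $ j = of_real (jacobian V (at (xh t)) $ i $ j)" for i j by (rule At_real[OF S(1)])
  qed (use that ap Yp in auto)
  define Y where "Y t = (if b < t then Ym (of_real t) else if t < a then Yp (of_real t) else Yt (of_real t))" for t
  define \<eta> where "\<eta> t = (\<chi> i. Re (Y t $ i))" for t
  have dY: "\<exists>B. (Y has_vector_derivative B *v Y t) (at t) \<and> (\<forall>i j. B $ i $ j = of_real (jacobian V (at (xh t)) $ i $ j))" for t
  proof -
    consider "b < t" | "t < a" | "a \<le> t" "t \<le> b" by linarith
    then show ?thesis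
    proof cases
      case 1
      then have H: "complex_of_real t \<in> minus.H" by (simp add: minus_real)
      have "(Y has_vector_derivative minus.A (of_real t) *v Ym (of_real t)) (at t)"
        by (rule has_vector_derivative_transform_within_open[OF minus.VEsol_real[OF Ym(1) H], of "{b<..}"]) (use 1 in \<open>auto simp: Y_def\<close>)
      then show ?thesis using minus.A_real[OF H] 1 by (auto simp: Y_def)
    next
      case 2
      then have H: "complex_of_real t \<in> plus.H" by (simp add: plus_real)
      have "(Y has_vector_derivative plus.A (of_real t) *v Yp (of_real t)) (at t)"
        by (rule has_vector_derivative_transform_within_open[OF plus.VEsol_real[OF Yp(1) H], of "{..<a}"]) (use 2 a_le_b in \<open>auto simp: Y_def\<close>)
      then show ?thesis using plus.A_real[OF H] 2 a_le_b by (auto simp: Y_def)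
    next
      case 3
      then have S: "complex_of_real t \<in> Sigma_t \<Gamma>" by (rule middle_Sigma)
      have "(Y has_vector_derivative At (of_real t) *v Yt (of_real t)) (at t)"
        by (rule has_vector_derivative_transform_within_open[OF TS_real[OF Yt(1) S], of "{a - \<delta><..<b + \<delta>}"])
          (use 3 \<delta>(1) m p in \<open>auto simp: Y_def\<close>)
      then show ?thesis using At_real[OF S] 3 by (auto simp: Y_def)
    qed
  qed
  have "(\<eta> has_vector_derivative jacobian V (at (xh t)) *v \<eta> t) (at t)" for t
  proof (rule has_vector_derivative_vec)
    fix i
    obtain B where B: "(Y has_vector_derivative B *v Y t) (at t)" "\<And>i j. B $ i $ j = of_real (jacobian V (at (xh t)) $ i $ j)"
      using dY by blast
    have "Re ((B *v Y t) $ i) = (jacobian V (at (xh t)) *v \<eta> t) $ i" by (simp add: matrix_vector_mult_def B(2) \<eta>_def)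
    then show "((\<lambda>t. \<eta> t $ i) has_vector_derivative (jacobian V (at (xh t)) *v \<eta> t) $ i) (at t)"
      using bounded_linear.has_vector_derivative[OF bounded_linear_Re has_vector_derivative_nth[OF B(1), of i]] by (simp add: \<eta>_def)
  qed
  moreover have "\<eta> b = y0" using Yt(2) a_le_b by (simp add: \<eta>_def Y_def vec_eq_iff)
  ultimately show ?thesis by (auto simp: solves_VE_def)
qed

lemma velocity_VE: "solves_VE V xh (\<lambda>t. V (xh t))"
  unfolding solves_VE_def
proof
  fix t
  have "(xh has_derivative (\<lambda>h. h *\<^sub>R V (xh t))) (at t)" using sol by (simp add: solves_on_def has_vector_derivative_def)
  from has_derivative_compose[OF this complexification_jacobian(1)[OF cx]]
  show "((\<lambda>t. V (xh t)) has_vector_derivative jacobian V (at (xh t)) *v V (xh t)) (at t)"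
    by (simp add: has_vector_derivative_def matrix_vector_mult_scaleR)
qed

lemma VE_zero:
  assumes "solves_VE V xh \<eta>" "\<eta> s = 0" shows "\<eta> t = 0"
  by (rule real_VE_unique[of UNIV]) (use assms in \<open>auto simp: solves_VE_def\<close>)

lemma VE_combination:
  assumes "solves_VE V xh \<eta>" "solves_VE V xh \<zeta>" "solves_VE V xh \<theta>"
  shows "solves_VE V xh (\<lambda>t. p *\<^sub>R \<eta> t + q *\<^sub>R \<zeta> t + r *\<^sub>R \<theta> t)"
proof -
  have s: "((\<lambda>t. r *\<^sub>R u t) has_vector_derivative r *\<^sub>R d) (at t)" if "(u has_vector_derivative d) (at t)" for r and u :: "real \<Rightarrow> real^4" and d t
    by (rule bounded_linear.has_vector_derivative[OF bounded_linear_scaleR_right that])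
  have "((\<lambda>t. p *\<^sub>R \<eta> t + q *\<^sub>R \<zeta> t + r *\<^sub>R \<theta> t) has_vector_derivative p *\<^sub>R (jacobian V (at (xh t)) *v \<eta> t) +
     q *\<^sub>R (jacobian V (at (xh t)) *v \<zeta> t) + r *\<^sub>R (jacobian V (at (xh t)) *v \<theta> t)) (at t)" for t
    using assms unfolding solves_VE_def by (intro has_vector_derivative_add s) auto
  then show ?thesis by (simp add: solves_VE_def matrix_vector_right_distrib matrix_vector_mult_scaleR)
qed

lemma velocity_tangent:
  assumes "range xh \<subseteq> M" shows "V (xh t) \<in> tangent_space M (xh t)"
proof -
  have "((\<lambda>s. xh (t + s)) has_vector_derivative V (xh t)) (at 0)"
  proof -
    have 1: "(xh has_vector_derivative V (xh t)) (at (t + 0))" using sol by (simp add: solves_on_def)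
    have 2: "((\<lambda>s. t + s) has_vector_derivative 1) (at 0)" by (auto intro!: derivative_eq_intros simp: has_vector_derivative_def)
    show ?thesis using vector_diff_chain_at[of "\<lambda>s. t + s" 1 0 xh "V (xh t)", OF 2 1] by (simp add: o_def)
  qed
  then show ?thesis unfolding tangent_space_def using assms
    by (auto intro!: exI[of _ "\<lambda>s. xh (t + s)"] exI[of _ 1])
qed

text \<open>A zero of the velocity would make it vanish identically, by uniqueness for the
  variational equation; the orbit would then be constant and equal to its limit 0.\<close>

lemma velocity_nonzero:
  assumes eq: "V 0 = 0" shows "V (xh t) \<noteq> 0"
proof
  assume z: "V (xh t) = 0"
  have "V (xh s) = 0" for s using VE_zero[OF velocity_VE z] .
  then have "(xh has_vector_derivative 0) (at s)" for s using sol unfolding solves_on_def by (metis UNIV_I)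
  then have "(xh has_derivative (\<lambda>_. 0)) (at s within UNIV)" for s by (simp add: has_vector_derivative_def)
  then obtain c where c: "\<And>s. xh s = c" using has_derivative_zero_constant[of UNIV xh] by (auto simp: convex_UNIV)
  then have "xh = (\<lambda>_. c)" by blast
  then have "((\<lambda>_. c) \<longlongrightarrow> 0) (at_top :: real filter)" using xh_limits(1) by simp
  then have "c = 0" by (simp add: tendsto_const_iff)
  then show False using homoclinic c by (auto simp: homoclinic_orbit_def)
qed

end

section \<open>The planes of bounded and of tangent solutions\<close>

text \<open>If the minor vanished, combinations of \<open>x\<close> and \<open>y\<close> with
  coefficients taken from these components would have zero components \<open>k\<close> and
  \<open>l\<close>, hence be zero, against independence.\<close>

lemma graph_minor_nonzero:
  fixes x y :: "real^'n"
  assumes x: "\<And>i. complex_of_real (x $ i) = g i * of_real (x $ k) + h i * of_real (x $ l)"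
    and y: "\<And>i. complex_of_real (y $ i) = g i * of_real (y $ k) + h i * of_real (y $ l)"
    and ind: "\<And>a b. a *\<^sub>R x + b *\<^sub>R y = 0 \<Longrightarrow> a = 0 \<and> b = 0"
  shows "x $ k * y $ l - x $ l * y $ k \<noteq> 0"
proof
  assume d: "x $ k * y $ l - x $ l * y $ k = 0"
  have lin: "a *\<^sub>R x + b *\<^sub>R y = 0" if k: "a * x $ k + b * y $ k = 0" and l: "a * x $ l + b * y $ l = 0" for a b
  proof -
    have "complex_of_real ((a *\<^sub>R x + b *\<^sub>R y) $ i) =
      g i * of_real (a * x $ k + b * y $ k) + h i * of_real (a * x $ l + b * y $ l)" for i
      using x[of i] y[of i] by (simp add: algebra_simps)
    then show ?thesis by (simp add: k l vec_eq_iff del: vector_add_component vector_scaleR_component)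
  qed
  have "y $ k = 0 \<and> - x $ k = 0" by (rule ind[OF lin]) (use d in \<open>auto simp: algebra_simps\<close>)
  moreover have "y $ l = 0 \<and> - x $ l = 0" by (rule ind[OF lin]) (use d in \<open>auto simp: algebra_simps\<close>)
  ultimately have "1 *\<^sub>R x + 0 *\<^sub>R y = 0" by (intro lin) auto
  from ind[OF this] show False by simp
qed

lemma tendsto_qf:
  assumes "(u \<longlongrightarrow> v) \<F>" shows "((\<lambda>t. qf sg W (u t) (u t)) \<longlongrightarrow> qf sg W v v) \<F>"
  unfolding qf_def
  by (intro tendsto_sum tendsto_mult tendsto_const tendsto_vec_nth bounded_linear.tendsto[OF matrix_vector_mul_bounded_linear assms])

context end_chart
begin

lemma bounded_plane_plucker:
  assumes t0: "of_real t0 \<in> H" and t1: "t1 \<in> tail t0"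
    and neg: "\<And>\<xi>. (\<And>t. t \<in> tail t0 \<Longrightarrow> (\<xi> has_vector_derivative jacobian V (at (xh t)) *v \<xi> t) (at t)) \<Longrightarrow>
       bounded (\<xi> ` tail t0) \<Longrightarrow> \<xi> t1 \<noteq> 0 \<Longrightarrow> qf sg W (\<xi> t1) (\<xi> t1) < 0"
    and sg: "\<And>k. k \<noteq> i \<Longrightarrow> k \<noteq> j \<Longrightarrow> sg k \<ge> 0"
    and \<xi>: "solves_VE V xh \<xi>1" "solves_VE V xh \<xi>2"
    and b: "bounded (\<xi>1 ` tail t0)" "bounded (\<xi>2 ` tail t0)"
    and ind: "\<And>a b. a *\<^sub>R \<xi>1 t1 + b *\<^sub>R \<xi>2 t1 = 0 \<Longrightarrow> a = 0 \<and> b = 0"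
    and Y: "VEsol Y1" "VEsol Y2" and Y1: "\<And>t. of_real t \<in> H \<Longrightarrow> Y1 (of_real t) = complex_vec (\<xi>1 t)"
    and Y2: "\<And>t. of_real t \<in> H \<Longrightarrow> Y2 (of_real t) = complex_vec (\<xi>2 t)"
  shows "\<exists>s P. (\<forall>i j. P i j meromorphic_on ball 0 \<rho>) \<and> (\<forall>t\<in>H. \<forall>i j. P i j (e t) = exp (s * t) * pl (Y1 t) (Y2 t) i j)"
proof -
  have bY: "bounded ((\<lambda>t. Y (of_real t)) ` tail t0)" if "bounded (\<xi> ` tail t0)" "\<And>t. of_real t \<in> H \<Longrightarrow> Y (of_real t) = complex_vec (\<xi> t)" for Y \<xi>
  proof -
    have "norm (Y (of_real t)) = norm (\<xi> t)" if "t \<in> tail t0" for t using tail_H[OF t0 that] \<open>\<And>t. of_real t \<in> H \<Longrightarrow> Y (of_real t) = complex_vec (\<xi> t)\<close> by simp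
    then show ?thesis using that(1) by (simp add: bounded_iff)
  qed
  have d: "(\<xi>1 has_vector_derivative jacobian V (at (xh t)) *v \<xi>1 t) (at t)" "(\<xi>2 has_vector_derivative jacobian V (at (xh t)) *v \<xi>2 t) (at t)" for t
    using \<xi> by (simp_all add: solves_VE_def)
  have t1H: "of_real t1 \<in> H" by (rule tail_H[OF t0 t1])
  have sh: "\<exists>a b. Y (of_real t1 + per) = a *s complex_vec (\<xi>1 t1) + b *s complex_vec (\<xi>2 t1)"
    if "VEsol Y" "bounded ((\<lambda>t. Y (of_real t)) ` tail t0)" for Y
  proof (rule bounded_plane_shift[OF t0 t1, where W=W and sg=sg and i=i and j=j])
    show "qf sg W (\<zeta> t1) (\<zeta> t1) < 0"
      if "\<And>t. t \<in> tail t0 \<Longrightarrow> (\<zeta> has_vector_derivative jacobian V (at (xh t)) *v \<zeta> t) (at t)" "bounded (\<zeta> ` tail t0)" "\<zeta> t1 \<noteq> 0" for \<zeta>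
      by (rule neg[OF that])
    show "0 \<le> sg k" if "k \<noteq> i" "k \<noteq> j" for k by (rule sg[OF that])
    show "(\<xi>1 has_vector_derivative jacobian V (at (xh t)) *v \<xi>1 t) (at t)" "(\<xi>2 has_vector_derivative jacobian V (at (xh t)) *v \<xi>2 t) (at t)" for t
      by (rule d)+
    show "p = 0 \<and> q = 0" if "p *\<^sub>R \<xi>1 t1 + q *\<^sub>R \<xi>2 t1 = 0" for p q by (rule ind[OF that])
  qed (fact b that)+
  obtain a1 b1 where 1: "Y1 (of_real t1 + per) = a1 *s complex_vec (\<xi>1 t1) + b1 *s complex_vec (\<xi>2 t1)"
    using sh[OF Y(1) bY[OF b(1) Y1]] by blast
  obtain a2 b2 where 2: "Y2 (of_real t1 + per) = a2 *s complex_vec (\<xi>1 t1) + b2 *s complex_vec (\<xi>2 t1)"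
    using sh[OF Y(2) bY[OF b(2) Y2]] by blast
  show ?thesis
    by (rule plucker_meromorphic[OF Y t1H]) (use 1 2 Y1[OF t1H] Y2[OF t1H] in auto)
qed

text \<open>Composed with \<open>h\<close>, the slopes of the graph are holomorphic on a disc about
  the singular point, centre included. The value at the centre makes the tangent plane at the
  equilibrium the limit of those along the orbit.\<close>

lemma tangent_graph:
  assumes M: "analytic_surface M" "0 \<in> M" and h0: "h 0 = 0" and xM: "\<And>t. xh t \<in> M"
  shows "\<exists>k l \<rho>' g g'. 0 < \<rho>' \<and> \<rho>' \<le> \<rho> \<and> (\<forall>i. g i holomorphic_on ball 0 \<rho>' \<and> g' i holomorphic_on ball 0 \<rho>') \<and>
    (\<forall>t. norm (e (of_real t)) < \<rho>' \<longrightarrow> (\<forall>v\<in>tangent_space M (xh t). \<forall>i.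
       of_real (v $ i) = g i (e (of_real t)) * of_real (v $ k) + g' i (e (of_real t)) * of_real (v $ l))) \<and>
    (\<forall>v\<in>tangent_space M 0. \<forall>i. of_real (v $ i) = g i 0 * of_real (v $ k) + g' i 0 * of_real (v $ l))"
proof -
  obtain k l r Gk Gl where r: "r > 0" and hol: "\<And>S x y i. open S \<Longrightarrow> x holomorphic_on S \<Longrightarrow> y holomorphic_on S \<Longrightarrow>
       (\<forall>z\<in>S. norm (x z - of_real ((0::real^4) $ k)) < r \<and> norm (y z - of_real ((0::real^4) $ l)) < r) \<Longrightarrow>
       (\<lambda>z. Gk i (x z) (y z)) holomorphic_on S \<and> (\<lambda>z. Gl i (x z) (y z)) holomorphic_on S"
    and gr: "\<And>q v i. q \<in> M \<Longrightarrow> dist q 0 < r \<Longrightarrow> v \<in> tangent_space M q \<Longrightarrow> complex_of_real (v $ i) =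
       Gk i (of_real (q $ k)) (of_real (q $ l)) * of_real (v $ k) + Gl i (of_real (q $ k)) (of_real (q $ l)) * of_real (v $ l)"
    using surface_graph[OF M] by (elim exE conjE) blast
  have hc: "continuous_on (ball 0 \<rho>) h"
  proof -
    have "h = (\<lambda>z. \<chi> i. h z $ i)" by simp
    moreover have "continuous_on (ball 0 \<rho>) (\<lambda>z. \<chi> i. h z $ i)"
      by (rule continuous_on_vec_lambda) (use h in \<open>auto simp: holo_curve_def intro: holomorphic_on_imp_continuous_on\<close>)
    ultimately show ?thesis by simp
  qed
  then have "isCont h 0" using \<rho> by (simp add: continuous_on_eq_continuous_at)
  then obtain d where d: "d > 0" "\<And>z. dist z 0 < d \<Longrightarrow> dist (h z) (h 0) < r"
    using r unfolding continuous_at_eps_delta by blast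
  define \<rho>' where "\<rho>' = min d \<rho>"
  define g where "g i z = Gk i (h z $ k) (h z $ l)" for i z
  define g' where "g' i z = Gl i (h z $ k) (h z $ l)" for i z
  have small: "norm (h z) < r" if "norm z < \<rho>'" for z using d(2)[of z] that h0 by (simp add: \<rho>'_def)
  have hh: "(\<lambda>z. h z $ i) holomorphic_on ball 0 \<rho>'" for i
    by (rule holomorphic_on_subset[OF h[unfolded holo_curve_def, rule_format]]) (auto simp: \<rho>'_def)
  have sm: "\<forall>z\<in>ball 0 \<rho>'. norm (h z $ k - of_real ((0::real^4) $ k)) < r \<and> norm (h z $ l - of_real ((0::real^4) $ l)) < r"
  proof
    fix z :: complex assume z: "z \<in> ball 0 \<rho>'"
    have "norm (h z $ i) < r" for i using Finite_Cartesian_Product.norm_nth_le[of "h z" i] small[of z] z by simp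
    then show "norm (h z $ k - of_real ((0::real^4) $ k)) < r \<and> norm (h z $ l - of_real ((0::real^4) $ l)) < r" by simp
  qed
  have gh: "g i holomorphic_on ball 0 \<rho>' \<and> g' i holomorphic_on ball 0 \<rho>'" for i
    unfolding g_def[abs_def] g'_def[abs_def] by (rule hol[OF open_ball hh hh sm])
  have grt: "complex_of_real (v $ i) = g i (e (of_real t)) * of_real (v $ k) + g' i (e (of_real t)) * of_real (v $ l)"
    if t: "norm (e (of_real t)) < \<rho>'" and v: "v \<in> tangent_space M (xh t)" for t v i
  proof -
    have "of_real t \<in> H" using t by (simp add: H_def \<rho>'_def)
    then have eq: "h (e (of_real t)) = complex_vec (xh t)" by (simp add: xh_eq)
    have "dist (xh t) 0 < r" using small[OF t] by (simp add: eq)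
    from gr[OF xM this v, of i] show ?thesis unfolding g_def g'_def eq complex_vec_nth .
  qed
  have gr0: "complex_of_real (v $ i) = g i 0 * of_real (v $ k) + g' i 0 * of_real (v $ l)" if "v \<in> tangent_space M 0" for v i
    using gr[OF M(2) _ that, of i] r unfolding g_def g'_def h0 by simp
  have pos: "0 < \<rho>'" "\<rho>' \<le> \<rho>" using d(1) \<rho> by (auto simp: \<rho>'_def)
  have A: "\<forall>i. g i holomorphic_on ball 0 \<rho>' \<and> g' i holomorphic_on ball 0 \<rho>'" by (intro allI gh)
  have B: "\<forall>t. norm (e (of_real t)) < \<rho>' \<longrightarrow> (\<forall>v\<in>tangent_space M (xh t). \<forall>i.
       of_real (v $ i) = g i (e (of_real t)) * of_real (v $ k) + g' i (e (of_real t)) * of_real (v $ l))"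
    by (intro allI impI ballI, rule grt)
  have C: "\<forall>v\<in>tangent_space M 0. \<forall>i. of_real (v $ i) = g i 0 * of_real (v $ k) + g' i 0 * of_real (v $ l)"
    by (intro ballI allI, rule gr0)
  show ?thesis
    by (rule exI[of _ k], rule exI[of _ l], rule exI[of _ \<rho>'], rule exI[of _ g], rule exI[of _ g'],
        rule conjI[OF pos(1) conjI[OF pos(2) conjI[OF A conjI[OF B C]]]])
qed

lemma tangent_plane_plucker:
  assumes M: "analytic_surface M" "0 \<in> M" and h0: "h 0 = 0" and xM: "\<And>t. xh t \<in> M"
    and tan: "\<And>t. \<xi>1 t \<in> tangent_space M (xh t)" "\<And>t. \<xi>2 t \<in> tangent_space M (xh t)"
    and ind: "\<And>t a b. a *\<^sub>R \<xi>1 t + b *\<^sub>R \<xi>2 t = 0 \<Longrightarrow> a = 0 \<and> b = 0"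
    and Y: "VEsol Y1" "VEsol Y2" and Y1: "\<And>t. of_real t \<in> H \<Longrightarrow> Y1 (of_real t) = complex_vec (\<xi>1 t)"
    and Y2: "\<And>t. of_real t \<in> H \<Longrightarrow> Y2 (of_real t) = complex_vec (\<xi>2 t)"
  shows "\<exists>s P. (\<forall>i j. P i j meromorphic_on ball 0 \<rho>) \<and> (\<forall>t\<in>H. \<forall>i j. P i j (e t) = exp (s * t) * pl (Y1 t) (Y2 t) i j)"
proof -
  obtain k l \<rho>' g g' where \<rho>': "0 < \<rho>'" "\<rho>' \<le> \<rho>" and g: "\<And>i. g i holomorphic_on ball 0 \<rho>'" "\<And>i. g' i holomorphic_on ball 0 \<rho>'"
    and gr: "\<And>t v i. norm (e (of_real t)) < \<rho>' \<Longrightarrow> v \<in> tangent_space M (xh t) \<Longrightarrow>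
       complex_of_real (v $ i) = g i (e (of_real t)) * of_real (v $ k) + g' i (e (of_real t)) * of_real (v $ l)"
    using tangent_graph[OF M h0 xM] by (elim exE conjE) blast
  define t1 where "t1 = (ln \<rho>' - 1) / lam"
  have t1: "norm (e (of_real t1)) < \<rho>'"
  proof -
    have "exp (lam * t1) = exp (ln \<rho>' - 1)" using lam by (simp add: t1_def)
    also have "\<dots> < exp (ln \<rho>')" by simp
    also have "\<dots> = \<rho>'" using \<rho>' by simp
    finally show ?thesis by (simp add: norm_e)
  qed
  have inH: "of_real t \<in> H" if "norm (e (of_real t)) < \<rho>'" for t using that \<rho>' by (simp add: H_def)
  have r1: "Y1 (of_real t) $ i = g i (e (of_real t)) * Y1 (of_real t) $ k + g' i (e (of_real t)) * Y1 (of_real t) $ l"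
    if "norm (e (of_real t)) < \<rho>'" for t i unfolding Y1[OF inH[OF that]] complex_vec_nth by (rule gr[OF that tan(1)])
  have r2: "Y2 (of_real t) $ i = g i (e (of_real t)) * Y2 (of_real t) $ k + g' i (e (of_real t)) * Y2 (of_real t) $ l"
    if "norm (e (of_real t)) < \<rho>'" for t i unfolding Y2[OF inH[OF that]] complex_vec_nth by (rule gr[OF that tan(2)])
  have "\<xi>1 t1 $ k * \<xi>2 t1 $ l - \<xi>1 t1 $ l * \<xi>2 t1 $ k \<noteq> 0"
    by (rule graph_minor_nonzero[OF gr[OF t1 tan(1)] gr[OF t1 tan(2)]]) (rule ind)
  then have "complex_of_real (\<xi>1 t1 $ k * \<xi>2 t1 $ l - \<xi>1 t1 $ l * \<xi>2 t1 $ k) \<noteq> 0" by (simp only: of_real_eq_0_iff not_False_eq_True)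
  then have p: "pl (Y1 (of_real t1)) (Y2 (of_real t1)) k l \<noteq> 0"
    by (simp add: pl_def Y1[OF inH[OF t1]] Y2[OF inH[OF t1]])
  obtain a1 b1 a2 b2 where "Y1 (of_real t1 + per) = a1 *s Y1 (of_real t1) + b1 *s Y2 (of_real t1)"
    "Y2 (of_real t1 + per) = a2 *s Y1 (of_real t1) + b2 *s Y2 (of_real t1)"
    using graph_plane_shift[OF \<rho>' t1 g Y r1 r2 p] by blast
  then show ?thesis by (rule plucker_meromorphic[OF Y inH[OF t1]])
qed

end

locale bounded_VE_setting = desing_orbit +
  fixes l1 l2 l3 l4 :: real and \<xi> :: "real \<Rightarrow> real^4"
  assumes surface: "analytic_surface M" and invariant: "flow_invariant V M" and M0: "0 \<in> M" and orbit_M: "range xh \<subseteq> M"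
    and V0: "V 0 = 0"
    and char: "\<forall>s. det (mat s - jacobian V (at 0)) = (s - l1) * (s - l2) * (s - l3) * (s - l4)"
    and saddle: "l1 \<le> l2" "l2 < 0" "0 < l3" "l3 \<le> l4"
    and \<xi>: "solves_VE V xh \<xi>" "bounded (range \<xi>)"
    and \<xi>_indep: "\<And>p q. (\<And>t. p *\<^sub>R \<xi> t + q *\<^sub>R V (xh t) = 0) \<Longrightarrow> p = 0 \<and> q = 0"
begin

abbreviation v where "v t \<equiv> V (xh t)"

lemma xM: "xh t \<in> M" using orbit_M by blast

lemma independent_at:
  assumes "p *\<^sub>R v t + q *\<^sub>R \<xi> t = 0" shows "p = 0 \<and> q = 0"
proof -
  have "solves_VE V xh (\<lambda>t. p *\<^sub>R v t + q *\<^sub>R \<xi> t + 0 *\<^sub>R \<xi> t)" by (rule VE_combination[OF velocity_VE \<xi>(1) \<xi>(1)])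
  from VE_zero[OF this, of t] assms have "q *\<^sub>R \<xi> s + p *\<^sub>R v s = 0" for s by (simp add: add.commute)
  from \<xi>_indep[OF this] show ?thesis by simp
qed

lemma v_limits: "(v \<longlongrightarrow> 0) at_top" "(v \<longlongrightarrow> 0) at_bot"
proof -
  have "isCont V 0" using complexification_jacobian(1)[OF cx, of 0] has_derivative_continuous by blast
  from isCont_tendsto_compose[OF this xh_limits(1)] isCont_tendsto_compose[OF this xh_limits(2)]
  show "(v \<longlongrightarrow> 0) at_top" "(v \<longlongrightarrow> 0) at_bot" by (simp_all add: V0)
qed

lemma tails: "minus.tail t = {t..}" "plus.tail t = {..t}"
  using lam_signs by (auto simp: minus.tail_def plus.tail_def)

lemma v_bounded: "\<exists>N. bounded (v ` {N..}) \<and> N > b" "\<exists>N. bounded (v ` {..N}) \<and> N < a"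
proof -
  obtain N where "\<And>t. t \<ge> N \<Longrightarrow> norm (v t) < 1"
    using tendstoD[OF v_limits(1), of 1] unfolding eventually_at_top_linorder by auto
  then show "\<exists>N. bounded (v ` {N..}) \<and> N > b"
    by (intro exI[of _ "max N (b + 1)"]) (auto simp: bounded_iff intro!: exI[of _ 1] less_imp_le)
  obtain N where "\<And>t. t \<le> N \<Longrightarrow> norm (v t) < 1"
    using tendstoD[OF v_limits(2), of 1] unfolding eventually_at_bot_linorder by auto
  then show "\<exists>N. bounded (v ` {..N}) \<and> N < a"
    by (intro exI[of _ "min N (a - 1)"]) (auto simp: bounded_iff intro!: exI[of _ 1] less_imp_le)
qed

lemma form: "\<exists>W c. c > 0 \<and> (\<forall>v. c * (norm v)\<^sup>2 \<le> 2 * qf sgn_form W v (jacobian V (at 0) *v v))"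
  by (rule lyapunov_form_exists[OF char saddle])

lemma bounded_plucker_minus:
  assumes X: "extends v Xt Xm Xp" and Z: "extends \<xi> Zt Zm Zp"
  shows "\<exists>s P. (\<forall>i j. P i j meromorphic_on ball 0 (rad_minus \<Gamma>)) \<and>
    (\<forall>t\<in>minus.H. \<forall>i j. P i j (minus.e t) = exp (s * t) * pl (Xm t) (Zm t) i j)"
proof -
  obtain W c where c: "c > 0" "\<And>v. c * (norm v)\<^sup>2 \<le> 2 * qf sgn_form W v (jacobian V (at 0) *v v)" using form by blast
  obtain N where N: "bounded (v ` {N..})" "N > b" using v_bounded by blast
  obtain T where T: "T \<ge> N" "\<And>\<zeta> t. (\<And>t. t \<ge> N \<Longrightarrow> (\<zeta> has_vector_derivative jacobian V (at (xh t)) *v \<zeta> t) (at t)) \<Longrightarrow>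
      bounded (\<zeta> ` {N..}) \<Longrightarrow> t \<ge> T \<Longrightarrow> \<zeta> t \<noteq> 0 \<Longrightarrow> qf sgn_form W (\<zeta> t) (\<zeta> t) < 0"
    using bounded_VE_solutions_negative[OF cx c xh_limits(1), of N] by blast
  show ?thesis
  \<comment> \<open>The weights of \<open>sgn_form\<close> are negative exactly at the indices 1 and
    2; at the other end the opposite form has its negative weights at 3 and 4.\<close>
  proof (rule minus.bounded_plane_plucker[of N T sgn_form W 1 2 v \<xi>])
    show "bounded (\<xi> ` minus.tail N)" using \<xi>(2) by (rule bounded_subset) auto
  qed (use N T X Z \<xi>(1) velocity_VE independent_at in \<open>auto simp: tails minus_real extends_def\<close>)
qed

lemma bounded_plucker_plus:
  assumes X: "extends v Xt Xm Xp" and Z: "extends \<xi> Zt Zm Zp"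
  shows "\<exists>s P. (\<forall>i j. P i j meromorphic_on ball 0 (rad_plus \<Gamma>)) \<and>
    (\<forall>t\<in>plus.H. \<forall>i j. P i j (plus.e t) = exp (s * t) * pl (Xp t) (Zp t) i j)"
proof -
  obtain W c where c: "c > 0" "\<And>v. c * (norm v)\<^sup>2 \<le> 2 * qf sgn_form W v (jacobian V (at 0) *v v)" using form by blast
  obtain N where N: "bounded (v ` {..N})" "N < a" using v_bounded by blast
  obtain T where T: "T \<le> N" "\<And>\<zeta> t. (\<And>t. t \<le> N \<Longrightarrow> (\<zeta> has_vector_derivative jacobian V (at (xh t)) *v \<zeta> t) (at t)) \<Longrightarrow>
      bounded (\<zeta> ` {..N}) \<Longrightarrow> t \<le> T \<Longrightarrow> \<zeta> t \<noteq> 0 \<Longrightarrow> qf (\<lambda>i. - sgn_form i) W (\<zeta> t) (\<zeta> t) < 0"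
    using bounded_VE_solutions_positive[OF cx c xh_limits(2), of N] by blast
  show ?thesis
  proof (rule plus.bounded_plane_plucker[of N T "\<lambda>i. - sgn_form i" W 3 4 v \<xi>])
    show "bounded (\<xi> ` plus.tail N)" using \<xi>(2) by (rule bounded_subset) auto
    show "0 \<le> - sgn_form k" if "k \<noteq> 3" "k \<noteq> 4" for k using that exhaust_4[of k] by auto
  qed (use N T X Z \<xi>(1) velocity_VE independent_at in \<open>auto simp: tails plus_real extends_def\<close>)
qed

text \<open>The bounded solutions are negative for the form near \<open>t = \<infinity>\<close>, whereas the limit \<open>T\<^sub>0M\<close> of the
  tangent planes contains an expanding direction.\<close>

lemma tangent_not_bounded:
  assumes \<tau>: "solves_VE V xh \<tau>" and tan: "\<And>t. \<tau> t \<in> tangent_space M (xh t)"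
    and ind: "\<And>t p q. p *\<^sub>R v t + q *\<^sub>R \<tau> t = 0 \<Longrightarrow> p = 0 \<and> q = 0"
    and z: "p *\<^sub>R v s + q *\<^sub>R \<xi> s + r *\<^sub>R \<tau> s = 0"
  shows "p = 0 \<and> q = 0 \<and> r = 0"
proof (cases "r = 0")
  case True
  then show ?thesis using independent_at[of p s q] z by simp
next
  case False
  have "p *\<^sub>R v t + q *\<^sub>R \<xi> t + r *\<^sub>R \<tau> t = 0" for t
    by (rule VE_zero[OF VE_combination[OF velocity_VE \<xi>(1) \<tau>] z])
  \<comment> \<open>A dependence with nonzero \<open>r\<close> makes \<open>\<tau>\<close> a
    combination of \<open>v\<close> and \<open>\<xi>\<close>, so all solutions tangent to
    \<open>M\<close> would be bounded at positive infinity.\<close>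
  then have \<tau>eq: "\<tau> t = (- p / r) *\<^sub>R v t + (- q / r) *\<^sub>R \<xi> t" for t
  proof -
    have "r *\<^sub>R \<tau> t = - p *\<^sub>R v t - q *\<^sub>R \<xi> t"
      using \<open>p *\<^sub>R v t + q *\<^sub>R \<xi> t + r *\<^sub>R \<tau> t = 0\<close> by (simp add: add_eq_0_iff)
    then have "(1 / r) *\<^sub>R (r *\<^sub>R \<tau> t) = (1 / r) *\<^sub>R (- p *\<^sub>R v t - q *\<^sub>R \<xi> t)" by (rule arg_cong)
    then show ?thesis using False by (simp add: scaleR_diff_right)
  qed
  obtain W c where c: "c > 0" "\<And>v. c * (norm v)\<^sup>2 \<le> 2 * qf sgn_form W v (jacobian V (at 0) *v v)" using form by blast
  obtain N where N: "bounded (v ` {N..})" "N > b" using v_bounded by blast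
  obtain T where T: "T \<ge> N" "\<And>\<zeta> t. (\<And>t. t \<ge> N \<Longrightarrow> (\<zeta> has_vector_derivative jacobian V (at (xh t)) *v \<zeta> t) (at t)) \<Longrightarrow>
      bounded (\<zeta> ` {N..}) \<Longrightarrow> t \<ge> T \<Longrightarrow> \<zeta> t \<noteq> 0 \<Longrightarrow> qf sgn_form W (\<zeta> t) (\<zeta> t) < 0"
    using bounded_VE_solutions_negative[OF cx c xh_limits(1), of N] by blast
  have b\<xi>: "bounded (\<xi> ` {N..})" using \<xi>(2) by (rule bounded_subset) auto
  have b\<tau>: "bounded (\<tau> ` {N..})" unfolding \<tau>eq by (intro bounded_plus_comp bounded_scaleR_comp N b\<xi>)
  have neg: "qf sgn_form W (\<alpha> *\<^sub>R v t + \<beta> *\<^sub>R \<tau> t) (\<alpha> *\<^sub>R v t + \<beta> *\<^sub>R \<tau> t) \<le> 0" if t: "t \<ge> T" for t \<alpha> \<beta>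
  proof (cases "\<alpha> *\<^sub>R v t + \<beta> *\<^sub>R \<tau> t = 0")
    case True
    then show ?thesis by (simp add: qf_def)
  next
    case nz: False
    have "solves_VE V xh (\<lambda>t. \<alpha> *\<^sub>R v t + \<beta> *\<^sub>R \<tau> t + 0 *\<^sub>R \<tau> t)" by (rule VE_combination[OF velocity_VE \<tau> \<tau>])
    then have "qf sgn_form W (\<alpha> *\<^sub>R v t + \<beta> *\<^sub>R \<tau> t) (\<alpha> *\<^sub>R v t + \<beta> *\<^sub>R \<tau> t) < 0"
      by (intro T(2)[of "\<lambda>t. \<alpha> *\<^sub>R v t + \<beta> *\<^sub>R \<tau> t"] bounded_plus_comp bounded_scaleR_comp N b\<tau> t nz) (simp add: solves_VE_def)
    then show ?thesis by simp
  qed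
  obtain w where w: "w \<in> tangent_space M 0" "w \<noteq> 0" "jacobian V (at 0) *v w = lam_plus \<Gamma> *\<^sub>R w"
    using nbhd unfolding desingularized_nbhd_def eigenvalue_on_def by blast
  obtain k l \<rho>' g g' where \<rho>': "0 < \<rho>'" "\<rho>' \<le> rad_minus \<Gamma>" and g: "\<And>i. g i holomorphic_on ball 0 \<rho>'" "\<And>i. g' i holomorphic_on ball 0 \<rho>'"
    and gr: "\<And>t v i. norm (minus.e (of_real t)) < \<rho>' \<Longrightarrow> v \<in> tangent_space M (xh t) \<Longrightarrow>
       complex_of_real (v $ i) = g i (minus.e (of_real t)) * of_real (v $ k) + g' i (minus.e (of_real t)) * of_real (v $ l)"
    and gr0: "\<And>v i. v \<in> tangent_space M 0 \<Longrightarrow> complex_of_real (v $ i) = g i 0 * of_real (v $ k) + g' i 0 * of_real (v $ l)"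
    using minus.tangent_graph[OF surface M0 h_0(1) xM] by (elim exE conjE) blast
  define d where "d t = v t $ k * \<tau> t $ l - v t $ l * \<tau> t $ k" for t
  \<comment> \<open>Coefficients by Cramer's rule: \<open>u t\<close> is the vector of the tangent
    plane at \<open>xh t\<close> with the same components \<open>k\<close> and \<open>l\<close> as
    the expanding eigenvector \<open>w\<close>. Since the slopes converge, \<open>u t\<close>
    converges to \<open>w\<close>.\<close>
  define \<alpha> where "\<alpha> t = (w $ k * \<tau> t $ l - w $ l * \<tau> t $ k) / d t" for t
  define \<beta> where "\<beta> t = (v t $ k * w $ l - v t $ l * w $ k) / d t" for t
  define u where "u t = \<alpha> t *\<^sub>R v t + \<beta> t *\<^sub>R \<tau> t" for t
  have vt: "v t \<in> tangent_space M (xh t)" for t by (rule velocity_tangent[OF orbit_M])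
  have e0: "((\<lambda>t. minus.e (of_real t)) \<longlongrightarrow> 0) at_top"
  proof (rule tendsto_norm_zero_cancel)
    have "filterlim (\<lambda>t. lam_minus \<Gamma> * t) at_bot at_top"
      using lam_signs(1) by (intro filterlim_tendsto_neg_mult_at_bot[OF tendsto_const]) (auto simp: filterlim_ident)
    then show "((\<lambda>t. norm (minus.e (of_real t))) \<longlongrightarrow> 0) at_top"
      unfolding minus.norm_e Re_complex_of_real by (rule filterlim_compose[OF exp_at_bot])
  qed
  have small: "\<forall>\<^sub>F t in at_top. norm (minus.e (of_real t)) < \<rho>'" using tendstoD[OF e0 \<rho>'(1)] by simp
  have uc: "complex_of_real (u t $ i) = g i (minus.e (of_real t)) * of_real (w $ k) + g' i (minus.e (of_real t)) * of_real (w $ l)"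
    if t: "norm (minus.e (of_real t)) < \<rho>'" for t i
  proof -
    have dn: "d t \<noteq> 0" unfolding d_def by (rule graph_minor_nonzero[OF gr[OF t vt] gr[OF t tan] ind])
    have "(\<alpha> t * v t $ k + \<beta> t * \<tau> t $ k) * d t = w $ k * d t" using dn by (simp add: \<alpha>_def \<beta>_def field_simps) (simp add: d_def algebra_simps)
    then have k: "\<alpha> t * v t $ k + \<beta> t * \<tau> t $ k = w $ k" using dn by simp
    have "(\<alpha> t * v t $ l + \<beta> t * \<tau> t $ l) * d t = w $ l * d t" using dn by (simp add: \<alpha>_def \<beta>_def field_simps) (simp add: d_def algebra_simps)
    then have l: "\<alpha> t * v t $ l + \<beta> t * \<tau> t $ l = w $ l" using dn by simp
    have "complex_of_real (u t $ i) = g i (minus.e (of_real t)) * of_real (\<alpha> t * v t $ k + \<beta> t * \<tau> t $ k) +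
       g' i (minus.e (of_real t)) * of_real (\<alpha> t * v t $ l + \<beta> t * \<tau> t $ l)"
      using gr[OF t vt, of i] gr[OF t tan, of i] by (simp add: u_def algebra_simps)
    then show ?thesis by (simp only: k l)
  qed
  have g0: "((\<lambda>t. f (minus.e (of_real t))) \<longlongrightarrow> f 0) at_top" if "f holomorphic_on ball 0 \<rho>'" for f
  proof -
    have "isCont f 0" using holomorphic_on_imp_continuous_on[OF that] \<rho>'(1) by (simp add: continuous_on_eq_continuous_at)
    then show ?thesis by (rule isCont_tendsto_compose[OF _ e0])
  qed
  have "((\<lambda>t. u t $ i) \<longlongrightarrow> w $ i) at_top" for i
  proof -
    have "((\<lambda>t. g i (minus.e (of_real t)) * of_real (w $ k) + g' i (minus.e (of_real t)) * of_real (w $ l)) \<longlongrightarrow>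
      g i 0 * of_real (w $ k) + g' i 0 * of_real (w $ l)) at_top" by (intro tendsto_intros g0 g)
    then have "((\<lambda>t. complex_of_real (u t $ i)) \<longlongrightarrow> complex_of_real (w $ i)) at_top"
      unfolding gr0[OF w(1), of i] by (rule Lim_transform_eventually) (use small in \<open>auto elim!: eventually_mono simp: uc\<close>)
    then show ?thesis by (simp add: tendsto_of_real_iff)
  qed
  then have "(u \<longlongrightarrow> w) at_top" by (rule vec_tendstoI)
  from tendsto_qf[OF this, of sgn_form W] have lim: "((\<lambda>t. qf sgn_form W (u t) (u t)) \<longlongrightarrow> qf sgn_form W w w) at_top" .
  \<comment> \<open>The sign on \<open>u t\<close> passes to the limit, while the growth condition
    on the form, applied to an eigenvector with positive eigenvalue, requires a positive value at
    \<open>w\<close>.\<close>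
  have "qf sgn_form W w w \<le> 0"
    by (rule tendsto_upperbound[OF lim]) (auto simp: u_def eventually_at_top_linorder intro!: exI[of _ T] neg)
  moreover have "0 < c * (norm w)\<^sup>2" using c(1) w(2) by simp
  then have "0 < 2 * (lam_plus \<Gamma> * qf sgn_form W w w)" using c(2)[of w] by (simp add: w(3) qf_scaleR_right)
  then have "0 < qf sgn_form W w w" using lam_signs(2) by (simp add: zero_less_mult_iff)
  ultimately show ?thesis by simp
qed

text \<open>A tangent vector at time \<open>b\<close> outside the line of the velocity is extended
  to a solution; it stays tangent by transport and independent by uniqueness.\<close>

lemma tangent_solution:
  "\<exists>\<tau>. solves_VE V xh \<tau> \<and> (\<forall>t. \<tau> t \<in> tangent_space M (xh t)) \<and> (\<forall>t p q. p *\<^sub>R v t + q *\<^sub>R \<tau> t = 0 \<longrightarrow> p = 0 \<and> q = 0)"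
proof -
  obtain y where y: "y \<in> tangent_space M (xh b)" "\<And>a. y \<noteq> a *\<^sub>R v b"
    using surface_tangent_vectors[OF surface xM, of b "v b"] velocity_nonzero[OF V0] by blast
  obtain \<tau> where \<tau>: "solves_VE V xh \<tau>" "\<tau> b = y" using VE_exists by blast
  have tan: "\<tau> t \<in> tangent_space M (xh t)" for t
    by (rule tangent_transport[OF cx sol invariant \<tau>(1), of b]) (use \<tau>(2) y(1) in simp)
  have "p = 0 \<and> q = 0" if z: "p *\<^sub>R v t + q *\<^sub>R \<tau> t = 0" for t p q
  proof -
    have "solves_VE V xh (\<lambda>t. p *\<^sub>R v t + q *\<^sub>R \<tau> t + 0 *\<^sub>R \<tau> t)" by (rule VE_combination[OF velocity_VE \<tau>(1) \<tau>(1)])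
    from VE_zero[OF this, of t b] z have zb: "p *\<^sub>R v b + q *\<^sub>R y = 0" by (simp add: \<tau>(2))
    have q: "q = 0"
    proof (rule ccontr)
      assume q: "q \<noteq> 0"
      have "q *\<^sub>R y = q *\<^sub>R ((- p / q) *\<^sub>R v b)" using zb q by (simp add: add_eq_0_iff)
      then show False using y(2) q by (metis scaleR_cancel_left)
    qed
    then show ?thesis using zb velocity_nonzero[OF V0, of b] by simp
  qed
  then show ?thesis using \<tau>(1) tan by blast
qed

lemma tangent_plucker:
  assumes X: "extends v Xt Xm Xp" and Z: "extends \<tau> Zt Zm Zp" and tan: "\<And>t. \<tau> t \<in> tangent_space M (xh t)"
    and ind: "\<And>t p q. p *\<^sub>R v t + q *\<^sub>R \<tau> t = 0 \<Longrightarrow> p = 0 \<and> q = 0"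
  shows "\<exists>s P. (\<forall>i j. P i j meromorphic_on ball 0 (rad_minus \<Gamma>)) \<and>
    (\<forall>t\<in>minus.H. \<forall>i j. P i j (minus.e t) = exp (s * t) * pl (Xm t) (Zm t) i j)"
   and "\<exists>s P. (\<forall>i j. P i j meromorphic_on ball 0 (rad_plus \<Gamma>)) \<and>
    (\<forall>t\<in>plus.H. \<forall>i j. P i j (plus.e t) = exp (s * t) * pl (Xp t) (Zp t) i j)"
proof -
  show "\<exists>s P. (\<forall>i j. P i j meromorphic_on ball 0 (rad_minus \<Gamma>)) \<and>
    (\<forall>t\<in>minus.H. \<forall>i j. P i j (minus.e t) = exp (s * t) * pl (Xm t) (Zm t) i j)"
    by (rule minus.tangent_plane_plucker[OF surface M0 h_0(1) xM velocity_tangent[OF orbit_M] tan ind])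
      (use X Z in \<open>auto simp: extends_def minus_real\<close>)
  show "\<exists>s P. (\<forall>i j. P i j meromorphic_on ball 0 (rad_plus \<Gamma>)) \<and>
    (\<forall>t\<in>plus.H. \<forall>i j. P i j (plus.e t) = exp (s * t) * pl (Xp t) (Zp t) i j)"
    by (rule plus.tangent_plane_plucker[OF surface M0 h_0(2) xM velocity_tangent[OF orbit_M] tan ind])
      (use X Z in \<open>auto simp: extends_def plus_real\<close>)
qed

end

section \<open>Planes as elements of the differential field\<close>

text \<open>In type \<open>4\<close> the numeral 4 denotes 0, so the indices are ordered as 4, 1, 2, 3.\<close>

lemma order_4: "\<not> (1::4) < 4" "\<not> (2::4) < 1" "\<not> (2::4) < 4" "\<not> (3::4) < 1" "\<not> (3::4) < 2" "\<not> (3::4) < 4"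
  by (simp_all add: less_bit0_def bit0.Rep_0 bit0.Rep_1 bit0.Rep_numeral)

text \<open>Three vectors do not span the space, so some standard basis vector completes them. A
  constant vector is a convenient last member of a frame because its derivative is 0.\<close>

lemma indep_axis:
  fixes x y z :: "real^4"
  assumes ind: "\<And>p q r. p *\<^sub>R x + q *\<^sub>R y + r *\<^sub>R z = 0 \<Longrightarrow> p = 0 \<and> q = 0 \<and> r = 0"
  shows "\<exists>m. \<forall>p q r s. p *\<^sub>R x + q *\<^sub>R y + r *\<^sub>R z + s *\<^sub>R axis m 1 = 0 \<longrightarrow> p = 0 \<and> q = 0 \<and> r = 0 \<and> s = 0"
proof -
  have "\<exists>m. axis m 1 \<notin> span {x, y, z}"
  proof (rule ccontr)
    assume "\<not> ?thesis"
    then have "Basis \<subseteq> span {x, y, z}" by (auto simp: Basis_vec_def)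
    then have "span {x, y, z} = UNIV" using span_minimal[OF _ subspace_span] span_Basis by blast
    then have "dim (UNIV :: (real^4) set) = dim {x, y, z}" by (metis dim_span)
    also have "\<dots> \<le> card {x, y, z}" by (rule dim_le_card') simp
    also have "\<dots> \<le> 3" by (simp add: card_insert_if)
    finally show False by (simp add: dim_UNIV)
  qed
  then obtain m where m: "axis m 1 \<notin> span {x, y, z}" by blast
  show ?thesis
  proof (intro exI[of _ m] allI impI)
    fix p q r s assume z: "p *\<^sub>R x + q *\<^sub>R y + r *\<^sub>R z + s *\<^sub>R axis m 1 = 0"
    have s: "s = 0"
    proof (rule ccontr)
      assume s: "s \<noteq> 0"
      have "p *\<^sub>R x + q *\<^sub>R y + r *\<^sub>R z \<in> span {x, y, z}" by (intro span_add span_scale span_base) auto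
      moreover have "s *\<^sub>R axis m 1 = - (p *\<^sub>R x + q *\<^sub>R y + r *\<^sub>R z)" using z by (simp add: add_eq_0_iff)
      ultimately have "s *\<^sub>R axis m 1 \<in> span {x, y, z}" by (metis span_neg)
      from span_scale[OF this, of "1 / s"] show False using m s by simp
    qed
    then show "p = 0 \<and> q = 0 \<and> r = 0 \<and> s = 0" using ind[of p q r] z by simp
  qed
qed

lemma complex_indep_axis:
  fixes x y z :: "real^4"
  assumes ind: "\<And>p q r s. p *\<^sub>R x + q *\<^sub>R y + r *\<^sub>R z + s *\<^sub>R axis m 1 = 0 \<Longrightarrow> p = 0 \<and> q = 0 \<and> r = 0 \<and> s = 0"
    and z: "p *s complex_vec x + q *s complex_vec y + r *s complex_vec z + s *s axis m 1 = 0"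
  shows "p = 0 \<and> q = 0 \<and> r = 0 \<and> s = 0"
proof -
  have e: "p * of_real (x $ i) + q * of_real (y $ i) + r * of_real (z $ i) + s * of_real (axis m 1 $ i) = 0" for i
    using arg_cong[OF z, of "\<lambda>v. v $ i"] by (simp add: axis_def if_distrib[of complex_of_real] cong: if_cong)
  have "Re p *\<^sub>R x + Re q *\<^sub>R y + Re r *\<^sub>R z + Re s *\<^sub>R axis m 1 = 0"
    unfolding vec_eq_iff
  proof
    fix i show "(Re p *\<^sub>R x + Re q *\<^sub>R y + Re r *\<^sub>R z + Re s *\<^sub>R axis m 1) $ i = 0 $ i" using arg_cong[OF e[of i], of Re] by simp
  qed
  moreover have "Im p *\<^sub>R x + Im q *\<^sub>R y + Im r *\<^sub>R z + Im s *\<^sub>R axis m 1 = 0"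
    unfolding vec_eq_iff
  proof
    fix i show "(Im p *\<^sub>R x + Im q *\<^sub>R y + Im r *\<^sub>R z + Im s *\<^sub>R axis m 1) $ i = 0 $ i" using arg_cong[OF e[of i], of Im] by simp
  qed
  ultimately show ?thesis using ind[of "Re p" "Re q" "Re r" "Re s"] ind[of "Im p" "Im q" "Im r" "Im s"] by (simp add: complex_eq_iff)
qed

text \<open>In the application \<open>a\<close> and \<open>c\<close> are solutions spanning a plane,
  \<open>f\<close> is the vector of this plane with components 0 at \<open>k\<close> and 1 at
  \<open>l\<close>, and \<open>w\<close> is f' - A f. The hypotheses place \<open>w\<close> in the
  plane again; the conclusion gives, up to the factor \<open>ak\<close>, its expansion in the basis
  \<open>a\<close>, \<open>f\<close>.\<close>

lemma plane_relation:
  fixes p :: complex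
  assumes "p = ak * cl - al * ck" "p \<noteq> 0" "f * p = ak * ci - ai * ck" "wi * p = m * ci - n * ai - f * p'"
    "wk * p = m * ck - n * ak" "wl * p = m * cl - n * al - p'"
  shows "ak * wi = (ak * wl - wk * al) * f + wk * ai"
proof -
  have "(ak * wi) * p = ((ak * wl - wk * al) * f + wk * ai) * p"
  proof -
    have "((ak * wl - wk * al) * f + wk * ai) * p = (ak * (wl * p) - (wk * p) * al) * f + (wk * p) * ai" by (simp add: algebra_simps)
    also have "\<dots> = m * ((ak * cl - al * ck) * f) - ak * p' * f + m * ck * ai - n * ak * ai"
      unfolding assms(5,6) by (simp add: algebra_simps)
    also have "(ak * cl - al * ck) * f = ak * ci - ai * ck" using assms(1,3) by (simp add: mult.commute)
    also have "m * (ak * ci - ai * ck) - ak * p' * f + m * ck * ai - n * ak * ai = ak * (wi * p)"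
      unfolding assms(4) by (simp add: algebra_simps)
    finally have "((ak * wl - wk * al) * f + wk * ai) * p = ak * (wi * p)" .
    then show ?thesis unfolding mult.assoc[of ak] by (rule sym)
  qed
  then show ?thesis using assms(2) by (metis mult_cancel_right)
qed

context desing_orbit
begin

lemma TS_continuous: "TS Y \<Longrightarrow> t \<in> Sigma_t \<Gamma> \<Longrightarrow> isCont (\<lambda>t. Y t $ i) t"
  using TS_deriv DERIV_isCont by blast

text \<open>In each disc numerator and denominator carry the same factor exp(s t); it cancels, so
  the quotients formed in the discs and in the time chart agree on the overlaps.\<close>

lemma plane_function:
  assumes X: "extends \<eta> Xt Xm Xp" and Z: "extends \<zeta> Zt Zm Zp"
    and m: "\<exists>s P. (\<forall>i j. P i j meromorphic_on ball 0 (rad_minus \<Gamma>)) \<and>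
      (\<forall>t\<in>minus.H. \<forall>i j. P i j (minus.e t) = exp (s * t) * pl (Xm t) (Zm t) i j)"
    and p: "\<exists>s P. (\<forall>i j. P i j meromorphic_on ball 0 (rad_plus \<Gamma>)) \<and>
      (\<forall>t\<in>plus.H. \<forall>i j. P i j (plus.e t) = exp (s * t) * pl (Xp t) (Zp t) i j)"
  shows "\<exists>g\<in>meromorphic_functions \<Gamma>. \<forall>\<^sub>F t in at (of_real b). g Time t = pl (Xt t) (Zt t) k i / pl (Xt t) (Zt t) k l"
proof -
  interpret surface_charts \<Gamma> "of_real bm" "of_real ap" "of_real b" by (rule charts)
  obtain s P where P: "\<And>i j. P i j meromorphic_on ball 0 (rad_minus \<Gamma>)"
    and Pe: "\<And>t i j. t \<in> minus.H \<Longrightarrow> P i j (minus.e t) = exp (s * t) * pl (Xm t) (Zm t) i j" using m by blast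
  obtain s' Q where Q: "\<And>i j. Q i j meromorphic_on ball 0 (rad_plus \<Gamma>)"
    and Qe: "\<And>t i j. t \<in> plus.H \<Longrightarrow> Q i j (plus.e t) = exp (s' * t) * pl (Xp t) (Zp t) i j" using p by blast
  define G where "G c = (case c of Minus \<Rightarrow> (\<lambda>z. P k i z / P k l z) | Time \<Rightarrow> (\<lambda>t. pl (Xt t) (Zt t) k i / pl (Xt t) (Zt t) k l)
    | Plus \<Rightarrow> (\<lambda>z. Q k i z / Q k l z))" for c
  have TX: "TS Xt" "TS Zt" using X Z by (auto simp: extends_def)
  have an: "(\<lambda>t. Y t $ i) meromorphic_on Sigma_t \<Gamma>" if "TS Y" for Y i
    by (rule analytic_on_imp_meromorphic_on) (use TS_holo[OF that] Sigma(1) analytic_on_open in blast)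
  have "G c meromorphic_on chart_dom \<Gamma> c" for c
    by (cases c) (auto simp: G_def pl_def intro!: meromorphic_on_divide meromorphic_on_diff meromorphic_on_mult an TX P Q)
  moreover have "\<forall>t\<in>overlap_minus \<Gamma>. G Time t = G Minus (glue_minus \<Gamma> t)"
  proof
    fix t assume t: "t \<in> overlap_minus \<Gamma>"
    then have "Xt t = Xm t" "Zt t = Zm t" "t \<in> minus.H" using X Z by (auto simp: extends_def overlap_eq)
    then show "G Time t = G Minus (glue_minus \<Gamma> t)" by (simp add: G_def glue_eq Pe)
  qed
  moreover have "\<forall>t\<in>overlap_plus \<Gamma>. G Time t = G Plus (glue_plus \<Gamma> t)"
  proof
    fix t assume t: "t \<in> overlap_plus \<Gamma>"
    then have "Xt t = Xp t" "Zt t = Zp t" "t \<in> plus.H" using X Z by (auto simp: extends_def overlap_eq)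
    then show "G Time t = G Plus (glue_plus \<Gamma> t)" by (simp add: G_def glue_eq Qe)
  qed
  ultimately have "reduce \<Gamma> G \<in> K" "\<forall>\<^sub>F t in at (of_real b). reduce \<Gamma> G Time t = G Time t"
    using reduce_K'[of G] b_Sigma by auto
  then show ?thesis by (intro bexI[of _ "reduce \<Gamma> G"]) (simp_all add: G_def)
qed

text \<open>The velocity is \<open>F\<close> along the parametrization, hence single-valued and
  holomorphic in every chart, which solutions in general are not.\<close>

lemma velocity_function:
  assumes X: "extends (\<lambda>t. V (xh t)) Xt Xm Xp"
  shows "\<exists>g\<in>meromorphic_functions \<Gamma>. \<forall>\<^sub>F t in at (of_real b). g Time t = Xt t $ i"
proof -
  interpret surface_charts \<Gamma> "of_real bm" "of_real ap" "of_real b" by (rule charts)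
  define g where "g c z = (if z \<in> chart_dom \<Gamma> c then F (param \<Gamma> c z) $ i else 0)" for c z
  have hol: "(\<lambda>z. F (param \<Gamma> c z) $ i) holomorphic_on chart_dom \<Gamma> c" for c
    using cdiff_on_curve_holomorphic[OF minus.F _ open_dom param_curve(2)] param_curve(1)[of c]
    unfolding holo_curve_def holomorphic_curve_on_def by blast
  have "g \<in> K"
  proof (rule holomorphic_K)
    show "g c holomorphic_on chart_dom \<Gamma> c" for c
      by (rule holomorphic_transform[OF hol]) (simp add: g_def)
    show "g c z = 0" if "z \<notin> chart_dom \<Gamma> c" for c z using that by (simp add: g_def)
    show "g Time t = g Minus (glue_minus \<Gamma> t)" if "t \<in> overlap_minus \<Gamma>" for t
      using that x_t_minus[OF that] minus.e_img[of t] by (simp add: g_def glue_eq overlap_eq)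
    show "g Time t = g Plus (glue_plus \<Gamma> t)" if "t \<in> overlap_plus \<Gamma>" for t
      using that x_t_plus[OF that] plus.e_img[of t] by (simp add: g_def glue_eq overlap_eq)
  qed
  moreover have "g Time t = Xt t $ i" if t: "t \<in> Sigma_t \<Gamma>" for t
  proof -
    define S where "S = {t. a - \<delta> < Re t \<and> Re t < b + \<delta>}"
    have S: "open S" unfolding S_def by (intro open_Collect_conj open_Collect_less continuous_intros)
    have bS: "complex_of_real b \<in> S" using \<delta>(1) a_le_b by (simp add: S_def)
    have "F (x_t \<Gamma> t) $ i = Xt t $ i"
    proof (rule identity_near_real[OF Sigma(1) conn_Sigma _ _ b_Sigma S bS _ t])
      show "(\<lambda>t. F (x_t \<Gamma> t) $ i) holomorphic_on Sigma_t \<Gamma>" using hol[of Time] by simp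
      show "(\<lambda>t. Xt t $ i) holomorphic_on Sigma_t \<Gamma>" using X by (intro TS_holo) (simp add: extends_def)
      show "F (x_t \<Gamma> (of_real t)) $ i = Xt (of_real t) $ i" if "of_real t \<in> Sigma_t \<Gamma>" "of_real t \<in> S" for t
        using that X by (simp add: x_t_real minus.FV extends_def S_def)
    qed
    then show ?thesis using t by (simp add: g_def)
  qed
  then have "\<forall>\<^sub>F t in at (of_real b). g Time t = Xt t $ i"
    using eventually_at_in_open'[OF Sigma(1) b_Sigma] by (rule eventually_mono[rotated])
  ultimately show ?thesis by blast
qed

lemma VE_matrix_function:
  "VE_matrix F \<Gamma> $ i $ j \<in> meromorphic_functions \<Gamma>"
  "\<forall>\<^sub>F t in at (of_real b). (VE_matrix F \<Gamma> $ i $ j) Time t = At t $ i $ j"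
proof -
  interpret surface_charts \<Gamma> "of_real bm" "of_real ap" "of_real b" by (rule charts)
  have hol: "(\<lambda>z. jacobian F (at (param \<Gamma> c z)) $ i $ j) holomorphic_on chart_dom \<Gamma> c" for c
    by (rule jacobian_entry_curve_holomorphic[OF minus.F _ open_dom param_curve(2)])
      (use param_curve(1)[of c] in \<open>simp add: holo_curve_def holomorphic_curve_on_def\<close>)
  have eq: "VE_matrix F \<Gamma> $ i $ j = (\<lambda>c z. if z \<in> chart_dom \<Gamma> c then jacobian F (at (param \<Gamma> c z)) $ i $ j else 0)"
    by (simp add: VE_matrix_def)
  show "VE_matrix F \<Gamma> $ i $ j \<in> meromorphic_functions \<Gamma>"
    unfolding eq
  proof (rule holomorphic_K)
    show "(\<lambda>z. if z \<in> chart_dom \<Gamma> c then jacobian F (at (param \<Gamma> c z)) $ i $ j else 0) holomorphic_on chart_dom \<Gamma> c" for c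
      by (rule holomorphic_transform[OF hol]) simp
    fix t
    show "(if t \<in> chart_dom \<Gamma> Time then jacobian F (at (param \<Gamma> Time t)) $ i $ j else 0) =
      (if glue_minus \<Gamma> t \<in> chart_dom \<Gamma> Minus then jacobian F (at (param \<Gamma> Minus (glue_minus \<Gamma> t))) $ i $ j else 0)" if "t \<in> overlap_minus \<Gamma>"
      using that x_t_minus[OF that] minus.e_img[of t] by (simp add: glue_eq overlap_eq)
    show "(if t \<in> chart_dom \<Gamma> Time then jacobian F (at (param \<Gamma> Time t)) $ i $ j else 0) =
      (if glue_plus \<Gamma> t \<in> chart_dom \<Gamma> Plus then jacobian F (at (param \<Gamma> Plus (glue_plus \<Gamma> t))) $ i $ j else 0)" if "t \<in> overlap_plus \<Gamma>"
      using that x_t_plus[OF that] plus.e_img[of t] by (simp add: glue_eq overlap_eq)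
  qed simp
  show "\<forall>\<^sub>F t in at (of_real b). (VE_matrix F \<Gamma> $ i $ j) Time t = At t $ i $ j"
    unfolding eq using eventually_at_in_open'[OF Sigma(1) b_Sigma] by (rule eventually_mono) (simp add: At_def)
qed

end

locale VE_extension = bounded_VE_setting +
  fixes \<iota> :: "surface_fun \<Rightarrow> 'l::field" and D :: "'l \<Rightarrow> 'l" and \<Phi> :: "'l^4^4"
  assumes extension: "picard_vessiot (meromorphic_field \<Gamma>) (time_deriv \<Gamma>) (VE_matrix F \<Gamma>) \<iota> D \<Phi>"

sublocale VE_extension \<subseteq> pv_surface \<Gamma> "of_real bm" "of_real ap" "of_real b" \<iota> D
proof -
  interpret surface_charts \<Gamma> "of_real bm" "of_real ap" "of_real b" by (rule charts)
  show "pv_surface \<Gamma> (of_real bm) (of_real ap) (of_real b) \<iota> D"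
    by unfold_locales (use extension in \<open>simp_all add: picard_vessiot_def meromorphic_field_def\<close>)
qed

context VE_extension
begin

definition AL :: "'l^4^4" where "AL = map_matrix \<iota> (VE_matrix F \<Gamma>)"

lemma rep_AL: "rep (AL $ i $ j) (\<lambda>t. At t $ i $ j)"
  unfolding rep_def AL_def using VE_matrix_function by auto

text \<open>The vector \<open>u\<close> of the plane is normalized to have component 0 at
  \<open>k\<close> and 1 at \<open>l\<close>, which makes its entries quotients of Pluecker
  coordinates. As the plane is spanned by solutions, \<open>D - A\<close> maps \<open>u\<close> back
  into it; \<open>g\<close> and \<open>e\<close> are the coordinates of the result.\<close>

lemma plane_vector:
  assumes X: "extends v Xt Xm Xp" and Z: "extends \<eta> Zt Zm Zp"
    and m: "\<exists>s P. (\<forall>i j. P i j meromorphic_on ball 0 (rad_minus \<Gamma>)) \<and>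
      (\<forall>t\<in>minus.H. \<forall>i j. P i j (minus.e t) = exp (s * t) * pl (Xm t) (Zm t) i j)"
    and p: "\<exists>s P. (\<forall>i j. P i j meromorphic_on ball 0 (rad_plus \<Gamma>)) \<and>
      (\<forall>t\<in>plus.H. \<forall>i j. P i j (plus.e t) = exp (s * t) * pl (Xp t) (Zp t) i j)"
    and ind: "\<And>p q. p *\<^sub>R v b + q *\<^sub>R \<eta> b = 0 \<Longrightarrow> p = 0 \<and> q = 0"
    and u1: "\<And>i. rep (u1 $ i) (\<lambda>t. Xt t $ i)"
  shows "\<exists>u k l g e. (\<forall>i. rep (u $ i) (\<lambda>t. pl (Xt t) (Zt t) k i / pl (Xt t) (Zt t) k l)) \<and>
    Xt (of_real b) $ k \<noteq> 0 \<and> pl (Xt (of_real b)) (Zt (of_real b)) k l \<noteq> 0 \<and>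
    (\<forall>i. D (u $ i) = (\<Sum>j\<in>UNIV. AL $ i $ j * u $ j) + g * u1 $ i + e * u $ i)"
proof -
  have TX: "TS Xt" "TS Zt" using X Z by (auto simp: extends_def)
  have b_in: "a - \<delta> < b" "b < b + \<delta>" using \<delta>(1) a_le_b by auto
  have Xb: "Xt (of_real b) = complex_vec (v b)" and Zb: "Zt (of_real b) = complex_vec (\<eta> b)"
    using X Z b_in by (auto simp: extends_def)
  obtain k where k: "v b $ k \<noteq> 0" using velocity_nonzero[OF V0, of b] by (auto simp: vec_eq_iff)
  have "\<exists>l. v b $ k * \<eta> b $ l - v b $ l * \<eta> b $ k \<noteq> 0"
  proof (rule ccontr)
    assume "\<not> ?thesis"
    then have "(- \<eta> b $ k) *\<^sub>R v b + (v b $ k) *\<^sub>R \<eta> b = 0" by (auto simp: vec_eq_iff algebra_simps)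
    from ind[OF this] k show False by simp
  qed
  then obtain l where l: "v b $ k * \<eta> b $ l - v b $ l * \<eta> b $ k \<noteq> 0" by blast
  have Xk: "Xt (of_real b) $ k \<noteq> 0" using k by (simp add: Xb)
  have pl0: "pl (Xt (of_real b)) (Zt (of_real b)) k l \<noteq> 0"
  proof -
    have "pl (Xt (of_real b)) (Zt (of_real b)) k l = of_real (v b $ k * \<eta> b $ l - v b $ l * \<eta> b $ k)" by (simp add: pl_def Xb Zb)
    then show ?thesis using l by (simp only: of_real_eq_0_iff not_False_eq_True)
  qed
  define u :: "'l^4" where "u = (\<chi> i. SOME x. rep x (\<lambda>t. pl (Xt t) (Zt t) k i / pl (Xt t) (Zt t) k l))"
  define f where "f i t = pl (Xt t) (Zt t) k i / pl (Xt t) (Zt t) k l" for i t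
  have u: "rep (u $ i) (f i)" for i
  proof -
    obtain x where "rep x (f i)" using plane_function[OF X Z m p, of k i l] unfolding rep_def f_def[abs_def] by blast
    from someI[of "\<lambda>x. rep x (f i)", OF this] show ?thesis by (simp add: u_def f_def[abs_def])
  qed
  \<comment> \<open>The defect of \<open>u\<close> as a solution, with germ \<open>\<omega>\<close>.
    That it lies in the plane is computed on germs and carried over to the field.\<close>
  define w where "w i = D (u $ i) - (\<Sum>j\<in>UNIV. AL $ i $ j * u $ j)" for i
  define \<omega> where "\<omega> i t = deriv (f i) t - (\<Sum>j\<in>UNIV. At t $ i $ j * f j t)" for i t
  have w: "rep (w i) (\<omega> i)" for i
    unfolding w_def \<omega>_def[abs_def] by (intro rep_diff rep_D u rep_sum rep_mult rep_AL)
  have "isCont (\<lambda>t. pl (Xt t) (Zt t) k l) (of_real b)"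
    unfolding pl_def by (intro continuous_intros TS_continuous TX b_Sigma)
  then have ne: "\<forall>\<^sub>F t in at (of_real b). pl (Xt t) (Zt t) k l \<noteq> 0"
    unfolding isCont_def using pl0 by (rule tendsto_imp_eventually_ne)
  have rel: "\<forall>\<^sub>F t in at (of_real b). Xt t $ k * \<omega> i t = (Xt t $ k * \<omega> l t - \<omega> k t * Xt t $ l) * f i t + \<omega> k t * Xt t $ i" for i
    using ne eventually_at_in_open'[OF Sigma(1) b_Sigma]
  proof eventually_elim
    fix t assume pn: "pl (Xt t) (Zt t) k l \<noteq> 0" and t: "t \<in> Sigma_t \<Gamma>"
    define a' where "a' = At t *v Xt t"
    define c' where "c' = At t *v Zt t"
    define q where "q j = a' $ k * Zt t $ j + Xt t $ k * c' $ j - a' $ j * Zt t $ k - Xt t $ j * c' $ k" for j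
    have dX: "((\<lambda>t. Xt t $ j) has_field_derivative a' $ j) (at t)" and dZ: "((\<lambda>t. Zt t $ j) has_field_derivative c' $ j) (at t)" for j
      using TS_deriv[OF TX(1) t] TS_deriv[OF TX(2) t] by (simp_all add: a'_def c'_def)
    have dp: "((\<lambda>t. pl (Xt t) (Zt t) k j) has_field_derivative q j) (at t)" for j
      unfolding pl_def by (rule derivative_eq_intros dX dZ refl)+ (simp add: q_def algebra_simps)
    have df: "deriv (f j) t = (q j * pl (Xt t) (Zt t) k l - pl (Xt t) (Zt t) k j * q l) / (pl (Xt t) (Zt t) k l * pl (Xt t) (Zt t) k l)" for j
      unfolding f_def[abs_def] by (rule DERIV_imp_deriv[OF DERIV_divide[OF dp dp pn]])
    have sm: "(\<Sum>j\<in>UNIV. At t $ i $ j * f j t) * pl (Xt t) (Zt t) k l = Xt t $ k * c' $ i - a' $ i * Zt t $ k" for i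
    proof -
      have "(\<Sum>j\<in>UNIV. At t $ i $ j * f j t) * pl (Xt t) (Zt t) k l = (\<Sum>j\<in>UNIV. At t $ i $ j * pl (Xt t) (Zt t) k j)"
        using pn by (simp add: f_def sum_distrib_right)
      also have "\<dots> = Xt t $ k * c' $ i - a' $ i * Zt t $ k"
        by (simp add: pl_def a'_def c'_def matrix_vector_mult_def sum_distrib_left sum_distrib_right sum_subtractf[symmetric] algebra_simps)
      finally show ?thesis .
    qed
    have \<omega>p: "\<omega> j t * pl (Xt t) (Zt t) k l = a' $ k * Zt t $ j - c' $ k * Xt t $ j - f j t * q l" for j
    proof -
      have "deriv (f j) t * pl (Xt t) (Zt t) k l = q j - f j t * q l"
        using pn by (simp add: df f_def divide_simps)
      then show ?thesis unfolding \<omega>_def left_diff_distrib sm by (simp add: q_def algebra_simps)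
    qed
    have fk: "f k t = 0" and fl: "f l t = 1" using pn by (simp_all add: f_def pl_def)
    show "Xt t $ k * \<omega> i t = (Xt t $ k * \<omega> l t - \<omega> k t * Xt t $ l) * f i t + \<omega> k t * Xt t $ i"
    proof (rule plane_relation[OF _ pn])
      show "pl (Xt t) (Zt t) k l = Xt t $ k * Zt t $ l - Xt t $ l * Zt t $ k" by (simp add: pl_def)
      show "f i t * pl (Xt t) (Zt t) k l = Xt t $ k * Zt t $ i - Xt t $ i * Zt t $ k" using pn by (simp add: f_def) (simp add: pl_def)
      show "\<omega> i t * pl (Xt t) (Zt t) k l = a' $ k * Zt t $ i - c' $ k * Xt t $ i - f i t * q l" by (rule \<omega>p)
      show "\<omega> k t * pl (Xt t) (Zt t) k l = a' $ k * Zt t $ k - c' $ k * Xt t $ k" using \<omega>p[of k] fk by simp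
      show "\<omega> l t * pl (Xt t) (Zt t) k l = a' $ k * Zt t $ l - c' $ k * Xt t $ l - q l" using \<omega>p[of l] fl by simp
    qed
  qed
  have relL: "u1 $ k * w i = (u1 $ k * w l - w k * u1 $ l) * u $ i + w k * u1 $ i" for i
    by (rule rep_eqI[OF rep_mult[OF u1 w] rep_add[OF rep_mult[OF rep_diff[OF rep_mult[OF u1 w] rep_mult[OF w u1]] u] rep_mult[OF w u1]] rel])
  have u1k: "u1 $ k \<noteq> 0"
  proof
    assume "u1 $ k = 0"
    then have "\<forall>\<^sub>F t in at (of_real b). Xt t $ k = 0" using rep_eq_0_iff[OF u1] by blast
    moreover have "\<forall>\<^sub>F t in at (of_real b). Xt t $ k \<noteq> 0"
      using TS_continuous[OF TX(1) b_Sigma, of k] Xk unfolding isCont_def by (rule tendsto_imp_eventually_ne)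
    ultimately have "\<forall>\<^sub>F t in at (complex_of_real b). False" by eventually_elim simp
    then show False by simp
  qed
  \<comment> \<open>Comparison of the components \<open>k\<close> and \<open>l\<close>, where
    \<open>u\<close> has the values 0 and 1, determines the two coefficients.\<close>
  define g where "g = w k / u1 $ k"
  define e where "e = w l - g * u1 $ l"
  have "w i = g * u1 $ i + e * u $ i" for i
  proof -
    have wk: "w k = u1 $ k * g" using u1k by (simp add: g_def)
    have "u1 $ k * w i = u1 $ k * (g * u1 $ i + e * u $ i)"
      unfolding relL[of i] e_def by (subst (1 2) wk) (simp add: algebra_simps)
    then show ?thesis using u1k by (metis mult_cancel_left)
  qed
  then have "D (u $ i) = (\<Sum>j\<in>UNIV. AL $ i $ j * u $ j) + g * u1 $ i + e * u $ i" for i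
    unfolding w_def by (simp add: algebra_simps)
  then show ?thesis using u[unfolded f_def[abs_def]] Xk pl0 by blast
qed

end

section \<open>The Galois group\<close>

context VE_extension
begin

text \<open>The columns, in the order 4, 1, 2, 3 of the index type, are the velocity, a vector of
  the plane of bounded solutions, one of the tangent plane, and a constant basis vector. Each of the
  first three is stable under \<open>D - A\<close> modulo its predecessors; on the last column of
  \<open>R\<close> triangularity imposes no condition.\<close>

lemma triangular_frame:
  "\<exists>(U :: 'l^4^4) R. invertible U \<and> map_matrix D U = AL ** U + U ** R \<and> upper_tri R \<and> (\<forall>i j. U $ i $ j \<in> \<iota> ` meromorphic_functions \<Gamma>)"
proof -
  obtain \<tau> where \<tau>: "solves_VE V xh \<tau>" and tan: "\<And>t. \<tau> t \<in> tangent_space M (xh t)"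
    and v\<tau>: "\<And>t p q. p *\<^sub>R v t + q *\<^sub>R \<tau> t = 0 \<Longrightarrow> p = 0 \<and> q = 0"
    using tangent_solution by blast
  obtain Xt Xm Xp where X: "extends v Xt Xm Xp" using VE_extends[OF velocity_VE] by blast
  obtain Zt Zm Zp where Z: "extends \<xi> Zt Zm Zp" using VE_extends[OF \<xi>(1)] by blast
  obtain Tt Tm Tp where T: "extends \<tau> Tt Tm Tp" using VE_extends[OF \<tau>] by blast
  define u1 :: "'l^4" where "u1 = (\<chi> i. SOME x. rep x (\<lambda>t. Xt t $ i))"
  have u1: "rep (u1 $ i) (\<lambda>t. Xt t $ i)" for i
  proof -
    obtain x where "rep x (\<lambda>t. Xt t $ i)" using velocity_function[OF X, of i] unfolding rep_def by blast
    from someI[of "\<lambda>x. rep x (\<lambda>t. Xt t $ i)", OF this] show ?thesis by (simp add: u1_def)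
  qed
  have ind2: "p = 0 \<and> q = 0" if "p *\<^sub>R v b + q *\<^sub>R \<xi> b = 0" for p q by (rule independent_at[OF that])
  have ind3: "p = 0 \<and> q = 0" if "p *\<^sub>R v b + q *\<^sub>R \<tau> b = 0" for p q by (rule v\<tau>[OF that])
  have ind4: "p = 0 \<and> q = 0 \<and> r = 0" if "p *\<^sub>R v b + q *\<^sub>R \<xi> b + r *\<^sub>R \<tau> b = 0" for p q r
    by (rule tangent_not_bounded[OF \<tau> tan v\<tau> that])
  have pT: "\<exists>s P. (\<forall>i j. P i j meromorphic_on ball 0 (rad_minus \<Gamma>)) \<and>
      (\<forall>t\<in>minus.H. \<forall>i j. P i j (minus.e t) = exp (s * t) * pl (Xm t) (Tm t) i j)"
    "\<exists>s P. (\<forall>i j. P i j meromorphic_on ball 0 (rad_plus \<Gamma>)) \<and>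
      (\<forall>t\<in>plus.H. \<forall>i j. P i j (plus.e t) = exp (s * t) * pl (Xp t) (Tp t) i j)"
    by (rule tangent_plucker(1)[OF X T tan v\<tau>], assumption) (rule tangent_plucker(2)[OF X T tan v\<tau>], assumption)
  obtain u2 k2 l2 g2 e2 where u2: "\<And>i. rep (u2 $ i) (\<lambda>t. pl (Xt t) (Zt t) k2 i / pl (Xt t) (Zt t) k2 l2)"
    and X2: "Xt (of_real b) $ k2 \<noteq> 0" and p2: "pl (Xt (of_real b)) (Zt (of_real b)) k2 l2 \<noteq> 0"
    and D2: "\<And>i. D (u2 $ i) = (\<Sum>j\<in>UNIV. AL $ i $ j * u2 $ j) + g2 * u1 $ i + e2 * u2 $ i"
    using plane_vector[OF X Z bounded_plucker_minus[OF X Z] bounded_plucker_plus[OF X Z] ind2 u1] by blast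
  obtain u3 k3 l3 g3 e3 where u3: "\<And>i. rep (u3 $ i) (\<lambda>t. pl (Xt t) (Tt t) k3 i / pl (Xt t) (Tt t) k3 l3)"
    and X3: "Xt (of_real b) $ k3 \<noteq> 0" and p3: "pl (Xt (of_real b)) (Tt (of_real b)) k3 l3 \<noteq> 0"
    and D3: "\<And>i. D (u3 $ i) = (\<Sum>j\<in>UNIV. AL $ i $ j * u3 $ j) + g3 * u1 $ i + e3 * u3 $ i"
    using plane_vector[OF X T pT ind3 u1] by blast
  obtain m where m: "\<And>p q r s. p *\<^sub>R v b + q *\<^sub>R \<xi> b + r *\<^sub>R \<tau> b + s *\<^sub>R axis m 1 = 0 \<Longrightarrow> p = 0 \<and> q = 0 \<and> r = 0 \<and> s = 0"
    using indep_axis[OF ind4] by blast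
  have TX: "TS Xt" "TS Zt" "TS Tt" using X Z T by (auto simp: extends_def)
  have b_in: "a - \<delta> < b" "b < b + \<delta>" using \<delta>(1) a_le_b by auto
  have at_b: "Xt (of_real b) = complex_vec (v b)" "Zt (of_real b) = complex_vec (\<xi> b)" "Tt (of_real b) = complex_vec (\<tau> b)"
    using X Z T b_in by (auto simp: extends_def)
  define U :: "'l^4^4" where "U = (\<chi> i j. if j = 4 then u1 $ i else if j = 1 then u2 $ i else if j = 2 then u3 $ i else if i = m then 1 else 0)"
  define W :: "complex \<Rightarrow> complex^4^4" where "W t = (\<chi> i j. if j = 4 then Xt t $ i else if j = 1 then pl (Xt t) (Zt t) k2 i / pl (Xt t) (Zt t) k2 l2
      else if j = 2 then pl (Xt t) (Tt t) k3 i / pl (Xt t) (Tt t) k3 l3 else if i = m then 1 else 0)" for t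
  have U: "U $ i $ 4 = u1 $ i" "U $ i $ 1 = u2 $ i" "U $ i $ 2 = u3 $ i" "U $ i $ 3 = (if i = m then 1 else 0)" for i
    by (simp_all add: U_def)
  have W: "W t $ i $ 4 = Xt t $ i" "W t $ i $ 1 = pl (Xt t) (Zt t) k2 i / pl (Xt t) (Zt t) k2 l2"
    "W t $ i $ 2 = pl (Xt t) (Tt t) k3 i / pl (Xt t) (Tt t) k3 l3" "W t $ i $ 3 = (if i = m then 1 else 0)" for t i
    by (simp_all add: W_def)
  have repU: "rep (U $ i $ j) (\<lambda>t. W t $ i $ j)" for i j
    using exhaust_4[of j]
  proof (elim disjE)
    assume "j = 3"
    then show ?thesis using rep_0 rep_1 by (simp add: U W)
  qed (simp_all add: U W u1 u2 u3)
  \<comment> \<open>Invertibility is checked at \<open>b\<close>, where the three solutions take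
    independent real values. Continuity of the entries at \<open>b\<close> makes the determinant
    nonzero as a germ.\<close>
  have ker: "y = 0" if y: "W (of_real b) *v y = 0" for y
  proof -
    define x where "x = Xt (of_real b)"
    define z where "z = Zt (of_real b)"
    define t where "t = Tt (of_real b)"
    define p where "p = pl x z k2 l2"
    define q where "q = pl x t k3 l3"
    have pq: "p \<noteq> 0" "q \<noteq> 0" "x $ k2 \<noteq> 0" "x $ k3 \<noteq> 0" using p2 p3 X2 X3 by (simp_all add: p_def q_def x_def z_def t_def)
    have "(y $ 4 - y $ 1 * z $ k2 / p - y $ 2 * t $ k3 / q) *s complex_vec (v b) + (y $ 1 * x $ k2 / p) *s complex_vec (\<xi> b) +
      (y $ 2 * x $ k3 / q) *s complex_vec (\<tau> b) + y $ 3 *s axis m 1 = 0"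
      unfolding vec_eq_iff
    proof
      fix i
      have "(W (of_real b) *v y) $ i = pl x z k2 i / p * y $ 1 + pl x t k3 i / q * y $ 2 + (if i = m then 1 else 0) * y $ 3 + x $ i * y $ 4"
        unfolding matrix_vector_mult_def by (simp add: sum_4 W x_def z_def t_def p_def q_def)
      then have "pl x z k2 i / p * y $ 1 + pl x t k3 i / q * y $ 2 + (if i = m then 1 else 0) * y $ 3 + x $ i * y $ 4 = 0" by (simp add: y)
      then show "((y $ 4 - y $ 1 * z $ k2 / p - y $ 2 * t $ k3 / q) *s complex_vec (v b) + (y $ 1 * x $ k2 / p) *s complex_vec (\<xi> b) +
        (y $ 2 * x $ k3 / q) *s complex_vec (\<tau> b) + y $ 3 *s axis m 1) $ i = 0 $ i"
        unfolding at_b[symmetric] x_def[symmetric] z_def[symmetric] t_def[symmetric]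
        by (simp add: pl_def axis_def diff_divide_distrib algebra_simps)
    qed
    from complex_indep_axis[OF m this] pq have "y $ 1 = 0" "y $ 2 = 0" "y $ 3 = 0" "y $ 4 = 0" by auto
    then show ?thesis unfolding vec_eq_iff by (simp add: forall_4)
  qed
  then have detWb: "det (W (of_real b)) \<noteq> 0"
    using matrix_left_invertible_ker[of "W (of_real b)"] invertible_left_inverse[of "W (of_real b)"] invertible_det_nz by blast
  have cpl: "isCont (\<lambda>t. pl (Xt t) (Y t) k i) (of_real b)" if "TS Y" for Y k i
    unfolding pl_def by (intro isCont_diff isCont_mult TS_continuous TX that b_Sigma)
  have contW: "isCont (\<lambda>t. W t $ i $ j) (of_real b)" for i j
    using exhaust_4[of j]
  proof (elim disjE)
    assume j: "j = 1" show ?thesis unfolding j W by (intro isCont_divide cpl TX p2)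
  next
    assume j: "j = 2" show ?thesis unfolding j W by (intro isCont_divide cpl TX p3)
  next
    assume j: "j = 3" show ?thesis unfolding j W by simp
  next
    assume j: "j = 4" show ?thesis unfolding j W by (intro TS_continuous TX b_Sigma)
  qed
  have "isCont (\<lambda>t. det (W t)) (of_real b)" unfolding det_def by (intro continuous_intros contW)
  then have ne: "\<forall>\<^sub>F t in at (of_real b). det (W t) \<noteq> 0" unfolding isCont_def using detWb by (rule tendsto_imp_eventually_ne)
  have "det U \<noteq> 0"
  proof
    assume "det U = 0"
    then have "\<forall>\<^sub>F t in at (of_real b). det (W t) = 0" using rep_eq_0_iff[OF rep_det[of U W, OF repU]] by blast
    with ne have "\<forall>\<^sub>F t in at (complex_of_real b). False" by eventually_elim simp
    then show False by simp
  qed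
  then have invU: "invertible U" by (simp add: invertible_det_nz)
  have D1: "D (u1 $ i) = (\<Sum>j\<in>UNIV. AL $ i $ j * u1 $ j)" for i
  proof (rule rep_eqI[OF rep_D[OF u1] rep_sum[OF rep_mult[OF rep_AL u1]]])
    show "\<forall>\<^sub>F t in at (of_real b). deriv (\<lambda>t. Xt t $ i) t = (\<Sum>j\<in>UNIV. At t $ i $ j * Xt t $ j)"
      using eventually_at_in_open'[OF Sigma(1) b_Sigma]
      by (rule eventually_mono) (use TS_deriv[OF TX(1)] in \<open>auto dest!: DERIV_imp_deriv simp: matrix_vector_mult_def\<close>)
  qed
  have D01: "D 1 = 0" "D 0 = 0"
  proof -
    have Dm: "D (x * y) = D x * y + x * D y" and Da: "D (x + y) = D x + D y" for x y using derivation_D by (auto simp: derivation_def)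
    have "D 1 + D 1 = D 1 + 0" using Dm[of 1 1] by (simp only: mult_1_left mult_1_right add_0_right)
    then show "D 1 = 0" by (rule add_left_imp_eq)
    have "D 0 + D 0 = D 0 + 0" using Da[of 0 0] by (simp only: add_0_right)
    then show "D 0 = 0" by (rule add_left_imp_eq)
  qed
  \<comment> \<open>The last column of \<open>R\<close>: as the constant vector has derivative 0,
    \<open>U *v y\<close> must cancel \<open>AL\<close> applied to it.\<close>
  define y where "y = - (matrix_inv U *v (AL *v axis m 1))"
  have Uy: "U *v y = - (AL *v axis m 1)"
  proof -
    have "U *v y = - (U *v (matrix_inv U *v (AL *v axis m 1)))" by (simp add: y_def matrix_vector_mult_def vec_eq_iff sum_negf)
    then show ?thesis by (simp add: matrix_vector_mul_assoc[of U] matrix_inv_mult[OF invU])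
  qed
  define R :: "'l^4^4" where "R = (\<chi> i j. if j = 4 then 0 else if j = 1 then (if i = 4 then g2 else if i = 1 then e2 else 0)
     else if j = 2 then (if i = 4 then g3 else if i = 2 then e3 else 0) else y $ i)"
  have R: "R $ i $ 4 = 0" "R $ i $ 1 = (if i = 4 then g2 else if i = 1 then e2 else 0)"
    "R $ i $ 2 = (if i = 4 then g3 else if i = 2 then e3 else 0)" "R $ i $ 3 = y $ i" for i by (simp_all add: R_def)
  have "D (U $ i $ j) = (\<Sum>k\<in>UNIV. AL $ i $ k * U $ k $ j) + (\<Sum>k\<in>UNIV. U $ i $ k * R $ k $ j)" for i j
    using exhaust_4[of j]
  proof (elim disjE)
    assume j: "j = 1"
    show ?thesis unfolding j U R using D2[of i] by (simp add: sum_4 U mult.commute)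
  next
    assume j: "j = 2"
    show ?thesis unfolding j U R using D3[of i] by (simp add: sum_4 U mult.commute)
  next
    assume j: "j = 3"
    have "D (if i = m then 1 else 0) = 0" using D01 by simp
    moreover have "(\<Sum>k\<in>UNIV. AL $ i $ k * (if k = m then 1 else 0)) = (AL *v axis m 1) $ i"
      by (simp only: matrix_vector_mult_def axis_def vec_lambda_beta)
    moreover have "(\<Sum>k\<in>UNIV. U $ i $ k * y $ k) = (U *v y) $ i" by (simp only: matrix_vector_mult_def vec_lambda_beta)
    ultimately show ?thesis unfolding j U R by (simp only: Uy vector_uminus_component right_minus)
  next
    assume j: "j = 4"
    show ?thesis unfolding j U R using D1[of i] by simp
  qed
  then have DU: "map_matrix D U = AL ** U + U ** R" by (simp add: vec_eq_iff matrix_mult_nth)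
  have "upper_tri R"
    unfolding upper_tri_def
  proof (intro allI impI)
    fix i j :: 4 assume ji: "j < i"
    show "R $ i $ j = 0" using exhaust_4[of j] exhaust_4[of i] ji order_4
      by (elim disjE) (simp_all add: R)
  qed
  moreover have "U $ i $ j \<in> \<iota> ` meromorphic_functions \<Gamma>" for i j using repU[of i j] by (auto simp: rep_def)
  ultimately show ?thesis using invU DU by blast
qed

lemma galois_triangularizable:
  "triangularizable (galois_group (meromorphic_field \<Gamma>) (const_fun \<Gamma>) \<iota> D \<Phi>)"
proof -
  interpret cf: constant_field D "\<lambda>c. \<iota> (const_fun \<Gamma> c)"
    by unfold_locales (use derivation_D iota_const_hom iota_1 constants_eq in auto)
  obtain U :: "'l^4^4" and R where U: "invertible U" "map_matrix D U = AL ** U + U ** R" "upper_tri R"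
    and UK: "\<And>i j. U $ i $ j \<in> \<iota> ` meromorphic_functions \<Gamma>" using triangular_frame by blast
  have \<Phi>: "invertible \<Phi>" "map_matrix D \<Phi> = AL ** \<Phi>" using extension by (simp_all add: picard_vessiot_def AL_def)
  obtain P :: "complex^4^4" where P: "invertible P"
    and tri: "\<And>M' \<sigma>. (\<forall>x y. \<sigma> (x + y) = \<sigma> x + \<sigma> y) \<Longrightarrow> (\<forall>x y. \<sigma> (x * y) = \<sigma> x * \<sigma> y) \<Longrightarrow> \<sigma> 1 = 1 \<Longrightarrow>
        (\<forall>c. \<sigma> (\<iota> (const_fun \<Gamma> c)) = \<iota> (const_fun \<Gamma> c)) \<Longrightarrow> map_matrix \<sigma> U = U \<Longrightarrow>
        map_matrix \<sigma> \<Phi> = \<Phi> ** map_matrix (\<lambda>c. \<iota> (const_fun \<Gamma> c)) M' \<Longrightarrow> upper_tri (matrix_inv P ** M' ** P)"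
    using cf.constant_matrices_triangularizable[OF \<Phi> U] by blast
  have "upper_triangular (matrix_inv P ** M' ** P)"
    if M': "M' \<in> galois_group (meromorphic_field \<Gamma>) (const_fun \<Gamma>) \<iota> D \<Phi>" for M'
  proof -
    obtain \<sigma> where \<sigma>: "\<sigma> \<in> ring_iso ring_of_type_algebra ring_of_type_algebra"
      and fix_K: "\<And>a. a \<in> meromorphic_functions \<Gamma> \<Longrightarrow> \<sigma> (\<iota> a) = \<iota> a"
      and \<sigma>\<Phi>: "map_matrix \<sigma> \<Phi> = \<Phi> ** map_matrix (\<iota> \<circ> const_fun \<Gamma>) M'"
      using M' unfolding galois_group_def by (auto simp: meromorphic_field_def)
    have "upper_tri (matrix_inv P ** M' ** P)"
    proof (rule tri)
      show "\<forall>x y. \<sigma> (x + y) = \<sigma> x + \<sigma> y" "\<forall>x y. \<sigma> (x * y) = \<sigma> x * \<sigma> y" "\<sigma> 1 = 1"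
        using \<sigma> by (auto simp: ring_iso_def ring_hom_def ring_of_type_algebra_def)
      show "\<forall>c. \<sigma> (\<iota> (const_fun \<Gamma> c)) = \<iota> (const_fun \<Gamma> c)" using fix_K const_K by blast
      have "\<sigma> (U $ i $ j) = U $ i $ j" for i j using UK[of i j] fix_K by auto
      then show "map_matrix \<sigma> U = U" by (simp add: vec_eq_iff)
      show "map_matrix \<sigma> \<Phi> = \<Phi> ** map_matrix (\<lambda>c. \<iota> (const_fun \<Gamma> c)) M'" using \<sigma>\<Phi> by (simp add: o_def)
    qed
    then show ?thesis by (simp add: upper_tri_def upper_triangular_def)
  qed
  then show ?thesis unfolding triangularizable_def using P by blast
qed

end

theorem theorem1p1:
  fixes f :: "(real^4) \<times> (real^'m) \<Rightarrow> real^4"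
    and l1 l2 l3 l4 :: real
    and xh :: "real \<Rightarrow> real^4"
    and M :: "(real^4) set"
    and U :: "(complex^4) set"
    and F :: "complex^4 \<Rightarrow> complex^4"
    and \<Gamma> :: desing
    and \<iota> :: "surface_fun \<Rightarrow> 'l::field"
    and D :: "'l \<Rightarrow> 'l"
    and \<Phi> :: "'l^4^4"
  assumes parameters: "CARD('m) = 1 \<or> CARD('m) = 2"
    and analytic: "real_analytic_on f UNIV"
    and equilibrium: "f (0, 0) = 0"
    and eigenvalues: "\<forall>s. det (mat s - jacobian (\<lambda>x. f (x, 0)) (at 0)) =
                            (s - l1) * (s - l2) * (s - l3) * (s - l4)"
    and saddle: "l1 \<le> l2" "l2 < 0" "0 < l3" "l3 \<le> l4"
    and homoclinic: "homoclinic_orbit (\<lambda>x. f (x, 0)) xh"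
    and manifold: "analytic_surface M" "flow_invariant (\<lambda>x. f (x, 0)) M" "0 \<in> M" "range xh \<subseteq> M"
    and condition_C: "\<exists>\<xi>. solves_VE (\<lambda>x. f (x, 0)) xh \<xi> \<and> bounded (range \<xi>) \<and>
                          lin_indep_solutions \<xi> (\<lambda>t. vector_derivative xh (at t))"
    and complexified: "complexification (\<lambda>x. f (x, 0)) U F"
    and Gamma_loc: "desingularized_nbhd (\<lambda>x. f (x, 0)) xh M U \<Gamma>"
    and extension: "picard_vessiot (meromorphic_field \<Gamma>) (time_deriv \<Gamma>) (VE_matrix F \<Gamma>) \<iota> D \<Phi>"
  shows "triangularizable (galois_group (meromorphic_field \<Gamma>) (const_fun \<Gamma>) \<iota> D \<Phi>)"
proof -
  obtain \<xi> where \<xi>: "solves_VE (\<lambda>x. f (x, 0)) xh \<xi>" "bounded (range \<xi>)"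
    and ind: "lin_indep_solutions \<xi> (\<lambda>t. vector_derivative xh (at t))"
    using condition_C by blast
  have vd: "vector_derivative xh (at t) = f (xh t, 0)" for t
    using homoclinic by (intro vector_derivative_at) (simp add: homoclinic_orbit_def solves_on_def)
  interpret VE_extension "\<lambda>x. f (x, 0)" xh M U F \<Gamma> l1 l2 l3 l4 \<xi> \<iota> D \<Phi>
  proof unfold_locales
    show "p = 0 \<and> q = 0" if "\<And>t. p *\<^sub>R \<xi> t + q *\<^sub>R f (xh t, 0) = 0" for p q
      using ind that unfolding lin_indep_solutions_def vd by blast
  qed (fact complexified homoclinic Gamma_loc manifold equilibrium eigenvalues saddle \<xi> extension)+
  show ?thesis by (rule galois_triangularizable)
qed

end
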